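(* Let $\Omega\subset\mathbb C^d$ be an open set and let $\Phi:\Omega\to\mathbb C$ be a holomorphic function. Let $(k,k')\in\mathcal K_{pol}(\mathbb R^n)\times\mathcal K_a(\mathbb R^n)$ be such that $\frac{k'(\xi)}{k(\xi)}\to0$ as $\xi\to\infty$ and $1/k'\in L^2(\mathbb R^n)$. (a) If $u=(u_1,\dots,u_d)\in\mathcal B_k^\infty(\mathbb R^n)^d$ satisfies $\overline{u(\mathbb R^n)}\subset\Omega$, then $\Phi\circ u\in\mathcal B_{k'}^\infty(\mathbb R^n)$. (b) If $u,u_\varepsilon\in\mathcal B_k^\infty(\mathbb R^n)^d$, $0<\varepsilon\le1$, $\overline{u(\mathbb R^n)}\subset\Omega$ and $u_\varepsilon\to u$ in $\mathcal B_{k'}^\infty(\mathbb R^n)^d$ as $\varepsilon\to0$, then there is $\varepsilon_0\in(0,1]$ such that $\overline{u_\varepsilon(\mathbb R^n)}\subset\Omega$ for every $0<\varepsilon\le\varepsilon_0$, and $\Phi(u_\varepsilon)\to\Phi(u)$ in $\mathcal B_{k'}^\infty(\mathbb R^n)$ as $\varepsilon\to0$.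
   Context: Notation: $\langle\xi\rangle=(1+|\xi|^2)^{1/2}$; $\widehat u(\xi)=\int e^{-i\langle x,\xi\rangle}u(x)\,dx$, extended to $\mathcal S'(\mathbb R^n)$; $\tau_y\chi=\chi(\cdot-y)$; $\Phi(u)=\Phi\circ u$. $\mathcal K_{pol}(\mathbb R^n)$ is the set of positive measurable functions $k$ on $\mathbb R^n$ for which there are constants $C,N>0$ with $k(\xi+\eta)\le C\langle\xi\rangle^N k(\eta)$ for all $\xi,\eta\in\mathbb R^n$. $\mathcal K_a(\mathbb R^n)$ is the set of $k\in\mathcal K_{pol}(\mathbb R^n)$ for which there is a constant $C_k>0$ with $\frac1{k^2}*\frac1{k^2}\le\frac{C_k^2}{k^2}$ pointwise. For $k\in\mathcal K_{pol}(\mathbb R^n)$, $\mathcal B_k(\mathbb R^n)$ is the set of $u\in\mathcal S'(\mathbb R^n)$ such that $\widehat u$ is a function and $k\widehat u\in L^2$, with norm $\|u\|_{\mathcal B_k}=\|k\widehat u\|_{L^2}$ ($=+\infty$ if $u\notin\mathcal B_k$). $\mathcal B_k^\infty(\mathbb R^n)$ is the set of $u\in\mathcal D'(\mathbb R^n)$ for which there is $\chi\in\mathcal C_0^\infty(\mathbb R^n)\setminus\{0\}$ with $\|u\|_{k,\infty,\chi}=\sup_{y\in\mathbb R^n}\|u\,\tau_y\chi\|_{\mathcal B_k}<\infty$; it is topologized by any of the (equivalent) norms $\|\cdot\|_{k,\infty,\chi}$, $\chi\in\mathcal C_0^\infty\setminus\{0\}$. If $1/k'\in L^2(\mathbb R^n)$,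 elements of $\mathcal B_{k'}^\infty(\mathbb R^n)$ are (identified with) bounded continuous functions; under the hypotheses $\mathcal B_k^\infty\subset\mathcal B_{k'}^\infty$. *)

theory Defs
  imports "HOL-Analysis.Analysis"
begin

definition partial_deriv :: "'a::euclidean_space \<Rightarrow> ('a \<Rightarrow> complex) \<Rightarrow> 'a \<Rightarrow> complex" where
  "partial_deriv b f x = vector_derivative (\<lambda>t. f (x + t *\<^sub>R b)) (at 0)"

text \<open>Multi-indices are encoded as lists of coordinate directions, the order of the derivative
  being the length of the list.\<close>

primrec iter_deriv :: "'a::euclidean_space list \<Rightarrow> ('a \<Rightarrow> complex) \<Rightarrow> 'a \<Rightarrow> complex" where
  "iter_deriv [] f = f"
| "iter_deriv (b # bs) f = partial_deriv b (iter_deriv bs f)"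

text \<open>Requiring total differentiability of every iterated partial derivative makes all of them
  continuous, so this is the usual class of infinitely differentiable functions.\<close>

definition smooth :: "('a::euclidean_space \<Rightarrow> complex) \<Rightarrow> bool" where
  "smooth f \<longleftrightarrow> (\<forall>bs\<in>lists Basis. \<forall>x. iter_deriv bs f differentiable at x)"

definition test_functions :: "('a::euclidean_space \<Rightarrow> complex) set" where
  "test_functions = {\<phi>. smooth \<phi> \<and> compact (closure {x. \<phi> x \<noteq> 0})}"

definition bracket :: "'a::euclidean_space \<Rightarrow> real" where
  "bracket \<xi> = sqrt (1 + (norm \<xi>)\<^sup>2)"

definition schwartz :: "('a::euclidean_space \<Rightarrow> complex) set" where
  "schwartz = {\<phi>. smooth \<phi> \<and>
     (\<forall>N::nat. \<forall>bs\<in>lists Basis. bounded (range (\<lambda>x. bracket x ^ N *\<^sub>R iter_deriv bs \<phi> x)))}"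

text \<open>A distribution is represented by a functional on all functions, of which only the values on
  test functions (for a tempered distribution: on Schwartz functions) are meaningful. Thus
  one functional can be read both as an element of the space of distributions and as an element
  of the space of tempered distributions.\<close>

type_synonym 'a distr = "('a \<Rightarrow> complex) \<Rightarrow> complex"

definition linear_on_fns :: "('a \<Rightarrow> complex) set \<Rightarrow> 'a distr \<Rightarrow> bool" where
  "linear_on_fns V u \<longleftrightarrow>
     (\<forall>\<phi>\<in>V. \<forall>\<psi>\<in>V. u (\<lambda>x. \<phi> x + \<psi> x) = u \<phi> + u \<psi>) \<and>
     (\<forall>c. \<forall>\<phi>\<in>V. u (\<lambda>x. c * \<phi> x) = c * u \<phi>)"

definition distributions :: "('a::euclidean_space) distr set" where
  "distributions = {u. linear_on_fns test_functions u \<and>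
     (\<forall>K. compact K \<longrightarrow> (\<exists>C. \<exists>N::nat. \<forall>\<phi>\<in>test_functions. (\<forall>x. x \<notin> K \<longrightarrow> \<phi> x = 0) \<longrightarrow>
        norm (u \<phi>) \<le> C * (\<Sum>bs | bs \<in> lists Basis \<and> length bs \<le> N.
                              SUP x. norm (iter_deriv bs \<phi> x))))}"

definition tempered_distributions :: "('a::euclidean_space) distr set" where
  "tempered_distributions = {u. linear_on_fns schwartz u \<and>
     (\<exists>C. \<exists>N::nat. \<forall>\<phi>\<in>schwartz.
        norm (u \<phi>) \<le> C * (\<Sum>bs | bs \<in> lists Basis \<and> length bs \<le> N.
                              SUP x. bracket x ^ N * norm (iter_deriv bs \<phi> x)))}"

definition locally_integrable :: "('a::euclidean_space \<Rightarrow> complex) \<Rightarrow> bool" where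
  "locally_integrable f \<longleftrightarrow> (\<forall>K. compact K \<longrightarrow> set_integrable lebesgue K f)"

definition distr_of :: "('a::euclidean_space \<Rightarrow> complex) \<Rightarrow> 'a distr" where
  "distr_of f \<phi> = (\<integral>x. f x * \<phi> x \<partial>lebesgue)"

definition represents :: "('a::euclidean_space \<Rightarrow> complex) \<Rightarrow> 'a distr \<Rightarrow> bool" where
  "represents f u \<longleftrightarrow> locally_integrable f \<and> (\<forall>\<phi>\<in>test_functions. u \<phi> = distr_of f \<phi>)"

text \<open>If a distribution is a function, that function is unique up to a null set; fix a choice.\<close>

definition function_of :: "('a::euclidean_space) distr \<Rightarrow> 'a \<Rightarrow> complex" where
  "function_of u = (SOME f. represents f u)"

text \<open>The bounded continuous function with which a distribution is identified, if there is one.\<close>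

definition bcfun_of :: "('a::euclidean_space) distr \<Rightarrow> 'a \<Rightarrow> complex" where
  "bcfun_of u = (THE f. continuous_on UNIV f \<and> bounded (range f) \<and> represents f u)"

definition translate :: "'a::euclidean_space \<Rightarrow> ('a \<Rightarrow> complex) \<Rightarrow> 'a \<Rightarrow> complex" where
  "translate y \<psi> x = \<psi> (x - y)"

text \<open>For a test function \<open>\<psi>\<close> and a distribution \<open>u\<close> this functional only uses values of \<open>u\<close> at
  test functions, also when it is evaluated at Schwartz functions.\<close>

definition distr_mult :: "('a::euclidean_space) distr \<Rightarrow> ('a \<Rightarrow> complex) \<Rightarrow> 'a distr" where
  "distr_mult u \<psi> \<phi> = u (\<lambda>x. \<psi> x * \<phi> x)"

definition distr_diff :: "('a::euclidean_space) distr \<Rightarrow> 'a distr \<Rightarrow> 'a distr" where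
  "distr_diff u v \<phi> = u \<phi> - v \<phi>"

definition fourier :: "('a::euclidean_space \<Rightarrow> complex) \<Rightarrow> 'a \<Rightarrow> complex" where
  "fourier \<phi> \<xi> = (\<integral>x. exp (- (\<i> * complex_of_real (x \<bullet> \<xi>))) * \<phi> x \<partial>lebesgue)"

definition distr_fourier :: "('a::euclidean_space) distr \<Rightarrow> 'a distr" where
  "distr_fourier u \<phi> = u (fourier \<phi>)"

definition square_integrable :: "('a::euclidean_space \<Rightarrow> 'b::{banach, second_countable_topology}) \<Rightarrow> bool" where
  "square_integrable f \<longleftrightarrow>
     f \<in> borel_measurable lebesgue \<and> integrable lebesgue (\<lambda>x. (norm (f x))\<^sup>2)"

definition L2_norm :: "('a::euclidean_space \<Rightarrow> 'b::{banach, second_countable_topology}) \<Rightarrow> real" where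
  "L2_norm f = sqrt (\<integral>x. (norm (f x))\<^sup>2 \<partial>lebesgue)"

definition K_pol :: "('a::euclidean_space \<Rightarrow> real) set" where
  "K_pol = {k. k \<in> borel_measurable lebesgue \<and> (\<forall>\<xi>. 0 < k \<xi>) \<and>
     (\<exists>C>0. \<exists>N>0. \<forall>\<xi> \<eta>. k (\<xi> + \<eta>) \<le> C * bracket \<xi> powr N * k \<eta>)}"

definition K_a :: "('a::euclidean_space \<Rightarrow> real) set" where
  "K_a = {k \<in> K_pol. \<exists>C>0. \<forall>\<xi>.
     (\<integral>\<^sup>+\<eta>. ennreal (1 / (k (\<xi> - \<eta>))\<^sup>2 * (1 / (k \<eta>)\<^sup>2)) \<partial>lebesgue) \<le> ennreal (C\<^sup>2 / (k \<xi>)\<^sup>2)}"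

definition Bk :: "('a::euclidean_space \<Rightarrow> real) \<Rightarrow> 'a distr set" where
  "Bk k = {u \<in> tempered_distributions. (\<exists>f. represents f (distr_fourier u)) \<and>
     square_integrable (\<lambda>\<xi>. k \<xi> *\<^sub>R function_of (distr_fourier u) \<xi>)}"

definition Bk_norm :: "('a::euclidean_space \<Rightarrow> real) \<Rightarrow> 'a distr \<Rightarrow> ennreal" where
  "Bk_norm k u = (if u \<in> Bk k
     then ennreal (L2_norm (\<lambda>\<xi>. k \<xi> *\<^sub>R function_of (distr_fourier u) \<xi>)) else \<infinity>)"

definition Bk_inf_norm :: "('a::euclidean_space \<Rightarrow> real) \<Rightarrow> ('a \<Rightarrow> complex) \<Rightarrow> 'a distr \<Rightarrow> ennreal" where
  "Bk_inf_norm k \<psi> u = (SUP y. Bk_norm k (distr_mult u (translate y \<psi>)))"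

definition Bk_inf :: "('a::euclidean_space \<Rightarrow> real) \<Rightarrow> 'a distr set" where
  "Bk_inf k = {u \<in> distributions. \<exists>\<psi>\<in>test_functions - {\<lambda>x. 0}. Bk_inf_norm k \<psi> u < \<infinity>}"

text \<open>Convergence in \<open>Bk_inf k\<close>. The norms belonging to different \<open>\<psi>\<close> are equivalent.\<close>

definition Bk_inf_tendsto ::
  "('a::euclidean_space \<Rightarrow> real) \<Rightarrow> ('e \<Rightarrow> 'a distr) \<Rightarrow> 'a distr \<Rightarrow> 'e filter \<Rightarrow> bool" where
  "Bk_inf_tendsto k v u F \<longleftrightarrow> u \<in> Bk_inf k \<and> (\<forall>\<^sub>F e in F. v e \<in> Bk_inf k) \<and>
     (\<forall>\<psi>\<in>test_functions - {\<lambda>x. 0}. ((\<lambda>e. Bk_inf_norm k \<psi> (distr_diff (v e) u)) \<longlongrightarrow> 0) F)"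

definition value_map :: "('d::finite \<Rightarrow> ('a::euclidean_space) distr) \<Rightarrow> 'a \<Rightarrow> complex ^ 'd" where
  "value_map u x = (\<chi> i. bcfun_of (u i) x)"

text \<open>Complex differentiability at every point: the real derivative exists and is complex linear.\<close>

definition holomorphic_several :: "(complex ^ 'd \<Rightarrow> complex) \<Rightarrow> (complex ^ 'd) set \<Rightarrow> bool" where
  "holomorphic_several \<Phi> \<Omega> \<longleftrightarrow>
     (\<forall>z\<in>\<Omega>. \<exists>D. (\<Phi> has_derivative D) (at z) \<and> (\<forall>c v. D (c *s v) = c * D v))"

end

theory Submission
  imports Defs "HOL-Complex_Analysis.Cauchy_Integral_Formula"
begin

text \<open>
  Weighted \<open>L\<^sup>2\<close> conditions on Fourier transforms are turned into statements about functions of the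
  form \<open>h x = fourier G (- x)\<close> with an integrable density \<open>G\<close>. The predicate \<open>fourier_ball w M h\<close> says
  that there is such a density of weighted norm at most \<open>M\<close>.

  Localisation. If \<open>1 / k\<close> is square integrable, each product of \<open>u\<close> in \<open>Bk_inf k\<close> with a translated
  window has an integrable Fourier transform and so is a continuous function. These pieces agree
  where windows overlap, and \<open>u\<close> is represented by a bounded continuous function
  (\<open>Bk_inf_represented\<close>). The norm of \<open>Bk_inf k\<close> becomes, up to the constant of Fourier inversion, a
  bound \<open>fourier_ball k M\<close> that is uniform in the position of the window (\<open>Bk_norm_le_of_fourier_ball\<close>,
  \<open>fourier_ball_of_Bk_norm_le\<close>). Since \<open>k'\<close> is dominated by \<open>k\<close>, the inverses of
  both weights are square integrable and all this applies to both.

  Algebra. The convolution inequality for a multiple \<open>w\<close> of \<open>k'\<close> and Cauchy-Schwarz make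
  \<open>fourier_ball w\<close> submultiplicative (\<open>fourier_ball_mult\<close>), and convergent series may be summed (\<open>fourier_ball_suminf\<close>).

  Composition. By compactness of the closure of the range of \<open>u\<close> there is one radius \<open>r\<close> such that
  \<open>\<Phi>\<close> is bounded and holomorphic on a polydisc of radius \<open>r\<close> about a point near \<open>u y\<close>, for each \<open>y\<close>.
  Inserting \<open>u\<close> into the power series of \<open>\<Phi>\<close> there requires powers of windowed differences to be
  small in the algebra, whereas a narrow window makes them small in the supremum norm only. This is
  where \<open>k' / k \<longlonglongrightarrow> 0\<close> enters. Cutting off high frequencies splits windowed pieces of \<open>u\<close> into
  functions with uniformly bounded derivatives of all orders and remainders that are as small as
  desired in the algebra (\<open>frequency_splitting\<close>). For a smooth function the growth of the powers in
  the algebra is governed by the supremum norm, since each of the finitely many derivatives needed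
  costs a power of the exponent only (\<open>unif_smooth_power_bound\<close>). So the powers of the sum grow
  slowly (\<open>power_estimate\<close>), and the power series of \<open>\<Phi>\<close>, summed one variable at a time, converges
  in the algebra uniformly in \<open>y\<close> (\<open>functional_calculus\<close>).

  Convergence. If the windowed differences \<open>u\<^sub>\<epsilon> - u\<close> lie in \<open>fourier_ball w \<eta>\<close>, then for small \<open>\<eta>\<close> the
  splitting of \<open>u\<close> is one of \<open>u\<^sub>\<epsilon>\<close> too, with the same smooth part. Differences of powers are bounded by
  multiples of \<open>\<eta>\<close>, and hence so is the windowed \<open>\<Phi> \<circ> u\<^sub>\<epsilon> - \<Phi> \<circ> u\<close>
  (\<open>composition_estimate\<close>). Smallness in the algebra implies smallness in the supremum norm, which
  keeps the values of \<open>u\<^sub>\<epsilon>\<close> in a compact subset of \<open>\<Omega>\<close>. The estimate is obtained for one window;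
  \<open>window_change\<close> gives it for all others.
\<close>

section \<open>Calculus of smooth functions\<close>

lemma partial_deriv_eq:
  assumes "(f has_derivative D) (at x)"
  shows "partial_deriv b f x = D b"
proof -
  interpret D: bounded_linear D using assms by (rule has_derivative_bounded_linear)
  have "((\<lambda>t. x + t *\<^sub>R b) has_derivative (\<lambda>t. t *\<^sub>R b)) (at 0)"
    by (auto intro!: derivative_eq_intros)
  then have "((\<lambda>t. f (x + t *\<^sub>R b)) has_derivative (\<lambda>t. D (t *\<^sub>R b))) (at 0)"
    using has_derivative_compose[of "\<lambda>t. x + t *\<^sub>R b" _ 0 UNIV f D] assms by simp
  then show ?thesis
    unfolding partial_deriv_def
    by (intro vector_derivative_at) (simp add: has_vector_derivative_def D.scaleR)
qed

lemma iter_deriv_append: "iter_deriv (bs @ cs) f = iter_deriv bs (iter_deriv cs f)"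
  by (induction bs) auto

lemma iter_deriv_snoc: "iter_deriv (bs @ [b]) f = iter_deriv bs (partial_deriv b f)"
  by (simp add: iter_deriv_append)

lemma smooth_differentiable: "smooth f \<Longrightarrow> f differentiable (at x)"
  unfolding smooth_def by (metis iter_deriv.simps(1) lists.Nil)

lemma smooth_has_derivative: "smooth f \<Longrightarrow> (f has_derivative frechet_derivative f (at x)) (at x)"
  using smooth_differentiable frechet_derivative_works by blast

lemma smooth_partial_deriv: "smooth f \<Longrightarrow> b \<in> Basis \<Longrightarrow> smooth (partial_deriv b f)"
  unfolding smooth_def
  by (metis iter_deriv_snoc append_in_lists_conv lists.Cons lists.Nil)

lemma smooth_iter_deriv: "smooth f \<Longrightarrow> bs \<in> lists Basis \<Longrightarrow> smooth (iter_deriv bs f)"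
  by (induction bs) (auto intro: smooth_partial_deriv)

lemma smooth_continuous_on: "smooth f \<Longrightarrow> continuous_on S f"
  by (meson continuous_at_imp_continuous_on differentiable_imp_continuous_within smooth_differentiable)

lemma smooth_borel: "smooth f \<Longrightarrow> f \<in> borel_measurable borel"
  by (intro borel_measurable_continuous_onI smooth_continuous_on)

lemma partial_deriv_add:
  assumes "f differentiable (at x)" "g differentiable (at x)"
  shows "partial_deriv b (\<lambda>x. f x + g x) x = partial_deriv b f x + partial_deriv b g x"
proof -
  from assms obtain F G where *: "(f has_derivative F) (at x)" "(g has_derivative G) (at x)"
    by (auto simp: differentiable_def)
  from has_derivative_add[OF this] show ?thesis
    by (simp add: partial_deriv_eq[OF *(1)] partial_deriv_eq[OF *(2)] partial_deriv_eq)
qed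

lemma partial_deriv_mult:
  assumes "f differentiable (at x)" "g differentiable (at x)"
  shows "partial_deriv b (\<lambda>x. f x * g x) x = partial_deriv b f x * g x + f x * partial_deriv b g x"
proof -
  from assms obtain F G where *: "(f has_derivative F) (at x)" "(g has_derivative G) (at x)"
    by (auto simp: differentiable_def)
  from has_derivative_mult[OF this] show ?thesis
    by (simp add: partial_deriv_eq[OF *(1)] partial_deriv_eq[OF *(2)] partial_deriv_eq)
qed

inductive_set add_closure :: "('a \<Rightarrow> complex) set \<Rightarrow> ('a \<Rightarrow> complex) set"
  for A :: "('a \<Rightarrow> complex) set" where
  base: "f \<in> A \<Longrightarrow> f \<in> add_closure A"
| add: "f \<in> add_closure A \<Longrightarrow> g \<in> add_closure A \<Longrightarrow> (\<lambda>x. f x + g x) \<in> add_closure A"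

text \<open>The rules of differentiation express partial derivatives as sums of functions of the same kind.
  A class with this property is not closed under addition itself, so derivatives are collected in
  the sums of its members.\<close>

lemma smooth_by_add_closure:
  fixes A :: "('a::euclidean_space \<Rightarrow> complex) set"
  assumes "\<And>f x. f \<in> A \<Longrightarrow> f differentiable (at x)"
    and "\<And>f b. f \<in> A \<Longrightarrow> b \<in> Basis \<Longrightarrow> partial_deriv b f \<in> add_closure A"
    and "f \<in> add_closure A"
  shows "smooth f"
proof -
  have step: "(\<forall>x. g differentiable (at x)) \<and> (\<forall>b\<in>Basis. partial_deriv b g \<in> add_closure A)"
    if "g \<in> add_closure A" for g
    using that
  proof induction
    case (base f)
    then show ?case using assms by auto
  next
    case (add f g)
    then have "partial_deriv b (\<lambda>x. f x + g x) = (\<lambda>x. partial_deriv b f x + partial_deriv b g x)" for b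
      by (intro ext partial_deriv_add) auto
    with add show ?case by (auto intro: add_closure.add)
  qed
  have "iter_deriv bs f \<in> add_closure A" if "bs \<in> lists Basis" for bs
    using that by (induction bs) (use assms step in auto)
  with step show ?thesis unfolding smooth_def by blast
qed

lemma smooth_const [simp]: "smooth (\<lambda>x. c)"
proof (rule smooth_by_add_closure[of "range (\<lambda>c x. c)"])
  show "partial_deriv b f \<in> add_closure (range (\<lambda>c x. c))"
    if "f \<in> range (\<lambda>c x. c)" for f :: "'a \<Rightarrow> complex" and b
  proof -
    have "partial_deriv b f = (\<lambda>x. 0)" using that partial_deriv_eq[OF has_derivative_const] by blast
    then show ?thesis by (auto intro: add_closure.base)
  qed
qed (auto intro: add_closure.base)

lemma smooth_add:
  assumes "smooth f" "smooth g"
  shows "smooth (\<lambda>x. f x + g x)"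
proof (rule smooth_by_add_closure)
  show "h differentiable at x" if "h \<in> Collect smooth" for h :: "'a \<Rightarrow> complex" and x
    using that smooth_differentiable by auto
qed (use assms in \<open>auto intro: add_closure.intros smooth_partial_deriv\<close>)

lemma smooth_mult:
  fixes f g :: "'a::euclidean_space \<Rightarrow> complex"
  assumes "smooth f" "smooth g"
  shows "smooth (\<lambda>x. f x * g x)"
proof -
  let ?A = "{(\<lambda>x. f x * g x) |f g :: 'a \<Rightarrow> complex. smooth f \<and> smooth g}"
  show ?thesis
  proof (rule smooth_by_add_closure[of ?A])
    show "h differentiable at x" if "h \<in> ?A" for h x
      using that smooth_differentiable by (fastforce intro: differentiable_mult)
    show "partial_deriv b h \<in> add_closure ?A" if "h \<in> ?A" "b \<in> Basis" for h b
    proof -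
      from that obtain f g where h: "h = (\<lambda>x. f x * g x)" "smooth f" "smooth g" by auto
      then have "partial_deriv b h = (\<lambda>x. partial_deriv b f x * g x + f x * partial_deriv b g x)"
        by (auto intro!: ext partial_deriv_mult smooth_differentiable)
      moreover have "(\<lambda>x. partial_deriv b f x * g x) \<in> ?A" "(\<lambda>x. f x * partial_deriv b g x) \<in> ?A"
        using h that smooth_partial_deriv by blast+
      ultimately show ?thesis by (simp only:) (intro add_closure.intros)
    qed
    show "(\<lambda>x. f x * g x) \<in> add_closure ?A" using assms by (blast intro: add_closure.base)
  qed
qed

lemma smooth_cmult: "smooth f \<Longrightarrow> smooth (\<lambda>x. c * f x)"
  by (intro smooth_mult) auto

lemma smooth_minus: "smooth f \<Longrightarrow> smooth (\<lambda>x. - f x)"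
  using smooth_cmult[of f "-1"] by simp

lemma smooth_diff: "smooth f \<Longrightarrow> smooth g \<Longrightarrow> smooth (\<lambda>x. f x - g x)"
  using smooth_add[of f "\<lambda>x. -1 * g x"] smooth_cmult[of g "-1"] by simp

lemma smooth_sum: "(\<And>i. i \<in> I \<Longrightarrow> smooth (f i)) \<Longrightarrow> smooth (\<lambda>x. \<Sum>i\<in>I. f i x)"
  by (induction I rule: infinite_finite_induct) (auto intro: smooth_add)

lemma smooth_prod: "(\<And>i. i \<in> I \<Longrightarrow> smooth (f i)) \<Longrightarrow> smooth (\<lambda>x. \<Prod>i\<in>I. f i x)"
  by (induction I rule: infinite_finite_induct) (auto intro: smooth_mult)

lemma smooth_power: "smooth f \<Longrightarrow> smooth (\<lambda>x. f x ^ m)"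
  by (induction m) (auto intro: smooth_mult)

lemma iter_deriv_add:
  assumes "smooth f" "smooth g" "bs \<in> lists Basis"
  shows "iter_deriv bs (\<lambda>x. f x + g x) = (\<lambda>x. iter_deriv bs f x + iter_deriv bs g x)"
  using assms(3)
proof (induction bs)
  case (Cons b bs)
  then show ?case
    using assms(1,2) by (auto intro!: ext partial_deriv_add smooth_differentiable smooth_iter_deriv)
qed auto

lemma partial_deriv_const [simp]: "partial_deriv b (\<lambda>x. c) x = 0"
  using partial_deriv_eq[OF has_derivative_const] by blast

lemma iter_deriv_cmult:
  assumes "smooth f" "bs \<in> lists Basis"
  shows "iter_deriv bs (\<lambda>x. c * f x) = (\<lambda>x. c * iter_deriv bs f x)"
  using assms(2)
proof (induction bs)
  case (Cons b bs)
  show ?case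
  proof
    fix x
    have "partial_deriv b (\<lambda>x. c * iter_deriv bs f x) x = c * partial_deriv b (iter_deriv bs f) x"
      using partial_deriv_mult[of "\<lambda>x. c" x "iter_deriv bs f" b] Cons assms
      by (auto intro!: smooth_differentiable smooth_iter_deriv)
    then show "iter_deriv (b # bs) (\<lambda>x. c * f x) x = c * iter_deriv (b # bs) f x"
      using Cons by auto
  qed
qed auto

lemma iter_deriv_mult_snoc:
  assumes "smooth f" "smooth g" "bs \<in> lists Basis" "b \<in> Basis"
  shows "iter_deriv (bs @ [b]) (\<lambda>x. f x * g x) =
    (\<lambda>x. iter_deriv bs (\<lambda>x. partial_deriv b f x * g x) x + iter_deriv bs (\<lambda>x. f x * partial_deriv b g x) x)"
proof -
  have "partial_deriv b (\<lambda>x. f x * g x) = (\<lambda>x. partial_deriv b f x * g x + f x * partial_deriv b g x)"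
    using assms by (auto intro!: ext partial_deriv_mult smooth_differentiable)
  then show ?thesis
    unfolding iter_deriv_snoc using assms
    by (simp add: iter_deriv_add smooth_mult smooth_partial_deriv)
qed

lemma smooth_of_linear:
  fixes L :: "'a::euclidean_space \<Rightarrow> complex"
  assumes "bounded_linear L"
  shows "smooth L"
proof (rule smooth_by_add_closure[of "insert L (range (\<lambda>c x. c))"])
  have d: "(L has_derivative L) (at x)" for x
    using assms by (simp add: bounded_linear_imp_has_derivative)
  then show "f differentiable at x" if "f \<in> insert L (range (\<lambda>c x. c))" for f x
    using that unfolding differentiable_def by (metis has_derivative_const insertE rangeE)
  show "partial_deriv b f \<in> add_closure (insert L (range (\<lambda>c x. c)))"
    if "f \<in> insert L (range (\<lambda>c x. c))" for f b
  proof -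
    have "partial_deriv b f = (\<lambda>x. L b) \<or> partial_deriv b f = (\<lambda>x. 0)"
      using that partial_deriv_eq[OF d] by auto
    then show ?thesis by (auto intro: add_closure.base)
  qed
qed (auto intro: add_closure.base)

lemma smooth_inner: "smooth (\<lambda>x. complex_of_real (x \<bullet> b))"
  by (intro smooth_of_linear bounded_linear_compose[OF bounded_linear_of_real bounded_linear_inner_left])

lemma smooth_dist_squared: "smooth (\<lambda>x. complex_of_real ((norm (x - c))\<^sup>2))"
proof -
  have "(\<lambda>x. complex_of_real ((norm (x - c))\<^sup>2)) =
    (\<lambda>x. \<Sum>b\<in>Basis. (complex_of_real (x \<bullet> b) - of_real (c \<bullet> b)) ^ 2)"
    by (subst power2_norm_eq_inner, subst euclidean_inner) (simp add: inner_diff_left power2_eq_square)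
  then show ?thesis by (auto intro!: smooth_sum smooth_power smooth_diff smooth_inner)
qed

lemma partial_deriv_zero_outside:
  assumes "\<And>x. x \<notin> K \<Longrightarrow> f x = 0" "closed K" "x \<notin> K"
  shows "partial_deriv b f x = 0"
proof -
  have "(f has_derivative (\<lambda>_. 0)) (at x)"
    by (rule has_derivative_transform_within_open[of "\<lambda>_. 0" _ _ _ "- K"])
       (use assms in \<open>auto simp: open_Compl\<close>)
  then show ?thesis by (simp add: partial_deriv_eq)
qed

lemma iter_deriv_zero_outside:
  assumes "\<And>x. x \<notin> K \<Longrightarrow> f x = 0" "closed K" "x \<notin> K"
  shows "iter_deriv bs f x = 0"
  using assms(3)
proof (induction bs arbitrary: x)
  case (Cons b bs)
  show ?case using partial_deriv_zero_outside[OF Cons.IH assms(2)] Cons.prems by simp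
qed (use assms in auto)

lemma smooth_translate:
  assumes "smooth f" shows "smooth (translate y f)"
    and "iter_deriv bs (translate y f) = translate y (iter_deriv bs f)"
proof -
  have p: "partial_deriv b (translate y g) = translate y (partial_deriv b g)" for b g
    unfolding partial_deriv_def translate_def by (auto simp: algebra_simps)
  show it: "iter_deriv bs (translate y f) = translate y (iter_deriv bs f)" for bs
    by (induction bs) (auto simp: p)
  have "translate y g differentiable at x" if "g differentiable at (x - y)" for g :: "'a \<Rightarrow> complex" and x
    using differentiable_chain_at[of "\<lambda>x. x - y" x g] that
    by (simp add: translate_def[abs_def] o_def)
  then show "smooth (translate y f)"
    using assms unfolding smooth_def it by auto
qed

lemma smooth_cnj:
  assumes "smooth f" shows "smooth (\<lambda>x. cnj (f x))"
proof -
  have p: "partial_deriv b (\<lambda>x. cnj (g x)) = (\<lambda>x. cnj (partial_deriv b g x))" if "smooth g" for b and g :: "'a \<Rightarrow> complex"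
  proof
    fix x
    show "partial_deriv b (\<lambda>x. cnj (g x)) x = cnj (partial_deriv b g x)"
      using bounded_linear.has_derivative[OF bounded_linear_cnj smooth_has_derivative[OF that, of x]]
      by (simp add: partial_deriv_eq partial_deriv_eq[OF smooth_has_derivative[OF that]])
  qed
  show ?thesis
  proof (rule smooth_by_add_closure[of "{(\<lambda>x. cnj (f x)) | f. smooth f}"])
    show "h differentiable at x" if "h \<in> {(\<lambda>x. cnj (f x)) | f. smooth f}" for h :: "'a \<Rightarrow> complex" and x
      using that bounded_linear.has_derivative[OF bounded_linear_cnj smooth_has_derivative]
      unfolding differentiable_def by blast
    show "partial_deriv b h \<in> add_closure {(\<lambda>x. cnj (f x)) | f. smooth f}"
      if "h \<in> {(\<lambda>x. cnj (f x)) | f. smooth f}" "b \<in> Basis" for h :: "'a \<Rightarrow> complex" and b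
      using that p smooth_partial_deriv by (force intro: add_closure.base)
  qed (use assms in \<open>auto intro: add_closure.base\<close>)
qed

text \<open>Off the closed support of \<open>\<phi>\<close> the quotient is locally zero whatever the values of \<open>D\<close>, so \<open>D\<close>
  may vanish there.\<close>

lemma smooth_divide:
  fixes \<phi> D :: "'a::euclidean_space \<Rightarrow> complex"
  assumes "smooth \<phi>" "smooth D" and "\<And>x. x \<in> closure {x. \<phi> x \<noteq> 0} \<Longrightarrow> D x \<noteq> 0"
  shows "smooth (\<lambda>x. \<phi> x / D x)"
proof -
  let ?ok = "\<lambda>\<phi> D :: 'a \<Rightarrow> complex. smooth \<phi> \<and> smooth D \<and> (\<forall>x. x \<in> closure {x. \<phi> x \<noteq> 0} \<longrightarrow> D x \<noteq> 0)"
  let ?A = "{(\<lambda>x. \<phi> x / D x) |\<phi> D. ?ok \<phi> D}"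
  have d: "((\<lambda>x. \<phi> x / D x) has_derivative (\<lambda>h. frechet_derivative \<phi> (at x) h / D x
            - \<phi> x * frechet_derivative D (at x) h / (D x * D x))) (at x)"
    if ok: "?ok \<phi> D" for \<phi> D x
  proof (cases "x \<in> closure {x. \<phi> x \<noteq> 0}")
    case True
    then have nz: "D x \<noteq> 0" using ok by auto
    have "((\<lambda>x. \<phi> x / D x) has_derivative (\<lambda>h. (frechet_derivative \<phi> (at x) h * D x - \<phi> x * frechet_derivative D (at x) h) / (D x * D x))) (at x)"
      using ok nz by (intro has_derivative_divide' smooth_has_derivative) auto
    then show ?thesis using nz by (simp add: diff_divide_distrib)
  next
    case False
    have z: "\<phi> y = 0" if "y \<in> - closure {x. \<phi> x \<noteq> 0}" for y
      using that closure_subset[of "{x. \<phi> x \<noteq> 0}"] by blast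
    have 0: "(F has_derivative (\<lambda>_. 0)) (at x)"
      if "\<And>y. y \<in> - closure {x. \<phi> x \<noteq> 0} \<Longrightarrow> F y = 0" for F :: "'a \<Rightarrow> complex"
      by (rule has_derivative_transform_within_open[OF has_derivative_const, of "- closure {x. \<phi> x \<noteq> 0}"])
        (use False in \<open>simp_all add: that open_Compl\<close>)
    have *: "(\<phi> has_derivative (\<lambda>_. 0)) (at x)" by (rule 0[OF z])
    moreover have "\<phi> y / D y = 0" if "y \<in> - closure {x. \<phi> x \<noteq> 0}" for y
      using z[OF that] by simp
    then have "((\<lambda>x. \<phi> x / D x) has_derivative (\<lambda>_. 0)) (at x)" by (rule 0)
    moreover have "frechet_derivative \<phi> (at x) = (\<lambda>_. 0)"
      by (rule frechet_derivative_at[OF *(1), symmetric])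
    moreover have "\<phi> x = 0" using False by (intro z) simp
    ultimately show ?thesis by simp
  qed
  have AI: "(\<lambda>x. f x / g x) \<in> ?A" if "?ok f g" for f g using that by blast
  show ?thesis
  proof (rule smooth_by_add_closure[of ?A])
    show "h differentiable at x" if "h \<in> ?A" for h x
      using that d unfolding differentiable_def by blast
    show "partial_deriv b h \<in> add_closure ?A" if h: "h \<in> ?A" and b: "b \<in> Basis" for h b
    proof -
      from h obtain \<phi> D where h: "h = (\<lambda>x. \<phi> x / D x)" and ok: "?ok \<phi> D" by auto
      have "partial_deriv b h x = partial_deriv b \<phi> x / D x + (- 1 * (\<phi> x * partial_deriv b D x)) / (D x * D x)" for x
        using d[OF ok, of x] ok unfolding h
        by (simp add: partial_deriv_eq smooth_has_derivative partial_deriv_eq[OF smooth_has_derivative])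
      then have eq: "partial_deriv b h = (\<lambda>x. partial_deriv b \<phi> x / D x + (- 1 * (\<phi> x * partial_deriv b D x)) / (D x * D x))"
        by auto
      have z: "\<phi> y = 0" if "y \<notin> closure {x. \<phi> x \<noteq> 0}" for y
        using that closure_subset[of "{x. \<phi> x \<noteq> 0}"] by blast
      have "{x. partial_deriv b \<phi> x \<noteq> 0} \<subseteq> closure {x. \<phi> x \<noteq> 0}"
        using partial_deriv_zero_outside[of "closure {x. \<phi> x \<noteq> 0}" \<phi>, OF z closed_closure] by blast
      then have "closure {x. partial_deriv b \<phi> x \<noteq> 0} \<subseteq> closure {x. \<phi> x \<noteq> 0}"
        by (simp add: closure_minimal)
      then have "(\<lambda>x. partial_deriv b \<phi> x / D x) \<in> ?A"
        using ok b smooth_partial_deriv by blast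
      moreover have "{x. - 1 * (\<phi> x * partial_deriv b D x) \<noteq> 0} \<subseteq> {x. \<phi> x \<noteq> 0}" by auto
      then have "closure {x. - 1 * (\<phi> x * partial_deriv b D x) \<noteq> 0} \<subseteq> closure {x. \<phi> x \<noteq> 0}"
        by (rule closure_mono)
      then have "?ok (\<lambda>x. - 1 * (\<phi> x * partial_deriv b D x)) (\<lambda>x. D x * D x)"
        using ok b by (intro conjI smooth_cmult smooth_mult) (auto intro: smooth_partial_deriv)
      then have "(\<lambda>x. (- 1 * (\<phi> x * partial_deriv b D x)) / (D x * D x)) \<in> ?A"
        by (rule AI)
      ultimately show ?thesis unfolding eq by (intro add_closure.intros)
    qed
    show "(\<lambda>x. \<phi> x / D x) \<in> add_closure ?A" using assms by (blast intro: add_closure.base)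
  qed
qed

section \<open>Test functions\<close>

lemma test_functions_iff: "\<phi> \<in> test_functions \<longleftrightarrow> smooth \<phi> \<and> bounded {x. \<phi> x \<noteq> 0}"
  by (simp add: test_functions_def compact_closure)

lemma test_smooth: "\<phi> \<in> test_functions \<Longrightarrow> smooth \<phi>"
  by (simp add: test_functions_iff)

lemma test_functionsI:
  assumes "smooth \<phi>" "bounded K" "\<And>x. x \<notin> K \<Longrightarrow> \<phi> x = 0"
  shows "\<phi> \<in> test_functions"
  unfolding test_functions_iff using assms bounded_subset[of K "{x. \<phi> x \<noteq> 0}"] by auto

lemma test_mult_left: "\<phi> \<in> test_functions \<Longrightarrow> smooth g \<Longrightarrow> (\<lambda>x. \<phi> x * g x) \<in> test_functions"
  by (rule test_functionsI[where K="{x. \<phi> x \<noteq> 0}"]) (auto simp: test_functions_iff smooth_mult)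

lemma test_mult_right: "\<phi> \<in> test_functions \<Longrightarrow> smooth g \<Longrightarrow> (\<lambda>x. g x * \<phi> x) \<in> test_functions"
  using test_mult_left[of \<phi> g] by (simp add: mult.commute)

lemma test_cmult: "\<phi> \<in> test_functions \<Longrightarrow> (\<lambda>x. c * \<phi> x) \<in> test_functions"
  by (intro test_mult_right) auto

lemma test_add:
  assumes "\<phi> \<in> test_functions" "\<theta> \<in> test_functions" shows "(\<lambda>x. \<phi> x + \<theta> x) \<in> test_functions"
  by (rule test_functionsI[where K="{x. \<phi> x \<noteq> 0} \<union> {x. \<theta> x \<noteq> 0}"])
    (use assms in \<open>auto simp: test_functions_iff smooth_add\<close>)

lemma test_zero: "(\<lambda>x. 0) \<in> test_functions"
  by (simp add: test_functions_iff)

lemma test_sum: "(\<And>i. i \<in> I \<Longrightarrow> f i \<in> test_functions) \<Longrightarrow> (\<lambda>x. \<Sum>i\<in>I. f i x) \<in> test_functions"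
  by (induction I rule: infinite_finite_induct) (auto intro: test_add test_zero)

lemma test_power: "\<phi> \<in> test_functions \<Longrightarrow> (\<lambda>x. \<phi> x ^ Suc m) \<in> test_functions"
  by (simp add: test_mult_left smooth_power test_smooth)

lemma test_iter_deriv:
  assumes "\<phi> \<in> test_functions" "bs \<in> lists Basis"
  shows "iter_deriv bs \<phi> \<in> test_functions"
proof (rule test_functionsI[where K="closure {x. \<phi> x \<noteq> 0}"])
  show "iter_deriv bs \<phi> x = 0" if "x \<notin> closure {x. \<phi> x \<noteq> 0}" for x
    by (rule iter_deriv_zero_outside[of "closure {x. \<phi> x \<noteq> 0}"])
      (use that closure_subset[of "{x. \<phi> x \<noteq> 0}"] in auto)
qed (use assms in \<open>auto simp: test_functions_iff smooth_iter_deriv\<close>)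

lemma test_partial_deriv: "\<phi> \<in> test_functions \<Longrightarrow> b \<in> Basis \<Longrightarrow> partial_deriv b \<phi> \<in> test_functions"
  using test_iter_deriv[of \<phi> "[b]"] by simp

lemma test_translate:
  assumes "\<phi> \<in> test_functions" shows "translate y \<phi> \<in> test_functions"
proof (rule test_functionsI[where K="(+) y ` {x. \<phi> x \<noteq> 0}"])
  show "translate y \<phi> x = 0" if "x \<notin> (+) y ` {x. \<phi> x \<noteq> 0}" for x
  proof (rule ccontr)
    assume "translate y \<phi> x \<noteq> 0"
    then have "x = y + (x - y)" "x - y \<in> {x. \<phi> x \<noteq> 0}" by (auto simp: translate_def)
    then show False using that by blast
  qed
qed (use assms in \<open>auto simp: test_functions_iff smooth_translate bounded_translation\<close>)

lemma test_bounded: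
  assumes "\<phi> \<in> test_functions" obtains B where "0 < B" "\<And>x. norm (\<phi> x) \<le> B"
proof -
  have "compact (\<phi> ` closure {x. \<phi> x \<noteq> 0})"
    using assms by (intro compact_continuous_image smooth_continuous_on) (auto simp: test_functions_def)
  then obtain B where B: "\<And>x. x \<in> closure {x. \<phi> x \<noteq> 0} \<Longrightarrow> norm (\<phi> x) \<le> B"
    using compact_imp_bounded bounded_iff by (metis imageI)
  have "norm (\<phi> x) \<le> max 1 B" for x
    using B[of x] closure_subset[of "{x. \<phi> x \<noteq> 0}"] by (cases "\<phi> x = 0") auto
  then show ?thesis by (intro that[of "max 1 B"]) auto
qed

lemma test_support_radius:
  assumes "\<phi> \<in> test_functions" obtains R where "0 < R" "\<And>x. R \<le> norm x \<Longrightarrow> \<phi> x = 0"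
proof -
  have "bounded {x. \<phi> x \<noteq> 0}" using assms by (simp add: test_functions_iff)
  then obtain R where "\<And>x. \<phi> x \<noteq> 0 \<Longrightarrow> norm x \<le> R" unfolding bounded_iff by auto
  then show ?thesis by (intro that[of "max 1 (R + 1)"]) force+
qed

text \<open>The function \<open>exp (- 1/t) / t ^ m\<close> extended by zero. The powers are included since the derivative
  of each member of the family is a combination of the next two.\<close>

definition flat :: "nat \<Rightarrow> real \<Rightarrow> real" where
  "flat m t = (if t \<le> 0 then 0 else inverse t ^ m * exp (- inverse t))"

lemma flat_tendsto_0: "(flat m \<longlongrightarrow> 0) (at 0)"
proof -
  have "((\<lambda>x. x ^ m / exp x) \<longlongrightarrow> (0::real)) at_top" by (rule tendsto_power_div_exp_0)
  then have "((\<lambda>t. inverse t ^ m / exp (inverse t)) \<longlongrightarrow> (0::real)) (at_right 0)"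
    by (rule filterlim_compose[OF _ filterlim_inverse_at_top_right])
  then have "(flat m \<longlongrightarrow> 0) (at_right 0)"
    by (rule Lim_transform_eventually)
      (auto simp: flat_def eventually_at_filter exp_minus divide_inverse)
  moreover have "(flat m \<longlongrightarrow> 0) (at_left 0)"
    by (rule Lim_transform_eventually[OF tendsto_const])
      (auto simp: flat_def eventually_at_filter)
  ultimately show ?thesis by (rule filterlim_split_at[rotated])
qed

lemma DERIV_flat: "(flat m has_real_derivative (- real m * flat (Suc m) t + flat (Suc (Suc m)) t)) (at t)"
proof (cases t "0::real" rule: linorder_cases)
  case less
  have "(flat m has_real_derivative 0) (at t)"
    by (rule has_field_derivative_transform_within_open[of "\<lambda>_. 0" _ _ "{..<0}"])
       (use less in \<open>auto simp: flat_def\<close>)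
  then show ?thesis using less by (simp add: flat_def)
next
  case equal
  have "(flat m has_real_derivative 0) (at 0)"
    unfolding has_field_derivative_iff
  proof (rule Lim_transform_eventually[OF flat_tendsto_0[of "Suc m"]])
    show "\<forall>\<^sub>F x in at 0. flat (Suc m) x = (flat m x - flat m 0) / (x - 0)"
      by (auto simp: eventually_at_filter flat_def divide_inverse)
  qed
  with equal show ?thesis by (simp add: flat_def)
next
  case greater
  have "((\<lambda>t. inverse t ^ m * exp (- inverse t)) has_real_derivative
      (- real m * flat (Suc m) t + flat (Suc (Suc m)) t)) (at t)"
  proof (cases m)
    case 0
    then show ?thesis using greater
      by (auto intro!: derivative_eq_intros simp: flat_def power2_eq_square algebra_simps)
  next
    case (Suc n)
    have "((\<lambda>t. inverse t ^ m) has_real_derivative real m * (- (inverse t ^ 2) * inverse t ^ n)) (at t)"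
      using DERIV_power[OF DERIV_inverse[of t], of m] greater by (simp add: Suc numeral_2_eq_2)
    moreover have "((\<lambda>t. exp (- inverse t)) has_real_derivative exp (- inverse t) * inverse t ^ 2) (at t)"
      using greater by (auto intro!: derivative_eq_intros simp: numeral_2_eq_2)
    ultimately have "((\<lambda>t. inverse t ^ m * exp (- inverse t)) has_real_derivative
       real m * (- (inverse t ^ 2) * inverse t ^ n) * exp (- inverse t)
       + exp (- inverse t) * inverse t ^ 2 * inverse t ^ m) (at t)"
      by (rule DERIV_mult)
    then show ?thesis using greater by (simp add: flat_def Suc power2_eq_square algebra_simps)
  qed
  then show ?thesis
    by (rule has_field_derivative_transform_within_open[of _ _ _ "{0<..}"])
       (use greater in \<open>auto simp: flat_def\<close>)
qed

lemma smooth_flat: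
  fixes p :: "'a::euclidean_space \<Rightarrow> real"
  assumes "smooth (\<lambda>x. complex_of_real (p x))"
  shows "smooth (\<lambda>x. complex_of_real (flat m (p x)))"
proof -
  let ?p = "\<lambda>x. complex_of_real (p x)"
  let ?A = "{(\<lambda>x. g x * complex_of_real (flat m (p x))) |g m. smooth g}"
  have d: "((\<lambda>x. complex_of_real (flat m (p x))) has_derivative
     (\<lambda>h. of_real (- real m * flat (Suc m) (p x) + flat (Suc (Suc m)) (p x)) * frechet_derivative ?p (at x) h)) (at x)" for m x
  proof -
    define Q where "Q = frechet_derivative ?p (at x)"
    have Q: "(?p has_derivative Q) (at x)" unfolding Q_def by (rule smooth_has_derivative[OF assms])
    have P: "(p has_derivative (\<lambda>h. Re (Q h))) (at x)"
      using bounded_linear.has_derivative[OF bounded_linear_Re Q] by simp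
    have "(?p has_derivative (\<lambda>h. of_real (Re (Q h)))) (at x)"
      by (rule bounded_linear.has_derivative[OF bounded_linear_of_real P])
    then have real: "Q = (\<lambda>h. of_real (Re (Q h)))" by (rule has_derivative_unique[OF Q])
    have "((\<lambda>x. flat m (p x)) has_derivative (\<lambda>h.
        (- real m * flat (Suc m) (p x) + flat (Suc (Suc m)) (p x)) * Re (Q h))) (at x)"
      by (rule has_derivative_compose[OF P DERIV_flat[unfolded has_field_derivative_def]])
    from bounded_linear.has_derivative[OF bounded_linear_of_real this]
    have "((\<lambda>x. complex_of_real (flat m (p x))) has_derivative (\<lambda>h. of_real (- real m * flat (Suc m) (p x) + flat (Suc (Suc m)) (p x)) * of_real (Re (Q h)))) (at x)"
      by simp
    then show ?thesis unfolding Q_def[symmetric] by (subst real)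
  qed
  show ?thesis
  proof (rule smooth_by_add_closure[of ?A])
    show "h differentiable at x" if "h \<in> ?A" for h x
    proof -
      from that obtain g m where "h = (\<lambda>x. g x * complex_of_real (flat m (p x)))" "smooth g" by auto
      then show ?thesis
        using differentiable_mult[OF smooth_differentiable[of g x] differentiableI[OF d]] by simp
    qed
    show "partial_deriv b h \<in> add_closure ?A" if h: "h \<in> ?A" and b: "b \<in> Basis" for h b
    proof -
      from h obtain g m where h: "h = (\<lambda>x. g x * complex_of_real (flat m (p x)))" and g: "smooth g" by auto
      have "partial_deriv b h x = partial_deriv b g x * complex_of_real (flat m (p x)) +
         ((g x * (- of_nat m * partial_deriv b ?p x)) * complex_of_real (flat (Suc m) (p x)) +
          (g x * partial_deriv b ?p x) * complex_of_real (flat (Suc (Suc m)) (p x)))" for x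
        unfolding h partial_deriv_mult[OF smooth_differentiable[OF g] differentiableI[OF d]]
          partial_deriv_eq[OF d] partial_deriv_eq[OF smooth_has_derivative[OF assms]]
        by (simp add: algebra_simps)
      then have eq: "partial_deriv b h = (\<lambda>x. partial_deriv b g x * complex_of_real (flat m (p x)) +
         ((g x * (- of_nat m * partial_deriv b ?p x)) * complex_of_real (flat (Suc m) (p x)) +
          (g x * partial_deriv b ?p x) * complex_of_real (flat (Suc (Suc m)) (p x))))" by auto
      have *: "(\<lambda>x. q x * complex_of_real (flat m (p x))) \<in> ?A" if "smooth q" for q m
        using that by auto
      show ?thesis unfolding eq
        by (rule add_closure.add[OF add_closure.base[OF *] add_closure.add[OF add_closure.base[OF *] add_closure.base[OF *]]])
          (use assms g b in \<open>auto intro!: smooth_minus smooth_mult smooth_partial_deriv\<close>)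
    qed
    have "(\<lambda>x. 1 * complex_of_real (flat m (p x))) \<in> ?A"
      by (rule CollectI, rule exI[of _ "\<lambda>_. 1"], rule exI[of _ m]) simp
    then show "(\<lambda>x. complex_of_real (flat m (p x))) \<in> add_closure ?A" by (auto intro: add_closure.base)
  qed
qed

lemma flat_0_pos: "0 < flat 0 t \<longleftrightarrow> 0 < t"
  by (simp add: flat_def)

lemma flat_0_eq_0: "flat 0 t = 0 \<longleftrightarrow> t \<le> 0"
  by (simp add: flat_def)

lemma flat_0_nonneg: "0 \<le> flat 0 t"
  by (simp add: flat_def)

lemma flat_0_le_1: "flat 0 t \<le> 1"
  by (simp add: flat_def)

definition ball_bump :: "real \<Rightarrow> 'a::euclidean_space \<Rightarrow> complex" where
  "ball_bump r x = of_real (flat 0 (r\<^sup>2 - (norm x)\<^sup>2))"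

lemma ball_bump_eq_0: "0 < r \<Longrightarrow> ball_bump r x = 0 \<longleftrightarrow> r \<le> norm x"
  using abs_le_square_iff[of r "norm x"] by (simp add: ball_bump_def flat_0_eq_0)

lemma smooth_norm_squared: "smooth (\<lambda>x. complex_of_real ((norm x)\<^sup>2))"
  using smooth_dist_squared[of 0] by simp

lemma test_ball_bump:
  assumes "0 < r" shows "ball_bump r \<in> test_functions"
proof (rule test_functionsI[where K="cball 0 r"])
  show "smooth (ball_bump r)"
    unfolding ball_bump_def[abs_def]
    using smooth_diff[OF smooth_const[of "of_real (r\<^sup>2)"] smooth_norm_squared] by (intro smooth_flat) simp
  show "ball_bump r x = 0" if "x \<notin> cball 0 r" for x
    using that ball_bump_eq_0[OF assms, of x] by simp
qed simp

text \<open>The quotient \<open>N / (N + M)\<close> of smooth cutoffs equals \<open>1\<close> where \<open>M\<close>, which is supported outside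
  the ball of radius \<open>R\<close>, vanishes.\<close>

lemma plateau_exists:
  assumes "0 < R"
  obtains \<eta> :: "'a::euclidean_space \<Rightarrow> complex" where "\<eta> \<in> test_functions"
    "\<And>x. norm (\<eta> x) \<le> 1" "\<And>x. norm x \<le> R \<Longrightarrow> \<eta> x = 1"
proof -
  define N where "N = (\<lambda>x::'a. flat 0 ((2*R)\<^sup>2 - (norm x)\<^sup>2))"
  define M where "M = (\<lambda>x::'a. flat 0 ((norm x)\<^sup>2 - R\<^sup>2))"
  have pos: "N x + M x > 0" for x
  proof -
    have "R\<^sup>2 < (2*R)\<^sup>2" using assms by (simp add: power_strict_mono)
    then have "0 < (2*R)\<^sup>2 - (norm x)\<^sup>2 \<or> 0 < (norm x)\<^sup>2 - R\<^sup>2" by linarith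
    then have "0 < N x \<or> 0 < M x" by (simp only: N_def M_def flat_0_pos)
    moreover have "0 \<le> N x" "0 \<le> M x" by (simp_all add: N_def M_def flat_0_nonneg)
    ultimately show ?thesis by linarith
  qed
  have N: "(\<lambda>x. complex_of_real (N x)) \<in> test_functions"
    using test_ball_bump[of "2*R", where 'a='a] assms by (simp add: N_def ball_bump_def[abs_def])
  have M: "smooth (\<lambda>x. complex_of_real (M x))"
    unfolding M_def using smooth_diff[OF smooth_norm_squared smooth_const[of "of_real (R\<^sup>2)"]]
    by (intro smooth_flat) simp
  let ?\<eta> = "\<lambda>x. complex_of_real (N x) / complex_of_real (N x + M x)"
  show ?thesis
  proof (rule that[of ?\<eta>])
    show "?\<eta> \<in> test_functions"
    proof (rule test_functionsI[where K="{x. complex_of_real (N x) \<noteq> 0}", OF smooth_divide])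
      show "smooth (\<lambda>x. complex_of_real (N x + M x))"
        using smooth_add[OF test_smooth[OF N] M] by simp
      show "complex_of_real (N x + M x) \<noteq> 0" for x using pos[of x] by (metis of_real_eq_0_iff less_irrefl)
    qed (use N test_smooth in \<open>auto simp: test_functions_iff\<close>)
    show "norm (?\<eta> x) \<le> 1" for x
      using pos[of x] unfolding norm_divide norm_of_real
      by (simp add: divide_le_eq N_def M_def flat_0_nonneg)
    show "?\<eta> x = 1" if "norm x \<le> R" for x
    proof -
      have "M x = 0" using that by (simp add: M_def flat_def power_mono)
      then show ?thesis using pos[of x] by simp
    qed
  qed
qed

text \<open>By compactness finitely many translates of \<open>\<psi>\<close> have no common zero on the support of \<open>\<omega>\<close>;
  dividing \<open>\<omega>\<close> by the sum of their squared moduli gives the coefficients.\<close>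

lemma test_function_partition:
  fixes \<psi> \<omega> :: "'a::euclidean_space \<Rightarrow> complex"
  assumes "\<psi> \<in> test_functions" "\<psi> z \<noteq> 0" "\<omega> \<in> test_functions"
  obtains Y \<theta> where "finite Y" "\<And>y. y \<in> Y \<Longrightarrow> \<theta> y \<in> test_functions"
    "\<And>x. \<omega> x = (\<Sum>y\<in>Y. \<theta> y x * translate y \<psi> x)"
proof -
  define K where "K = closure {x. \<omega> x \<noteq> 0}"
  have K: "compact K" using assms(3) by (simp add: K_def test_functions_def)
  have op: "open {x. translate y \<psi> x \<noteq> 0}" for y
    using open_Collect_neq[OF smooth_continuous_on[OF smooth_translate(1)[OF test_smooth[OF assms(1)]]], of "\<lambda>_. 0"]
    by simp
  have cov: "K \<subseteq> (\<Union>y. {x. translate y \<psi> x \<noteq> 0})"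
  proof
    fix x show "x \<in> (\<Union>y. {x. translate y \<psi> x \<noteq> 0})"
      using assms(2) by (auto simp: translate_def intro!: exI[of _ "x - z"])
  qed
  obtain Y where "Y \<subseteq> UNIV" and Y: "finite Y" "K \<subseteq> (\<Union>y\<in>Y. {x. translate y \<psi> x \<noteq> 0})"
    by (rule compactE_image[OF K op cov])
  define D where "D = (\<lambda>x. \<Sum>y\<in>Y. translate y \<psi> x * cnj (translate y \<psi> x))"
  have D: "smooth D" unfolding D_def
    using assms(1) by (intro smooth_sum smooth_mult smooth_cnj smooth_translate test_smooth)
  have D_nz: "D x \<noteq> 0" if "x \<in> K" for x
  proof -
    from Y that obtain y where y: "y \<in> Y" "translate y \<psi> x \<noteq> 0" by auto
    have "D x = of_real (\<Sum>y\<in>Y. (norm (translate y \<psi> x))\<^sup>2)"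
      by (simp add: D_def complex_norm_square[symmetric])
    moreover have "0 < (\<Sum>y\<in>Y. (norm (translate y \<psi> x))\<^sup>2)"
      using y Y by (intro sum_pos2[of _ y]) auto
    ultimately show ?thesis by (metis of_real_eq_0_iff less_irrefl)
  qed
  define \<theta> where "\<theta> = (\<lambda>y x. \<omega> x * cnj (translate y \<psi> x) / D x)"
  show ?thesis
  proof (rule that[OF Y(1), of \<theta>])
    show "\<theta> y \<in> test_functions" for y
      unfolding \<theta>_def
    proof (rule test_functionsI[where K=K, OF smooth_divide])
      show "smooth (\<lambda>x. \<omega> x * cnj (translate y \<psi> x))"
        using assms by (intro smooth_mult smooth_cnj smooth_translate test_smooth)
      show "D x \<noteq> 0" if "x \<in> closure {x. \<omega> x * cnj (translate y \<psi> x) \<noteq> 0}" for x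
      proof -
        have "closure {x. \<omega> x * cnj (translate y \<psi> x) \<noteq> 0} \<subseteq> K"
          unfolding K_def by (intro closure_mono) auto
        then show ?thesis using that D_nz by blast
      qed
      show "bounded K" using K by (rule compact_imp_bounded)
      show "\<omega> x * cnj (translate y \<psi> x) / D x = 0" if "x \<notin> K" for x
        proof -
          have "\<omega> x = 0" using that closure_subset[of "{x. \<omega> x \<noteq> 0}"] unfolding K_def by blast
          then show ?thesis by simp
        qed
    qed (rule D)
    show "\<omega> x = (\<Sum>y\<in>Y. \<theta> y x * translate y \<psi> x)" for x
    proof (cases "\<omega> x = 0")
      case False
      then have "x \<in> K" using closure_subset[of "{x. \<omega> x \<noteq> 0}"] unfolding K_def by blast
      then have "D x \<noteq> 0" by (rule D_nz)
      have "(\<Sum>y\<in>Y. \<theta> y x * translate y \<psi> x) = (\<Sum>y\<in>Y. \<omega> x / D x * (translate y \<psi> x * cnj (translate y \<psi> x)))"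
        unfolding \<theta>_def by (rule sum.cong) (simp_all add: mult_ac)
      also have "\<dots> = \<omega> x / D x * D x" unfolding sum_distrib_left[symmetric] by (simp only: D_def)
      finally have "(\<Sum>y\<in>Y. \<theta> y x * translate y \<psi> x) = \<omega> x / D x * D x" .
      then show ?thesis using \<open>D x \<noteq> 0\<close> by simp
    qed (simp add: \<theta>_def)
  qed
qed

section \<open>Families with uniformly bounded derivatives\<close>

text \<open>The parameter \<open>p\<close> will be the position of a window, and constants have to be uniform in it.\<close>

definition unif_smooth :: "('p \<Rightarrow> 'a::euclidean_space \<Rightarrow> complex) \<Rightarrow> bool" where
  "unif_smooth F \<longleftrightarrow> (\<forall>p. smooth (F p)) \<and>
     (\<forall>bs\<in>lists Basis. \<exists>B. \<forall>p x. norm (iter_deriv bs (F p) x) \<le> B)"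

lemma unif_smoothD: "unif_smooth F \<Longrightarrow> smooth (F p)"
  by (simp add: unif_smooth_def)

lemma unif_smooth_bound:
  assumes "unif_smooth F" "bs \<in> lists Basis"
  obtains B where "0 < B" "\<And>p x. norm (iter_deriv bs (F p) x) \<le> B"
proof -
  obtain B where "\<And>p x. norm (iter_deriv bs (F p) x) \<le> B"
    using assms unfolding unif_smooth_def by blast
  then have "norm (iter_deriv bs (F p) x) \<le> max B 1" for p x
    by (meson max.cobounded1 order_trans)
  then show ?thesis by (intro that[of "max B 1"]) auto
qed

lemma unif_smooth_partial_deriv:
  assumes "unif_smooth F" "b \<in> Basis" shows "unif_smooth (\<lambda>p. partial_deriv b (F p))"
proof -
  have "\<exists>B. \<forall>p x. norm (iter_deriv bs (partial_deriv b (F p)) x) \<le> B" if "bs \<in> lists Basis" for bs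
  proof -
    have "bs @ [b] \<in> lists Basis" using that assms(2) by simp
    from unif_smooth_bound[OF assms(1) this] show ?thesis unfolding iter_deriv_snoc by metis
  qed
  then show ?thesis using assms smooth_partial_deriv unfolding unif_smooth_def by blast
qed

lemma unif_smooth_add:
  assumes "unif_smooth F" "unif_smooth G" shows "unif_smooth (\<lambda>p x. F p x + G p x)"
  unfolding unif_smooth_def
proof (intro conjI allI ballI)
  show "smooth (\<lambda>x. F p x + G p x)" for p using assms by (intro smooth_add unif_smoothD)
  fix bs :: "'b list" assume bs: "bs \<in> lists Basis"
  obtain B where "0 < B" and B: "\<And>p x. norm (iter_deriv bs (F p) x) \<le> B" by (rule unif_smooth_bound[OF assms(1) bs]) auto
  obtain C where "0 < C" and C: "\<And>p x. norm (iter_deriv bs (G p) x) \<le> C" by (rule unif_smooth_bound[OF assms(2) bs]) auto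
  have "norm (iter_deriv bs (\<lambda>x. F p x + G p x) x) \<le> B + C" for p x
    using B[of p x] C[of p x] assms bs by (simp add: iter_deriv_add unif_smoothD norm_triangle_mono)
  then show "\<exists>B. \<forall>p x. norm (iter_deriv bs (\<lambda>x. F p x + G p x) x) \<le> B" by blast
qed

lemma unif_smooth_mult:
  assumes "unif_smooth F" "unif_smooth G" shows "unif_smooth (\<lambda>p x. F p x * G p x)"
  unfolding unif_smooth_def
proof (intro conjI allI ballI)
  show "smooth (\<lambda>x. F p x * G p x)" for p using assms by (intro smooth_mult unif_smoothD)
  fix bs :: "'b list" assume "bs \<in> lists Basis"
  then show "\<exists>B. \<forall>p x. norm (iter_deriv bs (\<lambda>x. F p x * G p x) x) \<le> B"
    using assms
  proof (induction bs arbitrary: F G rule: rev_induct)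
    case Nil
    obtain B where "0 < B" and B: "\<And>p x. norm (F p x) \<le> B" by (rule unif_smooth_bound[OF Nil(2), of "[]"]) auto
    obtain C where "0 < C" and C: "\<And>p x. norm (G p x) \<le> C" by (rule unif_smooth_bound[OF Nil(3), of "[]"]) auto
    have "norm (F p x * G p x) \<le> B * C" for p x
      using mult_mono[OF B[of p x] C[of p x]] B[of p x] by (simp add: norm_mult order_trans[OF norm_ge_zero])
    then show ?case by auto
  next
    case (snoc b bs)
    then have bs: "bs \<in> lists Basis" "b \<in> Basis" by auto
    obtain B where B: "\<And>p x. norm (iter_deriv bs (\<lambda>x. partial_deriv b (F p) x * G p x) x) \<le> B"
      using snoc.IH[OF bs(1) unif_smooth_partial_deriv[OF snoc.prems(2) bs(2)] snoc.prems(3)] by blast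
    obtain C where C: "\<And>p x. norm (iter_deriv bs (\<lambda>x. F p x * partial_deriv b (G p) x) x) \<le> C"
      using snoc.IH[OF bs(1) snoc.prems(2) unif_smooth_partial_deriv[OF snoc.prems(3) bs(2)]] by blast
    have "norm (iter_deriv (bs @ [b]) (\<lambda>x. F p x * G p x) x) \<le> B + C" for p x
      using B[of p x] C[of p x] snoc.prems bs
      by (simp add: iter_deriv_mult_snoc unif_smoothD norm_triangle_mono)
    then show ?case by blast
  qed
qed

lemma unif_smooth_translate:
  fixes \<phi> :: "'b::euclidean_space \<Rightarrow> complex"
  assumes "\<phi> \<in> test_functions"
  shows "unif_smooth (\<lambda>p. translate (y p) \<phi>)"
  unfolding unif_smooth_def
proof (intro conjI allI ballI)
  show "smooth (translate (y p) \<phi>)" for p using assms by (simp add: test_smooth smooth_translate)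
  fix bs :: "'b list" assume "bs \<in> lists Basis"
  from test_bounded[OF test_iter_deriv[OF assms this]]
  show "\<exists>B. \<forall>p x. norm (iter_deriv bs (translate (y p) \<phi>) x) \<le> B"
    unfolding smooth_translate(2)[OF test_smooth[OF assms]] translate_def by metis
qed

lemma iter_deriv_const: "bs \<noteq> [] \<Longrightarrow> iter_deriv bs (\<lambda>x. c) = (\<lambda>x. 0)"
proof (induction bs)
  case (Cons b bs) then show ?case by (cases "bs = []") auto
qed simp

lemma unif_smooth_scalars:
  fixes c :: "'p \<Rightarrow> complex"
  assumes "\<And>p. norm (c p) \<le> B" shows "unif_smooth (\<lambda>p (x::'b::euclidean_space). c p)"
  unfolding unif_smooth_def
proof (intro conjI allI ballI)
  fix bs :: "'b list" 
  show "\<exists>B. \<forall>p x. norm (iter_deriv bs (\<lambda>x::'b. c p) x) \<le> B"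
    using assms by (cases "bs = []") (auto simp: iter_deriv_const)
qed simp

lemma unif_smooth_sum: "(\<And>i. i \<in> I \<Longrightarrow> unif_smooth (F i)) \<Longrightarrow> unif_smooth (\<lambda>p x. \<Sum>i\<in>I. F i p x)"
  by (induction I rule: infinite_finite_induct)
     (auto intro: unif_smooth_add unif_smooth_scalars[of "\<lambda>_. 0" 0])

lemma unif_smooth_order_bound:
  fixes F :: "'p \<Rightarrow> 'a::euclidean_space \<Rightarrow> complex"
  assumes "unif_smooth F"
  obtains B where "0 < B" "\<And>p bs x. bs \<in> lists Basis \<Longrightarrow> length bs \<le> L \<Longrightarrow> norm (iter_deriv bs (F p) x) \<le> B"
proof -
  have "\<forall>bs. \<exists>B. bs \<in> lists Basis \<longrightarrow> (\<forall>p x. norm (iter_deriv bs (F p) x) \<le> B)"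
    using assms unfolding unif_smooth_def by blast
  from choice[OF this] obtain B where B: "\<And>bs p x. bs \<in> lists Basis \<Longrightarrow> norm (iter_deriv bs (F p) x) \<le> B bs" by blast
  have fin: "finite {bs \<in> lists (Basis :: 'a set). length bs \<le> L}"
    by (rule finite_subset[OF _ finite_lists_length_le[OF finite_Basis, of L]]) auto
  define S where "S = (\<Sum>bs | bs \<in> lists (Basis :: 'a set) \<and> length bs \<le> L. \<bar>B bs\<bar>)"
  have "norm (iter_deriv bs (F p) x) \<le> 1 + S" if "bs \<in> lists Basis" "length bs \<le> L" for p bs x
  proof -
    have "norm (iter_deriv bs (F p) x) \<le> \<bar>B bs\<bar>" using B[OF that(1), of p x] by simp
    also have "\<dots> \<le> S" unfolding S_def using fin that by (intro member_le_sum) auto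
    finally show ?thesis by simp
  qed
  moreover have "0 \<le> S" unfolding S_def by (intro sum_nonneg) auto
  ultimately show ?thesis by (intro that[of "1 + S"]) auto
qed

lemma test_order_bound:
  fixes \<phi> :: "'a::euclidean_space \<Rightarrow> complex"
  assumes "\<phi> \<in> test_functions"
  obtains B where "0 < B" "\<And>bs x. bs \<in> lists Basis \<Longrightarrow> length bs \<le> L \<Longrightarrow> norm (iter_deriv bs \<phi> x) \<le> B"
proof -
  obtain B where "0 < B" and B: "\<And>p bs x. \<lbrakk>bs \<in> lists Basis; length bs \<le> L\<rbrakk> \<Longrightarrow> norm (iter_deriv bs (translate 0 \<phi>) x) \<le> B"
    by (rule unif_smooth_order_bound[OF unif_smooth_translate[OF assms, of "\<lambda>_::unit. 0"], of L]) auto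
  then show ?thesis by (intro that[of B]) (auto simp: translate_def[abs_def])
qed

text \<open>Differentiating \<open>T ^ j\<close> brings down a factor \<open>j\<close> and replaces one factor \<open>T\<close> by a derivative. So
  only the supremum \<open>s\<close> of \<open>T\<close> on the support of \<open>F\<close> is raised to the power \<open>j\<close>, while the bounds
  of the derivatives of \<open>T\<close>, however large, enter the constant.\<close>

lemma unif_smooth_power_bound:
  fixes F T :: "'p \<Rightarrow> 'a::euclidean_space \<Rightarrow> complex"
  assumes "bs \<in> lists Basis" "unif_smooth F" "unif_smooth T" "0 < s"
    and "\<And>p x. x \<in> U p \<Longrightarrow> norm (T p x) \<le> s" "\<And>p. closed (U p)" "\<And>p x. x \<notin> U p \<Longrightarrow> F p x = 0"
  shows "\<exists>C>0. \<forall>p x j. norm (iter_deriv bs (\<lambda>x. F p x * T p x ^ j) x) \<le> C * real (Suc j) ^ length bs * s ^ j"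
  using assms(1,2,7)
proof (induction bs arbitrary: F rule: rev_induct)
  case Nil
  obtain B where B: "0 < B" "\<And>p x. norm (F p x) \<le> B" by (rule unif_smooth_bound[OF Nil(2), of "[]"]) auto
  have "norm (F p x * T p x ^ j) \<le> B * s ^ j" for p x j
  proof (cases "x \<in> U p")
    case True
    then show ?thesis unfolding norm_mult norm_power
      using assms(5)[OF True] B by (intro mult_mono power_mono) (auto simp: less_imp_le)
  qed (use Nil(3) B assms(4) in auto)
  then show ?case using B(1) by auto
next
  case (snoc b bs)
  then have bs: "bs \<in> lists Basis" "b \<in> Basis" by auto
  have F': "unif_smooth (\<lambda>p. partial_deriv b (F p))" "unif_smooth (\<lambda>p x. F p x * partial_deriv b (T p) x)"
    using snoc.prems assms(3) bs unif_smooth_mult unif_smooth_partial_deriv by blast+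
  have z: "partial_deriv b (F p) x = 0" if "x \<notin> U p" for p x
    using partial_deriv_zero_outside[of "U p" "F p"] snoc.prems(3) assms(6) that by blast
  obtain B where B: "0 < B" "\<And>p x j. norm (iter_deriv bs (\<lambda>x. partial_deriv b (F p) x * T p x ^ j) x)
      \<le> B * real (Suc j) ^ length bs * s ^ j"
    using snoc.IH[OF bs(1) F'(1) z] by blast
  obtain C where C: "0 < C" "\<And>p x j. norm (iter_deriv bs (\<lambda>x. F p x * partial_deriv b (T p) x * T p x ^ j) x)
      \<le> C * real (Suc j) ^ length bs * s ^ j"
    using snoc.IH[OF bs(1) F'(2)] snoc.prems(3) by auto
  have "norm (iter_deriv (bs @ [b]) (\<lambda>x. F p x * T p x ^ j) x)
      \<le> (B + C / s) * real (Suc j) ^ length (bs @ [b]) * s ^ j" for p x j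
  proof (cases j)
    case 0
    have "norm (iter_deriv (bs @ [b]) (\<lambda>x. F p x * T p x ^ j) x) \<le> B"
      using B(2)[of p 0 x] by (simp add: 0 iter_deriv_snoc)
    also have "\<dots> \<le> B + C / s" using C assms(4) by simp
    finally show ?thesis by (simp add: 0)
  next
    case (Suc i)
    have sm: "smooth (F p)" "smooth (T p)" using snoc.prems assms(3) unif_smoothD by auto
    have pd: "partial_deriv b (\<lambda>x. F p x * T p x ^ Suc i) x = partial_deriv b (F p) x * T p x ^ Suc i
        + of_nat (Suc i) * (F p x * partial_deriv b (T p) x * T p x ^ i)" for x
    proof -
      have "((\<lambda>x. T p x ^ Suc i) has_derivative
          (\<lambda>h. frechet_derivative (T p) (at x) h * of_nat (Suc i) * T p x ^ i)) (at x)"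
        using has_derivative_power[OF smooth_has_derivative[OF sm(2), of x], of "Suc i"] by (simp add: algebra_simps)
      from partial_deriv_eq[OF this, of b] show ?thesis
        using partial_deriv_mult[OF smooth_differentiable[OF sm(1), of x] smooth_differentiable[OF smooth_power[OF sm(2), of "Suc i"], of x], of b]
        by (simp add: partial_deriv_eq[OF smooth_has_derivative[OF sm(2)]] algebra_simps)
    qed
    have "iter_deriv (bs @ [b]) (\<lambda>x. F p x * T p x ^ j) x =
        iter_deriv bs (\<lambda>x. partial_deriv b (F p) x * T p x ^ Suc i) x
        + of_nat (Suc i) * iter_deriv bs (\<lambda>x. F p x * partial_deriv b (T p) x * T p x ^ i) x"
      unfolding iter_deriv_snoc Suc pd[abs_def]
      using sm bs by (subst iter_deriv_add)
       (auto simp: iter_deriv_cmult smooth_mult smooth_power smooth_partial_deriv smooth_cmult simp del: power_Suc)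
    also have "norm \<dots> \<le> B * real (Suc j) ^ length bs * s ^ j + real j * (C * real j ^ length bs * s ^ i)"
      using B(2)[of p "Suc i" x] C(2)[of p i x] unfolding Suc
      by (intro norm_triangle_mono) (simp_all add: norm_mult mult_left_mono del: power_Suc of_nat_Suc)
    also have "\<dots> \<le> B * real (Suc j) ^ length (bs @ [b]) * s ^ j + C / s * real (Suc j) ^ length (bs @ [b]) * s ^ j"
    proof (intro add_mono)
      show "B * real (Suc j) ^ length bs * s ^ j \<le> B * real (Suc j) ^ length (bs @ [b]) * s ^ j"
        using B(1) assms(4) by (intro mult_right_mono mult_left_mono power_increasing) auto
      have "real j * real j ^ length bs \<le> real (Suc j) ^ length (bs @ [b])"
        using power_mono[of "real j" "real (Suc j)" "Suc (length bs)"] by simp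
      then have "C * s ^ i * (real j * real j ^ length bs) \<le> C * s ^ i * real (Suc j) ^ length (bs @ [b])"
        using C(1) assms(4) by (intro mult_left_mono) auto
      then show "real j * (C * real j ^ length bs * s ^ i) \<le> C / s * real (Suc j) ^ length (bs @ [b]) * s ^ j"
        using assms(4) by (simp add: Suc mult_ac del: of_nat_Suc)
    qed
    finally show ?thesis by (simp add: algebra_simps)
  qed
  moreover have "0 < B + C / s" using B C assms(4) by (simp add: add_pos_pos)
  ultimately show ?case by blast
qed

section \<open>Fourier transforms of integrable functions\<close>

lemma lborel_affine_invariance:
  fixes f :: "'a::euclidean_space \<Rightarrow> 'b::{banach, second_countable_topology}"
  assumes "f \<in> borel_measurable borel" "c \<noteq> 0"
  shows "(\<integral>x. f x \<partial>lborel) = \<bar>c\<bar> ^ DIM('a) *\<^sub>R (\<integral>x. f (t + c *\<^sub>R x) \<partial>lborel)"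
    and "integrable lborel (\<lambda>x. f (t + c *\<^sub>R x)) \<longleftrightarrow> integrable lborel f"
proof -
  have [measurable]: "(\<lambda>x::'a. t + c *\<^sub>R x) \<in> borel_measurable borel" by simp
  note assms(1)[measurable]
  show "(\<integral>x. f x \<partial>lborel) = \<bar>c\<bar> ^ DIM('a) *\<^sub>R (\<integral>x. f (t + c *\<^sub>R x) \<partial>lborel)"
    by (subst lborel_affine[OF assms(2), of t])
      (simp add: integral_density integral_distr)
  have "integrable lborel f \<longleftrightarrow> integrable (density (distr lborel borel (\<lambda>x. t + c *\<^sub>R x)) (\<lambda>_. ennreal (\<bar>c\<bar>^DIM('a)))) f"
    by (subst lborel_affine[OF assms(2), of t]) simp
  also have "\<dots> \<longleftrightarrow> integrable lborel (\<lambda>x. \<bar>c\<bar> ^ DIM('a) *\<^sub>R f (t + c *\<^sub>R x))"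
    by (subst integrable_density) (auto simp: integrable_distr_eq)
  also have "\<dots> \<longleftrightarrow> integrable lborel (\<lambda>x. f (t + c *\<^sub>R x))"
  proof
    assume "integrable lborel (\<lambda>x. \<bar>c\<bar> ^ DIM('a) *\<^sub>R f (t + c *\<^sub>R x))"
    from integrable_scaleR_right[OF this, of "inverse (\<bar>c\<bar> ^ DIM('a))"]
    show "integrable lborel (\<lambda>x. f (t + c *\<^sub>R x))" using assms(2) by simp
  qed auto
  finally show "integrable lborel (\<lambda>x. f (t + c *\<^sub>R x)) \<longleftrightarrow> integrable lborel f" by simp
qed

lemma lborel_translation_invariance:
  fixes f :: "'a::euclidean_space \<Rightarrow> 'b::{banach, second_countable_topology}"
  assumes "f \<in> borel_measurable borel"
  shows "(\<integral>x. f (t + x) \<partial>lborel) = (\<integral>x. f x \<partial>lborel)"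
    and "integrable lborel (\<lambda>x. f (t + x)) \<longleftrightarrow> integrable lborel f"
  using lborel_affine_invariance[OF assms, of 1 t] by simp_all

lemma lborel_reflection_invariance:
  fixes f :: "'a::euclidean_space \<Rightarrow> 'b::{banach, second_countable_topology}"
  assumes "f \<in> borel_measurable borel"
  shows "(\<integral>x. f (- x) \<partial>lborel) = (\<integral>x. f x \<partial>lborel)"
    and "integrable lborel (\<lambda>x. f (- x)) \<longleftrightarrow> integrable lborel f"
  using lborel_affine_invariance[OF assms, of "-1" 0] by simp_all

abbreviation fourier_kernel :: "'a::euclidean_space \<Rightarrow> 'a \<Rightarrow> complex" where
  "fourier_kernel x \<xi> \<equiv> exp (- (\<i> * complex_of_real (x \<bullet> \<xi>)))"

lemma norm_fker [simp]: "norm (fourier_kernel x \<xi>) = 1"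
  by (simp add: norm_exp_eq_Re)

lemma fourier_lborel:
  assumes [measurable]: "f \<in> borel_measurable borel"
  shows "fourier f \<xi> = (\<integral>x. fourier_kernel x \<xi> * f x \<partial>lborel)"
  unfolding fourier_def by (rule integral_completion) simp

lemma integrable_borel: "integrable lborel f \<Longrightarrow> f \<in> borel_measurable borel"
  using borel_measurable_integrable[of lborel f] by simp

lemma integrable_fker:
  assumes "integrable lborel f" shows "integrable lborel (\<lambda>x. fourier_kernel x \<xi> * f x)"
proof (rule Bochner_Integration.integrable_bound[OF assms])
  note integrable_borel[OF assms, measurable]
  show "(\<lambda>x. fourier_kernel x \<xi> * f x) \<in> borel_measurable lborel" by simp
qed (simp add: norm_mult)

lemma norm_fourier_le:
  assumes "integrable lborel f" shows "norm (fourier f \<xi>) \<le> (\<integral>x. norm (f x) \<partial>lborel)"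
  unfolding fourier_lborel[OF integrable_borel[OF assms]]
  using integral_norm_bound[of lborel "\<lambda>x. fourier_kernel x \<xi> * f x"] by (simp add: norm_mult)

lemma fourier_add:
  assumes "integrable lborel f" "integrable lborel g"
  shows "fourier (\<lambda>x. f x + g x) \<xi> = fourier f \<xi> + fourier g \<xi>"
proof -
  note [measurable] = integrable_borel[OF assms(1)] integrable_borel[OF assms(2)]
  show ?thesis
    using integrable_fker[OF assms(1)] integrable_fker[OF assms(2)]
    by (simp add: fourier_lborel distrib_left)
qed

lemma fourier_cmult:
  assumes "integrable lborel f"
  shows "fourier (\<lambda>x. c * f x) \<xi> = c * fourier f \<xi>"
proof -
  note [measurable] = integrable_borel[OF assms]
  have "(\<integral>x. fourier_kernel x \<xi> * (c * f x) \<partial>lborel) = (\<integral>x. c * (fourier_kernel x \<xi> * f x) \<partial>lborel)"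
    by (simp add: mult_ac)
  then show ?thesis by (simp add: fourier_lborel)
qed

lemma fourier_diff:
  assumes "integrable lborel f" "integrable lborel g"
  shows "fourier (\<lambda>x. f x - g x) \<xi> = fourier f \<xi> - fourier g \<xi>"
  using fourier_add[of f "\<lambda>x. -1 * g x" \<xi>] fourier_cmult[of g "-1" \<xi>] assms by simp

lemma continuous_on_fourier:
  assumes "integrable lborel f" shows "continuous_on UNIV (fourier f)"
  unfolding continuous_on_sequentially
proof (safe)
  fix s :: "nat \<Rightarrow> 'a" and a assume s: "s \<longlonglongrightarrow> a"
  note [measurable] = integrable_borel[OF assms]
  have "(\<lambda>n. \<integral>x. fourier_kernel x (s n) * f x \<partial>lborel) \<longlonglongrightarrow> (\<integral>x. fourier_kernel x a * f x \<partial>lborel)"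
  proof (rule integral_dominated_convergence[where w="\<lambda>x. norm (f x)"])
    show "AE x in lborel. (\<lambda>n. fourier_kernel x (s n) * f x) \<longlonglongrightarrow> fourier_kernel x a * f x"
      by (intro AE_I2 tendsto_intros s)
  qed (use assms in \<open>simp_all add: norm_mult\<close>)
  then show "(fourier f \<circ> s) \<longlonglongrightarrow> fourier f a" by (simp add: fourier_lborel o_def)
qed

lemma borel_fourier:
  assumes "integrable lborel f" shows "fourier f \<in> borel_measurable borel"
  by (rule borel_measurable_continuous_onI[OF continuous_on_fourier[OF assms]])

lemma fourier_reflect:
  assumes [measurable]: "f \<in> borel_measurable borel"
  shows "fourier f (- \<xi>) = fourier (\<lambda>x. f (- x)) \<xi>"
  using lborel_reflection_invariance(1)[of "\<lambda>x. fourier_kernel x (- \<xi>) * f x"]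
  by (simp add: fourier_lborel)

lemma fourier_translate:
  assumes [measurable]: "f \<in> borel_measurable borel"
  shows "fourier (\<lambda>x. f (x - y)) \<xi> = fourier_kernel y \<xi> * fourier f \<xi>"
proof -
  have "fourier (\<lambda>x. f (x - y)) \<xi> = (\<integral>x. fourier_kernel (y + x) \<xi> * f x \<partial>lborel)"
    using lborel_translation_invariance(1)[of "\<lambda>x. fourier_kernel x \<xi> * f (x - y)" y]
    by (simp add: fourier_lborel)
  also have "\<dots> = (\<integral>x. fourier_kernel y \<xi> * (fourier_kernel x \<xi> * f x) \<partial>lborel)"
    by (simp add: inner_add_left distrib_left exp_add mult_ac exp_diff exp_minus divide_inverse)
  finally show ?thesis by (simp add: fourier_lborel)
qed

lemma fourier_multiplication_formula:
  fixes f g :: "'a::euclidean_space \<Rightarrow> complex"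
  assumes "integrable lborel f" "integrable lborel g"
  shows "(\<integral>x. fourier f x * g x \<partial>lborel) = (\<integral>x. f x * fourier g x \<partial>lborel)"
proof -
  note [measurable] = integrable_borel[OF assms(1)] integrable_borel[OF assms(2)]
  have "integrable (lborel \<Otimes>\<^sub>M lborel) (\<lambda>(x, y). fourier_kernel x y * f x * g y)"
  proof (rule lborel_pair.Fubini_integrable)
    show "integrable lborel (\<lambda>x. \<integral>y. norm (case (x, y) of (x, y) \<Rightarrow> fourier_kernel x y * f x * g y) \<partial>lborel)"
      using assms by (simp add: norm_mult)
    show "AE x in lborel. integrable lborel (\<lambda>y. case (x, y) of (x, y) \<Rightarrow> fourier_kernel x y * f x * g y)"
    proof (intro AE_I2)
      fix x
      have "integrable lborel (\<lambda>y. f x * (fourier_kernel y x * g y))"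
        by (intro integrable_mult_right integrable_fker assms)
      then show "integrable lborel (\<lambda>y. case (x, y) of (x, y) \<Rightarrow> fourier_kernel x y * f x * g y)"
        by (simp add: inner_commute mult_ac)
    qed
  qed simp
  from lborel_pair.Fubini_integral[OF this]
  have "(\<integral>y. (\<integral>x. fourier_kernel x y * f x \<partial>lborel) * g y \<partial>lborel) = (\<integral>x. f x * (\<integral>y. fourier_kernel x y * g y \<partial>lborel) \<partial>lborel)"
    by (simp add: mult_ac integral_mult_right_zero[symmetric] del: integral_mult_right_zero)
  then show ?thesis by (simp add: fourier_lborel inner_commute)
qed

definition convolution :: "('a::euclidean_space \<Rightarrow> complex) \<Rightarrow> ('a \<Rightarrow> complex) \<Rightarrow> 'a \<Rightarrow> complex" where
  "convolution f g x = (\<integral>y. f (x - y) * g y \<partial>lborel)"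

lemma
  fixes f g :: "'a::euclidean_space \<Rightarrow> complex"
  assumes "integrable lborel f" "integrable lborel g"
  shows integrable_conv: "integrable lborel (convolution f g)"
    and fourier_conv: "fourier (convolution f g) \<xi> = fourier f \<xi> * fourier g \<xi>"
proof -
  note [measurable] = integrable_borel[OF assms(1)] integrable_borel[OF assms(2)]
  have tr: "integrable lborel (\<lambda>x. f (x - y))" "(\<integral>x. norm (f (x - y)) \<partial>lborel) = (\<integral>x. norm (f x) \<partial>lborel)" for y
    using lborel_translation_invariance(2)[of f "- y"] lborel_translation_invariance(1)[of "\<lambda>x. norm (f x)" "- y"] assms
    by simp_all
  have int: "integrable (lborel \<Otimes>\<^sub>M lborel) (\<lambda>(y, x). f (x - y) * g y)"
  proof (rule lborel_pair.Fubini_integrable)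
    show "integrable lborel (\<lambda>y. \<integral>x. norm (case (y, x) of (y, x) \<Rightarrow> f (x - y) * g y) \<partial>lborel)"
      using assms by (simp add: norm_mult tr)
    show "AE y in lborel. integrable lborel (\<lambda>x. case (y, x) of (y, x) \<Rightarrow> f (x - y) * g y)"
      using tr by auto
  qed simp
  show ic: "integrable lborel (convolution f g)"
    using lborel_pair.integrable_snd[OF int] unfolding convolution_def[abs_def] by simp
  have "integrable (lborel \<Otimes>\<^sub>M lborel) (\<lambda>(y, x). fourier_kernel x \<xi> * (f (x - y) * g y))"
    by (rule Bochner_Integration.integrable_bound[OF int]) (auto simp: norm_mult)
  from lborel_pair.Fubini_integral[OF this]
  have *: "(\<integral>x. fourier_kernel x \<xi> * convolution f g x \<partial>lborel) = (\<integral>y. (\<integral>x. fourier_kernel x \<xi> * (f (x - y) * g y) \<partial>lborel) \<partial>lborel)"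
    by (simp add: convolution_def)
  have "fourier (convolution f g) \<xi> = (\<integral>x. fourier_kernel x \<xi> * convolution f g x \<partial>lborel)"
    by (rule fourier_lborel[OF integrable_borel[OF ic]])
  also have "\<dots> = (\<integral>y. (\<integral>x. g y * (fourier_kernel x \<xi> * f (x - y)) \<partial>lborel) \<partial>lborel)"
    unfolding * by (simp add: mult_ac)
  also have "\<dots> = (\<integral>y. g y * (\<integral>x. fourier_kernel x \<xi> * f (x - y) \<partial>lborel) \<partial>lborel)"
    by (subst integral_mult_right_zero) simp
  also have "\<dots> = (\<integral>y. fourier f \<xi> * (fourier_kernel y \<xi> * g y) \<partial>lborel)"
  proof -
    have "(\<integral>x. fourier_kernel x \<xi> * f (x - y) \<partial>lborel) = fourier_kernel y \<xi> * fourier f \<xi>" for y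
      using fourier_translate[of f y \<xi>] fourier_lborel[of "\<lambda>x. f (x - y)" \<xi>] by simp
    then show ?thesis by (simp add: mult_ac)
  qed
  also have "\<dots> = fourier f \<xi> * fourier g \<xi>"
    by (subst integral_mult_right_zero) (simp add: fourier_lborel)
  finally show "fourier (convolution f g) \<xi> = fourier f \<xi> * fourier g \<xi>" .
qed

text \<open>Moments of the density bound the derivatives of its Fourier transform. Multiplication by
  coordinates preserves the class, which makes these transforms smooth.\<close>

definition finite_moments :: "('a::euclidean_space \<Rightarrow> complex) \<Rightarrow> bool" where
  "finite_moments m \<longleftrightarrow> m \<in> borel_measurable borel \<and> (\<forall>L. integrable lborel (\<lambda>\<xi>. norm \<xi> ^ L * norm (m \<xi>)))"

lemma finite_moments_integrable:
  assumes "finite_moments m" shows "integrable lborel m"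
proof (rule Bochner_Integration.integrable_bound)
  have "integrable lborel (\<lambda>\<xi>. norm \<xi> ^ 0 * norm (m \<xi>))" using assms unfolding finite_moments_def by blast
  then show "integrable lborel (\<lambda>\<xi>. norm (m \<xi>))" by simp
qed (use assms in \<open>auto simp: finite_moments_def\<close>)

lemma finite_moments_bound:
  assumes "finite_moments m" "h \<in> borel_measurable borel" "\<And>\<xi>. norm (h \<xi>) \<le> C * norm \<xi> ^ k * norm (m \<xi>)"
  shows "finite_moments h"
  unfolding finite_moments_def
proof (intro conjI allI)
  fix L
  have "integrable lborel (\<lambda>\<xi>. C * (norm \<xi> ^ (L + k) * norm (m \<xi>)))"
    using assms(1) unfolding finite_moments_def by (intro integrable_mult_right) blast
  then show "integrable lborel (\<lambda>\<xi>. norm \<xi> ^ L * norm (h \<xi>))"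
  proof (rule Bochner_Integration.integrable_bound)
    show "(\<lambda>\<xi>. norm \<xi> ^ L * norm (h \<xi>)) \<in> borel_measurable lborel" using assms(2) by simp
    have "norm \<xi> ^ L * norm (h \<xi>) \<le> norm (C * (norm \<xi> ^ (L + k) * norm (m \<xi>)))" for \<xi>
    proof -
      have "norm \<xi> ^ L * norm (h \<xi>) \<le> norm \<xi> ^ L * (C * norm \<xi> ^ k * norm (m \<xi>))"
        by (intro mult_left_mono assms) auto
      also have "\<dots> = C * (norm \<xi> ^ (L + k) * norm (m \<xi>))" by (simp add: power_add mult_ac)
      finally show ?thesis by simp
    qed
    then show "AE \<xi> in lborel. norm (norm \<xi> ^ L * norm (h \<xi>)) \<le> norm (C * (norm \<xi> ^ (L + k) * norm (m \<xi>)))"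
      by auto
  qed
qed (use assms in auto)

lemma finite_moments_inner:
  assumes "finite_moments m" shows "finite_moments (\<lambda>\<xi>. - (\<i> * complex_of_real (\<xi> \<bullet> v)) * m \<xi>)"
proof (rule finite_moments_bound[OF assms, where C="norm v" and k=1])
  have [measurable]: "m \<in> borel_measurable borel" using assms by (simp add: finite_moments_def)
  show "(\<lambda>\<xi>. - (\<i> * complex_of_real (\<xi> \<bullet> v)) * m \<xi>) \<in> borel_measurable borel" by simp
  show "norm (- (\<i> * complex_of_real (\<xi> \<bullet> v)) * m \<xi>) \<le> norm v * norm \<xi> ^ 1 * norm (m \<xi>)" for \<xi>
    using Cauchy_Schwarz_ineq2[of \<xi> v] by (simp add: norm_mult mult_left_mono mult.commute)
qed

text \<open>On the imaginary axis the exponential differs from its linear Taylor polynomial by at most the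
  square of the argument, so the second absolute moment controls the remainder.\<close>

lemma has_derivative_fourier:
  fixes m :: "'a::euclidean_space \<Rightarrow> complex"
  assumes "finite_moments m"
  shows "(fourier m has_derivative (\<lambda>v. fourier (\<lambda>\<xi>. - (\<i> * complex_of_real (\<xi> \<bullet> v)) * m \<xi>) x)) (at x)"
    (is "(_ has_derivative ?D) _")
proof -
  have [measurable]: "m \<in> borel_measurable borel" using assms by (simp add: finite_moments_def)
  note int = finite_moments_integrable[OF finite_moments_inner[OF assms]]
  have "bounded_linear ?D"
  proof (rule bounded_linear_intro[where K="\<integral>\<xi>. norm \<xi> ^ 1 * norm (m \<xi>) \<partial>lborel"])
    fix v w
    have "(\<lambda>\<xi>. - (\<i> * complex_of_real (\<xi> \<bullet> (v + w))) * m \<xi>) =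
       (\<lambda>\<xi>. - (\<i> * complex_of_real (\<xi> \<bullet> v)) * m \<xi> + - (\<i> * complex_of_real (\<xi> \<bullet> w)) * m \<xi>)"
      by (simp add: inner_add_right algebra_simps)
    then show "?D (v + w) = ?D v + ?D w" using fourier_add[OF int int] by simp
  next
    fix r v
    have "(\<lambda>\<xi>. - (\<i> * complex_of_real (\<xi> \<bullet> (r *\<^sub>R v))) * m \<xi>) = (\<lambda>\<xi>. of_real r * (- (\<i> * complex_of_real (\<xi> \<bullet> v)) * m \<xi>))"
      by (simp add: algebra_simps)
    then show "?D (r *\<^sub>R v) = r *\<^sub>R ?D v" using fourier_cmult[OF int] by (simp add: scaleR_conv_of_real)
  next
    fix v
    have i1: "integrable lborel (\<lambda>\<xi>. norm \<xi> ^ 1 * norm (m \<xi>))" using assms unfolding finite_moments_def by blast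
    have "norm (?D v) \<le> (\<integral>\<xi>. norm (- (\<i> * complex_of_real (\<xi> \<bullet> v)) * m \<xi>) \<partial>lborel)"
      by (rule norm_fourier_le[OF int])
    also have "\<dots> \<le> (\<integral>\<xi>. (norm \<xi> ^ 1 * norm (m \<xi>)) * norm v \<partial>lborel)"
    proof (rule integral_mono)
      show "integrable lborel (\<lambda>\<xi>. (norm \<xi> ^ 1 * norm (m \<xi>)) * norm v)" using i1 by (rule integrable_mult_left)
      show "norm (- (\<i> * complex_of_real (\<xi> \<bullet> v)) * m \<xi>) \<le> (norm \<xi> ^ 1 * norm (m \<xi>)) * norm v" for \<xi>
        using mult_right_mono[OF Cauchy_Schwarz_ineq2[of \<xi> v], of "norm (m \<xi>)"] by (simp add: norm_mult mult_ac)
    qed (use int in auto)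
    finally show "norm (?D v) \<le> norm v * (\<integral>\<xi>. norm \<xi> ^ 1 * norm (m \<xi>) \<partial>lborel)"
      by (simp add: mult.commute)
  qed
  moreover
  define C where "C = (\<integral>\<xi>. norm \<xi> ^ 2 * norm (m \<xi>) \<partial>lborel)"
  have i2: "integrable lborel (\<lambda>\<xi>. norm \<xi> ^ 2 * norm (m \<xi>))" using assms unfolding finite_moments_def by blast
  have rem: "norm (fourier m y - fourier m x - ?D (y - x)) \<le> C * norm (y - x) ^ 2" for y
  proof -
    define R where "R = (\<lambda>\<xi>. (fourier_kernel \<xi> y - fourier_kernel \<xi> x - fourier_kernel \<xi> x * - (\<i> * complex_of_real (\<xi> \<bullet> (y - x)))) * m \<xi>)"
    have [measurable]: "R \<in> borel_measurable borel" unfolding R_def by measurable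
    have "fourier m y - fourier m x - ?D (y - x) = (\<integral>\<xi>. R \<xi> \<partial>lborel)"
    proof -
      note i = integrable_fker[OF finite_moments_integrable[OF assms]] integrable_fker[OF int]
      have "(\<integral>\<xi>. R \<xi> \<partial>lborel) = (\<integral>\<xi>. (fourier_kernel \<xi> y * m \<xi> - fourier_kernel \<xi> x * m \<xi>)
          - fourier_kernel \<xi> x * (- (\<i> * complex_of_real (\<xi> \<bullet> (y - x))) * m \<xi>) \<partial>lborel)"
        unfolding R_def by (simp add: algebra_simps)
      also have "\<dots> = (\<integral>\<xi>. fourier_kernel \<xi> y * m \<xi> - fourier_kernel \<xi> x * m \<xi> \<partial>lborel)
          - (\<integral>\<xi>. fourier_kernel \<xi> x * (- (\<i> * complex_of_real (\<xi> \<bullet> (y - x))) * m \<xi>) \<partial>lborel)"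
        by (rule Bochner_Integration.integral_diff[OF Bochner_Integration.integrable_diff[OF i(1) i(1)] i(2)])
      also have "(\<integral>\<xi>. fourier_kernel \<xi> y * m \<xi> - fourier_kernel \<xi> x * m \<xi> \<partial>lborel) = fourier m y - fourier m x"
        by (simp add: Bochner_Integration.integral_diff[OF i(1) i(1)] fourier_lborel)
      finally show ?thesis by (simp add: fourier_lborel)
    qed
    also have "norm \<dots> \<le> (\<integral>\<xi>. norm (R \<xi>) \<partial>lborel)" by (rule integral_norm_bound)
    also have "\<dots> \<le> (\<integral>\<xi>. (norm \<xi> ^ 2 * norm (m \<xi>)) * norm (y - x) ^ 2 \<partial>lborel)"
    proof (rule integral_mono')
      show "integrable lborel (\<lambda>\<xi>. (norm \<xi> ^ 2 * norm (m \<xi>)) * norm (y - x) ^ 2)"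
        using i2 by (rule integrable_mult_left)
      show "norm (R \<xi>) \<le> (norm \<xi> ^ 2 * norm (m \<xi>)) * norm (y - x) ^ 2" for \<xi>
      proof -
        define z where "z = - (\<i> * complex_of_real (\<xi> \<bullet> (y - x)))"
        have z: "fourier_kernel \<xi> y = fourier_kernel \<xi> x * exp z"
          unfolding z_def by (simp add: exp_add[symmetric] inner_diff_right algebra_simps)
        have "norm (exp z - (\<Sum>k\<le>1. z ^ k / fact k)) \<le> exp \<bar>Re z\<bar> * norm z ^ Suc 1 / fact 1"
          by (rule Taylor_exp)
        moreover have "Re z = 0" by (simp add: z_def)
        ultimately have n1: "norm (exp z - 1 - z) \<le> norm z ^ 2"
          by (simp add: numeral_2_eq_2 diff_diff_eq)
        have n2: "norm z \<le> norm \<xi> * norm (y - x)"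
          using Cauchy_Schwarz_ineq2[of \<xi> "y - x"] by (simp add: z_def norm_mult)
        have n3: "norm z ^ 2 \<le> norm \<xi> ^ 2 * norm (y - x) ^ 2"
          using power_mono[OF n2 norm_ge_zero, of 2] by (simp only: power_mult_distrib)
        have "norm (exp z - 1 - z) * norm (m \<xi>) \<le> (norm \<xi> ^ 2 * norm (y - x) ^ 2) * norm (m \<xi>)"
          by (rule mult_right_mono[OF order_trans[OF n1 n3] norm_ge_zero])
        moreover have "R \<xi> = fourier_kernel \<xi> x * ((exp z - 1 - z) * m \<xi>)"
          unfolding R_def z z_def[symmetric] by (simp add: algebra_simps)
        ultimately show ?thesis by (simp add: norm_mult mult_ac)
      qed
    qed auto
    finally show ?thesis by (simp add: C_def)
  qed
  ultimately show ?thesis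
  proof (intro has_derivativeI_sandwich[of 1, where H="\<lambda>y. C * norm (y - x)"])
    show "norm (fourier m y - fourier m x - ?D (y - x)) / norm (y - x) \<le> C * norm (y - x)"
      if "y \<noteq> x" for y
    proof -
      define V where "V = fourier m y - fourier m x - ?D (y - x)"
      have "norm V \<le> C * norm (y - x) * norm (y - x)"
        using rem[of y] by (simp add: V_def power2_eq_square)
      moreover have "0 < norm (y - x)" using that by simp
      ultimately show ?thesis unfolding V_def[symmetric] by (simp add: divide_le_eq)
    qed
    show "((\<lambda>y. C * norm (y - x)) \<longlongrightarrow> 0) (at x)"
      by (auto intro!: tendsto_eq_intros)
  qed auto
qed

lemma smooth_fourier:
  assumes "finite_moments m" shows "smooth (fourier m)"
proof (rule smooth_by_add_closure[of "{fourier m | m. finite_moments m}"])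
  show "f differentiable at x" if "f \<in> {fourier m | m. finite_moments m}" for f :: "'a \<Rightarrow> complex" and x
    using that has_derivative_fourier unfolding differentiable_def by blast
  show "partial_deriv b f \<in> add_closure {fourier m | m. finite_moments m}"
    if "f \<in> {fourier m | m. finite_moments m}" for f :: "'a \<Rightarrow> complex" and b
  proof -
    from that obtain m where m: "f = fourier m" "finite_moments m" by auto
    have "partial_deriv b f = fourier (\<lambda>\<xi>. - (\<i> * complex_of_real (\<xi> \<bullet> b)) * m \<xi>)"
      using partial_deriv_eq[OF has_derivative_fourier[OF m(2)]] m(1) by auto
    then show ?thesis using finite_moments_inner[OF m(2)] by (blast intro: add_closure.base)
  qed
qed (use assms in \<open>blast intro: add_closure.base\<close>)

lemma norm_iter_deriv_fourier_le:
  assumes "finite_moments m" "bs \<in> lists Basis"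
  shows "norm (iter_deriv bs (fourier m) x) \<le> (\<integral>\<xi>. norm \<xi> ^ length bs * norm (m \<xi>) \<partial>lborel)"
proof -
  have "\<exists>h. finite_moments h \<and> iter_deriv bs (fourier m) = fourier h \<and>
      (\<forall>\<xi>. norm (h \<xi>) \<le> norm \<xi> ^ length bs * norm (m \<xi>))"
    using assms(2)
  proof (induction bs)
    case (Cons b bs)
    then obtain h where h: "finite_moments h" "iter_deriv bs (fourier m) = fourier h"
       "\<And>\<xi>. norm (h \<xi>) \<le> norm \<xi> ^ length bs * norm (m \<xi>)" by auto
    have "iter_deriv (b # bs) (fourier m) = fourier (\<lambda>\<xi>. - (\<i> * complex_of_real (\<xi> \<bullet> b)) * h \<xi>)"
      using partial_deriv_eq[OF has_derivative_fourier[OF h(1)]] h(2) by auto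
    moreover have "norm (- (\<i> * complex_of_real (\<xi> \<bullet> b)) * h \<xi>) \<le> norm \<xi> ^ length (b # bs) * norm (m \<xi>)" for \<xi>
    proof -
      have "\<bar>\<xi> \<bullet> b\<bar> \<le> norm \<xi>" using Cons.hyps by (intro Basis_le_norm)
      then have "\<bar>\<xi> \<bullet> b\<bar> * norm (h \<xi>) \<le> norm \<xi> * (norm \<xi> ^ length bs * norm (m \<xi>))"
        using h(3)[of \<xi>] by (intro mult_mono) auto
      then show ?thesis by (simp add: norm_mult)
    qed
    ultimately show ?case using finite_moments_inner[OF h(1), of b] by blast
  qed (use assms in auto)
  then obtain h where h: "finite_moments h" "iter_deriv bs (fourier m) = fourier h"
      "\<And>\<xi>. norm (h \<xi>) \<le> norm \<xi> ^ length bs * norm (m \<xi>)" by auto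
  have "norm (fourier h x) \<le> (\<integral>\<xi>. norm (h \<xi>) \<partial>lborel)"
    by (rule norm_fourier_le[OF finite_moments_integrable[OF h(1)]])
  also have "\<dots> \<le> (\<integral>\<xi>. norm \<xi> ^ length bs * norm (m \<xi>) \<partial>lborel)"
    by (rule integral_mono') (use h(3) assms(1) in \<open>auto simp: finite_moments_def\<close>)
  finally show ?thesis using h(2) by simp
qed

section \<open>Decay of Fourier transforms and Fourier inversion\<close>

lemma continuous_AE_zero:
  fixes f :: "'a::euclidean_space \<Rightarrow> complex"
  assumes "continuous_on UNIV f" "AE x in lborel. f x = 0" shows "f x = 0"
proof (rule ccontr)
  assume nz: "f x \<noteq> 0"
  have op: "open {x. f x \<noteq> 0}" using open_Collect_neq[OF assms(1), of "\<lambda>_. 0"] by simp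
  have "AE x in lebesgue. x \<notin> {x. f x \<noteq> 0}" using AE_completion[OF assms(2)] by simp
  then have "negligible {x. f x \<noteq> 0}"
    by (simp add: negligible_iff_null_sets AE_iff_null_sets[of _ lebesgue] op borel_open)
  then show False using open_not_negligible[OF op] nz by blast
qed

lemma test_integrable: "\<phi> \<in> test_functions \<Longrightarrow> integrable lborel \<phi>"
proof -
  assume *: "\<phi> \<in> test_functions"
  obtain B where "0 < B" and B: "\<And>x. norm (\<phi> x) \<le> B" by (rule test_bounded[OF *]) auto
  obtain R where "0 < R" and R: "\<And>x. R \<le> norm x \<Longrightarrow> \<phi> x = 0" by (rule test_support_radius[OF *]) auto
  have "integrable lborel (\<lambda>x. indicator (cball 0 R) x * B)"
    by (intro integrable_mult_left integrable_real_indicator) (simp_all add: emeasure_lborel_cball_finite[unfolded infinity_ennreal_def])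
  then show ?thesis
  proof (rule Bochner_Integration.integrable_bound)
    show "\<phi> \<in> borel_measurable lborel" using smooth_borel[OF test_smooth[OF *]] by simp
    have "norm (\<phi> x) \<le> norm (indicator (cball 0 R) x * B)" for x
      using B[of x] R[of x] \<open>0 < B\<close> by (cases "norm x \<le> R") (auto simp: indicator_def)
    then show "AE x in lborel. norm (\<phi> x) \<le> norm (indicator (cball 0 R) x * B)" by auto
  qed
qed

lemma smooth_mean_value:
  fixes f :: "'a::euclidean_space \<Rightarrow> complex"
  assumes "smooth f" "\<And>x. norm (partial_deriv b f x) \<le> B"
  shows "norm (f (x + t *\<^sub>R b) - f x) \<le> B * \<bar>t\<bar>"
proof -
  have "norm ((\<lambda>s. f (x + s *\<^sub>R b)) t - (\<lambda>s. f (x + s *\<^sub>R b)) 0) \<le> B * norm (t - 0)"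
  proof (rule differentiable_bound[of UNIV])
    fix s :: real
    define F where "F = frechet_derivative f (at (x + s *\<^sub>R b))"
    have F: "(f has_derivative F) (at (x + s *\<^sub>R b))" unfolding F_def by (rule smooth_has_derivative[OF assms(1)])
    interpret F: bounded_linear F using F by (rule has_derivative_bounded_linear)
    have "((\<lambda>s. x + s *\<^sub>R b) has_derivative (\<lambda>s. s *\<^sub>R b)) (at s)" by (auto intro!: derivative_eq_intros)
    from has_derivative_compose[OF this F]
    have "((\<lambda>s. f (x + s *\<^sub>R b)) has_derivative (\<lambda>s. F (s *\<^sub>R b))) (at s)" .
    then show "((\<lambda>s. f (x + s *\<^sub>R b)) has_derivative (\<lambda>h. h *\<^sub>R partial_deriv b f (x + s *\<^sub>R b))) (at s within UNIV)"
      by (simp add: F.scaleR partial_deriv_eq[OF F])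
    show "onorm (\<lambda>h::real. h *\<^sub>R partial_deriv b f (x + s *\<^sub>R b)) \<le> B"
      by (rule onorm_le)
        (use mult_left_mono[OF assms(2)[of "x + s *\<^sub>R b"] abs_ge_zero] in \<open>simp add: mult.commute\<close>)
  qed auto
  then show ?thesis by simp
qed

lemma has_vector_derivative_quotient_tendsto:
  assumes "(f has_vector_derivative d) (at a)"
  shows "((\<lambda>s. (f s - f a) /\<^sub>R (s - a)) \<longlongrightarrow> d) (at a)"
proof -
  have "((\<lambda>s. norm (f s - f a - (s - a) *\<^sub>R d) / norm (s - a)) \<longlongrightarrow> 0) (at a)"
    using assms by (simp add: has_vector_derivative_def has_derivative_iff_norm)
  then have "((\<lambda>s. norm ((f s - f a) /\<^sub>R (s - a) - d)) \<longlongrightarrow> 0) (at a)"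
  proof (rule Lim_transform_eventually)
    have "norm (f s - f a - (s - a) *\<^sub>R d) / norm (s - a) = norm ((f s - f a) /\<^sub>R (s - a) - d)" if "s \<noteq> a" for s
    proof -
      have "(f s - f a) /\<^sub>R (s - a) - d = (f s - f a - (s - a) *\<^sub>R d) /\<^sub>R (s - a)"
        using that by (simp add: scaleR_diff_right)
      then show ?thesis by (simp add: divide_inverse_commute)
    qed
    then show "\<forall>\<^sub>F s in at a. norm (f s - f a - (s - a) *\<^sub>R d) / norm (s - a) = norm ((f s - f a) /\<^sub>R (s - a) - d)"
      by (auto simp: eventually_at_filter)
  qed
  then show ?thesis by (simp add: tendsto_norm_zero_iff Lim_null[of _ d])
qed

text \<open>The transform of a translate is multiplied by a character; the formula is the limit of this for
  difference quotients, which replaces an integration by parts.\<close>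

lemma fourier_partial_deriv:
  fixes \<phi> :: "'a::euclidean_space \<Rightarrow> complex"
  assumes "\<phi> \<in> test_functions" "b \<in> Basis"
  shows "fourier (partial_deriv b \<phi>) \<xi> = \<i> * complex_of_real (\<xi> \<bullet> b) * fourier \<phi> \<xi>"
proof -
  note d = test_partial_deriv[OF assms]
  note [measurable] = smooth_borel[OF test_smooth[OF assms(1)]] smooth_borel[OF test_smooth[OF d]]
  obtain B where "0 < B" and B: "\<And>x. norm (partial_deriv b \<phi> x) \<le> B" by (rule test_bounded[OF d]) auto
  obtain R where "0 < R" and R: "\<And>x. R \<le> norm x \<Longrightarrow> \<phi> x = 0" by (rule test_support_radius[OF assms(1)]) auto
  define t where "t = (\<lambda>n. inverse (real (Suc n)))"
  have t: "0 < t n" "t n \<le> 1" for n by (auto simp: t_def field_simps)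
  have t0: "t \<longlonglongrightarrow> 0" unfolding t_def by (rule LIMSEQ_inverse_real_of_nat)
  have t0': "filterlim t (at 0) sequentially" using t0 t by (auto simp: filterlim_at less_imp_neq[symmetric])
  define q where "q = (\<lambda>n x. (\<phi> (x + t n *\<^sub>R b) - \<phi> x) / of_real (t n))"
  have [measurable]: "q n \<in> borel_measurable borel" for n unfolding q_def by measurable
  have "(\<lambda>n. \<integral>x. fourier_kernel x \<xi> * q n x \<partial>lborel) \<longlonglongrightarrow> (\<integral>x. fourier_kernel x \<xi> * partial_deriv b \<phi> x \<partial>lborel)"
  proof (rule integral_dominated_convergence[where w="\<lambda>x. indicator (cball 0 (R + 1)) x * B"])
    show "integrable lborel (\<lambda>x. indicator (cball 0 (R + 1)) x * B)"
      by (intro integrable_mult_left integrable_real_indicator) (simp_all add: emeasure_lborel_cball_finite[unfolded infinity_ennreal_def])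
    show "AE x in lborel. (\<lambda>n. fourier_kernel x \<xi> * q n x) \<longlonglongrightarrow> fourier_kernel x \<xi> * partial_deriv b \<phi> x"
    proof (intro AE_I2 tendsto_mult tendsto_const)
      fix x
      define F where "F = frechet_derivative \<phi> (at x)"
      have F: "(\<phi> has_derivative F) (at (x + 0 *\<^sub>R b))"
        unfolding F_def using smooth_has_derivative[OF test_smooth[OF assms(1)]] by simp
      interpret F: bounded_linear F using F by (rule has_derivative_bounded_linear)
      have "((\<lambda>s. x + s *\<^sub>R b) has_derivative (\<lambda>s. s *\<^sub>R b)) (at 0)" by (auto intro!: derivative_eq_intros)
      from has_derivative_compose[OF this F]
      have "((\<lambda>s. \<phi> (x + s *\<^sub>R b)) has_vector_derivative partial_deriv b \<phi> x) (at 0)"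
        using partial_deriv_eq[OF F, of b] by (simp add: has_vector_derivative_def F.scaleR)
      from has_vector_derivative_quotient_tendsto[OF this]
      have "((\<lambda>s. (\<phi> (x + s *\<^sub>R b) - \<phi> x) /\<^sub>R s) \<longlongrightarrow> partial_deriv b \<phi> x) (at 0)"
        by simp
      from filterlim_compose[OF this t0']
      show "(\<lambda>n. q n x) \<longlonglongrightarrow> partial_deriv b \<phi> x"
        by (simp add: q_def scaleR_conv_of_real divide_inverse mult.commute)
    qed
    fix n
    have "norm (fourier_kernel x \<xi> * q n x) \<le> indicator (cball 0 (R + 1)) x * B" for x
    proof (cases "norm x \<le> R + 1")
      case True
      have "norm (\<phi> (x + t n *\<^sub>R b) - \<phi> x) \<le> B * \<bar>t n\<bar>"
        by (rule smooth_mean_value[OF test_smooth[OF assms(1)] B])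
      then show ?thesis using True t[of n] by (simp add: norm_mult q_def norm_divide divide_le_eq)
    next
      case False
      have "norm (t n *\<^sub>R b) \<le> 1" using t[of n] assms(2) by simp
      then have "norm (x + t n *\<^sub>R b) \<ge> R" using False norm_triangle_ineq4[of "x + t n *\<^sub>R b" "t n *\<^sub>R b"] by simp
      then show ?thesis using False R[of x] R[of "x + t n *\<^sub>R b"] by (simp add: q_def)
    qed
    then show "AE x in lborel. norm (fourier_kernel x \<xi> * q n x) \<le> indicator (cball 0 (R + 1)) x * B" by auto
  qed auto
  moreover have "(\<integral>x. fourier_kernel x \<xi> * q n x \<partial>lborel) = (exp (\<i> * complex_of_real (t n * (\<xi> \<bullet> b))) - 1) / of_real (t n) * fourier \<phi> \<xi>" for n
  proof -
    have tr: "integrable lborel (\<lambda>x. \<phi> (x + t n *\<^sub>R b))"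
      using lborel_translation_invariance(2)[of \<phi> "t n *\<^sub>R b"] test_integrable[OF assms(1)] by (simp add: add.commute)
    have "(\<integral>x. fourier_kernel x \<xi> * q n x \<partial>lborel) = fourier (\<lambda>x. inverse (of_real (t n)) * (\<phi> (x - - (t n *\<^sub>R b)) - \<phi> x)) \<xi>"
      by (simp add: fourier_lborel q_def divide_inverse mult_ac)
    also have "\<dots> = inverse (of_real (t n)) * (fourier_kernel (- (t n *\<^sub>R b)) \<xi> * fourier \<phi> \<xi> - fourier \<phi> \<xi>)"
      using tr test_integrable[OF assms(1)] fourier_translate[of \<phi> "- (t n *\<^sub>R b)" \<xi>]
      by (subst fourier_cmult) (auto simp: fourier_diff)
    also have "\<dots> = (exp (\<i> * complex_of_real (t n * (\<xi> \<bullet> b))) - 1) / of_real (t n) * fourier \<phi> \<xi>"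
      by (simp add: divide_inverse algebra_simps inner_commute)
    finally show ?thesis .
  qed
  moreover have "(\<lambda>n. (exp (\<i> * complex_of_real (t n * (\<xi> \<bullet> b))) - 1) / of_real (t n) * fourier \<phi> \<xi>)
      \<longlonglongrightarrow> (\<i> * complex_of_real (\<xi> \<bullet> b)) * fourier \<phi> \<xi>"
  proof (intro tendsto_mult tendsto_const)
    have "((\<lambda>z. exp (\<i> * complex_of_real (\<xi> \<bullet> b) * z)) has_field_derivative (\<i> * complex_of_real (\<xi> \<bullet> b))) (at 0)"
      by (auto intro!: derivative_eq_intros)
    then have "((\<lambda>z. (exp (\<i> * complex_of_real (\<xi> \<bullet> b) * z) - 1) / z) \<longlongrightarrow> \<i> * complex_of_real (\<xi> \<bullet> b)) (at 0)"
      by (simp add: has_field_derivative_iff)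
    moreover have "filterlim (\<lambda>n. complex_of_real (t n)) (at 0) sequentially"
      using tendsto_of_real[OF t0] t by (auto simp: filterlim_at less_imp_neq[symmetric])
    ultimately have "(\<lambda>n. (exp (\<i> * complex_of_real (\<xi> \<bullet> b) * complex_of_real (t n)) - 1) / complex_of_real (t n)) \<longlonglongrightarrow> \<i> * complex_of_real (\<xi> \<bullet> b)"
      by (rule filterlim_compose)
    then show "(\<lambda>n. (exp (\<i> * complex_of_real (t n * (\<xi> \<bullet> b))) - 1) / complex_of_real (t n)) \<longlonglongrightarrow> \<i> * complex_of_real (\<xi> \<bullet> b)"
      by (simp add: mult_ac)
  qed
  ultimately have "(\<integral>x. fourier_kernel x \<xi> * partial_deriv b \<phi> x \<partial>lborel) = \<i> * complex_of_real (\<xi> \<bullet> b) * fourier \<phi> \<xi>"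
    by (simp add: LIMSEQ_unique)
  then show ?thesis by (simp add: fourier_lborel)
qed

lemma bracket_ge_1: "1 \<le> bracket \<xi>"
  by (simp add: bracket_def)

lemma norm_le_bracket: "norm \<xi> \<le> bracket \<xi>"
  unfolding bracket_def by (rule real_le_rsqrt) simp

lemma bracket_le: "bracket \<xi> \<le> 1 + norm \<xi>"
  unfolding bracket_def by (rule real_le_lsqrt) (auto simp: power2_eq_square algebra_simps)

lemma continuous_on_bracket: "continuous_on S bracket"
  unfolding bracket_def by (intro continuous_intros)

lemma borel_bracket [measurable]: "bracket \<in> borel_measurable borel"
  by (rule borel_measurable_continuous_onI[OF continuous_on_bracket])

text \<open>The largest coordinate of \<open>\<xi>\<close> is comparable to its norm, so it suffices to differentiate \<open>L\<close>
  times in one direction. The constant involves \<open>\<phi>\<close> through \<open>B\<close> and the radius of a supporting ball,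
  not through the centre of that ball.\<close>

lemma fourier_decay:
  fixes \<phi> :: "'a::euclidean_space \<Rightarrow> complex"
  assumes "\<phi> \<in> test_functions" "0 \<le> r" "\<And>x. x \<notin> cball y r \<Longrightarrow> \<phi> x = 0"
    and B: "\<And>bs x. bs \<in> lists Basis \<Longrightarrow> length bs \<le> L \<Longrightarrow> norm (iter_deriv bs \<phi> x) \<le> B"
  shows "bracket \<xi> ^ L * norm (fourier \<phi> \<xi>) \<le>
    (1 + real DIM('a)) ^ Suc L * (unit_ball_vol DIM('a) * r ^ DIM('a)) * B"
proof -
  let ?V = "unit_ball_vol (real DIM('a)) * r ^ DIM('a)" and ?n = "real DIM('a)"
  have B0: "0 \<le> B" using order_trans[OF norm_ge_zero B[of "[]" 0]] by simp
  have V0: "0 \<le> ?V" using assms(2) by simp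
  have *: "norm (fourier (iter_deriv bs \<phi>) \<xi>) \<le> ?V * B" if bs: "bs \<in> lists Basis" "length bs \<le> L" for bs
  proof -
    have "norm (fourier (iter_deriv bs \<phi>) \<xi>) \<le> (\<integral>x. norm (iter_deriv bs \<phi> x) \<partial>lborel)"
      by (rule norm_fourier_le[OF test_integrable[OF test_iter_deriv[OF assms(1) bs(1)]]])
    also have "\<dots> \<le> (\<integral>x. indicator (cball y r) x * B \<partial>lborel)"
    proof (rule integral_mono')
      show "integrable lborel (\<lambda>x. indicator (cball y r) x * B)"
        by (intro integrable_mult_left integrable_real_indicator) (simp_all add: emeasure_lborel_cball_finite[unfolded infinity_ennreal_def])
      show "norm (iter_deriv bs \<phi> x) \<le> indicator (cball y r) x * B" for x
        using B[OF bs] iter_deriv_zero_outside[of "cball y r" \<phi> x bs] assms(3) B0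
        by (cases "x \<in> cball y r") auto
    qed (use B0 in simp_all)
    also have "\<dots> = ?V * B" using assms(2) by (simp add: content_cball)
    finally show ?thesis .
  qed
  have **: "\<bar>\<xi> \<bullet> b\<bar> ^ j * norm (fourier \<phi> \<xi>) = norm (fourier (iter_deriv (replicate j b) \<phi>) \<xi>)" if "b \<in> Basis" for b j
  proof (induction j)
    case (Suc j)
    have "replicate j b \<in> lists Basis" using that by auto
    then show ?case
      using Suc fourier_partial_deriv[OF test_iter_deriv[OF assms(1)] that, of "replicate j b" \<xi>]
      by (simp add: norm_mult mult_ac)
  qed simp
  have F0: "norm (fourier \<phi> \<xi>) \<le> ?V * B" using *[of "[]"] by simp
  have F1: "\<bar>\<xi> \<bullet> b\<bar> ^ L * norm (fourier \<phi> \<xi>) \<le> ?V * B" if "b \<in> Basis" for b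
  proof -
    have "replicate L b \<in> lists Basis" using that by auto
    from *[OF this] show ?thesis unfolding **[OF that, of L] by simp
  qed
  define M where "M = Max (insert 1 ((\<lambda>b. \<bar>\<xi> \<bullet> b\<bar>) ` Basis))"
  have M: "1 \<le> M" "\<And>b. b \<in> Basis \<Longrightarrow> \<bar>\<xi> \<bullet> b\<bar> \<le> M" unfolding M_def by (rule Max_ge; auto)+
  have "M \<in> insert 1 ((\<lambda>b. \<bar>\<xi> \<bullet> b\<bar>) ` Basis)" unfolding M_def by (rule Max_in) auto
  then have MF: "M ^ L * norm (fourier \<phi> \<xi>) \<le> ?V * B" using F0 F1 by auto
  have "bracket \<xi> \<le> 1 + norm \<xi>" by (rule bracket_le)
  also have "norm \<xi> \<le> (\<Sum>b\<in>Basis. \<bar>\<xi> \<bullet> b\<bar>)" by (rule norm_le_l1)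
  also have "\<dots> \<le> (\<Sum>b\<in>(Basis::'a set). M)" by (intro sum_mono M)
  finally have "bracket \<xi> \<le> (1 + ?n) * M" using M(1) by (simp add: algebra_simps)
  then have "bracket \<xi> ^ L \<le> ((1 + ?n) * M) ^ L"
    using bracket_ge_1[of \<xi>] by (intro power_mono) auto
  then have "bracket \<xi> ^ L * norm (fourier \<phi> \<xi>) \<le> ((1 + ?n) * M) ^ L * norm (fourier \<phi> \<xi>)"
    by (rule mult_right_mono) simp
  also have "\<dots> = (1 + ?n) ^ L * (M ^ L * norm (fourier \<phi> \<xi>))" by (simp add: power_mult_distrib mult_ac)
  also have "\<dots> \<le> (1 + ?n) ^ L * (?V * B)" using MF by (intro mult_left_mono) auto
  also have "\<dots> \<le> (1 + ?n) ^ Suc L * (?V * B)"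
    using V0 B0 by (intro mult_right_mono power_increasing) auto
  finally show ?thesis by (simp add: mult_ac)
qed

lemma fourier_rapid_decay:
  fixes \<phi> :: "'a::euclidean_space \<Rightarrow> complex"
  assumes "\<phi> \<in> test_functions"
  obtains C where "0 < C" "\<And>\<xi>. bracket \<xi> ^ L * norm (fourier \<phi> \<xi>) \<le> C"
proof -
  obtain R where "0 < R" and R: "\<And>x. R \<le> norm x \<Longrightarrow> \<phi> x = 0" by (rule test_support_radius[OF assms]) auto
  obtain B' where B': "\<And>bs x. bs \<in> lists Basis \<Longrightarrow> length bs \<le> L \<Longrightarrow> norm (iter_deriv bs \<phi> x) \<le> B'"
    by (rule test_order_bound[OF assms, of L]) auto
  have out: "\<phi> x = 0" if "x \<notin> cball 0 R" for x using R[of x] that by simp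
  let ?C = "(1 + real DIM('a)) ^ Suc L * (unit_ball_vol DIM('a) * R ^ DIM('a)) * B'"
  have "bracket \<xi> ^ L * norm (fourier \<phi> \<xi>) \<le> ?C" for \<xi>
    by (rule fourier_decay[OF assms less_imp_le[OF \<open>0 < R\<close>] out B'])
  then have "bracket \<xi> ^ L * norm (fourier \<phi> \<xi>) \<le> max 1 ?C" for \<xi>
    by (meson max.cobounded2 order_trans)
  then show ?thesis by (intro that[of "max 1 ?C"]) auto
qed

text \<open>Comparison with the value on the shells \<open>m \<le> norm \<xi> \<le> m + 1\<close>: the volume of a ball grows like
  the power \<open>DIM('a)\<close> of its radius, which leaves the convergent series of \<open>1 / m\<^sup>2\<close>.\<close>

lemma integrable_bracket_power:
  "integrable lborel (\<lambda>\<xi>::'a::euclidean_space. 1 / bracket \<xi> ^ (DIM('a) + 2))"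
proof (rule integrableI_nonneg)
  let ?n = "DIM('a)"
  let ?V = "unit_ball_vol (real ?n)"
  let ?g = "\<lambda>m (\<xi>::'a). ennreal (2 ^ (?n + 2) / real (Suc m) ^ (?n + 2)) * indicator (cball 0 (real (Suc m))) \<xi>"
  show "(\<lambda>\<xi>::'a. 1 / bracket \<xi> ^ (?n + 2)) \<in> borel_measurable lborel" by simp
  have b0: "0 < bracket \<xi>" for \<xi> :: 'a using bracket_ge_1[of \<xi>] by simp
  then show "AE \<xi>::'a in lborel. 0 \<le> 1 / bracket \<xi> ^ (?n + 2)"
    by (intro AE_I2 divide_nonneg_nonneg zero_le_power) (auto simp: less_imp_le)
  have "ennreal (1 / bracket \<xi> ^ (?n + 2)) \<le> (\<Sum>m. ?g m \<xi>)" for \<xi> :: 'a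
  proof -
    define m where "m = nat \<lfloor>norm \<xi>\<rfloor>"
    have "of_int \<lfloor>norm \<xi>\<rfloor> \<le> norm \<xi>" "norm \<xi> < of_int \<lfloor>norm \<xi>\<rfloor> + 1" by linarith+
    moreover have "real m = of_int \<lfloor>norm \<xi>\<rfloor>" by (simp add: m_def)
    ultimately have m: "real m \<le> norm \<xi>" "norm \<xi> \<le> real (Suc m)" unfolding of_nat_Suc by linarith+
    have "real (Suc m) / 2 \<le> bracket \<xi>"
      using m bracket_ge_1[of \<xi>] norm_le_bracket[of \<xi>] by simp
    then have "(real (Suc m) / 2) ^ (?n + 2) \<le> bracket \<xi> ^ (?n + 2)" by (intro power_mono) auto
    then have "1 / bracket \<xi> ^ (?n + 2) \<le> 1 / (real (Suc m) / 2) ^ (?n + 2)"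
      using b0[of \<xi>] by (intro divide_left_mono mult_pos_pos zero_less_power) auto
    also have "\<dots> = 2 ^ (?n + 2) / real (Suc m) ^ (?n + 2)" by (simp add: power_divide)
    finally have "ennreal (1 / bracket \<xi> ^ (?n + 2)) \<le> ?g m \<xi>" using m by (simp add: ennreal_leI)
    also have "\<dots> \<le> (\<Sum>m. ?g m \<xi>)"
    proof -
      have "G m \<le> (\<Sum>m. G m)" for G :: "nat \<Rightarrow> ennreal"
        using sum_le_suminf[of G "{m}"] by simp
      then show ?thesis .
    qed
    finally show ?thesis .
  qed
  then have "(\<integral>\<^sup>+\<xi>. ennreal (1 / bracket \<xi> ^ (?n + 2)) \<partial>(lborel :: 'a measure)) \<le> (\<integral>\<^sup>+\<xi>. (\<Sum>m. ?g m \<xi>) \<partial>(lborel :: 'a measure))"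
    by (rule nn_integral_mono)
  also have "\<dots> = (\<Sum>m. \<integral>\<^sup>+\<xi>. ?g m \<xi> \<partial>(lborel :: 'a measure))" 
    by (rule nn_integral_suminf) (intro borel_measurable_times_ennreal borel_measurable_const borel_measurable_indicator, simp)
  also have "\<dots> = (\<Sum>m. ennreal (2 ^ (?n + 2) * ?V * (1 / real (Suc m) ^ 2)))"
  proof (rule suminf_cong)
    fix m
    have "(\<integral>\<^sup>+\<xi>. ?g m \<xi> \<partial>(lborel :: 'a measure)) = ennreal (2 ^ (?n + 2) / real (Suc m) ^ (?n + 2)) * ennreal (?V * real (Suc m) ^ ?n)"
      by (subst nn_integral_cmult_indicator) (simp_all add: emeasure_cball)
    also have "\<dots> = ennreal (2 ^ (?n + 2) / real (Suc m) ^ (?n + 2) * (?V * real (Suc m) ^ ?n))"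
      by (rule ennreal_mult[symmetric]) auto
    also have "2 ^ (?n + 2) / real (Suc m) ^ (?n + 2) * (?V * real (Suc m) ^ ?n) = 2 ^ (?n + 2) * ?V * (1 / real (Suc m) ^ 2)"
      unfolding power_add[of "real (Suc m)"] by (simp add: field_simps del: of_nat_Suc)
    finally show "(\<integral>\<^sup>+\<xi>. ?g m \<xi> \<partial>(lborel :: 'a measure)) = ennreal (2 ^ (?n + 2) * ?V * (1 / real (Suc m) ^ 2))" .
  qed
  also have "\<dots> < \<infinity>"
  proof -
    have "summable (\<lambda>m. 2 ^ (?n + 2) * ?V * (1 / real (Suc m) ^ 2))"
      using inverse_power_summable[of 2, where 'a=real] summable_Suc_iff[of "\<lambda>n. inverse (real n ^ 2)"]
      by (intro summable_mult) (simp add: inverse_eq_divide)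
    then show ?thesis by (subst suminf_ennreal2) auto
  qed
  finally show "(\<integral>\<^sup>+(\<xi>::'a). ennreal (1 / bracket \<xi> ^ (?n + 2)) \<partial>(lborel :: 'a measure)) < \<infinity>" .
qed

lemma finite_moments_test:
  assumes "\<phi> \<in> test_functions" shows "finite_moments \<phi>"
proof -
  obtain R where "0 < R" and R: "\<And>x. R \<le> norm x \<Longrightarrow> \<phi> x = 0" by (rule test_support_radius[OF assms]) auto
  note [measurable] = smooth_borel[OF test_smooth[OF assms]]
  have "integrable lborel (\<lambda>x. norm x ^ L * norm (\<phi> x))" for L
  proof (rule Bochner_Integration.integrable_bound)
    show "integrable lborel (\<lambda>x. R ^ L * norm (\<phi> x))" using test_integrable[OF assms] by simp
    have "norm x ^ L * norm (\<phi> x) \<le> R ^ L * norm (\<phi> x)" for x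
      using R[of x] by (cases "norm x < R") (auto intro!: mult_right_mono power_mono)
    then show "AE x in lborel. norm (norm x ^ L * norm (\<phi> x)) \<le> norm (R ^ L * norm (\<phi> x))"
      using \<open>0 < R\<close> by auto
  qed simp
  then show ?thesis by (simp add: finite_moments_def)
qed

lemma finite_moments_fourier_test:
  fixes \<phi> :: "'a::euclidean_space \<Rightarrow> complex"
  assumes "\<phi> \<in> test_functions" shows "finite_moments (fourier \<phi>)"
  unfolding finite_moments_def
proof (intro conjI allI)
  show [measurable]: "fourier \<phi> \<in> borel_measurable borel" by (rule borel_fourier[OF test_integrable[OF assms]])
  fix L
  obtain C where "0 < C" and C: "\<And>\<xi>. bracket \<xi> ^ (L + (DIM('a) + 2)) * norm (fourier \<phi> \<xi>) \<le> C"
    by (rule fourier_rapid_decay[OF assms, of "L + (DIM('a) + 2)"]) auto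
  show "integrable lborel (\<lambda>\<xi>. norm \<xi> ^ L * norm (fourier \<phi> \<xi>))"
  proof (rule Bochner_Integration.integrable_bound)
    show "integrable lborel (\<lambda>\<xi>::'a. C * (1 / bracket \<xi> ^ (DIM('a) + 2)))"
      by (intro integrable_mult_right integrable_bracket_power)
    have "norm \<xi> ^ L * norm (fourier \<phi> \<xi>) \<le> C * (1 / bracket \<xi> ^ (DIM('a) + 2))" for \<xi>
    proof -
      have b0: "0 < bracket \<xi> ^ (DIM('a) + 2)" using bracket_ge_1[of \<xi>] by (intro zero_less_power) simp
      have "norm \<xi> ^ L * norm (fourier \<phi> \<xi>) \<le> bracket \<xi> ^ L * norm (fourier \<phi> \<xi>)"
        by (intro mult_right_mono power_mono norm_le_bracket) auto
      also have "\<dots> = bracket \<xi> ^ (L + (DIM('a) + 2)) * norm (fourier \<phi> \<xi>) / bracket \<xi> ^ (DIM('a) + 2)"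
        using bracket_ge_1[of \<xi>] by (auto simp: power_add)
      also have "\<dots> \<le> C / bracket \<xi> ^ (DIM('a) + 2)" using b0 C[of \<xi>] by (intro divide_right_mono) auto
      finally show ?thesis by simp
    qed
    then show "AE \<xi> in lborel. norm (norm \<xi> ^ L * norm (fourier \<phi> \<xi>)) \<le> norm (C * (1 / bracket \<xi> ^ (DIM('a) + 2)))"
      by (intro AE_I2) (smt (verit) mult_nonneg_nonneg norm_ge_zero real_norm_def zero_le_power)
  qed simp
qed

text \<open>The pairing of \<open>fourier \<phi>\<close> with a modulated dilation of \<open>\<eta>\<close> is, by the multiplication formula,
  an average of \<open>\<phi>\<close> around \<open>x\<close> with weight \<open>fourier \<eta>\<close>. As the dilation degenerates the average
  concentrates at \<open>x\<close> and \<open>\<eta>\<close> is replaced by \<open>\<eta> 0\<close>.\<close>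

lemma fourier_averaging:
  fixes \<phi> \<eta> :: "'a::euclidean_space \<Rightarrow> complex"
  assumes \<phi>: "\<phi> \<in> test_functions" and \<eta>: "integrable lborel \<eta>" "integrable lborel (fourier \<eta>)"
    and B: "\<And>\<xi>. norm (\<eta> \<xi>) \<le> B" and c: "isCont \<eta> 0"
  shows "\<phi> x * (\<integral>s. fourier \<eta> s \<partial>lborel) = \<eta> 0 * fourier (fourier \<phi>) (- x)"
proof -
  define t where "t = (\<lambda>n. inverse (real (Suc n)))"
  have t: "0 < t n" for n by (simp add: t_def)
  have t0: "t \<longlonglongrightarrow> 0" unfolding t_def by (rule LIMSEQ_inverse_real_of_nat)
  note [measurable] = integrable_borel[OF \<eta>(1)] integrable_borel[OF \<eta>(2)] smooth_borel[OF test_smooth[OF \<phi>]]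
    borel_fourier[OF test_integrable[OF \<phi>]]
  have c\<phi>: "isCont \<phi> y" for y
    using smooth_continuous_on[OF test_smooth[OF \<phi>], of UNIV] by (simp add: continuous_on_eq_continuous_at)
  obtain B\<phi> where "0 < B\<phi>" and B\<phi>: "\<And>x. norm (\<phi> x) \<le> B\<phi>" by (rule test_bounded[OF \<phi>]) auto
  define m where "m = (\<lambda>n \<xi>. fourier_kernel \<xi> (- x) * \<eta> (t n *\<^sub>R \<xi>))"
  have eta_n: "integrable lborel (\<lambda>\<xi>. \<eta> (t n *\<^sub>R \<xi>))" for n
    using lborel_affine_invariance(2)[of \<eta> "t n" 0] \<eta>(1) t[of n] by simp
  have im: "integrable lborel (m n)" for n unfolding m_def by (rule integrable_fker[OF eta_n])
  have fm: "fourier (m n) (x + t n *\<^sub>R s) = fourier \<eta> s /\<^sub>R t n ^ DIM('a)" for n s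
  proof -
    have "fourier (m n) (x + t n *\<^sub>R s) = (\<integral>\<xi>. fourier_kernel (t n *\<^sub>R \<xi>) s * \<eta> (t n *\<^sub>R \<xi>) \<partial>lborel)"
      unfolding fourier_lborel[OF integrable_borel[OF im]]
      by (rule Bochner_Integration.integral_cong)
        (auto simp: m_def exp_add[symmetric] inner_add_right algebra_simps)
    also have "\<dots> = fourier \<eta> s /\<^sub>R t n ^ DIM('a)"
      using lborel_affine_invariance(1)[of "\<lambda>\<xi>. fourier_kernel \<xi> s * \<eta> \<xi>" "t n" 0] t[of n]
      by (simp add: fourier_lborel)
    finally show ?thesis .
  qed
  have "(\<integral>y. \<phi> y * fourier (m n) y \<partial>lborel) = (\<integral>s. \<phi> (x + t n *\<^sub>R s) * fourier \<eta> s \<partial>lborel)" for n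
  proof -
    have [measurable]: "fourier (m n) \<in> borel_measurable borel" by (rule borel_fourier[OF im])
    have "(\<integral>y. \<phi> y * fourier (m n) y \<partial>lborel)
        = t n ^ DIM('a) *\<^sub>R (\<integral>s. (\<phi> (x + t n *\<^sub>R s) * fourier \<eta> s) /\<^sub>R t n ^ DIM('a) \<partial>lborel)"
      using lborel_affine_invariance(1)[of "\<lambda>y. \<phi> y * fourier (m n) y" "t n" x] t[of n] by (simp add: fm)
    also have "\<dots> = (\<integral>s. \<phi> (x + t n *\<^sub>R s) * fourier \<eta> s \<partial>lborel)"
      using t[of n] by (subst integral_scaleR_right) auto
    finally show ?thesis .
  qed
  then have eq: "(\<integral>y. fourier \<phi> y * m n y \<partial>lborel) = (\<integral>s. \<phi> (x + t n *\<^sub>R s) * fourier \<eta> s \<partial>lborel)" for n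
    using fourier_multiplication_formula[OF test_integrable[OF \<phi>] im] by simp
  have "(\<lambda>n. \<integral>s. \<phi> (x + t n *\<^sub>R s) * fourier \<eta> s \<partial>lborel) \<longlonglongrightarrow> (\<integral>s. \<phi> x * fourier \<eta> s \<partial>lborel)"
  proof (rule integral_dominated_convergence[where w="\<lambda>s. B\<phi> * norm (fourier \<eta> s)"])
    show "AE s in lborel. (\<lambda>n. \<phi> (x + t n *\<^sub>R s) * fourier \<eta> s) \<longlonglongrightarrow> \<phi> x * fourier \<eta> s"
    proof (intro AE_I2 tendsto_mult tendsto_const)
      fix s
      have "(\<lambda>n. x + t n *\<^sub>R s) \<longlonglongrightarrow> x + 0 *\<^sub>R s" by (intro tendsto_intros t0)
      then show "(\<lambda>n. \<phi> (x + t n *\<^sub>R s)) \<longlonglongrightarrow> \<phi> x" by (intro isCont_tendsto_compose[OF c\<phi>]) simp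
    qed
    show "integrable lborel (\<lambda>s. B\<phi> * norm (fourier \<eta> s))" using \<eta>(2) by simp
  qed (use B\<phi> in \<open>auto simp: norm_mult intro!: AE_I2 mult_right_mono\<close>)
  moreover have "(\<lambda>n. \<integral>y. fourier \<phi> y * m n y \<partial>lborel) \<longlonglongrightarrow> (\<integral>y. fourier \<phi> y * (fourier_kernel y (- x) * \<eta> 0) \<partial>lborel)"
  proof (rule integral_dominated_convergence[where w="\<lambda>y. norm (fourier \<phi> y) * B"])
    show "integrable lborel (\<lambda>y. norm (fourier \<phi> y) * B)"
      using finite_moments_integrable[OF finite_moments_fourier_test[OF \<phi>]] by simp
    show "AE y in lborel. (\<lambda>n. fourier \<phi> y * m n y) \<longlonglongrightarrow> fourier \<phi> y * (fourier_kernel y (- x) * \<eta> 0)"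
      unfolding m_def
    proof (intro AE_I2 tendsto_mult tendsto_const)
      fix y :: 'a
      have "(\<lambda>n. t n *\<^sub>R y) \<longlonglongrightarrow> 0 *\<^sub>R y" by (rule tendsto_scaleR[OF t0 tendsto_const])
      then show "(\<lambda>n. \<eta> (t n *\<^sub>R y)) \<longlonglongrightarrow> \<eta> 0" by (intro isCont_tendsto_compose[OF c]) simp
    qed
    show "AE y in lborel. norm (fourier \<phi> y * m n y) \<le> norm (fourier \<phi> y) * B" for n
      using B by (auto simp: m_def norm_mult intro!: AE_I2 mult_left_mono)
    show "(\<lambda>y. fourier \<phi> y * m n y) \<in> borel_measurable lborel" for n
      unfolding m_def by measurable
  qed measurable
  ultimately have "(\<integral>s. \<phi> x * fourier \<eta> s \<partial>lborel) = (\<integral>y. \<eta> 0 * (fourier_kernel y (- x) * fourier \<phi> y) \<partial>lborel)"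
    unfolding eq by (simp add: LIMSEQ_unique mult_ac)
  then show ?thesis by (simp add: fourier_lborel)
qed

text \<open>Any admissible \<open>\<eta>\<close> in \<open>fourier_averaging\<close> with nonzero integral of its transform yields
  inversion up to a constant, and norms enter below only up to constants. For an autocorrelation
  \<open>\<eta> = convolution r r\<close> the transform is the squared modulus of \<open>fourier r\<close>, so that its integral is positive.\<close>

lemma fourier_inversion:
  obtains c :: complex where "c \<noteq> 0"
    "\<And>(\<phi> :: 'a::euclidean_space \<Rightarrow> complex) x. \<phi> \<in> test_functions \<Longrightarrow> \<phi> x = c * fourier (fourier \<phi>) (- x)"
proof -
  define r where "r = (ball_bump 1 :: 'a \<Rightarrow> complex)"
  have r: "r \<in> test_functions" unfolding r_def by (rule test_ball_bump) simp
  note [measurable] = smooth_borel[OF test_smooth[OF r]]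
  note ir = test_integrable[OF r]
  have r_real: "r x = of_real (Re (r x))" "0 \<le> Re (r x)" for x
    by (simp_all add: r_def ball_bump_def flat_0_nonneg)
  have r0: "r 0 \<noteq> 0" using ball_bump_eq_0[of 1 "0::'a"] by (simp add: r_def)
  obtain B where "0 < B" and B: "\<And>x. norm (r x) \<le> B" by (rule test_bounded[OF r]) auto
  define \<eta> where "\<eta> = convolution r r"
  have f\<eta>: "fourier \<eta> \<xi> = of_real ((norm (fourier r \<xi>))\<^sup>2)" for \<xi>
  proof -
    have "cnj (fourier r \<xi>) = (\<integral>x. cnj (fourier_kernel x \<xi> * r x) \<partial>lborel)"
      unfolding fourier_lborel[OF smooth_borel[OF test_smooth[OF r]]]
      by (rule Bochner_Integration.integral_cnj[symmetric])
    also have "\<dots> = fourier r (- \<xi>)"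
      unfolding fourier_lborel[OF smooth_borel[OF test_smooth[OF r]]]
      by (rule Bochner_Integration.integral_cong) (auto simp: exp_cnj r_def ball_bump_def)
    also have "\<dots> = fourier (\<lambda>x. r (- x)) \<xi>"
      by (rule fourier_reflect[OF smooth_borel[OF test_smooth[OF r]]])
    also have "(\<lambda>x. r (- x)) = r" by (auto simp: r_def ball_bump_def)
    finally have "cnj (fourier r \<xi>) = fourier r \<xi>" .
    then show ?thesis
      unfolding \<eta>_def fourier_conv[OF ir ir] complex_norm_square by simp
  qed
  have c\<eta>: "continuous_on UNIV \<eta>"
    unfolding continuous_on_sequentially
  proof safe
    fix s :: "nat \<Rightarrow> 'a" and a assume s: "s \<longlonglongrightarrow> a"
    have "(\<lambda>n. \<integral>y. r (s n - y) * r y \<partial>lborel) \<longlonglongrightarrow> (\<integral>y. r (a - y) * r y \<partial>lborel)"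
    proof (rule integral_dominated_convergence[where w="\<lambda>y. B * norm (r y)"])
      show "AE y in lborel. (\<lambda>n. r (s n - y) * r y) \<longlonglongrightarrow> r (a - y) * r y"
      proof (intro AE_I2 tendsto_mult tendsto_const)
        fix y
        have "isCont r (a - y)"
          using smooth_continuous_on[OF test_smooth[OF r], of UNIV] by (simp add: continuous_on_eq_continuous_at)
        then show "(\<lambda>n. r (s n - y)) \<longlonglongrightarrow> r (a - y)"
          by (rule isCont_tendsto_compose) (intro tendsto_intros s)
      qed
    qed (use ir B in \<open>auto simp: norm_mult intro!: AE_I2 mult_right_mono\<close>)
    then show "(\<eta> \<circ> s) \<longlonglongrightarrow> \<eta> a" by (simp add: \<eta>_def convolution_def o_def)
  qed
  have B\<eta>: "norm (\<eta> x) \<le> (\<integral>y. B * norm (r y) \<partial>lborel)" for x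
  proof -
    have "norm (\<eta> x) \<le> (\<integral>y. norm (r (x - y) * r y) \<partial>lborel)"
      unfolding \<eta>_def convolution_def by (rule integral_norm_bound)
    also have "\<dots> \<le> (\<integral>y. B * norm (r y) \<partial>lborel)"
      using ir B \<open>0 < B\<close> by (intro integral_mono') (auto simp: norm_mult intro!: mult_right_mono)
    finally show ?thesis .
  qed
  have int: "integrable lborel (\<lambda>\<xi>. (norm (fourier r \<xi>))\<^sup>2)"
  proof (rule Bochner_Integration.integrable_bound)
    define K where "K = (\<integral>x. norm (r x) \<partial>lborel)"
    show "integrable lborel (\<lambda>\<xi>. K * norm (fourier r \<xi>))"
      using finite_moments_integrable[OF finite_moments_fourier_test[OF r]] by simp
    note [measurable] = borel_fourier[OF ir]
    show "(\<lambda>\<xi>. (norm (fourier r \<xi>))\<^sup>2) \<in> borel_measurable lborel" by measurable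
    have "(norm (fourier r \<xi>))\<^sup>2 \<le> K * norm (fourier r \<xi>)" for \<xi>
      using norm_fourier_le[OF ir, of \<xi>] unfolding K_def[symmetric] power2_eq_square by (intro mult_right_mono) auto
    then show "AE \<xi> in lborel. norm ((norm (fourier r \<xi>))\<^sup>2) \<le> norm (K * norm (fourier r \<xi>))"
      by (intro AE_I2) (smt (verit) norm_ge_zero real_norm_def zero_le_power2)
  qed
  have i\<eta>: "integrable lborel \<eta>" unfolding \<eta>_def by (rule integrable_conv[OF ir ir])
  have "fourier \<eta> = (\<lambda>\<xi>. of_real ((norm (fourier r \<xi>))\<^sup>2))" by (rule ext) (rule f\<eta>)
  then have i\<eta>': "integrable lborel (fourier \<eta>)" using integrable_of_real[OF int] by (simp only:)
  define d where "d = (\<integral>s. fourier \<eta> s \<partial>lborel)"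
  have avg: "\<phi> x * d = \<eta> 0 * fourier (fourier \<phi>) (- x)" if "\<phi> \<in> test_functions" for \<phi> and x :: 'a
    unfolding d_def using c\<eta> by (intro fourier_averaging[OF that i\<eta> i\<eta>' B\<eta>]) (simp add: continuous_on_eq_continuous_at)
  have d: "d \<noteq> 0"
  proof
    assume "d = 0"
    then have "(\<integral>\<xi>. (norm (fourier r \<xi>))\<^sup>2 \<partial>lborel) = 0" unfolding d_def f\<eta> by (simp del: of_real_power)
    then have "AE \<xi> in lborel. (norm (fourier r \<xi>))\<^sup>2 = 0"
      by (subst (asm) integral_nonneg_eq_0_iff_AE[OF int]) auto
    then have "AE \<xi> in lborel. fourier r \<xi> = 0" by simp
    from continuous_AE_zero[OF continuous_on_fourier[OF ir] this, of 0]
    have "(\<integral>x. complex_of_real (Re (r x)) \<partial>lborel) = 0" using r_real(1) by (simp add: fourier_lborel)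
    then have "(\<integral>x. Re (r x) \<partial>lborel) = 0" by simp
    then have "AE x in lborel. Re (r x) = 0"
      by (subst (asm) integral_nonneg_eq_0_iff_AE) (use ir r_real in auto)
    then have "AE x in lborel. r x = 0" by eventually_elim (metis of_real_0 r_real(1))
    from continuous_AE_zero[OF smooth_continuous_on[OF test_smooth[OF r]] this, of 0] show False using r0 by simp
  qed
  have "\<eta> 0 \<noteq> 0" using avg[OF r, of 0] r0 d by auto
  then show ?thesis
    using d avg by (intro that[of "\<eta> 0 / d"]) (auto simp: field_simps)
qed

section \<open>Functions as distributions\<close>

lemma lebesgue_complex_borel_version:
  fixes g :: "'a::euclidean_space \<Rightarrow> complex"
  assumes "g \<in> borel_measurable lebesgue"
  obtains g' where "g' \<in> borel_measurable borel" "AE x in lebesgue. g x = g' x"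
proof -
  have "(\<lambda>x. Re (g x)) \<in> borel_measurable lebesgue" "(\<lambda>x. Im (g x)) \<in> borel_measurable lebesgue"
    using assms by measurable
  then obtain p q where pq: "p \<in> borel_measurable lborel" "q \<in> borel_measurable lborel"
     "AE x in lborel. Re (g x) = p x" "AE x in lborel. Im (g x) = q x"
    using completion_ex_borel_measurable_real[of _ lborel] by metis
  have [measurable]: "p \<in> borel_measurable borel" "q \<in> borel_measurable borel" using pq by auto
  show ?thesis
  proof (rule that[of "\<lambda>x. Complex (p x) (q x)"])
    have "(\<lambda>x. complex_of_real (p x) + \<i> * complex_of_real (q x)) \<in> borel_measurable borel" by measurable
    then show "(\<lambda>x. Complex (p x) (q x)) \<in> borel_measurable borel" by (simp add: Complex_eq)
    show "AE x in lebesgue. g x = Complex (p x) (q x)"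
      using AE_completion[OF pq(3)] AE_completion[OF pq(4)] by eventually_elim (simp add: complex_eq_iff)
  qed
qed

lemma locally_integrable_measurable:
  fixes f :: "'a::euclidean_space \<Rightarrow> complex"
  assumes "locally_integrable f" shows "f \<in> borel_measurable lebesgue"
proof (rule borel_measurable_LIMSEQ_metric)
  show "(\<lambda>x. indicator (cball 0 (real n)) x *\<^sub>R f x) \<in> borel_measurable lebesgue" for n
    using assms compact_cball unfolding locally_integrable_def set_integrable_def
    by (intro borel_measurable_integrable) blast
  show "(\<lambda>n. indicator (cball 0 (real n)) x *\<^sub>R f x) \<longlonglongrightarrow> f x" for x
  proof (rule tendsto_eventually)
    obtain N where N: "norm x \<le> real N" using real_arch_simple by blast
    show "\<forall>\<^sub>F n in sequentially. indicator (cball 0 (real n)) x *\<^sub>R f x = f x"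
      using eventually_ge_at_top[of N] by eventually_elim (use N in auto)
  qed
qed

lemma continuous_integrable_compact:
  fixes f :: "'a::euclidean_space \<Rightarrow> complex"
  assumes "continuous_on UNIV f" "compact K"
  shows "set_integrable lebesgue K f"
proof -
  have "set_integrable lborel K f"
    unfolding set_integrable_def
    by (rule borel_integrable_compact) (use assms continuous_on_subset in blast)+
  then show ?thesis
    unfolding set_integrable_def
    by (subst integrable_completion) (auto dest: borel_measurable_integrable)
qed

lemma continuous_locally_integrable:
  fixes f :: "'a::euclidean_space \<Rightarrow> complex"
  shows "continuous_on UNIV f \<Longrightarrow> locally_integrable f"
  by (simp add: locally_integrable_def continuous_integrable_compact)

lemma locally_integrable_mult_test:
  fixes f :: "'a::euclidean_space \<Rightarrow> complex"
  assumes "locally_integrable f" "\<phi> \<in> test_functions"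
  shows "integrable lebesgue (\<lambda>x. f x * \<phi> x)"
proof -
  obtain R where "0 < R" and R: "\<And>x. R \<le> norm x \<Longrightarrow> \<phi> x = 0" by (rule test_support_radius[OF assms(2)]) auto
  obtain B where "0 < B" and B: "\<And>x. norm (\<phi> x) \<le> B" by (rule test_bounded[OF assms(2)]) auto
  have "integrable lebesgue (\<lambda>x. indicator (cball 0 R) x *\<^sub>R f x)"
    using assms(1) compact_cball unfolding locally_integrable_def set_integrable_def by blast
  then have "integrable lebesgue (\<lambda>x. of_real B * (indicator (cball 0 R) x *\<^sub>R f x))"
    by (rule integrable_mult_right)
  then show ?thesis
  proof (rule Bochner_Integration.integrable_bound)
    have "\<phi> \<in> borel_measurable lebesgue"
      using smooth_borel[OF test_smooth[OF assms(2)]] by (simp add: measurable_completion)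
    then show "(\<lambda>x. f x * \<phi> x) \<in> borel_measurable lebesgue"
      using locally_integrable_measurable[OF assms(1)] by measurable
    have "norm (f x * \<phi> x) \<le> norm (of_real B * (indicator (cball 0 R) x *\<^sub>R f x))" for x
      using R[of x] mult_right_mono[OF B[of x] norm_ge_zero[of "f x"]] \<open>0 < B\<close>
      by (cases "norm x \<le> R") (auto simp: norm_mult mult.commute)
    then show "AE x in lebesgue. norm (f x * \<phi> x) \<le> norm (of_real B * (indicator (cball 0 R) x *\<^sub>R f x))"
      by auto
  qed
qed

text \<open>Products over the coordinates of one-dimensional cutoffs that steepen with \<open>n\<close>.\<close>

lemma box_approximation:
  fixes l u :: "'a::euclidean_space"
  obtains \<phi> :: "nat \<Rightarrow> 'a \<Rightarrow> complex" where "\<And>n. \<phi> n \<in> test_functions"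
    "\<And>n x. norm (\<phi> n x) \<le> indicator (box l u) x" "\<And>x. (\<lambda>n. \<phi> n x) \<longlonglongrightarrow> indicator (box l u) x"
proof -
  define p where "p = (\<lambda>n x b. flat 0 (real (Suc n) * (x \<bullet> b - l \<bullet> b)) * flat 0 (real (Suc n) * (u \<bullet> b - x \<bullet> b)))"
  define \<phi> where "\<phi> = (\<lambda>n x. \<Prod>b\<in>Basis. complex_of_real (p n x b))"
  have out: "\<phi> n x = 0" if "x \<notin> box l u" for n x
  proof -
    from that obtain b where b: "b \<in> Basis" "x \<bullet> b \<le> l \<bullet> b \<or> u \<bullet> b \<le> x \<bullet> b"
      by (auto simp: mem_box not_less)
    then have "p n x b = 0" by (auto simp: p_def flat_0_eq_0 mult_le_0_iff)
    then show ?thesis unfolding \<phi>_def using b(1) by (intro prod_zero) auto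
  qed
  show ?thesis
  proof (rule that[of \<phi>])
    show "\<phi> n \<in> test_functions" for n
    proof (rule test_functionsI[OF _ bounded_box out])
      have "smooth (\<lambda>x. complex_of_real (real (Suc n) * (x \<bullet> b - l \<bullet> b)))"
           "smooth (\<lambda>x. complex_of_real (real (Suc n) * (u \<bullet> b - x \<bullet> b)))" for b
        unfolding of_real_mult of_real_diff by (intro smooth_cmult smooth_diff smooth_inner smooth_const)+
      then show "smooth (\<phi> n)"
        unfolding \<phi>_def p_def of_real_mult by (intro smooth_prod smooth_mult smooth_flat) (simp_all only: of_real_mult)
    qed
    show "norm (\<phi> n x) \<le> indicator (box l u) x" for n x
    proof (cases "x \<in> box l u")
      case True
      have "norm (\<phi> n x) = (\<Prod>b\<in>Basis. p n x b)"
        unfolding \<phi>_def prod_norm[symmetric] by (intro prod.cong) (auto simp: p_def norm_mult flat_0_nonneg)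
      also have "\<dots> \<le> 1"
        unfolding p_def by (intro prod_le_1) (auto intro!: mult_le_one flat_0_nonneg flat_0_le_1 mult_nonneg_nonneg)
      finally show ?thesis using True by simp
    qed (simp add: out)
    show "(\<lambda>n. \<phi> n x) \<longlonglongrightarrow> indicator (box l u) x" for x
    proof (cases "x \<in> box l u")
      case True
      have lim: "(\<lambda>n. flat 0 (real (Suc n) * t)) \<longlonglongrightarrow> 1" if "0 < t" for t
      proof -
        have "(\<lambda>n. exp (- (inverse t * inverse (real (Suc n))))) \<longlonglongrightarrow> exp (- (inverse t * 0))"
          by (intro tendsto_intros LIMSEQ_inverse_real_of_nat)
        moreover have "flat 0 (real (Suc n) * t) = exp (- (inverse t * inverse (real (Suc n))))" for n
        proof -
          have "0 < real (Suc n) * t" using that by simp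
          then show ?thesis by (simp add: flat_def mult.commute del: of_nat_Suc)
        qed
        ultimately show ?thesis by simp
      qed
      have "(\<lambda>n. p n x b) \<longlonglongrightarrow> 1 * 1" if "b \<in> Basis" for b
        unfolding p_def by (intro tendsto_mult lim) (use True that in \<open>auto simp: mem_box\<close>)
      then have "(\<lambda>n. \<phi> n x) \<longlonglongrightarrow> (\<Prod>b\<in>(Basis::'a set). complex_of_real (1 * 1))"
        unfolding \<phi>_def by (intro tendsto_prod tendsto_of_real)
      then show ?thesis using True by simp
    qed (simp add: out)
  qed
qed

lemma integral_box_zero:
  fixes f :: "'a::euclidean_space \<Rightarrow> complex"
  assumes f: "locally_integrable f" and z: "\<And>\<phi>. \<phi> \<in> test_functions \<Longrightarrow> (\<integral>x. f x * \<phi> x \<partial>lebesgue) = 0"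
  shows "(\<integral>x. indicator (box l u) x *\<^sub>R f x \<partial>lebesgue) = 0"
proof -
  obtain \<phi> :: "nat \<Rightarrow> 'a \<Rightarrow> complex" where \<phi>: "\<And>n. \<phi> n \<in> test_functions"
    "\<And>n x. norm (\<phi> n x) \<le> indicator (box l u) x" "\<And>x. (\<lambda>n. \<phi> n x) \<longlonglongrightarrow> indicator (box l u) x"
    using box_approximation[of l u] by blast
  have "set_integrable lebesgue (cbox l u) f" using f unfolding locally_integrable_def by auto
  then have int: "integrable lebesgue (\<lambda>x. indicator (cbox l u) x *\<^sub>R f x)" unfolding set_integrable_def .
  have "(\<lambda>n. \<integral>x. f x * \<phi> n x \<partial>lebesgue) \<longlonglongrightarrow> (\<integral>x. f x * indicator (box l u) x \<partial>lebesgue)"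
  proof (rule integral_dominated_convergence[where w="\<lambda>x. norm (indicator (cbox l u) x *\<^sub>R f x)"])
    show "integrable lebesgue (\<lambda>x. norm (indicator (cbox l u) x *\<^sub>R f x))" using int by (rule integrable_norm)
    show "(\<lambda>x. f x * indicator (box l u) x) \<in> borel_measurable lebesgue"
      using locally_integrable_measurable[OF f] by (intro borel_measurable_times borel_measurable_indicator) auto
    show "(\<lambda>x. f x * \<phi> n x) \<in> borel_measurable lebesgue" for n
      using locally_integrable_mult_test[OF f \<phi>(1)] by (rule borel_measurable_integrable)
    show "AE x in lebesgue. (\<lambda>n. f x * \<phi> n x) \<longlonglongrightarrow> f x * indicator (box l u) x"
      by (intro AE_I2 tendsto_mult tendsto_const \<phi>)
    have "norm (f x * \<phi> n x) \<le> norm (indicator (cbox l u) x *\<^sub>R f x)" for n x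
    proof -
      have "norm (f x * \<phi> n x) \<le> norm (f x) * indicator (box l u) x"
        unfolding norm_mult by (intro mult_left_mono \<phi>) auto
      also have "\<dots> \<le> norm (indicator (cbox l u) x *\<^sub>R f x)"
        using box_subset_cbox[of l u] by (auto simp: indicator_def)
      finally show ?thesis .
    qed
    then show "AE x in lebesgue. norm (f x * \<phi> n x) \<le> norm (indicator (cbox l u) x *\<^sub>R f x)" for n by auto
  qed
  then have "(\<integral>x. f x * indicator (box l u) x \<partial>lebesgue) = 0"
    using z[OF \<phi>(1)] by (simp add: LIMSEQ_const_iff)
  moreover have "f x * indicator (box l u) x = indicator (box l u) x *\<^sub>R f x" for x
    by (simp add: indicator_def)
  ultimately show ?thesis by simp
qed

text \<open>The fundamental lemma of the calculus of variations: indicators of open boxes are limits of test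
  functions, and boxes generate the Borel sets.\<close>

lemma test_functions_separate:
  fixes f :: "'a::euclidean_space \<Rightarrow> complex"
  assumes f: "locally_integrable f" and z: "\<And>\<phi>. \<phi> \<in> test_functions \<Longrightarrow> (\<integral>x. f x * \<phi> x \<partial>lebesgue) = 0"
  shows "AE x in lebesgue. f x = 0"
proof -
  define Q where "Q = (\<lambda>n::nat. box (- (real n *\<^sub>R One)) (real n *\<^sub>R One :: 'a))"
  have "AE x in lebesgue. x \<in> Q n \<longrightarrow> f x = 0" for n
  proof -
    have "set_integrable lebesgue (cbox (- (real n *\<^sub>R One)) (real n *\<^sub>R One)) f"
      using f unfolding locally_integrable_def by auto
    then have "set_integrable lebesgue (Q n) f"
      by (rule set_integrable_subset) (auto simp: Q_def box_subset_cbox)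
    then have int: "integrable lebesgue (\<lambda>x. indicator (Q n) x *\<^sub>R f x)" unfolding set_integrable_def .
    then obtain g where g[measurable]: "g \<in> borel_measurable borel" and ae: "AE x in lebesgue. indicator (Q n) x *\<^sub>R f x = g x"
      using lebesgue_complex_borel_version[OF borel_measurable_integrable[OF int]] by blast
    have "integrable lebesgue g"
      by (rule integrable_cong_AE_imp[OF int _ ae]) (use g in \<open>auto intro: measurable_completion\<close>)
    then have gi: "integrable lborel g" by (subst (asm) integrable_completion) auto
    have eq: "set_lebesgue_integral lborel A g = (\<integral>x. indicator (A \<inter> Q n) x *\<^sub>R f x \<partial>lebesgue)" if A: "A \<in> sets borel" for A
    proof -
      have "set_lebesgue_integral lborel A g = (\<integral>x. indicator A x *\<^sub>R g x \<partial>lebesgue)"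
        unfolding set_lebesgue_integral_def using A by (intro integral_completion[symmetric]) auto
      also have "\<dots> = (\<integral>x. indicator (A \<inter> Q n) x *\<^sub>R f x \<partial>lebesgue)"
      proof (rule integral_cong_AE)
        show "AE x in lebesgue. indicator A x *\<^sub>R g x = indicator (A \<inter> Q n) x *\<^sub>R f x"
          using ae by eventually_elim (auto simp: indicator_def split: if_splits)
        show "(\<lambda>x. indicator A x *\<^sub>R g x) \<in> borel_measurable lebesgue"
          using A by (intro measurable_completion) simp
        show "(\<lambda>x. indicator (A \<inter> Q n) x *\<^sub>R f x) \<in> borel_measurable lebesgue"
          using A locally_integrable_measurable[OF f]
          by (intro borel_measurable_scaleR borel_measurable_indicator) (auto simp: Q_def)
      qed
      finally show ?thesis .
    qed
    have "set_lebesgue_integral lborel A g = 0" if "A \<in> sets lborel" for A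
    proof -
      have "Int_stable (range (\<lambda>(a, b). box a b :: 'a set))"
        by (auto simp: Int_stable_def box_Int_box)
      moreover have "(range (\<lambda>(a, b). box a b :: 'a set)) \<subseteq> Pow UNIV" by auto
      moreover have "A \<in> sigma_sets UNIV (range (\<lambda>(a, b). box a b))"
        using that unfolding sets_lborel borel_eq_box by simp
      ultimately show ?thesis
      proof (induction rule: sigma_sets_induct_disjoint)
        case (basic A)
        then obtain a b where A: "A = box a b" by auto
        show ?case unfolding A by (subst eq) (simp_all add: Q_def box_Int_box integral_box_zero[OF f z])
      next
        case empty
        then show ?case by (simp add: set_lebesgue_integral_def)
      next
        case (compl A)
        then have [measurable]: "A \<in> sets borel" by (simp add: borel_eq_box)
        have "set_lebesgue_integral lborel UNIV g = 0"
          by (subst eq) (simp_all add: Q_def integral_box_zero[OF f z])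
        moreover have "indicator (UNIV - A) x *\<^sub>R g x = indicator UNIV x *\<^sub>R g x - indicator A x *\<^sub>R g x" for x
          by (simp add: indicator_def)
        ultimately show ?case
          using compl.IH gi unfolding set_lebesgue_integral_def
          by (simp add: integrable_mult_indicator)
      next
        case (union F)
        then have [measurable]: "\<And>i. F i \<in> sets borel" by (simp add: borel_eq_box subset_eq)
        have "set_lebesgue_integral lborel (\<Union>i. F i) g = (\<Sum>i. set_lebesgue_integral lborel (F i) g)"
        proof (rule lebesgue_integral_countable_add)
          show "F i \<inter> F j = {}" if "i \<noteq> j" for i j using union(1) that by (auto simp: disjoint_family_on_def)
          show "set_integrable lborel (\<Union>i. F i) g" unfolding set_integrable_def by (rule integrable_mult_indicator[OF _ gi]) simp
        qed simp
        then show ?case using union.IH by simp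
      qed
    qed
    then have "AE x in lborel. g x = 0" by (rule sigma_finite_measure.density_zero[OF sigma_finite_lborel gi])
    from AE_completion[OF this] ae show ?thesis
      by eventually_elim (auto simp: indicator_def split: if_splits)
  qed
  then have "AE x in lebesgue. \<forall>n. x \<in> Q n \<longrightarrow> f x = 0" unfolding AE_all_countable by blast
  moreover have "\<exists>n. x \<in> Q n" for x using UN_box_eq_UNIV[where 'a='a] by (auto simp: Q_def)
  ultimately show ?thesis by auto
qed

lemma represents_unique_AE:
  fixes f :: "'a::euclidean_space \<Rightarrow> complex"
  assumes "represents f u" "represents g u"
  shows "AE x in lebesgue. f x = g x"
proof -
  have lf: "locally_integrable f" "locally_integrable g" using assms by (auto simp: represents_def)
  have "AE x in lebesgue. f x - g x = 0"
  proof (rule test_functions_separate)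
    show "locally_integrable (\<lambda>x. f x - g x)"
      using lf unfolding locally_integrable_def set_integrable_def
      by (auto simp: scaleR_diff_right intro!: Bochner_Integration.integrable_diff)
    fix \<phi> :: "'a \<Rightarrow> complex" assume \<phi>: "\<phi> \<in> test_functions"
    have "(\<integral>x. f x * \<phi> x \<partial>lebesgue) = (\<integral>x. g x * \<phi> x \<partial>lebesgue)"
      using assms \<phi> unfolding represents_def distr_of_def by metis
    then show "(\<integral>x. (f x - g x) * \<phi> x \<partial>lebesgue) = 0"
      using locally_integrable_mult_test[OF lf(1) \<phi>] locally_integrable_mult_test[OF lf(2) \<phi>]
      by (simp add: left_diff_distrib)
  qed
  then show ?thesis by auto
qed

lemma AE_lebesgue_lborel_continuous:
  fixes f g :: "'a::euclidean_space \<Rightarrow> complex"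
  assumes "continuous_on UNIV f" "continuous_on UNIV g" "AE x in lebesgue. f x = g x"
  shows "f = g"
proof
  fix x
  have "closed {x. f x = g x}" using assms(1,2) by (simp add: closed_Collect_eq)
  then have "{x. f x = g x} \<in> sets borel" by simp
  then have "AE x in lborel. f x = g x" using assms(3) by (subst (asm) AE_completion_iff) auto
  then have "AE x in lborel. f x - g x = 0" by simp
  from continuous_AE_zero[OF _ this, of x] show "f x = g x" using assms by (simp add: continuous_on_diff)
qed

lemma represents_unique_continuous:
  fixes f :: "'a::euclidean_space \<Rightarrow> complex"
  assumes "represents f u" "represents g u" "continuous_on UNIV f" "continuous_on UNIV g"
  shows "f = g"
  by (rule AE_lebesgue_lborel_continuous[OF assms(3,4) represents_unique_AE[OF assms(1,2)]])

lemma bcfun_of_eq: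
  fixes f :: "'a::euclidean_space \<Rightarrow> complex"
  assumes "represents f u" "continuous_on UNIV f" "bounded (range f)"
  shows "bcfun_of u = f"
  unfolding bcfun_of_def
  by (rule the_equality) (use assms represents_unique_continuous in blast)+

lemma represents_distr_of: "locally_integrable f \<Longrightarrow> represents f (distr_of f)"
  by (simp add: represents_def)

lemma represents_distr_diff:
  assumes "represents f u" "represents g v"
  shows "represents (\<lambda>x. f x - g x) (distr_diff u v)"
proof -
  have lf: "locally_integrable f" "locally_integrable g" using assms by (auto simp: represents_def)
  have "locally_integrable (\<lambda>x. f x - g x)"
    using lf unfolding locally_integrable_def set_integrable_def
    by (auto simp: scaleR_diff_right intro!: Bochner_Integration.integrable_diff)
  moreover have "distr_diff u v \<phi> = distr_of (\<lambda>x. f x - g x) \<phi>" if "\<phi> \<in> test_functions" for \<phi>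
    using assms that locally_integrable_mult_test[OF lf(1) that] locally_integrable_mult_test[OF lf(2) that]
    by (simp add: represents_def distr_diff_def distr_of_def left_diff_distrib)
  ultimately show ?thesis by (simp add: represents_def)
qed

lemma distributions_represented:
  fixes f :: "'a::euclidean_space \<Rightarrow> complex"
  assumes "represents f u" shows "u \<in> distributions"
proof -
  have f: "locally_integrable f" and u: "\<And>\<phi>. \<phi> \<in> test_functions \<Longrightarrow> u \<phi> = (\<integral>x. f x * \<phi> x \<partial>lebesgue)"
    using assms by (auto simp: represents_def distr_of_def)
  note int = locally_integrable_mult_test[OF f]
  have "linear_on_fns test_functions u"
    unfolding linear_on_fns_def
  proof (intro conjI ballI allI)
    fix \<phi> \<psi> :: "'a \<Rightarrow> complex" assume *: "\<phi> \<in> test_functions" "\<psi> \<in> test_functions"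
    then show "u (\<lambda>x. \<phi> x + \<psi> x) = u \<phi> + u \<psi>"
      using int[OF *(1)] int[OF *(2)] by (simp add: u test_add distrib_left)
  next
    fix c and \<phi> :: "'a \<Rightarrow> complex" assume *: "\<phi> \<in> test_functions"
    then show "u (\<lambda>x. c * \<phi> x) = c * u \<phi>"
      by (simp add: u test_cmult mult.left_commute[of _ c])
  qed
  moreover have "\<exists>C. \<exists>N::nat. \<forall>\<phi>\<in>test_functions. (\<forall>x. x \<notin> K \<longrightarrow> \<phi> x = 0) \<longrightarrow>
        norm (u \<phi>) \<le> C * (\<Sum>bs | bs \<in> lists Basis \<and> length bs \<le> N. SUP x. norm (iter_deriv bs \<phi> x))"
    if K: "compact K" for K
  proof (intro exI ballI impI)
    fix \<phi> :: "'a \<Rightarrow> complex" assume \<phi>: "\<phi> \<in> test_functions" and supp: "\<forall>x. x \<notin> K \<longrightarrow> \<phi> x = 0"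
    obtain B where "0 < B" and B: "\<And>x. norm (\<phi> x) \<le> B" by (rule test_bounded[OF \<phi>]) auto
    then have bdd: "bdd_above (range (\<lambda>x. norm (\<phi> x)))" by (intro bdd_aboveI2[of _ _ B])
    let ?S = "SUP x. norm (\<phi> x)"
    have S: "norm (\<phi> x) \<le> ?S" for x using bdd by (rule cSUP_upper2[of _ _ x]) auto
    have "integrable lebesgue (\<lambda>x. indicator K x *\<^sub>R f x)"
      using f K unfolding locally_integrable_def set_integrable_def by blast
    then have iK: "integrable lebesgue (\<lambda>x. norm (indicator K x *\<^sub>R f x) * ?S)"
      by (intro integrable_mult_left integrable_norm)
    have "norm (u \<phi>) \<le> (\<integral>x. norm (f x * \<phi> x) \<partial>lebesgue)"
      unfolding u[OF \<phi>] by (rule integral_norm_bound)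
    also have "\<dots> \<le> (\<integral>x. norm (indicator K x *\<^sub>R f x) * ?S \<partial>lebesgue)"
    proof (rule integral_mono[OF _ iK])
      show "integrable lebesgue (\<lambda>x. norm (f x * \<phi> x))" using int[OF \<phi>] by simp
      show "norm (f x * \<phi> x) \<le> norm (indicator K x *\<^sub>R f x) * ?S" for x
        using supp S[of x] by (cases "x \<in> K") (auto simp: norm_mult mult_left_mono)
    qed
    also have "\<dots> = (\<integral>x. norm (indicator K x *\<^sub>R f x) \<partial>lebesgue) *
        (\<Sum>bs | bs \<in> lists Basis \<and> length bs \<le> 0. SUP x. norm (iter_deriv bs \<phi> x))"
    proof -
      have "{bs. bs \<in> lists (Basis::'a set) \<and> length bs \<le> 0} = {[]}" by auto
      then show ?thesis by simp
    qed
    finally show "norm (u \<phi>) \<le> (\<integral>x. norm (indicator K x *\<^sub>R f x) \<partial>lebesgue) *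
        (\<Sum>bs | bs \<in> lists Basis \<and> length bs \<le> 0. SUP x. norm (iter_deriv bs \<phi> x))" .
  qed
  ultimately show ?thesis by (auto simp: distributions_def)
qed

lemma schwartz_smooth: "\<phi> \<in> schwartz \<Longrightarrow> smooth \<phi>"
  by (simp add: schwartz_def)

text \<open>The window turns Schwartz functions into test functions, so that the functional is integration
  against the integrable function \<open>f \<psi>\<close> and of order zero.\<close>

lemma tempered_represented:
  fixes f :: "'a::euclidean_space \<Rightarrow> complex"
  assumes "represents f u" "\<psi> \<in> test_functions"
  shows "distr_mult u \<psi> \<in> tempered_distributions"
proof -
  have f: "locally_integrable f" and u: "\<And>\<phi>. \<phi> \<in> test_functions \<Longrightarrow> u \<phi> = (\<integral>x. f x * \<phi> x \<partial>lebesgue)"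
    using assms by (auto simp: represents_def distr_of_def)
  have t: "(\<lambda>x. \<psi> x * \<phi> x) \<in> test_functions" if "\<phi> \<in> schwartz" for \<phi>
    using test_mult_left[OF assms(2) schwartz_smooth[OF that]] .
  have v: "distr_mult u \<psi> \<phi> = (\<integral>x. f x * (\<psi> x * \<phi> x) \<partial>lebesgue)"
    and int: "integrable lebesgue (\<lambda>x. f x * (\<psi> x * \<phi> x))" if "\<phi> \<in> schwartz" for \<phi>
    using u[OF t[OF that]] locally_integrable_mult_test[OF f t[OF that]] by (simp_all add: distr_mult_def)
  have vt: "distr_mult u \<psi> \<phi> = (\<integral>x. f x * (\<psi> x * \<phi> x) \<partial>lebesgue)" if "(\<lambda>x. \<psi> x * \<phi> x) \<in> test_functions" for \<phi>
    using u[OF that] by (simp add: distr_mult_def)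
  have "linear_on_fns schwartz (distr_mult u \<psi>)"
    unfolding linear_on_fns_def
  proof (intro conjI ballI allI)
    fix \<phi> \<theta> :: "'a \<Rightarrow> complex" assume *: "\<phi> \<in> schwartz" "\<theta> \<in> schwartz"
    have "(\<lambda>x. \<psi> x * (\<phi> x + \<theta> x)) \<in> test_functions"
      using * by (intro test_mult_left assms smooth_add schwartz_smooth)
    then show "distr_mult u \<psi> (\<lambda>x. \<phi> x + \<theta> x) = distr_mult u \<psi> \<phi> + distr_mult u \<psi> \<theta>"
      using int[OF *(1)] int[OF *(2)] * by (simp add: vt v distrib_left)
  next
    fix c and \<phi> :: "'a \<Rightarrow> complex" assume *: "\<phi> \<in> schwartz"
    have "(\<lambda>x. \<psi> x * (c * \<phi> x)) \<in> test_functions"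
      using * by (intro test_mult_left assms smooth_cmult schwartz_smooth)
    then show "distr_mult u \<psi> (\<lambda>x. c * \<phi> x) = c * distr_mult u \<psi> \<phi>"
      using * by (simp add: vt v mult.left_commute[of _ c])
  qed
  moreover have "norm (distr_mult u \<psi> \<phi>) \<le> (\<integral>x. norm (f x * \<psi> x) \<partial>lebesgue) *
      (\<Sum>bs | bs \<in> lists Basis \<and> length bs \<le> 0. SUP x. bracket x ^ 0 * norm (iter_deriv bs \<phi> x))"
    if \<phi>: "\<phi> \<in> schwartz" for \<phi>
  proof -
    have "bounded (range (\<lambda>x. bracket x ^ 0 *\<^sub>R iter_deriv [] \<phi> x))"
      using \<phi> unfolding schwartz_def by blast
    then obtain B where "\<And>x. norm (\<phi> x) \<le> B" by (auto simp: bounded_iff)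
    then have bdd: "bdd_above (range (\<lambda>x. norm (\<phi> x)))" by (intro bdd_aboveI2[of _ _ B])
    let ?S = "SUP x. norm (\<phi> x)"
    have S: "norm (\<phi> x) \<le> ?S" for x using bdd by (rule cSUP_upper2[of _ _ x]) auto
    have iK: "integrable lebesgue (\<lambda>x. norm (f x * \<psi> x) * ?S)"
      by (intro integrable_mult_left integrable_norm locally_integrable_mult_test f assms)
    have "norm (distr_mult u \<psi> \<phi>) \<le> (\<integral>x. norm (f x * (\<psi> x * \<phi> x)) \<partial>lebesgue)"
      unfolding v[OF \<phi>] by (rule integral_norm_bound)
    also have "\<dots> \<le> (\<integral>x. norm (f x * \<psi> x) * ?S \<partial>lebesgue)"
    proof (rule integral_mono[OF _ iK])
      show "integrable lebesgue (\<lambda>x. norm (f x * (\<psi> x * \<phi> x)))" using int[OF \<phi>] by simp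
      show "norm (f x * (\<psi> x * \<phi> x)) \<le> norm (f x * \<psi> x) * ?S" for x
        using S[of x] by (simp add: norm_mult mult_left_mono mult.assoc[symmetric])
    qed
    also have "\<dots> = (\<integral>x. norm (f x * \<psi> x) \<partial>lebesgue) *
      (\<Sum>bs | bs \<in> lists Basis \<and> length bs \<le> 0. SUP x. bracket x ^ 0 * norm (iter_deriv bs \<phi> x))"
    proof -
      have "{bs. bs \<in> lists (Basis::'a set) \<and> length bs \<le> 0} = {[]}" by auto
      then show ?thesis by simp
    qed
    finally show ?thesis .
  qed
  ultimately show ?thesis unfolding tempered_distributions_def by blast
qed

section \<open>Localised distributions as Fourier integrals\<close>

text \<open>The constant \<open>(2 \<pi>)\<^sup>-\<^sup>n\<close> of the inversion formula in dimension \<open>n\<close>.\<close>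

definition inversion_factor :: "'a::euclidean_space itself \<Rightarrow> complex" where
  "inversion_factor _ = (SOME c. c \<noteq> 0 \<and>
     (\<forall>\<phi>\<in>test_functions. \<forall>x::'a. \<phi> x = c * fourier (fourier \<phi>) (- x)))"

lemma
  shows inversion_factor_nonzero: "inversion_factor TYPE('a::euclidean_space) \<noteq> 0"
    and inversion_factor: "\<phi> \<in> test_functions \<Longrightarrow>
      \<phi> x = inversion_factor TYPE('a) * fourier (fourier \<phi>) (- (x::'a))"
proof -
  have "\<exists>c. c \<noteq> 0 \<and> (\<forall>\<phi>\<in>test_functions. \<forall>x::'a. \<phi> x = c * fourier (fourier \<phi>) (- x))"
    using fourier_inversion[where 'a='a] by metis
  from someI_ex[OF this]
  show "inversion_factor TYPE('a) \<noteq> 0" "\<phi> \<in> test_functions \<Longrightarrow>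
      \<phi> x = inversion_factor TYPE('a) * fourier (fourier \<phi>) (- (x::'a))"
    unfolding inversion_factor_def by blast+
qed

text \<open>The ball of radius \<open>M\<close> in the space of inverse Fourier transforms of densities that are square
  integrable with weight \<open>w\<close>. Integrability of the density makes \<open>h\<close> a continuous function, given
  at every point. Radii are positive so that one can divide by them.\<close>

definition fourier_ball :: "('a::euclidean_space \<Rightarrow> real) \<Rightarrow> real \<Rightarrow> ('a \<Rightarrow> complex) \<Rightarrow> bool" where
  "fourier_ball w M h \<longleftrightarrow> 0 < M \<and> (\<exists>G. integrable lborel G \<and>
     (\<integral>\<^sup>+\<xi>. ennreal ((w \<xi> * norm (G \<xi>))\<^sup>2) \<partial>lebesgue) \<le> ennreal (M\<^sup>2) \<and> (\<forall>x. h x = fourier G (- x)))"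

lemma fourier_ball_continuous: "fourier_ball w M h \<Longrightarrow> continuous_on UNIV h"
proof -
  assume "fourier_ball w M h"
  then obtain G where G: "integrable lborel G" "\<And>x. h x = fourier G (- x)" by (auto simp: fourier_ball_def)
  have "continuous_on UNIV (\<lambda>x. fourier G (- x))"
    by (rule continuous_on_compose2[OF continuous_on_fourier[OF G(1)]]) (auto intro: continuous_intros)
  moreover have "h = (\<lambda>x. fourier G (- x))" using G(2) by auto
  ultimately show ?thesis by simp
qed

lemma integral_mult_le_weighted:
  fixes w g :: "'a \<Rightarrow> real"
  assumes "0 < t" "integrable N (\<lambda>x. (1 / w x)\<^sup>2)" "integrable N (\<lambda>x. (w x * g x)\<^sup>2)"
    "g \<in> borel_measurable N" "\<And>x. 0 < w x"
  shows "integrable N g"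
    and "(\<integral>x. \<bar>g x\<bar> \<partial>N) \<le> ((\<integral>x. (w x * g x)\<^sup>2 \<partial>N) / t + t * (\<integral>x. (1 / w x)\<^sup>2 \<partial>N)) / 2"
proof -
  let ?h = "\<lambda>x. ((w x * g x)\<^sup>2 / t + t * (1 / w x)\<^sup>2) / 2"
  have le: "\<bar>g x\<bar> \<le> ?h x" for x
  proof -
    have "0 \<le> (w x * \<bar>g x\<bar> / sqrt t - sqrt t * (1 / w x))\<^sup>2" by simp
    also have "\<dots> = (w x * g x)\<^sup>2 / t + t * (1 / w x)\<^sup>2 - 2 * \<bar>g x\<bar>"
      using assms(1) assms(5)[of x] by (simp add: power2_diff power_divide power_mult_distrib)
    finally show ?thesis by simp
  qed
  have int: "integrable N ?h" using assms(2,3) by simp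
  show "integrable N g"
  proof (rule Bochner_Integration.integrable_bound[OF int assms(4)], intro AE_I2)
    show "norm (g x) \<le> norm (?h x)" for x
      unfolding real_norm_def by (rule order_trans[OF le abs_ge_self])
  qed
  then have "(\<integral>x. \<bar>g x\<bar> \<partial>N) \<le> (\<integral>x. ?h x \<partial>N)" by (intro integral_mono int le) auto
  also have "\<dots> = ((\<integral>x. (w x * g x)\<^sup>2 \<partial>N) / t + t * (\<integral>x. (1 / w x)\<^sup>2 \<partial>N)) / 2"
    using assms(2,3) by simp
  finally show "(\<integral>x. \<bar>g x\<bar> \<partial>N) \<le> ((\<integral>x. (w x * g x)\<^sup>2 \<partial>N) / t + t * (\<integral>x. (1 / w x)\<^sup>2 \<partial>N)) / 2" .
qed

text \<open>Cauchy-Schwarz for \<open>norm (G \<xi>) = (w \<xi> * norm (G \<xi>)) * (1 / w \<xi>)\<close>, in the form with a parameter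
  \<open>t\<close>; the choice \<open>t = M\<close> makes the bound linear in \<open>M\<close>.\<close>

lemma weighted_L1_bound:
  fixes w :: "'a::euclidean_space \<Rightarrow> real" and G :: "'a \<Rightarrow> complex"
  assumes w: "w \<in> borel_measurable lebesgue" "\<And>\<xi>. 0 < w \<xi>" "square_integrable (\<lambda>\<xi>. 1 / w \<xi>)"
    and G: "G \<in> borel_measurable borel" and M: "0 < M"
      "(\<integral>\<^sup>+\<xi>. ennreal ((w \<xi> * norm (G \<xi>))\<^sup>2) \<partial>lebesgue) \<le> ennreal (M\<^sup>2)"
  shows "integrable lborel G" "(\<integral>\<xi>. norm (G \<xi>) \<partial>lborel) \<le> (1 + (L2_norm (\<lambda>\<xi>. 1 / w \<xi>))\<^sup>2) * M"
proof -
  let ?I = "\<integral>\<xi>. (1 / w \<xi>)\<^sup>2 \<partial>lebesgue"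
  have [measurable]: "G \<in> borel_measurable lebesgue" using G by (simp add: measurable_completion)
  note w(1)[measurable]
  have i1: "integrable lebesgue (\<lambda>\<xi>. (1 / w \<xi>)\<^sup>2)" using w(3) by (simp add: square_integrable_def power_divide)
  have I: "(L2_norm (\<lambda>\<xi>. 1 / w \<xi>))\<^sup>2 = ?I" unfolding L2_norm_def by (simp add: real_sqrt_pow2 power_divide)
  have i2: "integrable lebesgue (\<lambda>\<xi>. (w \<xi> * norm (G \<xi>))\<^sup>2)"
  proof (rule integrableI_nonneg)
    show "(\<integral>\<^sup>+\<xi>. ennreal ((w \<xi> * norm (G \<xi>))\<^sup>2) \<partial>lebesgue) < \<infinity>"
      using M(2) by (rule order.strict_trans1) simp
  qed auto
  have le: "(\<integral>\<xi>. (w \<xi> * norm (G \<xi>))\<^sup>2 \<partial>lebesgue) \<le> M\<^sup>2"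
    using M(2) nn_integral_eq_integral[OF i2] by (simp add: ennreal_le_iff)
  note * = integral_mult_le_weighted[OF M(1) i1 i2 _ w(2)]
  have iG: "integrable lebesgue (\<lambda>\<xi>. norm (G \<xi>))" by (rule *(1)) simp
  have iG': "integrable lebesgue G" using integrable_norm_iff[of G lebesgue] iG by simp
  then show "integrable lborel G" using G by (subst (asm) integrable_completion) auto
  have "(\<integral>\<xi>. norm (G \<xi>) \<partial>lborel) = (\<integral>\<xi>. norm (G \<xi>) \<partial>lebesgue)"
    using G by (intro integral_completion[symmetric]) simp
  also have "\<dots> \<le> ((\<integral>\<xi>. (w \<xi> * norm (G \<xi>))\<^sup>2 \<partial>lebesgue) / M + M * ?I) / 2"
    using *(2) by simp
  also have "\<dots> \<le> (M\<^sup>2 / M + M * ?I) / 2"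
    using M(1) le by (intro divide_right_mono add_right_mono) auto
  also have "\<dots> = (1 + ?I) * M / 2" using M(1) by (simp add: power2_eq_square algebra_simps)
  also have "\<dots> \<le> (1 + ?I) * M" using M(1) by (simp add: field_simps)
  finally show "(\<integral>\<xi>. norm (G \<xi>) \<partial>lborel) \<le> (1 + (L2_norm (\<lambda>\<xi>. 1 / w \<xi>))\<^sup>2) * M" by (simp add: I)
qed

lemma fourier_ball_bounded:
  assumes "w \<in> borel_measurable lebesgue" "\<And>\<xi>. 0 < w \<xi>" "square_integrable (\<lambda>\<xi>. 1 / w \<xi>)" "fourier_ball w M h"
  shows "norm (h x) \<le> (1 + (L2_norm (\<lambda>\<xi>. 1 / w \<xi>))\<^sup>2) * M"
proof -
  from assms(4) obtain G where G: "0 < M" "integrable lborel G" "h x = fourier G (- x)"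
     "(\<integral>\<^sup>+\<xi>. ennreal ((w \<xi> * norm (G \<xi>))\<^sup>2) \<partial>lebesgue) \<le> ennreal (M\<^sup>2)" by (auto simp: fourier_ball_def)
  have "norm (h x) \<le> (\<integral>\<xi>. norm (G \<xi>) \<partial>lborel)" unfolding G(3) by (rule norm_fourier_le[OF G(2)])
  then show ?thesis using weighted_L1_bound(2)[OF assms(1-3) integrable_borel[OF G(2)] G(1,4)] by linarith
qed

lemma iter_deriv_mult_uniformly_small:
  fixes \<psi> :: "'a::euclidean_space \<Rightarrow> complex"
  assumes "bs \<in> lists Basis" "\<psi> \<in> test_functions" "\<And>n. smooth (D n)"
    and "\<And>bs. bs \<in> lists Basis \<Longrightarrow> uniform_limit UNIV (\<lambda>n. iter_deriv bs (D n)) (\<lambda>_. 0) sequentially"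
  shows "uniform_limit UNIV (\<lambda>n. iter_deriv bs (\<lambda>x. \<psi> x * D n x)) (\<lambda>_. 0) sequentially"
  using assms
proof (induction bs arbitrary: \<psi> D rule: rev_induct)
  case Nil
  obtain B where "0 < B" and B: "\<And>x. norm (\<psi> x) \<le> B" by (rule test_bounded[OF Nil(2)]) auto
  show ?case
  proof (rule uniform_limitI)
    fix e :: real assume "0 < e"
    have "uniform_limit UNIV (\<lambda>n. D n) (\<lambda>_. 0) sequentially" using Nil(4)[of "[]"] by simp
    then have "\<forall>\<^sub>F n in sequentially. \<forall>x\<in>UNIV. dist (D n x) 0 < e / B"
      by (rule uniform_limitD) (use \<open>0 < e\<close> \<open>0 < B\<close> in simp)
    then show "\<forall>\<^sub>F n in sequentially. \<forall>x\<in>UNIV. dist (iter_deriv [] (\<lambda>x. \<psi> x * D n x) x) 0 < e"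
    proof eventually_elim
      case (elim n)
      have "norm (\<psi> x * D n x) < e" for x
      proof -
        have "norm (\<psi> x * D n x) \<le> B * norm (D n x)" unfolding norm_mult by (intro mult_right_mono B) simp
        also have "\<dots> < B * (e / B)" using elim \<open>0 < B\<close> by (intro mult_strict_left_mono) auto
        finally show ?thesis using \<open>0 < B\<close> by simp
      qed
      then show ?case by simp
    qed
  qed
next
  case (snoc b bs)
  then have bs: "bs \<in> lists Basis" "b \<in> Basis" by auto
  have "uniform_limit UNIV (\<lambda>n. iter_deriv bs (\<lambda>x. partial_deriv b \<psi> x * D n x)) (\<lambda>_. 0) sequentially"
    by (rule snoc.IH[OF bs(1) test_partial_deriv[OF snoc.prems(2) bs(2)] snoc.prems(3,4)])
  moreover have "uniform_limit UNIV (\<lambda>n. iter_deriv bs (\<lambda>x. \<psi> x * partial_deriv b (D n) x)) (\<lambda>_. 0) sequentially"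
  proof (rule snoc.IH[OF bs(1) snoc.prems(2)])
    show "smooth (partial_deriv b (D n))" for n using snoc.prems(3) bs(2) smooth_partial_deriv by blast
    show "uniform_limit UNIV (\<lambda>n. iter_deriv cs (partial_deriv b (D n))) (\<lambda>_. 0) sequentially"
      if "cs \<in> lists Basis" for cs
      using snoc.prems(4)[of "cs @ [b]"] that bs(2) unfolding iter_deriv_snoc by auto
  qed
  ultimately have "uniform_limit UNIV (\<lambda>n x. iter_deriv bs (\<lambda>x. partial_deriv b \<psi> x * D n x) x
      + iter_deriv bs (\<lambda>x. \<psi> x * partial_deriv b (D n) x) x) (\<lambda>x. 0 + 0) sequentially"
    by (rule uniform_limit_add)
  then show ?case
    using iter_deriv_mult_snoc[OF test_smooth[OF snoc.prems(2)] snoc.prems(3) bs] by simp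
qed

lemma distribution_sequential_continuity:
  fixes u :: "'a::euclidean_space distr"
  assumes u: "u \<in> distributions" and K: "compact K"
    and \<phi>: "\<And>n. \<phi> n \<in> test_functions" "\<And>n x. x \<notin> K \<Longrightarrow> \<phi> n x = 0"
    and lim: "\<And>bs. bs \<in> lists Basis \<Longrightarrow> uniform_limit UNIV (\<lambda>n. iter_deriv bs (\<phi> n)) (\<lambda>_. 0) sequentially"
  shows "(\<lambda>n. u (\<phi> n)) \<longlonglongrightarrow> 0"
proof -
  have "\<exists>C. \<exists>N::nat. \<forall>\<phi>\<in>test_functions. (\<forall>x. x \<notin> K \<longrightarrow> \<phi> x = 0) \<longrightarrow>
     norm (u \<phi>) \<le> C * (\<Sum>bs | bs \<in> lists Basis \<and> length bs \<le> N. SUP x. norm (iter_deriv bs \<phi> x))"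
    using u K by (simp add: distributions_def)
  then obtain C N where C: "\<forall>\<phi>\<in>test_functions. (\<forall>x. x \<notin> K \<longrightarrow> \<phi> x = 0) \<longrightarrow>
     norm (u \<phi>) \<le> C * (\<Sum>bs | bs \<in> lists Basis \<and> length bs \<le> N. SUP x. norm (iter_deriv bs \<phi> x))"
    by (elim exE) (rule that)
  have "(\<lambda>n. SUP x. norm (iter_deriv bs (\<phi> n) x)) \<longlonglongrightarrow> 0" if bs: "bs \<in> lists Basis" for bs
  proof (rule LIMSEQ_I)
    fix e :: real assume "0 < e"
    have "\<forall>\<^sub>F n in sequentially. \<forall>x\<in>UNIV. dist (iter_deriv bs (\<phi> n) x) 0 < e / 2"
      using lim[OF bs] by (rule uniform_limitD) (use \<open>0 < e\<close> in simp)
    then obtain m where m: "\<And>n x. m \<le> n \<Longrightarrow> norm (iter_deriv bs (\<phi> n) x) < e / 2"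
      by (auto simp: eventually_sequentially)
    have "norm ((SUP x. norm (iter_deriv bs (\<phi> n) x)) - 0) < e" if "m \<le> n" for n
    proof -
      have bdd: "bdd_above (range (\<lambda>x. norm (iter_deriv bs (\<phi> n) x)))"
        using m[OF that] by (intro bdd_aboveI2[of _ _ "e/2"]) (auto intro: less_imp_le)
      have "(SUP x. norm (iter_deriv bs (\<phi> n) x)) \<le> e / 2"
        using m[OF that] by (intro cSUP_least) (auto intro: less_imp_le)
      moreover have "0 \<le> (SUP x. norm (iter_deriv bs (\<phi> n) x))"
        by (rule cSUP_upper2[OF bdd, of 0]) auto
      ultimately show ?thesis using \<open>0 < e\<close> by simp
    qed
    then show "\<exists>m. \<forall>n\<ge>m. norm ((SUP x. norm (iter_deriv bs (\<phi> n) x)) - 0) < e" by blast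
  qed
  then have "(\<lambda>n. C * (\<Sum>bs | bs \<in> lists Basis \<and> length bs \<le> N. SUP x. norm (iter_deriv bs (\<phi> n) x)))
     \<longlonglongrightarrow> C * (\<Sum>bs | bs \<in> lists (Basis::'a set) \<and> length bs \<le> N. 0)"
    by (intro tendsto_mult tendsto_const tendsto_sum) auto
  then show ?thesis
    by (intro Lim_null_comparison[of "\<lambda>n. u (\<phi> n)"]) (use C \<phi> in \<open>auto intro!: always_eventually\<close>)
qed

lemma distribution_add:
  assumes "u \<in> distributions" "\<phi> \<in> test_functions" "\<theta> \<in> test_functions"
  shows "u (\<lambda>x. \<phi> x + \<theta> x) = u \<phi> + u \<theta>"
  using assms by (simp add: distributions_def linear_on_fns_def)

lemma distribution_cmult:
  assumes "u \<in> distributions" "\<phi> \<in> test_functions"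
  shows "u (\<lambda>x. c * \<phi> x) = c * u \<phi>"
  using assms by (simp add: distributions_def linear_on_fns_def)

lemma distribution_diff:
  assumes "u \<in> distributions" "\<phi> \<in> test_functions" "\<theta> \<in> test_functions"
  shows "u (\<lambda>x. \<phi> x - \<theta> x) = u \<phi> - u \<theta>"
  using distribution_add[OF assms(1,2) test_cmult[OF assms(3), of "-1"]] distribution_cmult[OF assms(1,3), of "-1"]
  by simp

lemma distribution_sum:
  assumes "u \<in> distributions" "\<And>i. i \<in> I \<Longrightarrow> \<phi> i \<in> test_functions"
  shows "u (\<lambda>x. \<Sum>i\<in>I. \<phi> i x) = (\<Sum>i\<in>I. u (\<phi> i))"
  using assms(2)
proof (induction I rule: infinite_finite_induct)
  case (insert i I)
  have "u (\<lambda>x. \<phi> i x + (\<Sum>i\<in>I. \<phi> i x)) = u (\<phi> i) + u (\<lambda>x. \<Sum>i\<in>I. \<phi> i x)"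
    by (intro distribution_add assms(1) test_sum insert.prems) auto
  then show ?case using insert by simp
qed (use distribution_cmult[OF assms(1) test_zero, of 0] in auto)

text \<open>By Cauchy-Schwarz the Fourier transform \<open>g\<close> of \<open>u \<psi>\<close> is integrable, and \<open>h\<close> is its inverse
  transform. The definition relates \<open>u \<psi>\<close> and \<open>g\<close> through test functions in the frequency variable,
  whereas the transform \<open>m\<close> of a test function \<open>\<theta>\<close> has no compact support. It is reached by cutting
  off \<open>m\<close> at growing radii: behind the window the transforms of the cut off functions converge with
  all derivatives, and \<open>u\<close> is continuous with respect to this convergence.\<close>

lemma localised_distribution:
  fixes k :: "'a::euclidean_space \<Rightarrow> real" and u :: "'a distr"
  assumes k: "k \<in> borel_measurable lebesgue" "\<And>\<xi>. 0 < k \<xi>" "square_integrable (\<lambda>\<xi>. 1 / k \<xi>)"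
    and u: "u \<in> distributions" and \<psi>: "\<psi> \<in> test_functions"
    and M: "0 < M" "Bk_norm k (distr_mult u \<psi>) \<le> ennreal M"
  obtains h where "fourier_ball k (norm (inversion_factor TYPE('a)) * M) h"
    "\<And>\<theta>. \<theta> \<in> test_functions \<Longrightarrow> u (\<lambda>x. \<psi> x * \<theta> x) = (\<integral>x. h x * \<theta> x \<partial>lborel)"
proof -
  let ?c = "inversion_factor TYPE('a)"
  define v where "v = distr_mult u \<psi>"
  have v: "v \<in> Bk k" using M(2) unfolding Bk_norm_def v_def by (auto simp: top_unique split: if_splits)
  define g0 where "g0 = function_of (distr_fourier v)"
  have g0: "represents g0 (distr_fourier v)"
  proof -
    have "\<exists>f. represents f (distr_fourier v)" using v by (simp add: Bk_def)
    then show ?thesis unfolding g0_def function_of_def by (rule someI_ex)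
  qed
  have sq: "square_integrable (\<lambda>\<xi>. k \<xi> *\<^sub>R g0 \<xi>)" using v by (simp add: Bk_def g0_def)
  have "L2_norm (\<lambda>\<xi>. k \<xi> *\<^sub>R g0 \<xi>) \<le> M"
    using M v by (simp add: Bk_norm_def v_def[symmetric] g0_def[symmetric] ennreal_le_iff)
  then have L2: "(\<integral>\<xi>. (norm (k \<xi> *\<^sub>R g0 \<xi>))\<^sup>2 \<partial>lebesgue) \<le> M\<^sup>2"
    unfolding L2_norm_def by (rule sqrt_le_D)
  have g0m: "g0 \<in> borel_measurable lebesgue"
    using g0 locally_integrable_measurable by (auto simp: represents_def)
  then obtain g where g: "g \<in> borel_measurable borel" "AE \<xi> in lebesgue. g0 \<xi> = g \<xi>"
    by (rule lebesgue_complex_borel_version)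
  have gl: "g \<in> borel_measurable lebesgue" using g(1) by (simp add: measurable_completion)
  have "(\<integral>\<^sup>+\<xi>. ennreal ((k \<xi> * norm (g \<xi>))\<^sup>2) \<partial>lebesgue) = (\<integral>\<^sup>+\<xi>. ennreal ((norm (k \<xi> *\<^sub>R g0 \<xi>))\<^sup>2) \<partial>lebesgue)"
    using g(2) k(2) by (intro nn_integral_cong_AE) (auto simp: less_imp_le)
  also have "\<dots> = ennreal (\<integral>\<xi>. (norm (k \<xi> *\<^sub>R g0 \<xi>))\<^sup>2 \<partial>lebesgue)"
    using sq by (intro nn_integral_eq_integral) (auto simp: square_integrable_def)
  finally have gM: "(\<integral>\<^sup>+\<xi>. ennreal ((k \<xi> * norm (g \<xi>))\<^sup>2) \<partial>lebesgue) \<le> ennreal (M\<^sup>2)"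
    using L2 by (simp add: ennreal_leI)
  have gi: "integrable lborel g" by (rule weighted_L1_bound(1)[OF k g(1) M(1) gM])
  have rep: "u (\<lambda>x. \<psi> x * fourier \<phi> x) = (\<integral>\<xi>. g \<xi> * \<phi> \<xi> \<partial>lborel)" if \<phi>: "\<phi> \<in> test_functions" for \<phi>
  proof -
    note [measurable] = g(1) smooth_borel[OF test_smooth[OF \<phi>]]
    have "u (\<lambda>x. \<psi> x * fourier \<phi> x) = (\<integral>\<xi>. g0 \<xi> * \<phi> \<xi> \<partial>lebesgue)"
      using g0 \<phi> by (simp add: represents_def distr_of_def distr_fourier_def v_def distr_mult_def)
    also have "\<dots> = (\<integral>\<xi>. g \<xi> * \<phi> \<xi> \<partial>lebesgue)"
    proof (rule integral_cong_AE)
      show "(\<lambda>\<xi>. g0 \<xi> * \<phi> \<xi>) \<in> borel_measurable lebesgue"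
        using g0 \<phi> by (intro borel_measurable_integrable locally_integrable_mult_test) (auto simp: represents_def)
    qed (use g(2) in \<open>auto intro!: measurable_completion\<close>)
    also have "\<dots> = (\<integral>\<xi>. g \<xi> * \<phi> \<xi> \<partial>lborel)" by (rule integral_completion) simp
    finally show ?thesis .
  qed
  have key: "u (\<lambda>x. \<psi> x * \<theta> x) = ?c * (\<integral>\<xi>. g \<xi> * fourier \<theta> (- \<xi>) \<partial>lborel)" if \<theta>: "\<theta> \<in> test_functions" for \<theta>
  proof -
    define m where "m = (\<lambda>\<xi>. fourier \<theta> (- \<xi>))"
    have bth: "fourier \<theta> \<in> borel_measurable borel" by (rule borel_fourier[OF test_integrable[OF \<theta>]])
    have [measurable]: "m \<in> borel_measurable borel" unfolding m_def by (intro measurable_compose[OF _ bth]) simp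
    have fm: "finite_moments m"
      unfolding finite_moments_def
    proof (intro conjI allI)
      fix L
      have "integrable lborel (\<lambda>\<xi>. norm \<xi> ^ L * norm (fourier \<theta> \<xi>))"
        using finite_moments_fourier_test[OF \<theta>] by (simp add: finite_moments_def)
      then show "integrable lborel (\<lambda>\<xi>. norm \<xi> ^ L * norm (m \<xi>))"
        using lborel_reflection_invariance(2)[of "\<lambda>\<xi>. norm \<xi> ^ L * norm (fourier \<theta> \<xi>)"] bth
        by (simp add: m_def)
    qed simp
    have \<theta>m: "\<theta> x = ?c * fourier m x" for x
      using inversion_factor[OF \<theta>, of x] fourier_reflect[OF bth, of x] by (simp add: m_def)
    have sm: "smooth m"
      using smooth_fourier[OF finite_moments_test[OF \<theta>]] fourier_reflect[OF smooth_borel[OF test_smooth[OF \<theta>]]]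
      unfolding m_def
    proof -
      have "finite_moments (\<lambda>x. \<theta> (- x))"
        unfolding finite_moments_def
      proof (intro conjI allI)
        show "(\<lambda>x. \<theta> (- x)) \<in> borel_measurable borel"
          by (intro measurable_compose[OF _ smooth_borel[OF test_smooth[OF \<theta>]]]) simp
        fix L
        have "integrable lborel (\<lambda>\<xi>. norm \<xi> ^ L * norm (\<theta> \<xi>))"
          using finite_moments_test[OF \<theta>] by (simp add: finite_moments_def)
        then show "integrable lborel (\<lambda>\<xi>. norm \<xi> ^ L * norm (\<theta> (- \<xi>)))"
          using lborel_reflection_invariance(2)[of "\<lambda>\<xi>. norm \<xi> ^ L * norm (\<theta> \<xi>)"] smooth_borel[OF test_smooth[OF \<theta>]]
          by simp
      qed
      moreover have "(\<lambda>\<xi>. fourier \<theta> (- \<xi>)) = fourier (\<lambda>x. \<theta> (- x))"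
        using fourier_reflect[OF smooth_borel[OF test_smooth[OF \<theta>]]] by auto
      ultimately show "smooth (\<lambda>\<xi>. fourier \<theta> (- \<xi>))" using smooth_fourier by metis
    qed
    have "\<exists>\<eta>. \<eta> \<in> test_functions \<and> (\<forall>x::'a. norm (\<eta> x) \<le> 1) \<and> (\<forall>x. norm x \<le> real (Suc n) \<longrightarrow> \<eta> x = 1)" for n
      using plateau_exists[of "real (Suc n)", where 'a='a] by (metis of_nat_0_less_iff zero_less_Suc)
    then obtain \<eta> :: "nat \<Rightarrow> 'a \<Rightarrow> complex" where \<eta>: "\<And>n. \<eta> n \<in> test_functions" "\<And>n x. norm (\<eta> n x) \<le> 1"
      "\<And>n x. norm x \<le> real (Suc n) \<Longrightarrow> \<eta> n x = 1" by metis
    have \<eta>lim: "(\<lambda>n. \<eta> n x) \<longlonglongrightarrow> 1" for x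
    proof (rule tendsto_eventually)
      obtain N where N: "norm x \<le> real N" using real_arch_simple by blast
      show "\<forall>\<^sub>F n in sequentially. \<eta> n x = 1"
        using eventually_ge_at_top[of N] by eventually_elim (use N \<eta>(3) in auto)
    qed
    have \<eta>b[measurable]: "\<eta> n \<in> borel_measurable borel" for n by (rule smooth_borel[OF test_smooth[OF \<eta>(1)]])
    define q where "q = (\<lambda>n \<xi>. (\<eta> n \<xi> - 1) * m \<xi>)"
    have [measurable]: "q n \<in> borel_measurable borel" for n unfolding q_def by measurable
    have qle: "norm (q n \<xi>) \<le> 2 * norm (m \<xi>)" for n \<xi>
    proof -
      have "norm (\<eta> n \<xi> - 1) \<le> 2" using norm_triangle_ineq4[of "\<eta> n \<xi>" 1] \<eta>(2)[of n \<xi>] by simp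
      then show ?thesis unfolding q_def norm_mult by (rule mult_right_mono) simp
    qed
    have fq: "finite_moments (q n)" for n
      by (rule finite_moments_bound[OF fm, where C=2 and k=0]) (use qle in auto)
    have t\<eta>m: "(\<lambda>\<xi>. \<eta> n \<xi> * m \<xi>) \<in> test_functions" for n by (rule test_mult_left[OF \<eta>(1) sm])
    have lim1: "(\<lambda>n. u (\<lambda>x. \<psi> x * fourier (q n) x)) \<longlonglongrightarrow> 0"
    proof (rule distribution_sequential_continuity[OF u, of "closure {x. \<psi> x \<noteq> 0}"])
      show "compact (closure {x. \<psi> x \<noteq> 0})" using \<psi> by (simp add: test_functions_def)
      show "(\<lambda>x. \<psi> x * fourier (q n) x) \<in> test_functions" for n
        by (rule test_mult_left[OF \<psi> smooth_fourier[OF fq]])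
      show "\<psi> x * fourier (q n) x = 0" if "x \<notin> closure {x. \<psi> x \<noteq> 0}" for n x
      proof -
        have "\<psi> x = 0" using that closure_subset[of "{x. \<psi> x \<noteq> 0}"] by blast
        then show ?thesis by simp
      qed
      show "uniform_limit UNIV (\<lambda>n. iter_deriv bs (\<lambda>x. \<psi> x * fourier (q n) x)) (\<lambda>_. 0) sequentially"
        if "bs \<in> lists Basis" for bs
      proof (rule iter_deriv_mult_uniformly_small[OF that \<psi> smooth_fourier[OF fq]])
        fix bs :: "'a list" assume bs: "bs \<in> lists Basis"
        let ?I = "\<lambda>n. \<integral>\<xi>. norm \<xi> ^ length bs * norm (q n \<xi>) \<partial>lborel"
        have "?I \<longlonglongrightarrow> (\<integral>\<xi>. 0 \<partial>(lborel :: 'a measure))"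
        proof (rule integral_dominated_convergence[where w="\<lambda>\<xi>. 2 * (norm \<xi> ^ length bs * norm (m \<xi>))"])
          show "integrable lborel (\<lambda>\<xi>. 2 * (norm \<xi> ^ length bs * norm (m \<xi>)))"
            using fm unfolding finite_moments_def by (intro integrable_mult_right) blast
          have "(\<lambda>n. norm \<xi> ^ length bs * norm (q n \<xi>)) \<longlonglongrightarrow> norm \<xi> ^ length bs * norm ((1 - 1) * m \<xi>)" for \<xi>
            unfolding q_def by (intro tendsto_intros \<eta>lim)
          then show "AE \<xi> in lborel. (\<lambda>n. norm \<xi> ^ length bs * norm (q n \<xi>)) \<longlonglongrightarrow> 0" by simp
          show "AE \<xi> in lborel. norm (norm \<xi> ^ length bs * norm (q n \<xi>)) \<le> 2 * (norm \<xi> ^ length bs * norm (m \<xi>))" for n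
            using qle[of n] by (auto intro!: AE_I2 simp: mult.left_commute[of 2] mult_left_mono)
        qed auto
        then have I0: "?I \<longlonglongrightarrow> 0" by simp
        show "uniform_limit UNIV (\<lambda>n. iter_deriv bs (fourier (q n))) (\<lambda>_. 0) sequentially"
        proof (rule uniform_limitI)
          fix e :: real assume "0 < e"
          with I0 have "\<forall>\<^sub>F n in sequentially. ?I n < e" by (rule order_tendstoD(2))
          then show "\<forall>\<^sub>F n in sequentially. \<forall>x\<in>UNIV. dist (iter_deriv bs (fourier (q n)) x) 0 < e"
            by eventually_elim (use norm_iter_deriv_fourier_le[OF fq bs] in \<open>auto intro: le_less_trans\<close>)
        qed
      qed
    qed
    have "u (\<lambda>x. \<psi> x * fourier (q n) x) = (\<integral>\<xi>. g \<xi> * (\<eta> n \<xi> * m \<xi>) \<partial>lborel) - u (\<lambda>x. \<psi> x * fourier m x)" for n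
    proof -
      have "fourier (q n) x = fourier (\<lambda>\<xi>. \<eta> n \<xi> * m \<xi>) x - fourier m x" for x
        using fourier_diff[OF test_integrable[OF t\<eta>m[of n]] finite_moments_integrable[OF fm], of x]
        by (simp add: q_def left_diff_distrib)
      then have e: "(\<lambda>x. \<psi> x * fourier (q n) x) = (\<lambda>x. \<psi> x * fourier (\<lambda>\<xi>. \<eta> n \<xi> * m \<xi>) x - \<psi> x * fourier m x)"
        by (simp add: right_diff_distrib)
      have "u (\<lambda>x. \<psi> x * fourier (q n) x) = u (\<lambda>x. \<psi> x * fourier (\<lambda>\<xi>. \<eta> n \<xi> * m \<xi>) x - \<psi> x * fourier m x)"
        by (rule arg_cong[OF e])
      also have "\<dots> = u (\<lambda>x. \<psi> x * fourier (\<lambda>\<xi>. \<eta> n \<xi> * m \<xi>) x) - u (\<lambda>x. \<psi> x * fourier m x)"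
        by (intro distribution_diff u test_mult_left \<psi> smooth_fourier fm finite_moments_test t\<eta>m)
      finally show ?thesis using rep[OF t\<eta>m[of n]] by simp
    qed
    with lim1 have "(\<lambda>n. \<integral>\<xi>. g \<xi> * (\<eta> n \<xi> * m \<xi>) \<partial>lborel) \<longlonglongrightarrow> u (\<lambda>x. \<psi> x * fourier m x)"
      by (simp add: LIM_zero_iff)
    moreover have "(\<lambda>n. \<integral>\<xi>. g \<xi> * (\<eta> n \<xi> * m \<xi>) \<partial>lborel) \<longlonglongrightarrow> (\<integral>\<xi>. g \<xi> * (1 * m \<xi>) \<partial>lborel)"
    proof (rule integral_dominated_convergence[where w="\<lambda>\<xi>. norm (g \<xi>) * (\<integral>x. norm (\<theta> x) \<partial>lborel)"])
      show "integrable lborel (\<lambda>\<xi>. norm (g \<xi>) * (\<integral>x. norm (\<theta> x) \<partial>lborel))" using gi by simp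
      show "AE \<xi> in lborel. (\<lambda>n. g \<xi> * (\<eta> n \<xi> * m \<xi>)) \<longlonglongrightarrow> g \<xi> * (1 * m \<xi>)"
        by (intro AE_I2 tendsto_mult tendsto_const \<eta>lim)
      have "norm (g \<xi> * (\<eta> n \<xi> * m \<xi>)) \<le> norm (g \<xi>) * (\<integral>x. norm (\<theta> x) \<partial>lborel)" for n \<xi>
      proof -
        have "norm (\<eta> n \<xi>) * norm (m \<xi>) \<le> 1 * (\<integral>x. norm (\<theta> x) \<partial>lborel)"
          unfolding m_def by (intro mult_mono \<eta> norm_fourier_le test_integrable \<theta>) auto
        then show ?thesis unfolding norm_mult by (intro mult_left_mono) auto
      qed
      then show "AE \<xi> in lborel. norm (g \<xi> * (\<eta> n \<xi> * m \<xi>)) \<le> norm (g \<xi>) * (\<integral>x. norm (\<theta> x) \<partial>lborel)" for n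
        by auto
    qed (use g(1) in measurable)
    ultimately have "u (\<lambda>x. \<psi> x * fourier m x) = (\<integral>\<xi>. g \<xi> * m \<xi> \<partial>lborel)"
      by (simp add: LIMSEQ_unique)
    moreover have "u (\<lambda>x. \<psi> x * \<theta> x) = ?c * u (\<lambda>x. \<psi> x * fourier m x)"
    proof -
      have "(\<lambda>x. \<psi> x * \<theta> x) = (\<lambda>x. ?c * (\<psi> x * fourier m x))" by (simp add: \<theta>m mult_ac)
      then show ?thesis
        using distribution_cmult[OF u test_mult_left[OF \<psi> smooth_fourier[OF fm]]] by simp
    qed
    ultimately show ?thesis by (simp add: m_def)
  qed
  define h where "h = (\<lambda>x. fourier (\<lambda>\<xi>. ?c * g \<xi>) (- x))"
  show ?thesis
  proof (rule that[of h])
    show "fourier_ball k (norm ?c * M) h"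
      unfolding fourier_ball_def
    proof (intro conjI exI[of _ "\<lambda>\<xi>. ?c * g \<xi>"] allI)
      show "0 < norm ?c * M" using M(1) inversion_factor_nonzero[where 'a='a] by simp
      show "integrable lborel (\<lambda>\<xi>. ?c * g \<xi>)" using gi by simp
      have "(\<integral>\<^sup>+\<xi>. ennreal ((k \<xi> * norm (?c * g \<xi>))\<^sup>2) \<partial>lebesgue) =
        (\<integral>\<^sup>+\<xi>. ennreal ((norm ?c)\<^sup>2) * ennreal ((k \<xi> * norm (g \<xi>))\<^sup>2) \<partial>lebesgue)"
        by (intro nn_integral_cong) (simp add: ennreal_mult[symmetric] norm_mult power_mult_distrib mult_ac)
      also have "\<dots> = ennreal ((norm ?c)\<^sup>2) * (\<integral>\<^sup>+\<xi>. ennreal ((k \<xi> * norm (g \<xi>))\<^sup>2) \<partial>lebesgue)"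
        by (rule nn_integral_cmult) (use k(1) gl in measurable)
      also have "\<dots> \<le> ennreal ((norm ?c)\<^sup>2) * ennreal (M\<^sup>2)" by (intro mult_left_mono gM) simp
      finally show "(\<integral>\<^sup>+\<xi>. ennreal ((k \<xi> * norm (?c * g \<xi>))\<^sup>2) \<partial>lebesgue) \<le> ennreal ((norm ?c * M)\<^sup>2)"
        by (simp add: ennreal_mult[symmetric] power_mult_distrib)
    qed (simp add: h_def)
    fix \<theta> :: "'a \<Rightarrow> complex" assume \<theta>: "\<theta> \<in> test_functions"
    note [measurable] = g(1) smooth_borel[OF test_smooth[OF \<theta>]] borel_fourier[OF test_integrable[OF \<theta>]] borel_fourier[OF gi]
    have "(\<integral>\<xi>. g \<xi> * fourier \<theta> (- \<xi>) \<partial>lborel) = (\<integral>\<xi>. g \<xi> * fourier (\<lambda>x. \<theta> (- x)) \<xi> \<partial>lborel)"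
      by (simp add: fourier_reflect)
    also have "\<dots> = (\<integral>x. fourier g x * \<theta> (- x) \<partial>lborel)"
      by (rule fourier_multiplication_formula[symmetric, OF gi])
        (use lborel_reflection_invariance(2)[of \<theta>] test_integrable[OF \<theta>] in simp)
    also have "\<dots> = (\<integral>x. fourier g (- x) * \<theta> x \<partial>lborel)"
      using lborel_reflection_invariance(1)[of "\<lambda>x. fourier g (- x) * \<theta> x"] by simp
    finally show "u (\<lambda>x. \<psi> x * \<theta> x) = (\<integral>x. h x * \<theta> x \<partial>lborel)"
      using fourier_cmult[OF gi] by (simp add: key[OF \<theta>] h_def mult.assoc)
  qed
qed

lemma integrable_locally_integrable:
  fixes G :: "'a::euclidean_space \<Rightarrow> complex"
  assumes "integrable lborel G" shows "locally_integrable G"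
proof -
  have "integrable lebesgue G"
    using assms by (subst integrable_completion) (auto dest: borel_measurable_integrable)
  then show ?thesis
    unfolding locally_integrable_def set_integrable_def
    by (auto intro!: integrable_mult_indicator dest!: compact_imp_closed)
qed

text \<open>By the inversion formula the Fourier transform of \<open>u \<psi>\<close> is the density divided by the inversion
  factor.\<close>

lemma Bk_norm_le_of_fourier_ball:
  fixes k :: "'a::euclidean_space \<Rightarrow> real"
  assumes k: "k \<in> borel_measurable lebesgue" "\<And>\<xi>. 0 < k \<xi>"
    and f: "represents f u" "continuous_on UNIV f" and \<psi>: "\<psi> \<in> test_functions"
    and fourier_ball: "fourier_ball k M (\<lambda>x. \<psi> x * f x)"
  shows "Bk_norm k (distr_mult u \<psi>) \<le> ennreal (M / norm (inversion_factor TYPE('a)))"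
proof -
  let ?c = "inversion_factor TYPE('a)"
  have c: "0 < norm ?c" using inversion_factor_nonzero[where 'a='a] by simp
  from fourier_ball obtain G where M: "0 < M" and G: "integrable lborel G"
     "(\<integral>\<^sup>+\<xi>. ennreal ((k \<xi> * norm (G \<xi>))\<^sup>2) \<partial>lebesgue) \<le> ennreal (M\<^sup>2)" "\<And>x. \<psi> x * f x = fourier G (- x)"
    by (auto simp: fourier_ball_def)
  note [measurable] = integrable_borel[OF G(1)] borel_fourier[OF G(1)]
  define v where "v = distr_mult u \<psi>"
  have rep: "represents (\<lambda>\<xi>. G \<xi> / ?c) (distr_fourier v)"
    unfolding represents_def
  proof (intro conjI ballI)
    show "locally_integrable (\<lambda>\<xi>. G \<xi> / ?c)" using G(1) by (intro integrable_locally_integrable) simp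
    fix \<phi> :: "'a \<Rightarrow> complex" assume \<phi>: "\<phi> \<in> test_functions"
    note [measurable] = smooth_borel[OF test_smooth[OF \<phi>]] borel_fourier[OF test_integrable[OF \<phi>]]
      smooth_borel[OF test_smooth[OF \<psi>]] borel_measurable_continuous_onI[OF f(2)]
    have t: "(\<lambda>x. \<psi> x * fourier \<phi> x) \<in> test_functions"
      by (rule test_mult_left[OF \<psi> smooth_fourier[OF finite_moments_test[OF \<phi>]]])
    have "distr_fourier v \<phi> = (\<integral>x. f x * (\<psi> x * fourier \<phi> x) \<partial>lebesgue)"
      using f(1) t by (simp add: represents_def distr_fourier_def v_def distr_mult_def distr_of_def)
    also have "\<dots> = (\<integral>x. f x * (\<psi> x * fourier \<phi> x) \<partial>lborel)" by (rule integral_completion) simp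
    also have "\<dots> = (\<integral>x. fourier G (- x) * fourier \<phi> x \<partial>lborel)"
      by (intro Bochner_Integration.integral_cong) (auto simp: G(3)[symmetric])
    also have "\<dots> = (\<integral>x. fourier G x * fourier \<phi> (- x) \<partial>lborel)"
      using lborel_reflection_invariance(1)[of "\<lambda>x. fourier G x * fourier \<phi> (- x)"] by simp
    also have "\<dots> = (\<integral>\<xi>. G \<xi> * fourier (\<lambda>x. fourier \<phi> (- x)) \<xi> \<partial>lborel)"
      by (rule fourier_multiplication_formula[OF G(1)])
        (use lborel_reflection_invariance(2)[of "fourier \<phi>"] finite_moments_integrable[OF finite_moments_fourier_test[OF \<phi>]] in simp)
    also have "\<dots> = (\<integral>\<xi>. G \<xi> / ?c * \<phi> \<xi> \<partial>lborel)"
    proof (intro Bochner_Integration.integral_cong refl)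
      fix \<xi> :: 'a
      have "\<phi> \<xi> = ?c * fourier (\<lambda>x. fourier \<phi> (- x)) \<xi>"
        using inversion_factor[OF \<phi>, of \<xi>] fourier_reflect[of "fourier \<phi>" \<xi>] by simp
      then show "G \<xi> * fourier (\<lambda>x. fourier \<phi> (- x)) \<xi> = G \<xi> / ?c * \<phi> \<xi>" using c by simp
    qed
    also have "\<dots> = distr_of (\<lambda>\<xi>. G \<xi> / ?c) \<phi>"
      unfolding distr_of_def by (rule integral_completion[symmetric]) simp
    finally show "distr_fourier v \<phi> = distr_of (\<lambda>\<xi>. G \<xi> / ?c) \<phi>" .
  qed
  define g0 where "g0 = function_of (distr_fourier v)"
  have g0: "represents g0 (distr_fourier v)"
    unfolding g0_def function_of_def by (rule someI[of "\<lambda>f. represents f (distr_fourier v)", OF rep])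
  have ae: "AE \<xi> in lebesgue. g0 \<xi> = G \<xi> / ?c" by (rule represents_unique_AE[OF g0 rep])
  have g0m[measurable]: "g0 \<in> borel_measurable lebesgue"
    using g0 locally_integrable_measurable by (auto simp: represents_def)
  note k(1)[measurable]
  have Gl[measurable]: "G \<in> borel_measurable lebesgue" by (simp add: measurable_completion)
  have "(\<integral>\<^sup>+\<xi>. ennreal ((norm (k \<xi> *\<^sub>R g0 \<xi>))\<^sup>2) \<partial>lebesgue) =
     (\<integral>\<^sup>+\<xi>. ennreal ((1 / norm ?c)\<^sup>2) * ennreal ((k \<xi> * norm (G \<xi>))\<^sup>2) \<partial>lebesgue)"
    by (rule nn_integral_cong_AE, use ae in eventually_elim)
      (use k(2) in \<open>auto simp: ennreal_mult[symmetric] norm_divide less_imp_le power_mult_distrib power_divide\<close>)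
  also have "\<dots> = ennreal ((1 / norm ?c)\<^sup>2) * (\<integral>\<^sup>+\<xi>. ennreal ((k \<xi> * norm (G \<xi>))\<^sup>2) \<partial>lebesgue)"
    by (rule nn_integral_cmult) measurable
  also have "\<dots> \<le> ennreal ((1 / norm ?c)\<^sup>2) * ennreal (M\<^sup>2)" by (intro mult_left_mono G(2)) simp
  also have "\<dots> = ennreal ((M / norm ?c)\<^sup>2)"
    by (simp add: ennreal_mult[symmetric] power_divide)
  finally have le: "(\<integral>\<^sup>+\<xi>. ennreal ((norm (k \<xi> *\<^sub>R g0 \<xi>))\<^sup>2) \<partial>lebesgue) \<le> ennreal ((M / norm ?c)\<^sup>2)" .
  have int: "integrable lebesgue (\<lambda>\<xi>. (norm (k \<xi> *\<^sub>R g0 \<xi>))\<^sup>2)"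
  proof (rule integrableI_nonneg)
    show "(\<integral>\<^sup>+\<xi>. ennreal ((norm (k \<xi> *\<^sub>R g0 \<xi>))\<^sup>2) \<partial>lebesgue) < \<infinity>"
      using le by (rule order.strict_trans1) simp
  qed auto
  have "square_integrable (\<lambda>\<xi>. k \<xi> *\<^sub>R g0 \<xi>)" unfolding square_integrable_def using int by simp
  moreover have "v \<in> tempered_distributions" unfolding v_def by (rule tempered_represented[OF f(1) \<psi>])
  ultimately have "v \<in> Bk k" using rep unfolding Bk_def g0_def by blast
  moreover have "L2_norm (\<lambda>\<xi>. k \<xi> *\<^sub>R g0 \<xi>) \<le> M / norm ?c"
    unfolding L2_norm_def
  proof (rule real_le_lsqrt)
    show "(\<integral>\<xi>. (norm (k \<xi> *\<^sub>R g0 \<xi>))\<^sup>2 \<partial>lebesgue) \<le> (M / norm ?c)\<^sup>2"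
      using le nn_integral_eq_integral[OF int] by (simp add: ennreal_le_iff)
    show "0 \<le> M / norm ?c" using M by simp
  qed
  ultimately show ?thesis by (simp add: Bk_norm_def v_def[symmetric] g0_def[symmetric] ennreal_leI)
qed

text \<open>The product \<open>\<psi> f\<close> and the Fourier integral of \<open>localised_distribution\<close> are continuous and
  represent the same distribution, hence agree.\<close>

lemma fourier_ball_of_Bk_norm_le:
  fixes k :: "'a::euclidean_space \<Rightarrow> real"
  assumes k: "k \<in> borel_measurable lebesgue" "\<And>\<xi>. 0 < k \<xi>" "square_integrable (\<lambda>\<xi>. 1 / k \<xi>)"
    and f: "represents f u" "continuous_on UNIV f" and \<psi>: "\<psi> \<in> test_functions"
    and M: "0 < M" "Bk_norm k (distr_mult u \<psi>) \<le> ennreal M"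
  shows "fourier_ball k (norm (inversion_factor TYPE('a)) * M) (\<lambda>x. \<psi> x * f x)"
proof -
  obtain h where h: "fourier_ball k (norm (inversion_factor TYPE('a)) * M) h"
    "\<And>\<theta>. \<theta> \<in> test_functions \<Longrightarrow> u (\<lambda>x. \<psi> x * \<theta> x) = (\<integral>x. h x * \<theta> x \<partial>lborel)"
    by (rule localised_distribution[OF k distributions_represented[OF f(1)] \<psi> M]) blast
  have ch: "continuous_on UNIV h" by (rule fourier_ball_continuous[OF h(1)])
  have cf: "continuous_on UNIV (\<lambda>x. \<psi> x * f x)"
    by (intro continuous_on_mult f smooth_continuous_on test_smooth \<psi>)
  have "represents (\<lambda>x. \<psi> x * f x) (distr_of h)"
    unfolding represents_def
  proof (intro conjI ballI)
    show "locally_integrable (\<lambda>x. \<psi> x * f x)" by (rule continuous_locally_integrable[OF cf])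
    fix \<theta> :: "'a \<Rightarrow> complex" assume \<theta>: "\<theta> \<in> test_functions"
    have [measurable]: "h \<in> borel_measurable borel" "\<theta> \<in> borel_measurable borel"
      using ch \<theta> by (auto intro: borel_measurable_continuous_onI smooth_borel test_smooth)
    have "distr_of h \<theta> = (\<integral>x. h x * \<theta> x \<partial>lborel)" unfolding distr_of_def by (rule integral_completion) simp
    also have "\<dots> = u (\<lambda>x. \<psi> x * \<theta> x)" using h(2)[OF \<theta>] by simp
    also have "\<dots> = (\<integral>x. f x * (\<psi> x * \<theta> x) \<partial>lebesgue)"
      using f(1) test_mult_left[OF \<psi> test_smooth[OF \<theta>]] by (simp add: represents_def distr_of_def)
    also have "\<dots> = distr_of (\<lambda>x. \<psi> x * f x) \<theta>" unfolding distr_of_def by (simp add: mult_ac)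
    finally show "distr_of h \<theta> = distr_of (\<lambda>x. \<psi> x * f x) \<theta>" .
  qed
  then have "(\<lambda>x. \<psi> x * f x) = h"
    by (rule represents_unique_continuous[OF _ represents_distr_of[OF continuous_locally_integrable[OF ch]] cf ch])
  then show ?thesis using h(1) by simp
qed

text \<open>The local pieces satisfy \<open>translate y' \<psi> * h y = translate y \<psi> * h y'\<close>, since both sides represent
  the distribution cut off by both windows. Hence the quotients \<open>h y / translate y \<psi>\<close> fit together
  to one function. It represents \<open>u\<close> because test functions are combinations of the windows.\<close>

lemma Bk_inf_represented:
  fixes k :: "'a::euclidean_space \<Rightarrow> real"
  assumes k: "k \<in> borel_measurable lebesgue" "\<And>\<xi>. 0 < k \<xi>" "square_integrable (\<lambda>\<xi>. 1 / k \<xi>)"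
    and u: "u \<in> Bk_inf k"
  obtains f where "continuous_on UNIV f" "bounded (range f)" "represents f u"
proof -
  let ?c = "norm (inversion_factor TYPE('a))"
  have ud: "u \<in> distributions" using u by (simp add: Bk_inf_def)
  from u obtain \<psi> where \<psi>: "\<psi> \<in> test_functions" "\<psi> \<noteq> (\<lambda>x. 0)" "Bk_inf_norm k \<psi> u < \<infinity>"
    by (auto simp: Bk_inf_def)
  then obtain z where z: "\<psi> z \<noteq> 0" by auto
  obtain M where M: "0 < M" "Bk_inf_norm k \<psi> u \<le> ennreal M"
  proof -
    obtain M where "Bk_inf_norm k \<psi> u = ennreal M" "0 \<le> M" using \<psi>(3) by (cases "Bk_inf_norm k \<psi> u") auto
    then show ?thesis by (intro that[of "M + 1"]) (auto simp: ennreal_leI)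
  qed
  have My: "Bk_norm k (distr_mult u (translate y \<psi>)) \<le> ennreal M" for y
    using M(2) unfolding Bk_inf_norm_def by (meson SUP_upper UNIV_I order_trans)
  have "\<exists>h. fourier_ball k (?c * M) h \<and> (\<forall>\<theta>\<in>test_functions. u (\<lambda>x. translate y \<psi> x * \<theta> x) = (\<integral>x. h x * \<theta> x \<partial>lborel))" for y
    using localised_distribution[OF k ud test_translate[OF \<psi>(1)] M(1) My[of y]] by metis
  then obtain h where h: "\<And>y. fourier_ball k (?c * M) (h y)"
    "\<And>y \<theta>. \<theta> \<in> test_functions \<Longrightarrow> u (\<lambda>x. translate y \<psi> x * \<theta> x) = (\<integral>x. h y x * \<theta> x \<partial>lborel)" by metis
  have ch: "continuous_on UNIV (h y)" for y by (rule fourier_ball_continuous[OF h(1)])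
  have c\<psi>: "continuous_on S (translate y \<psi>)" for y S
    by (intro smooth_continuous_on test_smooth test_translate \<psi>)
  have rep: "represents (\<lambda>x. translate y' \<psi> x * h y x) (\<lambda>\<theta>. u (\<lambda>x. translate y \<psi> x * (translate y' \<psi> x * \<theta> x)))" for y y'
    unfolding represents_def
  proof (intro conjI ballI)
    have c: "continuous_on UNIV (\<lambda>x. translate y' \<psi> x * h y x)" by (intro continuous_on_mult c\<psi> ch)
    then show "locally_integrable (\<lambda>x. translate y' \<psi> x * h y x)" by (rule continuous_locally_integrable)
    fix \<theta> :: "'a \<Rightarrow> complex" assume \<theta>: "\<theta> \<in> test_functions"
    note [measurable] = borel_measurable_continuous_onI[OF c] smooth_borel[OF test_smooth[OF \<theta>]]
    have "u (\<lambda>x. translate y \<psi> x * (translate y' \<psi> x * \<theta> x)) = (\<integral>x. h y x * (translate y' \<psi> x * \<theta> x) \<partial>lborel)"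
      by (rule h(2)) (intro test_mult_right \<theta> test_smooth test_translate \<psi>)
    also have "\<dots> = (\<integral>x. (translate y' \<psi> x * h y x) * \<theta> x \<partial>lborel)" by (simp add: mult_ac)
    also have "\<dots> = distr_of (\<lambda>x. translate y' \<psi> x * h y x) \<theta>"
      unfolding distr_of_def by (rule integral_completion[symmetric]) simp
    finally show "u (\<lambda>x. translate y \<psi> x * (translate y' \<psi> x * \<theta> x)) = distr_of (\<lambda>x. translate y' \<psi> x * h y x) \<theta>" .
  qed
  have glue: "translate y' \<psi> x * h y x = translate y \<psi> x * h y' x" for y y' x
  proof -
    have "(\<lambda>\<theta>. u (\<lambda>x. translate y' \<psi> x * (translate y \<psi> x * \<theta> x))) = (\<lambda>\<theta>. u (\<lambda>x. translate y \<psi> x * (translate y' \<psi> x * \<theta> x)))"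
      by (simp add: mult.left_commute)
    then have "(\<lambda>x. translate y' \<psi> x * h y x) = (\<lambda>x. translate y \<psi> x * h y' x)"
      using rep[of y' y] rep[of y y'] by (intro represents_unique_continuous[where u="\<lambda>\<theta>. u (\<lambda>x. translate y \<psi> x * (translate y' \<psi> x * \<theta> x))"] continuous_on_mult c\<psi> ch) auto
    then show ?thesis by (rule fun_cong)
  qed
  \<comment> \<open>the window at \<open>x - z\<close> takes the value \<open>\<psi> z\<close> at \<open>x\<close>\<close>
  define f where "f = (\<lambda>x. h (x - z) x / \<psi> z)"
  have hf: "h y x = translate y \<psi> x * f x" for y x
    using glue[of "x - z" x y] z by (simp add: f_def translate_def field_simps)
  have cont: "isCont f x0" for x0
  proof -
    let ?U = "{x. translate (x0 - z) \<psi> x \<noteq> 0}"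
    have op: "open ?U" using open_Collect_neq[OF c\<psi>[of UNIV], of "\<lambda>_. 0"] by simp
    have "continuous_on ?U (\<lambda>x. h (x0 - z) x / translate (x0 - z) \<psi> x)"
      by (intro continuous_on_divide c\<psi> continuous_on_subset[OF ch]) auto
    then have "continuous_on ?U f" by (rule continuous_on_eq) (simp add: hf)
    moreover have "x0 \<in> ?U" using z by (simp add: translate_def)
    ultimately show ?thesis using op by (simp add: continuous_on_eq_continuous_at)
  qed
  show ?thesis
  proof (rule that)
    show cf: "continuous_on UNIV f" using cont by (simp add: continuous_at_imp_continuous_on)
    let ?B = "(1 + (L2_norm (\<lambda>\<xi>. 1 / k \<xi>))\<^sup>2) * (?c * M) / norm (\<psi> z)"
    have "norm (f x) \<le> ?B" for x
      unfolding f_def norm_divide by (intro divide_right_mono fourier_ball_bounded[OF k h(1)]) simp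
    then show "bounded (range f)" by (auto simp: bounded_iff)
    show "represents f u"
      unfolding represents_def
    proof (intro conjI ballI)
      show lf: "locally_integrable f" by (rule continuous_locally_integrable[OF cf])
      fix \<phi> :: "'a \<Rightarrow> complex" assume \<phi>: "\<phi> \<in> test_functions"
      obtain Y \<theta> where Y: "finite Y" "\<And>y. y \<in> Y \<Longrightarrow> \<theta> y \<in> test_functions"
        "\<And>x. \<phi> x = (\<Sum>y\<in>Y. \<theta> y x * translate y \<psi> x)"
        using test_function_partition[OF \<psi>(1) z \<phi>] by metis
      have t: "(\<lambda>x. translate y \<psi> x * \<theta> y x) \<in> test_functions" if "y \<in> Y" for y
        by (intro test_mult_right Y that test_smooth test_translate \<psi>)
      have "\<phi> = (\<lambda>x. \<Sum>y\<in>Y. translate y \<psi> x * \<theta> y x)"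
        using Y(3) by (intro ext) (simp add: mult.commute)
      then have "u \<phi> = u (\<lambda>x. \<Sum>y\<in>Y. translate y \<psi> x * \<theta> y x)" by (rule arg_cong)
      also have "\<dots> = (\<Sum>y\<in>Y. u (\<lambda>x. translate y \<psi> x * \<theta> y x))" by (rule distribution_sum[OF ud t])
      also have "\<dots> = (\<Sum>y\<in>Y. \<integral>x. f x * (translate y \<psi> x * \<theta> y x) \<partial>lebesgue)"
      proof (rule sum.cong[OF refl])
        fix y assume y: "y \<in> Y"
        note [measurable] = borel_measurable_continuous_onI[OF cf] smooth_borel[OF test_smooth[OF t[OF y]]]
        have "u (\<lambda>x. translate y \<psi> x * \<theta> y x) = (\<integral>x. h y x * \<theta> y x \<partial>lborel)" by (rule h(2)[OF Y(2)[OF y]])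
        also have "\<dots> = (\<integral>x. f x * (translate y \<psi> x * \<theta> y x) \<partial>lborel)" by (simp add: hf mult_ac)
        also have "\<dots> = (\<integral>x. f x * (translate y \<psi> x * \<theta> y x) \<partial>lebesgue)"
          by (rule integral_completion[symmetric]) simp
        finally show "u (\<lambda>x. translate y \<psi> x * \<theta> y x) = (\<integral>x. f x * (translate y \<psi> x * \<theta> y x) \<partial>lebesgue)" .
      qed
      also have "\<dots> = (\<integral>x. (\<Sum>y\<in>Y. f x * (translate y \<psi> x * \<theta> y x)) \<partial>lebesgue)"
        by (rule Bochner_Integration.integral_sum[symmetric]) (rule locally_integrable_mult_test[OF lf t])
      also have "\<dots> = distr_of f \<phi>"
        by (simp add: distr_of_def Y(3) sum_distrib_left mult_ac)
      finally show "u \<phi> = distr_of f \<phi>" .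
    qed
  qed
qed

section \<open>The algebra of Fourier integrals with weighted density\<close>

lemma fourier_ball_pos: "fourier_ball w M h \<Longrightarrow> 0 < M"
  by (simp add: fourier_ball_def)

lemma fourier_ball_mono: "fourier_ball w M h \<Longrightarrow> M \<le> M' \<Longrightarrow> fourier_ball w M' h"
  unfolding fourier_ball_def by (meson ennreal_leI less_le_trans order_trans power_mono less_imp_le)

lemma fourier_ball_cong: "fourier_ball w M h \<Longrightarrow> (\<And>x. h x = h' x) \<Longrightarrow> fourier_ball w M h'"
  by (simp add: fourier_ball_def)

lemma nn_integral_Cauchy_Schwarz_bound:
  fixes a b :: "'a \<Rightarrow> real"
  assumes [measurable]: "a \<in> borel_measurable N" "b \<in> borel_measurable N"
    and nn: "\<And>x. 0 \<le> a x" "\<And>x. 0 \<le> b x" and \<beta>: "0 < \<beta>" "(\<integral>\<^sup>+x. ennreal ((b x)\<^sup>2) \<partial>N) \<le> ennreal (\<beta>\<^sup>2)"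
  shows "(\<integral>\<^sup>+x. ennreal (a x * b x) \<partial>N)\<^sup>2 \<le> ennreal (\<beta>\<^sup>2) * (\<integral>\<^sup>+x. ennreal ((a x)\<^sup>2) \<partial>N)"
proof (cases "(\<integral>\<^sup>+x. ennreal ((a x)\<^sup>2) \<partial>N)")
  case top
  then show ?thesis using \<beta>(1) by (simp add: ennreal_mult_top)
next
  case (real A)
  show ?thesis
  proof (cases "A = 0")
    case True
    then have "AE x in N. a x = 0"
      using real nn_integral_0_iff_AE[of "\<lambda>x. ennreal ((a x)\<^sup>2)" N] by simp
    then have "(\<integral>\<^sup>+x. ennreal (a x * b x) \<partial>N) = 0"
      by (subst nn_integral_0_iff_AE) auto
    then show ?thesis by simp
  next
    case False
    define \<alpha> where "\<alpha> = sqrt A"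
    have \<alpha>: "0 < \<alpha>" "A = \<alpha>\<^sup>2" using False real(1) by (auto simp: \<alpha>_def)
    have le: "a x * b x \<le> (\<beta> / (2 * \<alpha>)) * (a x)\<^sup>2 + (\<alpha> / (2 * \<beta>)) * (b x)\<^sup>2" for x
    proof -
      have "0 \<le> (\<beta> * a x - \<alpha> * b x)\<^sup>2" by simp
      then have "2 * (\<alpha> * \<beta>) * (a x * b x) \<le> \<beta>\<^sup>2 * (a x)\<^sup>2 + \<alpha>\<^sup>2 * (b x)\<^sup>2"
        by (simp add: power2_diff power_mult_distrib algebra_simps)
      then have "a x * b x \<le> (\<beta>\<^sup>2 * (a x)\<^sup>2 + \<alpha>\<^sup>2 * (b x)\<^sup>2) / (2 * (\<alpha> * \<beta>))"
        using \<alpha>(1) \<beta>(1) by (simp add: pos_le_divide_eq mult.commute)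
      also have "\<dots> = (\<beta> / (2 * \<alpha>)) * (a x)\<^sup>2 + (\<alpha> / (2 * \<beta>)) * (b x)\<^sup>2"
        using \<alpha>(1) \<beta>(1) by (simp add: field_simps power2_eq_square)
      finally show ?thesis .
    qed
    have "(\<integral>\<^sup>+x. ennreal (a x * b x) \<partial>N) \<le>
       (\<integral>\<^sup>+x. ennreal (\<beta> / (2 * \<alpha>)) * ennreal ((a x)\<^sup>2) + ennreal (\<alpha> / (2 * \<beta>)) * ennreal ((b x)\<^sup>2) \<partial>N)"
    proof (rule nn_integral_mono)
      fix x
      have "ennreal (a x * b x) \<le> ennreal ((\<beta> / (2 * \<alpha>)) * (a x)\<^sup>2 + (\<alpha> / (2 * \<beta>)) * (b x)\<^sup>2)"
        by (rule ennreal_leI[OF le])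
      also have "\<dots> = ennreal (\<beta> / (2 * \<alpha>)) * ennreal ((a x)\<^sup>2) + ennreal (\<alpha> / (2 * \<beta>)) * ennreal ((b x)\<^sup>2)"
        using \<alpha>(1) \<beta>(1) by (simp add: ennreal_mult[symmetric] ennreal_plus[symmetric] del: ennreal_plus)
      finally show "ennreal (a x * b x) \<le> ennreal (\<beta> / (2 * \<alpha>)) * ennreal ((a x)\<^sup>2) + ennreal (\<alpha> / (2 * \<beta>)) * ennreal ((b x)\<^sup>2)" .
    qed
    also have "\<dots> = ennreal (\<beta> / (2 * \<alpha>)) * (\<integral>\<^sup>+x. ennreal ((a x)\<^sup>2) \<partial>N) + ennreal (\<alpha> / (2 * \<beta>)) * (\<integral>\<^sup>+x. ennreal ((b x)\<^sup>2) \<partial>N)"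
      by (simp add: nn_integral_add nn_integral_cmult)
    also have "\<dots> \<le> ennreal (\<beta> / (2 * \<alpha>)) * ennreal (\<alpha>\<^sup>2) + ennreal (\<alpha> / (2 * \<beta>)) * ennreal (\<beta>\<^sup>2)"
      using real(2) \<alpha>(2) by (intro add_mono mult_left_mono \<beta>) auto
    also have "\<dots> = ennreal (\<alpha> * \<beta>)"
    proof -
      have "\<beta> / (2 * \<alpha>) * \<alpha>\<^sup>2 + \<alpha> / (2 * \<beta>) * \<beta>\<^sup>2 = \<alpha> * \<beta>"
        using \<alpha>(1) \<beta>(1) by (simp add: field_simps power2_eq_square)
      then show ?thesis
        using \<alpha>(1) \<beta>(1) by (simp add: ennreal_mult[symmetric] ennreal_plus[symmetric] del: ennreal_plus)
    qed
    finally have "(\<integral>\<^sup>+x. ennreal (a x * b x) \<partial>N)\<^sup>2 \<le> (ennreal (\<alpha> * \<beta>))\<^sup>2" by (rule power_mono) simp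
    also have "\<dots> = ennreal (\<beta>\<^sup>2) * ennreal A"
      using \<alpha>(1) \<beta>(1) by (simp add: \<alpha>(2) ennreal_power ennreal_mult[symmetric] power_mult_distrib mult.commute)
    finally show ?thesis using real(2) by simp
  qed
qed

text \<open>Minkowski's inequality for balls; convexity of the square with weights adapted to the two radii
  gives the sharp sum of radii.\<close>

lemma weighted_L2_add:
  fixes w g1 g2 :: "'a::euclidean_space \<Rightarrow> real"
  assumes m: "w \<in> borel_measurable lebesgue" "g1 \<in> borel_measurable borel" "g2 \<in> borel_measurable borel"
    and M: "0 < M1" "0 < M2" and le1: "(\<integral>\<^sup>+\<xi>. ennreal ((w \<xi> * g1 \<xi>)\<^sup>2) \<partial>lebesgue) \<le> ennreal (M1\<^sup>2)"
    and le2: "(\<integral>\<^sup>+\<xi>. ennreal ((w \<xi> * g2 \<xi>)\<^sup>2) \<partial>lebesgue) \<le> ennreal (M2\<^sup>2)"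
  shows "(\<integral>\<^sup>+\<xi>. ennreal ((w \<xi> * (g1 \<xi> + g2 \<xi>))\<^sup>2) \<partial>lebesgue) \<le> ennreal ((M1 + M2)\<^sup>2)"
proof -
  have [measurable]: "w \<in> borel_measurable lebesgue" "g1 \<in> borel_measurable lebesgue" "g2 \<in> borel_measurable lebesgue"
    using m by (auto intro: measurable_completion)
  have convex: "(a + b)\<^sup>2 \<le> (M1 + M2) / M1 * a\<^sup>2 + (M1 + M2) / M2 * b\<^sup>2" for a b :: real
  proof -
    have "0 \<le> (M2 * a - M1 * b)\<^sup>2 / (M1 * M2)" using M by simp
    also have "\<dots> = (M1 + M2) / M1 * a\<^sup>2 + (M1 + M2) / M2 * b\<^sup>2 - (a + b)\<^sup>2"
      using M by (simp add: field_simps power2_eq_square)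
    finally show ?thesis by simp
  qed
  have "(\<integral>\<^sup>+\<xi>. ennreal ((w \<xi> * (g1 \<xi> + g2 \<xi>))\<^sup>2) \<partial>lebesgue) \<le>
     (\<integral>\<^sup>+\<xi>. ennreal ((M1 + M2) / M1) * ennreal ((w \<xi> * g1 \<xi>)\<^sup>2) + ennreal ((M1 + M2) / M2) * ennreal ((w \<xi> * g2 \<xi>)\<^sup>2) \<partial>lebesgue)"
  proof (rule nn_integral_mono)
    fix \<xi> :: 'a
    show "ennreal ((w \<xi> * (g1 \<xi> + g2 \<xi>))\<^sup>2) \<le> ennreal ((M1 + M2) / M1) * ennreal ((w \<xi> * g1 \<xi>)\<^sup>2) + ennreal ((M1 + M2) / M2) * ennreal ((w \<xi> * g2 \<xi>)\<^sup>2)"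
      using M convex[of "w \<xi> * g1 \<xi>" "w \<xi> * g2 \<xi>"]
      by (simp add: ennreal_mult[symmetric] ennreal_plus[symmetric] distrib_left ennreal_leI del: ennreal_plus)
  qed
  also have "\<dots> = ennreal ((M1 + M2) / M1) * (\<integral>\<^sup>+\<xi>. ennreal ((w \<xi> * g1 \<xi>)\<^sup>2) \<partial>lebesgue)
      + ennreal ((M1 + M2) / M2) * (\<integral>\<^sup>+\<xi>. ennreal ((w \<xi> * g2 \<xi>)\<^sup>2) \<partial>lebesgue)"
    by (simp add: nn_integral_add nn_integral_cmult)
  also have "\<dots> \<le> ennreal ((M1 + M2) / M1) * ennreal (M1\<^sup>2) + ennreal ((M1 + M2) / M2) * ennreal (M2\<^sup>2)"
    by (intro add_mono mult_left_mono le1 le2) auto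
  also have "\<dots> = ennreal ((M1 + M2)\<^sup>2)"
  proof -
    have "(M1 + M2) / M1 * M1\<^sup>2 + (M1 + M2) / M2 * M2\<^sup>2 = (M1 + M2)\<^sup>2"
      using M by (simp add: field_simps power2_eq_square)
    then show ?thesis
      using M by (simp add: ennreal_mult[symmetric] ennreal_plus[symmetric] del: ennreal_plus)
  qed
  finally show ?thesis .
qed

lemma fourier_ball_cmult:
  assumes "w \<in> borel_measurable lebesgue" "fourier_ball w M h" "norm c * M \<le> M'" "0 < M'"
  shows "fourier_ball w M' (\<lambda>x. c * h x)"
proof -
  from assms(2) obtain G where G: "integrable lborel G"
     "(\<integral>\<^sup>+\<xi>. ennreal ((w \<xi> * norm (G \<xi>))\<^sup>2) \<partial>lebesgue) \<le> ennreal (M\<^sup>2)" "\<And>x. h x = fourier G (- x)" and M: "0 < M"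
    by (auto simp: fourier_ball_def)
  have [measurable]: "w \<in> borel_measurable lebesgue" "G \<in> borel_measurable lebesgue"
    using assms(1) integrable_borel[OF G(1)] by (auto intro: measurable_completion)
  show ?thesis
    unfolding fourier_ball_def
  proof (intro conjI exI[of _ "\<lambda>\<xi>. c * G \<xi>"] allI)
    have "(\<integral>\<^sup>+\<xi>. ennreal ((w \<xi> * norm (c * G \<xi>))\<^sup>2) \<partial>lebesgue) =
        (\<integral>\<^sup>+\<xi>. ennreal ((norm c)\<^sup>2) * ennreal ((w \<xi> * norm (G \<xi>))\<^sup>2) \<partial>lebesgue)"
      by (intro nn_integral_cong) (simp add: ennreal_mult[symmetric] norm_mult power_mult_distrib mult_ac)
    also have "\<dots> = ennreal ((norm c)\<^sup>2) * (\<integral>\<^sup>+\<xi>. ennreal ((w \<xi> * norm (G \<xi>))\<^sup>2) \<partial>lebesgue)"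
      by (rule nn_integral_cmult) measurable
    also have "\<dots> \<le> ennreal ((norm c)\<^sup>2) * ennreal (M\<^sup>2)" by (intro mult_left_mono G) simp
    also have "\<dots> = ennreal ((norm c * M)\<^sup>2)" by (simp add: ennreal_mult[symmetric] power_mult_distrib)
    also have "\<dots> \<le> ennreal (M'\<^sup>2)" using M assms(3) by (intro ennreal_leI power_mono) auto
    finally show "(\<integral>\<^sup>+\<xi>. ennreal ((w \<xi> * norm (c * G \<xi>))\<^sup>2) \<partial>lebesgue) \<le> ennreal (M'\<^sup>2)" .
    show "c * h x = fourier (\<lambda>\<xi>. c * G \<xi>) (- x)" for x using fourier_cmult[OF G(1)] G(3) by simp
  qed (use G(1) assms(4) in auto)
qed

lemma fourier_ball_translate:
  assumes "fourier_ball w M h" shows "fourier_ball w M (\<lambda>x. h (x - y))"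
proof -
  from assms obtain G where G: "integrable lborel G"
     "(\<integral>\<^sup>+\<xi>. ennreal ((w \<xi> * norm (G \<xi>))\<^sup>2) \<partial>lebesgue) \<le> ennreal (M\<^sup>2)" "\<And>x. h x = fourier G (- x)" and M: "0 < M"
    by (auto simp: fourier_ball_def)
  note [measurable] = integrable_borel[OF G(1)]
  have "h (x - y) = fourier (\<lambda>\<xi>. fourier_kernel \<xi> y * G \<xi>) (- x)" for x
  proof -
    have "h (x - y) = (\<integral>\<xi>. fourier_kernel \<xi> (y - x) * G \<xi> \<partial>lborel)" by (simp add: G(3) fourier_lborel)
    also have "\<dots> = (\<integral>\<xi>. fourier_kernel \<xi> (- x) * (fourier_kernel \<xi> y * G \<xi>) \<partial>lborel)"
    proof -
      have "fourier_kernel \<xi> (y - x) = fourier_kernel \<xi> (- x) * fourier_kernel \<xi> y" for \<xi> :: 'a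
        by (simp add: exp_add[symmetric] inner_diff_right algebra_simps)
      then show ?thesis by (simp only: mult.assoc)
    qed
    finally show ?thesis by (simp add: fourier_lborel)
  qed
  moreover have "(\<integral>\<^sup>+\<xi>. ennreal ((w \<xi> * norm (fourier_kernel \<xi> y * G \<xi>))\<^sup>2) \<partial>lebesgue) \<le> ennreal (M\<^sup>2)"
    using G(2) by (simp add: norm_mult)
  ultimately show ?thesis
    unfolding fourier_ball_def using M integrable_fker[OF G(1), of y] by blast
qed

lemma fourier_ball_zero: "0 < M \<Longrightarrow> fourier_ball w M (\<lambda>x. 0)"
  unfolding fourier_ball_def by (auto intro!: exI[of _ "\<lambda>_. 0"] simp: fourier_def)

lemma fourier_ball_add:
  assumes w: "w \<in> borel_measurable lebesgue" "\<And>\<xi>. 0 < w \<xi>" and F: "fourier_ball w M1 h1" "fourier_ball w M2 h2"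
  shows "fourier_ball w (M1 + M2) (\<lambda>x. h1 x + h2 x)"
proof -
  from F(1) obtain G1 where G1: "integrable lborel G1"
     "(\<integral>\<^sup>+\<xi>. ennreal ((w \<xi> * norm (G1 \<xi>))\<^sup>2) \<partial>lebesgue) \<le> ennreal (M1\<^sup>2)" "\<And>x. h1 x = fourier G1 (- x)" and M1: "0 < M1"
    by (auto simp: fourier_ball_def)
  from F(2) obtain G2 where G2: "integrable lborel G2"
     "(\<integral>\<^sup>+\<xi>. ennreal ((w \<xi> * norm (G2 \<xi>))\<^sup>2) \<partial>lebesgue) \<le> ennreal (M2\<^sup>2)" "\<And>x. h2 x = fourier G2 (- x)" and M2: "0 < M2"
    by (auto simp: fourier_ball_def)
  note [measurable] = integrable_borel[OF G1(1)] integrable_borel[OF G2(1)]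
  show ?thesis
    unfolding fourier_ball_def
  proof (intro conjI exI[of _ "\<lambda>\<xi>. G1 \<xi> + G2 \<xi>"] allI)
    have "(\<integral>\<^sup>+\<xi>. ennreal ((w \<xi> * norm (G1 \<xi> + G2 \<xi>))\<^sup>2) \<partial>lebesgue)
      \<le> (\<integral>\<^sup>+\<xi>. ennreal ((w \<xi> * (norm (G1 \<xi>) + norm (G2 \<xi>)))\<^sup>2) \<partial>lebesgue)"
      using w(2) by (intro nn_integral_mono ennreal_leI power_mono mult_left_mono norm_triangle_ineq)
        (auto simp: less_imp_le)
    also have "\<dots> \<le> ennreal ((M1 + M2)\<^sup>2)"
      by (rule weighted_L2_add[OF w(1) _ _ M1 M2 G1(2) G2(2)]) measurable
    finally show "(\<integral>\<^sup>+\<xi>. ennreal ((w \<xi> * norm (G1 \<xi> + G2 \<xi>))\<^sup>2) \<partial>lebesgue) \<le> ennreal ((M1 + M2)\<^sup>2)" .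
    show "h1 x + h2 x = fourier (\<lambda>\<xi>. G1 \<xi> + G2 \<xi>) (- x)" for x
      using fourier_add[OF G1(1) G2(1)] G1(3) G2(3) by simp
  qed (use M1 M2 G1 G2 in auto)
qed

lemma fourier_ball_sum:
  assumes w: "w \<in> borel_measurable lebesgue" "\<And>\<xi>. 0 < w \<xi>" and I: "finite I" "I \<noteq> {}"
    and F: "\<And>i. i \<in> I \<Longrightarrow> fourier_ball w (M i) (h i)"
  shows "fourier_ball w (\<Sum>i\<in>I. M i) (\<lambda>x. \<Sum>i\<in>I. h i x)"
  using I F by (induction I rule: finite_ne_induct) (auto intro: fourier_ball_add[OF w])

lemma fourier_ball_diff:
  assumes w: "w \<in> borel_measurable lebesgue" "\<And>\<xi>. 0 < w \<xi>" and F: "fourier_ball w M1 h1" "fourier_ball w M2 h2"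
  shows "fourier_ball w (M1 + M2) (\<lambda>x. h1 x - h2 x)"
  using fourier_ball_add[OF w F(1) fourier_ball_cmult[OF w(1) F(2), of "-1" M2]] fourier_ball_pos[OF F(2)] by simp

text \<open>The densities are summed. Their \<open>L\<^sup>1\<close> bounds make the series converge almost everywhere, and
  Fatou's lemma carries the weighted bounds of the partial sums over to the limit.\<close>

lemma fourier_ball_suminf:
  fixes w :: "'a::euclidean_space \<Rightarrow> real"
  assumes w: "w \<in> borel_measurable lebesgue" "\<And>\<xi>. 0 < w \<xi>" "square_integrable (\<lambda>\<xi>. 1 / w \<xi>)"
    and F: "\<And>m. fourier_ball w (M m) (h m)" and s: "summable M"
  shows "fourier_ball w (suminf M) (\<lambda>x. \<Sum>m. h m x)"
proof -
  have "\<forall>m. \<exists>G. integrable lborel G \<and>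
     (\<integral>\<^sup>+\<xi>. ennreal ((w \<xi> * norm (G \<xi>))\<^sup>2) \<partial>lebesgue) \<le> ennreal ((M m)\<^sup>2) \<and> (\<forall>x. h m x = fourier G (- x))"
    using F unfolding fourier_ball_def by blast
  from choice[OF this] obtain G where G: "\<And>m. integrable lborel (G m)"
     "\<And>m. (\<integral>\<^sup>+\<xi>. ennreal ((w \<xi> * norm (G m \<xi>))\<^sup>2) \<partial>lebesgue) \<le> ennreal ((M m)\<^sup>2)"
     "\<And>m x. h m x = fourier (G m) (- x)" by blast
  have M: "0 < M m" for m by (rule fourier_ball_pos[OF F])
  note Gb[measurable] = integrable_borel[OF G(1)]
  note w(1)[measurable]
  have Gl[measurable]: "G m \<in> borel_measurable lebesgue" for m using Gb by (simp add: measurable_completion)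
  let ?S = "suminf M" and ?K = "1 + (L2_norm (\<lambda>\<xi>. 1 / w \<xi>))\<^sup>2"
  have L1: "(\<integral>\<xi>. norm (G m \<xi>) \<partial>lborel) \<le> ?K * M m" for m
    by (rule weighted_L1_bound(2)[OF w Gb M G(2)])
  have sL1: "summable (\<lambda>m. \<integral>\<xi>. norm (G m \<xi>) \<partial>lborel)"
    by (rule summable_comparison_test'[OF summable_mult[OF s, of ?K], of 0]) (use L1 in auto)
  have "(\<integral>\<^sup>+\<xi>. (\<Sum>m. ennreal (norm (G m \<xi>))) \<partial>lborel) = (\<Sum>m. \<integral>\<^sup>+\<xi>. ennreal (norm (G m \<xi>)) \<partial>lborel)"
    by (rule nn_integral_suminf) simp
  also have "\<dots> = (\<Sum>m. ennreal (\<integral>\<xi>. norm (G m \<xi>) \<partial>lborel))"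
    using G(1) by (simp add: nn_integral_eq_integral)
  also have "\<dots> \<noteq> \<infinity>" using sL1 by (subst suminf_ennreal2) auto
  finally have "AE \<xi> in lborel. (\<Sum>m. ennreal (norm (G m \<xi>))) \<noteq> \<infinity>"
    by (intro nn_integral_PInf_AE) auto
  then have ae: "AE \<xi> in lborel. summable (\<lambda>m. norm (G m \<xi>))"
    by eventually_elim (rule summable_suminf_not_top, auto)
  define H where "H = (\<lambda>\<xi>. \<Sum>m. G m \<xi>)"
  have Hi: "integrable lborel H" unfolding H_def by (rule integrable_suminf[OF G(1) ae sL1])
  have part: "(\<integral>\<^sup>+\<xi>. ennreal ((w \<xi> * (\<Sum>m<Suc n. norm (G m \<xi>)))\<^sup>2) \<partial>lebesgue) \<le> ennreal ((\<Sum>m<Suc n. M m)\<^sup>2)" for n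
  proof (induction n)
    case 0 then show ?case using G(2)[of 0] by simp
  next
    case (Suc n)
    have "0 < (\<Sum>m<Suc n. M m)" using M by (intro sum_pos) auto
    from weighted_L2_add[OF w(1) _ _ this M Suc G(2)] show ?case by simp
  qed
  have "(\<integral>\<^sup>+\<xi>. ennreal ((w \<xi> * norm (H \<xi>))\<^sup>2) \<partial>lebesgue)
     \<le> (\<integral>\<^sup>+\<xi>. liminf (\<lambda>n. ennreal ((w \<xi> * (\<Sum>m<Suc n. norm (G m \<xi>)))\<^sup>2)) \<partial>lebesgue)"
  proof (rule nn_integral_mono_AE, use AE_completion[OF ae] in eventually_elim)
    case (elim \<xi>)
    have "(\<lambda>n. \<Sum>m<Suc n. norm (G m \<xi>)) \<longlonglongrightarrow> (\<Sum>m. norm (G m \<xi>))"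
      using summable_LIMSEQ[OF elim] by (rule LIMSEQ_Suc)
    then have "(\<lambda>n. ennreal ((w \<xi> * (\<Sum>m<Suc n. norm (G m \<xi>)))\<^sup>2)) \<longlonglongrightarrow> ennreal ((w \<xi> * (\<Sum>m. norm (G m \<xi>)))\<^sup>2)"
      by (intro tendsto_ennrealI tendsto_power tendsto_mult tendsto_const)
    then have "liminf (\<lambda>n. ennreal ((w \<xi> * (\<Sum>m<Suc n. norm (G m \<xi>)))\<^sup>2)) = ennreal ((w \<xi> * (\<Sum>m. norm (G m \<xi>)))\<^sup>2)"
      by (rule lim_imp_Liminf[OF sequentially_bot])
    moreover have "norm (H \<xi>) \<le> (\<Sum>m. norm (G m \<xi>))" unfolding H_def by (rule summable_norm[OF elim])
    ultimately show ?case
      using w(2)[of \<xi>] by (auto intro!: ennreal_leI power_mono mult_left_mono)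
  qed
  also have "\<dots> \<le> liminf (\<lambda>n. \<integral>\<^sup>+\<xi>. ennreal ((w \<xi> * (\<Sum>m<Suc n. norm (G m \<xi>)))\<^sup>2) \<partial>lebesgue)"
    by (rule nn_integral_liminf) measurable
  also have "\<dots> \<le> ennreal (?S\<^sup>2)"
  proof (rule Liminf_le[OF sequentially_bot], intro always_eventually allI)
    fix n
    have "(\<Sum>m<Suc n. M m) \<le> ?S" using M by (intro sum_le_suminf s) (auto intro: less_imp_le)
    moreover have "0 \<le> (\<Sum>m<Suc n. M m)" using M by (intro sum_nonneg) (auto intro: less_imp_le)
    ultimately show "(\<integral>\<^sup>+\<xi>. ennreal ((w \<xi> * (\<Sum>m<Suc n. norm (G m \<xi>)))\<^sup>2) \<partial>lebesgue) \<le> ennreal (?S\<^sup>2)"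
      by (intro order_trans[OF part] ennreal_leI power_mono)
  qed
  finally have HS: "(\<integral>\<^sup>+\<xi>. ennreal ((w \<xi> * norm (H \<xi>))\<^sup>2) \<partial>lebesgue) \<le> ennreal (?S\<^sup>2)" .
  have "(\<Sum>m. h m x) = fourier H (- x)" for x
  proof -
    have "(\<Sum>m. \<integral>\<xi>. fourier_kernel \<xi> (- x) * G m \<xi> \<partial>lborel) = (\<integral>\<xi>. (\<Sum>m. fourier_kernel \<xi> (- x) * G m \<xi>) \<partial>lborel)"
      by (rule integral_suminf[symmetric, OF integrable_fker[OF G(1)]]) (use ae sL1 in \<open>simp_all add: norm_mult\<close>)
    also have "\<dots> = (\<integral>\<xi>. fourier_kernel \<xi> (- x) * H \<xi> \<partial>lborel)"
    proof (rule integral_cong_AE)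
      show "AE \<xi> in lborel. (\<Sum>m. fourier_kernel \<xi> (- x) * G m \<xi>) = fourier_kernel \<xi> (- x) * H \<xi>"
        using ae unfolding H_def by eventually_elim (rule suminf_mult[OF summable_norm_cancel])
    qed (use integrable_borel[OF Hi] in measurable)
    finally show ?thesis by (simp add: G(3) fourier_lborel integrable_borel[OF Hi])
  qed
  moreover have "0 < ?S" using M by (intro suminf_pos s)
  ultimately show ?thesis unfolding fourier_ball_def using Hi HS by blast
qed

section \<open>Submultiplicative weights\<close>

lemma nn_integral_lborel_reflect:
  fixes f :: "'a::euclidean_space \<Rightarrow> ennreal"
  assumes [measurable]: "f \<in> borel_measurable borel"
  shows "(\<integral>\<^sup>+y. f (x - y) \<partial>lborel) = (\<integral>\<^sup>+y. f y \<partial>lborel)"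
proof -
  have "(\<integral>\<^sup>+y. f y \<partial>lborel) = (\<integral>\<^sup>+y. f y \<partial>density (distr lborel borel (\<lambda>y. x + (- 1) *\<^sub>R y)) (\<lambda>_. ennreal (\<bar>- 1 :: real\<bar> ^ DIM('a))))"
    by (subst lborel_affine[of "-1" x]) auto
  also have "\<dots> = (\<integral>\<^sup>+y. f (x - y) \<partial>lborel)"
    by (simp add: nn_integral_density nn_integral_distr)
  finally show ?thesis by simp
qed

lemma nn_integral_lborel_translate:
  fixes f :: "'a::euclidean_space \<Rightarrow> ennreal"
  assumes [measurable]: "f \<in> borel_measurable borel"
  shows "(\<integral>\<^sup>+y. f (y - x) \<partial>lborel) = (\<integral>\<^sup>+y. f y \<partial>lborel)"
proof -
  have "(\<integral>\<^sup>+y. f y \<partial>lborel) = (\<integral>\<^sup>+y. f y \<partial>density (distr lborel borel (\<lambda>y. - x + 1 *\<^sub>R y)) (\<lambda>_. ennreal (\<bar>1 :: real\<bar> ^ DIM('a))))"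
    by (subst lborel_affine[of "1" "- x"]) auto
  also have "\<dots> = (\<integral>\<^sup>+y. f (y - x) \<partial>lborel)"
    by (simp add: nn_integral_density nn_integral_distr)
  finally show ?thesis by simp
qed

lemma AE_lborel_reflect:
  fixes P :: "'a::euclidean_space \<Rightarrow> bool"
  assumes "AE y in lborel. P y" shows "AE y in lborel. P (x - y)"
proof -
  from assms obtain N where N: "{y \<in> space lborel. \<not> P y} \<subseteq> N" "emeasure lborel N = 0" "N \<in> sets lborel"
    by (rule AE_E)
  then have [measurable]: "N \<in> sets borel" by simp
  have "(\<integral>\<^sup>+y. indicator N (x - y) \<partial>lborel) = (\<integral>\<^sup>+y. indicator N y \<partial>lborel)"
    by (rule nn_integral_lborel_reflect) simp
  also have "\<dots> = 0" using N by simp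
  finally have "AE y in lborel. indicator N (x - y) = (0::ennreal)"
    by (subst (asm) nn_integral_0_iff_AE) auto
  then show ?thesis by eventually_elim (use N(1) in \<open>auto simp: indicator_def split: if_splits\<close>)
qed

lemma ennreal_norm_integral_le:
  fixes f :: "'a \<Rightarrow> 'b::{banach, second_countable_topology}"
  shows "ennreal (norm (\<integral>x. f x \<partial>N)) \<le> (\<integral>\<^sup>+x. ennreal (norm (f x)) \<partial>N)"
  by (cases "integrable N f") (auto simp: integral_norm_bound_ennreal not_integrable_integral_eq)

text \<open>The moderateness condition compares \<open>k \<xi>\<close> with \<open>k 0\<close> in both directions.\<close>

lemma K_pol_bounds:
  fixes k :: "'a::euclidean_space \<Rightarrow> real"
  assumes "k \<in> K_pol"
  obtains C N where "0 < C" "\<And>\<xi>. k \<xi> \<le> C * bracket \<xi> ^ N" "\<And>\<xi>. 1 \<le> C * bracket \<xi> ^ N * k \<xi>"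
proof -
  from assms obtain C N where CN: "0 < C" "0 < N" "\<And>\<xi> \<eta>. k (\<xi> + \<eta>) \<le> C * bracket \<xi> powr N * k \<eta>" and pos: "\<And>\<xi>. 0 < k \<xi>"
    by (auto simp: K_pol_def)
  define n where "n = nat \<lceil>N\<rceil>"
  have pw: "bracket \<xi> powr N \<le> bracket \<xi> ^ n" for \<xi> :: 'a
  proof -
    have "bracket \<xi> powr N \<le> bracket \<xi> powr real n"
      using bracket_ge_1[of \<xi>] CN(2) unfolding n_def by (intro powr_mono) auto
    also have "\<dots> = bracket \<xi> ^ n" using bracket_ge_1[of \<xi>] by (intro powr_realpow) simp
    finally show ?thesis .
  qed
  define C' where "C' = max (C * k 0) (C / k 0)"
  have up: "k \<xi> \<le> C' * bracket \<xi> ^ n" for \<xi>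
  proof -
    have "k \<xi> \<le> C * bracket \<xi> powr N * k 0" using CN(3)[of \<xi> 0] by simp
    also have "\<dots> \<le> C * bracket \<xi> ^ n * k 0"
      using pw[of \<xi>] CN(1) pos[of 0] by (intro mult_right_mono mult_left_mono) auto
    also have "\<dots> = (C * k 0) * bracket \<xi> ^ n" by simp
    also have "\<dots> \<le> C' * bracket \<xi> ^ n"
      unfolding C'_def using bracket_ge_1[of \<xi>] by (intro mult_right_mono) auto
    finally show ?thesis .
  qed
  have lo: "1 \<le> C' * bracket \<xi> ^ n * k \<xi>" for \<xi>
  proof -
    have "k 0 \<le> C * bracket (- \<xi>) powr N * k \<xi>" using CN(3)[of "- \<xi>" \<xi>] by simp
    also have "bracket (- \<xi>) = bracket \<xi>" by (simp add: bracket_def)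
    also have "C * bracket \<xi> powr N * k \<xi> \<le> C * bracket \<xi> ^ n * k \<xi>"
      using pw[of \<xi>] CN(1) pos[of \<xi>] by (intro mult_right_mono mult_left_mono) auto
    finally have "1 \<le> (C / k 0) * (bracket \<xi> ^ n * k \<xi>)" using pos[of 0] by (simp add: field_simps)
    also have "\<dots> \<le> C' * (bracket \<xi> ^ n * k \<xi>)"
      unfolding C'_def using bracket_ge_1[of \<xi>] pos[of \<xi>] by (intro mult_right_mono) auto
    finally show ?thesis by (simp add: mult.assoc)
  qed
  have "0 < C'" unfolding C'_def using CN(1) pos[of 0] by (simp add: less_max_iff_disj)
  then show ?thesis using that up lo by blast
qed

lemma K_pol_measurable: "k \<in> K_pol \<Longrightarrow> k \<in> borel_measurable lebesgue"
  and K_pol_pos: "k \<in> K_pol \<Longrightarrow> 0 < k \<xi>"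
  by (simp_all add: K_pol_def)

lemma K_pol_dominated:
  fixes k k' :: "'a::euclidean_space \<Rightarrow> real"
  assumes "k \<in> K_pol" "k' \<in> K_pol" "((\<lambda>\<xi>. k' \<xi> / k \<xi>) \<longlongrightarrow> 0) at_infinity"
  obtains C where "0 < C" "\<And>\<xi>. k' \<xi> \<le> C * k \<xi>"
proof -
  obtain C N where C: "0 < C" "\<And>\<xi>. 1 \<le> C * bracket \<xi> ^ N * k \<xi>" using K_pol_bounds[OF assms(1)] by metis
  obtain D m where D: "0 < D" "\<And>\<xi>. k' \<xi> \<le> D * bracket \<xi> ^ m" using K_pol_bounds[OF assms(2)] by metis
  have "\<forall>\<^sub>F \<xi> in at_infinity. k' \<xi> / k \<xi> < 1" using assms(3) by (rule order_tendstoD(2)) simp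
  then obtain R where R: "\<And>\<xi>. R \<le> norm \<xi> \<Longrightarrow> k' \<xi> / k \<xi> < 1" by (auto simp: eventually_at_infinity)
  define A where "A = 1 + D * (1 + \<bar>R\<bar>) ^ m * (C * (1 + \<bar>R\<bar>) ^ N)"
  have A1: "1 \<le> A" unfolding A_def using C(1) D(1) by simp
  have "k' \<xi> \<le> A * k \<xi>" for \<xi>
  proof (cases "R \<le> norm \<xi>")
    case True
    have "k' \<xi> \<le> 1 * k \<xi>" using R[OF True] K_pol_pos[OF assms(1), of \<xi>] by (simp add: divide_less_eq)
    also have "\<dots> \<le> A * k \<xi>" using A1 K_pol_pos[OF assms(1), of \<xi>] by (intro mult_right_mono) auto
    finally show ?thesis .
  next
    case False
    have b: "bracket \<xi> \<le> 1 + \<bar>R\<bar>" using bracket_le[of \<xi>] False by linarith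
    have bn: "bracket \<xi> ^ j \<le> (1 + \<bar>R\<bar>) ^ j" for j using b bracket_ge_1[of \<xi>] by (intro power_mono) auto
    have kp: "0 < k \<xi>" by (rule K_pol_pos[OF assms(1)])
    have "k' \<xi> \<le> D * bracket \<xi> ^ m" by (rule D)
    also have "\<dots> \<le> D * (1 + \<bar>R\<bar>) ^ m" using D(1) bn by (intro mult_left_mono) auto
    also have "\<dots> \<le> D * (1 + \<bar>R\<bar>) ^ m * (C * (1 + \<bar>R\<bar>) ^ N * k \<xi>)"
    proof -
      have "1 \<le> C * bracket \<xi> ^ N * k \<xi>" by (rule C)
      also have "\<dots> \<le> C * (1 + \<bar>R\<bar>) ^ N * k \<xi>"
        using C(1) kp bn by (intro mult_right_mono mult_left_mono) auto
      finally show ?thesis using D(1) by (intro mult_le_cancel_left1[THEN iffD2]) (auto simp: mult_less_0_iff)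
    qed
    also have "\<dots> = (A - 1) * k \<xi>" by (simp add: A_def)
    also have "\<dots> \<le> A * k \<xi>" using kp by (intro mult_right_mono) auto
    finally show ?thesis .
  qed
  then show ?thesis using A1 that[of A] by auto
qed

text \<open>The weight is normalised so that under multiplication the radii of \<open>fourier_ball w\<close> multiply without a
  constant. Polynomial growth is what makes test functions members of some \<open>fourier_ball w M\<close>.\<close>

locale algebra_weight =
  fixes w :: "'a::euclidean_space \<Rightarrow> real"
  assumes w_measurable: "w \<in> borel_measurable lebesgue"
    and w_pos: "0 < w \<xi>"
    and w_L2: "square_integrable (\<lambda>\<xi>. 1 / w \<xi>)"
    and w_conv: "(\<integral>\<^sup>+\<eta>. ennreal (1 / (w (\<xi> - \<eta>))\<^sup>2 * (1 / (w \<eta>)\<^sup>2)) \<partial>lebesgue) \<le> ennreal (1 / (w \<xi>)\<^sup>2)"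
    and w_growth: "\<exists>C N. 0 < C \<and> (\<forall>\<xi>. w \<xi> \<le> C * bracket \<xi> ^ N)"
begin

text \<open>A product has the convolution of the densities as its density. Inserting
  \<open>w (\<xi> - \<eta>) * w \<eta>\<close> and its inverse and applying Cauchy-Schwarz produces the integral in \<open>w_conv\<close>,
  and the other factor is integrated by Fubini's theorem.\<close>

lemma fourier_ball_mult:
  assumes "fourier_ball w M1 h1" "fourier_ball w M2 h2"
  shows "fourier_ball w (M1 * M2) (\<lambda>x. h1 x * h2 x)"
proof -
  from assms(1) obtain G1 where G1: "integrable lborel G1"
     "(\<integral>\<^sup>+\<xi>. ennreal ((w \<xi> * norm (G1 \<xi>))\<^sup>2) \<partial>lebesgue) \<le> ennreal (M1\<^sup>2)" "\<And>x. h1 x = fourier G1 (- x)" and M1: "0 < M1"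
    by (auto simp: fourier_ball_def)
  from assms(2) obtain G2 where G2: "integrable lborel G2"
     "(\<integral>\<^sup>+\<xi>. ennreal ((w \<xi> * norm (G2 \<xi>))\<^sup>2) \<partial>lebesgue) \<le> ennreal (M2\<^sup>2)" "\<And>x. h2 x = fourier G2 (- x)" and M2: "0 < M2"
    by (auto simp: fourier_ball_def)
  note [measurable] = integrable_borel[OF G1(1)] integrable_borel[OF G2(1)]
  \<comment> \<open>a Borel measurable version of the weight, for the sake of the convolution integrals\<close>
  obtain \<kappa>0 where \<kappa>0: "\<kappa>0 \<in> borel_measurable lborel" "AE \<xi> in lborel. w \<xi> = \<kappa>0 \<xi>"
    using completion_ex_borel_measurable_real[OF w_measurable] by blast
  define \<kappa> where "\<kappa> = (\<lambda>\<xi>. if 0 < \<kappa>0 \<xi> then \<kappa>0 \<xi> else 1)"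
  have [measurable]: "\<kappa>0 \<in> borel_measurable borel" using \<kappa>0(1) by simp
  have \<kappa>m[measurable]: "\<kappa> \<in> borel_measurable borel" unfolding \<kappa>_def by measurable
  have \<kappa>pos: "0 < \<kappa> \<xi>" for \<xi> by (simp add: \<kappa>_def)
  have ae: "AE \<xi> in lborel. w \<xi> = \<kappa> \<xi>"
    using \<kappa>0(2)
  proof eventually_elim
    case (elim \<xi>)
    then show ?case using w_pos[of \<xi>] by (simp add: \<kappa>_def)
  qed
  define F1 where "F1 = (\<lambda>\<xi>. ennreal ((\<kappa> \<xi> * norm (G1 \<xi>))\<^sup>2))"
  define F2 where "F2 = (\<lambda>\<xi>. ennreal ((\<kappa> \<xi> * norm (G2 \<xi>))\<^sup>2))"
  have [measurable]: "F1 \<in> borel_measurable borel" "F2 \<in> borel_measurable borel"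
    unfolding F1_def F2_def by measurable
  have FM: "(\<integral>\<^sup>+\<xi>. F1 \<xi> \<partial>lborel) \<le> ennreal (M1\<^sup>2)" "(\<integral>\<^sup>+\<xi>. F2 \<xi> \<partial>lborel) \<le> ennreal (M2\<^sup>2)"
  proof -
    have "(\<integral>\<^sup>+\<xi>. F1 \<xi> \<partial>lborel) = (\<integral>\<^sup>+\<xi>. ennreal ((w \<xi> * norm (G1 \<xi>))\<^sup>2) \<partial>lborel)"
      by (rule nn_integral_cong_AE) (use ae in \<open>eventually_elim, simp add: F1_def\<close>)
    then show "(\<integral>\<^sup>+\<xi>. F1 \<xi> \<partial>lborel) \<le> ennreal (M1\<^sup>2)" using G1(2) by (simp add: nn_integral_completion)
    have "(\<integral>\<^sup>+\<xi>. F2 \<xi> \<partial>lborel) = (\<integral>\<^sup>+\<xi>. ennreal ((w \<xi> * norm (G2 \<xi>))\<^sup>2) \<partial>lborel)"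
      by (rule nn_integral_cong_AE) (use ae in \<open>eventually_elim, simp add: F2_def\<close>)
    then show "(\<integral>\<^sup>+\<xi>. F2 \<xi> \<partial>lborel) \<le> ennreal (M2\<^sup>2)" using G2(2) by (simp add: nn_integral_completion)
  qed
  have pt: "ennreal ((w \<xi> * norm (convolution G1 G2 \<xi>))\<^sup>2) \<le> (\<integral>\<^sup>+\<eta>. F1 (\<xi> - \<eta>) * F2 \<eta> \<partial>lborel)" for \<xi>
  proof -
    define a where "a = (\<lambda>\<eta>. (\<kappa> (\<xi> - \<eta>) * norm (G1 (\<xi> - \<eta>))) * (\<kappa> \<eta> * norm (G2 \<eta>)))"
    define b where "b = (\<lambda>\<eta>. (1 / \<kappa> (\<xi> - \<eta>)) * (1 / \<kappa> \<eta>))"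
    have m: "a \<in> borel_measurable lborel" "b \<in> borel_measurable lborel" unfolding a_def b_def by measurable
    have nn: "0 \<le> a \<eta>" "0 \<le> b \<eta>" for \<eta>
      using less_imp_le[OF \<kappa>pos] by (simp_all add: a_def b_def)
    have "(\<integral>\<^sup>+\<eta>. ennreal ((b \<eta>)\<^sup>2) \<partial>lborel) = (\<integral>\<^sup>+\<eta>. ennreal (1 / (w (\<xi> - \<eta>))\<^sup>2 * (1 / (w \<eta>)\<^sup>2)) \<partial>lborel)"
      by (rule nn_integral_cong_AE, use ae AE_lborel_reflect[OF ae, of \<xi>] in eventually_elim)
        (simp add: b_def power_mult_distrib power_divide)
    also have "\<dots> \<le> ennreal ((1 / w \<xi>)\<^sup>2)" using w_conv[of \<xi>] by (simp add: nn_integral_completion power_divide)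
    finally have b: "(\<integral>\<^sup>+\<eta>. ennreal ((b \<eta>)\<^sup>2) \<partial>lborel) \<le> ennreal ((1 / w \<xi>)\<^sup>2)" .
    have "ennreal (norm (convolution G1 G2 \<xi>)) \<le> (\<integral>\<^sup>+\<eta>. ennreal (norm (G1 (\<xi> - \<eta>) * G2 \<eta>)) \<partial>lborel)"
      unfolding convolution_def by (rule ennreal_norm_integral_le)
    also have "\<dots> = (\<integral>\<^sup>+\<eta>. ennreal (a \<eta> * b \<eta>) \<partial>lborel)"
    proof (intro nn_integral_cong arg_cong[where f=ennreal])
      fix \<eta>
      show "norm (G1 (\<xi> - \<eta>) * G2 \<eta>) = a \<eta> * b \<eta>"
        using \<kappa>pos[of "\<xi> - \<eta>"] \<kappa>pos[of \<eta>] by (simp add: a_def b_def norm_mult)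
    qed
    finally have "(ennreal (norm (convolution G1 G2 \<xi>)))\<^sup>2 \<le> (\<integral>\<^sup>+\<eta>. ennreal (a \<eta> * b \<eta>) \<partial>lborel)\<^sup>2"
      by (rule power_mono) simp
    also have "\<dots> \<le> ennreal ((1 / w \<xi>)\<^sup>2) * (\<integral>\<^sup>+\<eta>. ennreal ((a \<eta>)\<^sup>2) \<partial>lborel)"
      using w_pos[of \<xi>] by (intro nn_integral_Cauchy_Schwarz_bound m nn b) simp
    finally have *: "(ennreal (norm (convolution G1 G2 \<xi>)))\<^sup>2 \<le> ennreal ((1 / w \<xi>)\<^sup>2) * (\<integral>\<^sup>+\<eta>. ennreal ((a \<eta>)\<^sup>2) \<partial>lborel)" .
    have "ennreal ((w \<xi> * norm (convolution G1 G2 \<xi>))\<^sup>2) = ennreal ((w \<xi>)\<^sup>2) * (ennreal (norm (convolution G1 G2 \<xi>)))\<^sup>2"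
      by (simp add: power_mult_distrib ennreal_mult ennreal_power)
    also have "\<dots> \<le> ennreal ((w \<xi>)\<^sup>2) * (ennreal ((1 / w \<xi>)\<^sup>2) * (\<integral>\<^sup>+\<eta>. ennreal ((a \<eta>)\<^sup>2) \<partial>lborel))"
      by (rule mult_left_mono[OF *]) simp
    also have "\<dots> = (\<integral>\<^sup>+\<eta>. ennreal ((a \<eta>)\<^sup>2) \<partial>lborel)"
      using w_pos[of \<xi>] by (simp add: mult.assoc[symmetric] ennreal_mult[symmetric] power_divide)
    also have "\<dots> = (\<integral>\<^sup>+\<eta>. F1 (\<xi> - \<eta>) * F2 \<eta> \<partial>lborel)"
      by (simp add: a_def F1_def F2_def power_mult_distrib ennreal_mult)
    finally show ?thesis .
  qed
  have "(\<integral>\<^sup>+\<xi>. ennreal ((w \<xi> * norm (convolution G1 G2 \<xi>))\<^sup>2) \<partial>lebesgue) \<le> (\<integral>\<^sup>+\<xi>. (\<integral>\<^sup>+\<eta>. F1 (\<xi> - \<eta>) * F2 \<eta> \<partial>lborel) \<partial>lebesgue)"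
    by (rule nn_integral_mono) (rule pt)
  also have "\<dots> = (\<integral>\<^sup>+\<xi>. (\<integral>\<^sup>+\<eta>. F1 (\<xi> - \<eta>) * F2 \<eta> \<partial>lborel) \<partial>lborel)" by (rule nn_integral_completion)
  also have "\<dots> = (\<integral>\<^sup>+\<eta>. (\<integral>\<^sup>+\<xi>. F1 (\<xi> - \<eta>) * F2 \<eta> \<partial>lborel) \<partial>lborel)"
    using lborel_pair.Fubini[of "\<lambda>(\<xi>, \<eta>). F1 (\<xi> - \<eta>) * F2 \<eta>"] by simp
  also have "\<dots> = (\<integral>\<^sup>+\<eta>. (\<integral>\<^sup>+\<xi>. F1 (\<xi> - \<eta>) \<partial>lborel) * F2 \<eta> \<partial>lborel)"
    by (intro nn_integral_cong nn_integral_multc) simp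
  also have "\<dots> = (\<integral>\<^sup>+\<xi>. F1 \<xi> \<partial>lborel) * (\<integral>\<^sup>+\<eta>. F2 \<eta> \<partial>lborel)"
    by (simp add: nn_integral_lborel_translate nn_integral_cmult)
  also have "\<dots> \<le> ennreal (M1\<^sup>2) * ennreal (M2\<^sup>2)" by (intro mult_mono FM) auto
  also have "\<dots> = ennreal ((M1 * M2)\<^sup>2)" by (simp add: ennreal_mult[symmetric] power_mult_distrib)
  finally show ?thesis
    unfolding fourier_ball_def using M1 M2 integrable_conv[OF G1(1) G2(1)]
    by (intro conjI exI[of _ "convolution G1 G2"]) (auto simp: fourier_conv[OF G1(1) G2(1)] G1(3) G2(3))
qed

lemma fourier_ball_power: "fourier_ball w M h \<Longrightarrow> fourier_ball w (M ^ Suc m) (\<lambda>x. h x ^ Suc m)"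
  by (induction m) (use fourier_ball_mult in auto)

lemmas fourier_ball_add = fourier_ball_add[OF w_measurable w_pos]
lemmas fourier_ball_diff = fourier_ball_diff[OF w_measurable w_pos]
lemmas fourier_ball_sum = fourier_ball_sum[OF w_measurable w_pos]
lemmas fourier_ball_cmult = fourier_ball_cmult[OF w_measurable]
lemmas fourier_ball_suminf = fourier_ball_suminf[OF w_measurable w_pos w_L2]
lemmas fourier_ball_bounded = fourier_ball_bounded[OF w_measurable w_pos w_L2]

text \<open>For \<open>L = 2 * N\<close> the decay of the transform makes \<open>(w \<xi>)\<^sup>2 * norm (fourier \<phi> \<xi>)\<close> bounded, so that the
  weighted density is dominated by the square integrable \<open>1 / w\<close>. As \<open>C\<close> and \<open>L\<close> serve all
  \<open>\<phi>\<close>, radii can be read off from finitely many derivatives.\<close>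

lemma fourier_ball_test_function:
  assumes "0 \<le> r"
  obtains C L where "0 < C" "\<And>\<phi> y B. \<lbrakk>\<phi> \<in> test_functions; \<And>x. x \<notin> cball y r \<Longrightarrow> \<phi> x = 0; 0 < B;
     \<And>bs x. bs \<in> lists Basis \<Longrightarrow> length bs \<le> L \<Longrightarrow> norm (iter_deriv bs \<phi> x) \<le> B\<rbrakk> \<Longrightarrow> fourier_ball w (C * B) \<phi>"
proof -
  let ?c = "inversion_factor TYPE('a)"
  obtain C0 N where C0: "0 < C0" "\<And>\<xi>. w \<xi> \<le> C0 * bracket \<xi> ^ N" using w_growth by blast
  define L where "L = 2 * N"
  define K where "K = 1 + (1 + real DIM('a)) ^ Suc L * (unit_ball_vol DIM('a) * r ^ DIM('a))"
  have K: "1 \<le> K" unfolding K_def using assms by simp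
  define I where "I = (\<integral>\<xi>. (1 / w \<xi>)\<^sup>2 \<partial>lebesgue)"
  have i1: "integrable lebesgue (\<lambda>\<xi>. (1 / w \<xi>)\<^sup>2)" using w_L2 by (simp add: square_integrable_def power_divide)
  have I0: "0 \<le> I" unfolding I_def by (rule Bochner_Integration.integral_nonneg) simp
  define C where "C = norm ?c * C0\<^sup>2 * K * (1 + sqrt I)"
  have C: "0 < C" unfolding C_def using C0(1) K I0 inversion_factor_nonzero[where 'a='a]
    by (intro mult_pos_pos) (auto intro: add_pos_nonneg)
  show ?thesis
  proof (rule that[OF C, of L])
    fix \<phi> :: "'a \<Rightarrow> complex" and y B
    assume \<phi>: "\<phi> \<in> test_functions" and supp: "\<And>x. x \<notin> cball y r \<Longrightarrow> \<phi> x = 0" and B0: "0 < B"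
      and B: "\<And>bs x. bs \<in> lists Basis \<Longrightarrow> length bs \<le> L \<Longrightarrow> norm (iter_deriv bs \<phi> x) \<le> B"
    define G where "G = (\<lambda>\<xi>. ?c * fourier \<phi> \<xi>)"
    have Gi: "integrable lborel G"
      unfolding G_def using finite_moments_integrable[OF finite_moments_fourier_test[OF \<phi>]] by simp
    have dec: "bracket \<xi> ^ L * norm (fourier \<phi> \<xi>) \<le> K * B" for \<xi>
    proof -
      have "bracket \<xi> ^ L * norm (fourier \<phi> \<xi>) \<le> (K - 1) * B"
      proof -
        have "bracket \<xi> ^ L * norm (fourier \<phi> \<xi>) \<le>
          (1 + real DIM('a)) ^ Suc L * (unit_ball_vol DIM('a) * r ^ DIM('a)) * B"
          by (rule fourier_decay[OF \<phi> assms supp B])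
        then show ?thesis by (simp add: K_def)
      qed
      also have "\<dots> \<le> K * B" using B0 by (intro mult_right_mono) auto
      finally show ?thesis .
    qed
    define A where "A = norm ?c * C0\<^sup>2 * K * B"
    have A0: "0 \<le> A" unfolding A_def using K B0 by simp
    have pt: "w \<xi> * norm (G \<xi>) \<le> A * (1 / w \<xi>)" for \<xi>
    proof -
      have "(w \<xi>)\<^sup>2 \<le> (C0 * bracket \<xi> ^ N)\<^sup>2" using C0(2)[of \<xi>] w_pos[of \<xi>] by (intro power_mono) auto
      also have "\<dots> = C0\<^sup>2 * bracket \<xi> ^ L" by (simp add: power_mult_distrib L_def power_mult[symmetric] mult.commute)
      finally have "(w \<xi>)\<^sup>2 * norm (G \<xi>) \<le> C0\<^sup>2 * bracket \<xi> ^ L * norm (G \<xi>)" by (rule mult_right_mono) simp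
      also have "\<dots> = norm ?c * C0\<^sup>2 * (bracket \<xi> ^ L * norm (fourier \<phi> \<xi>))" by (simp add: G_def norm_mult mult_ac)
      also have "\<dots> \<le> norm ?c * C0\<^sup>2 * (K * B)" by (intro mult_left_mono dec) auto
      finally have "(w \<xi>)\<^sup>2 * norm (G \<xi>) \<le> A" by (simp add: A_def mult.assoc)
      then show ?thesis using w_pos[of \<xi>] by (simp add: field_simps power2_eq_square)
    qed
    have "(\<integral>\<^sup>+\<xi>. ennreal ((w \<xi> * norm (G \<xi>))\<^sup>2) \<partial>lebesgue) \<le> (\<integral>\<^sup>+\<xi>. ennreal (A\<^sup>2 * (1 / w \<xi>)\<^sup>2) \<partial>lebesgue)"
    proof (intro nn_integral_mono ennreal_leI)
      fix \<xi>
      have "(w \<xi> * norm (G \<xi>))\<^sup>2 \<le> (A * (1 / w \<xi>))\<^sup>2"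
        using pt[of \<xi>] w_pos[of \<xi>] by (intro power_mono) auto
      then show "(w \<xi> * norm (G \<xi>))\<^sup>2 \<le> A\<^sup>2 * (1 / w \<xi>)\<^sup>2" by (simp only: power_mult_distrib)
    qed
    also have "\<dots> = ennreal (A\<^sup>2 * I)"
      unfolding I_def using i1 by (subst nn_integral_eq_integral) auto
    also have "\<dots> \<le> ennreal ((C * B)\<^sup>2)"
    proof (rule ennreal_leI)
      have "A\<^sup>2 * I = (A * sqrt I)\<^sup>2" using I0 by (simp add: power_mult_distrib)
      also have "\<dots> \<le> (A * (1 + sqrt I))\<^sup>2" using A0 I0 by (intro power_mono mult_left_mono) auto
      also have "A * (1 + sqrt I) = C * B" by (simp add: A_def C_def)
      finally show "A\<^sup>2 * I \<le> (C * B)\<^sup>2" .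
    qed
    finally have le: "(\<integral>\<^sup>+\<xi>. ennreal ((w \<xi> * norm (G \<xi>))\<^sup>2) \<partial>lebesgue) \<le> ennreal ((C * B)\<^sup>2)" .
    have "\<phi> x = fourier G (- x)" for x
      using inversion_factor[OF \<phi>, of x] fourier_cmult[OF finite_moments_integrable[OF finite_moments_fourier_test[OF \<phi>]]]
      by (simp add: G_def)
    then show "fourier_ball w (C * B) \<phi>" unfolding fourier_ball_def using C B0 Gi le by auto
  qed
qed

lemma fourier_ball_test:
  assumes "\<phi> \<in> test_functions" obtains C where "\<And>y. fourier_ball w C (translate y \<phi>)"
proof -
  obtain R where "0 < R" and R: "\<And>x. R \<le> norm x \<Longrightarrow> \<phi> x = 0" by (rule test_support_radius[OF assms]) auto
  obtain C L where C: "0 < C" "\<And>\<phi> y B. \<lbrakk>\<phi> \<in> test_functions; \<And>x. x \<notin> cball y R \<Longrightarrow> \<phi> x = 0; 0 < B;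
     \<And>bs x. bs \<in> lists Basis \<Longrightarrow> length bs \<le> L \<Longrightarrow> norm (iter_deriv bs \<phi> x) \<le> B\<rbrakk> \<Longrightarrow> fourier_ball w (C * B) \<phi>"
    by (rule fourier_ball_test_function[of R, OF less_imp_le[OF \<open>0 < R\<close>]]) blast
  obtain B' where "0 < B'" and B': "\<And>bs x. bs \<in> lists Basis \<Longrightarrow> length bs \<le> L \<Longrightarrow> norm (iter_deriv bs \<phi> x) \<le> B'"
    by (rule test_order_bound[OF assms, of L]) auto
  have F: "fourier_ball w (C * B') \<phi>" using \<open>0 < B'\<close> by (intro C(2)[of _ 0] assms B') (use R in auto)
  show ?thesis
    by (rule that[of "C * B'"]) (use fourier_ball_translate[OF F] in \<open>simp add: translate_def[abs_def]\<close>)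
qed

end

text \<open>For arbitrary functions, so that it applies to products of a Lebesgue measurable weight with its
  reflected translates, whose measurability would take extra work.\<close>

lemma nn_integral_cmult_le:
  fixes f :: "'a \<Rightarrow> ennreal"
  assumes "c \<noteq> 0" "c \<noteq> \<infinity>"
  shows "(\<integral>\<^sup>+x. c * f x \<partial>N) \<le> c * (\<integral>\<^sup>+x. f x \<partial>N)"
  unfolding nn_integral_def[of N "\<lambda>x. c * f x"]
proof (rule SUP_least)
  fix g assume "g \<in> {g. simple_function N g \<and> g \<le> (\<lambda>x. c * f x)}"
  then have g: "simple_function N g" "\<And>x. g x \<le> c * f x" by (auto simp: le_fun_def)
  have c: "inverse c * c = 1" 
    using assms ennreal_divide_self[of c] by (simp add: less_top divide_ennreal_def mult.commute)
  have s: "simple_function N (\<lambda>x. inverse c * g x)"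
    using simple_function_compose1[OF g(1), of "\<lambda>y. inverse c * y"] by simp
  have "inverse c * g x \<le> f x" for x
  proof -
    have "inverse c * g x \<le> inverse c * (c * f x)" by (intro mult_left_mono g) simp
    also have "\<dots> = f x" by (simp add: mult.assoc[symmetric] c)
    finally show ?thesis .
  qed
  then have le: "integral\<^sup>S N (\<lambda>x. inverse c * g x) \<le> (\<integral>\<^sup>+x. f x \<partial>N)"
    unfolding nn_integral_eq_simple_integral[OF s, symmetric] by (rule nn_integral_mono)
  have "integral\<^sup>S N g = integral\<^sup>S N (\<lambda>x. c * (inverse c * g x))"
    using c by (simp add: mult.assoc[symmetric] mult.commute)
  also have "\<dots> = c * integral\<^sup>S N (\<lambda>x. inverse c * g x)" by (rule simple_integral_mult[OF s])
  also have "\<dots> \<le> c * (\<integral>\<^sup>+x. f x \<partial>N)" by (rule mult_left_mono[OF le]) simp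
  finally show "integral\<^sup>S N g \<le> c * (\<integral>\<^sup>+x. f x \<partial>N)" .
qed

text \<open>Multiplying the weight by its own algebra constant normalises that constant to one.\<close>

lemma algebra_weight_K_a:
  fixes k :: "'a::euclidean_space \<Rightarrow> real"
  assumes "k \<in> K_a" "square_integrable (\<lambda>\<xi>. 1 / k \<xi>)"
  obtains C where "0 < C" "algebra_weight (\<lambda>\<xi>. C * k \<xi>)"
proof -
  from assms(1) obtain C where C: "0 < C" and kp: "k \<in> K_pol"
    and cv: "\<And>\<xi>. (\<integral>\<^sup>+\<eta>. ennreal (1 / (k (\<xi> - \<eta>))\<^sup>2 * (1 / (k \<eta>)\<^sup>2)) \<partial>lebesgue) \<le> ennreal (C\<^sup>2 / (k \<xi>)\<^sup>2)"
    by (auto simp: K_a_def)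
  note km = K_pol_measurable[OF kp] and kpos = K_pol_pos[OF kp]
  have "algebra_weight (\<lambda>\<xi>. C * k \<xi>)"
  proof
    show "(\<lambda>\<xi>. C * k \<xi>) \<in> borel_measurable lebesgue" using km by measurable
    show "0 < C * k \<xi>" for \<xi> using C kpos by simp
    have "integrable lebesgue (\<lambda>\<xi>. (1 / C\<^sup>2) * (norm (1 / k \<xi>))\<^sup>2)"
      using assms(2) unfolding square_integrable_def by (intro integrable_mult_right) simp
    then have "integrable lebesgue (\<lambda>\<xi>. (norm (1 / (C * k \<xi>)))\<^sup>2)"
      by (simp add: power_divide power_mult_distrib)
    moreover have "(\<lambda>\<xi>. 1 / (C * k \<xi>)) \<in> borel_measurable lebesgue" using km by measurable
    ultimately show "square_integrable (\<lambda>\<xi>. 1 / (C * k \<xi>))" by (simp add: square_integrable_def)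
    show "(\<integral>\<^sup>+\<eta>. ennreal (1 / (C * k (\<xi> - \<eta>))\<^sup>2 * (1 / (C * k \<eta>)\<^sup>2)) \<partial>lebesgue) \<le> ennreal (1 / (C * k \<xi>)\<^sup>2)" for \<xi>
    proof -
      have "(\<integral>\<^sup>+\<eta>. ennreal (1 / (C * k (\<xi> - \<eta>))\<^sup>2 * (1 / (C * k \<eta>)\<^sup>2)) \<partial>lebesgue)
         = (\<integral>\<^sup>+\<eta>. ennreal (1 / C ^ 4) * ennreal (1 / (k (\<xi> - \<eta>))\<^sup>2 * (1 / (k \<eta>)\<^sup>2)) \<partial>lebesgue)"
        by (intro nn_integral_cong) (simp add: ennreal_mult[symmetric] power_mult_distrib)
      also have "\<dots> \<le> ennreal (1 / C ^ 4) * (\<integral>\<^sup>+\<eta>. ennreal (1 / (k (\<xi> - \<eta>))\<^sup>2 * (1 / (k \<eta>)\<^sup>2)) \<partial>lebesgue)"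
        using C by (intro nn_integral_cmult_le) auto
      also have "\<dots> \<le> ennreal (1 / C ^ 4) * ennreal (C\<^sup>2 / (k \<xi>)\<^sup>2)" by (intro mult_left_mono cv) simp
      also have "\<dots> = ennreal (1 / (C * k \<xi>)\<^sup>2)"
        using C by (simp add: ennreal_mult[symmetric] power_mult_distrib power2_eq_square power4_eq_xxxx)
      finally show ?thesis .
    qed
    obtain D N where D: "0 < D" "\<And>\<xi>. k \<xi> \<le> D * bracket \<xi> ^ N" using K_pol_bounds[OF kp] by metis
    have "C * k \<xi> \<le> (C * D) * bracket \<xi> ^ N" for \<xi>
      using mult_left_mono[OF D(2)[of \<xi>], of C] C by (simp add: mult.assoc)
    then show "\<exists>C' N. 0 < C' \<and> (\<forall>\<xi>. C * k \<xi> \<le> C' * bracket \<xi> ^ N)"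
      using C D(1) by (intro exI[of _ "C * D"] exI[of _ N]) auto
  qed
  with C show ?thesis by (rule that)
qed

section \<open>Splitting into a smooth and a small part\<close>

lemma unif_smooth_reindex: "unif_smooth F \<Longrightarrow> unif_smooth (\<lambda>p. F (\<sigma> p))"
  unfolding unif_smooth_def by meson

lemma unif_smooth_Lipschitz:
  fixes F :: "'p \<Rightarrow> 'a::euclidean_space \<Rightarrow> complex"
  assumes "unif_smooth F"
  obtains C where "0 < C" "\<And>p x y. norm (F p x - F p y) \<le> C * norm (x - y)"
proof -
  obtain B where B: "0 < B" "\<And>p bs x. bs \<in> lists Basis \<Longrightarrow> length bs \<le> 1 \<Longrightarrow> norm (iter_deriv bs (F p) x) \<le> B"
    by (rule unif_smooth_order_bound[OF assms, of 1]) blast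
  have pd: "norm (partial_deriv b (F p) x) \<le> B" if "b \<in> Basis" for b p x
    using B(2)[of "[b]" p x] that by simp
  have "norm (F p x - F p y) \<le> (B * real DIM('a)) * norm (x - y)" for p x y
  proof (rule differentiable_bound[of UNIV])
    fix x
    define D where "D = frechet_derivative (F p) (at x)"
    have D: "(F p has_derivative D) (at x)" unfolding D_def by (rule smooth_has_derivative[OF unif_smoothD[OF assms]])
    then show "(F p has_derivative D) (at x within UNIV)" by simp
    interpret D: bounded_linear D using D by (rule has_derivative_bounded_linear)
    show "onorm D \<le> B * real DIM('a)"
    proof (rule onorm_le)
      fix v
      have "D v = D (\<Sum>b\<in>Basis. (v \<bullet> b) *\<^sub>R b)" by (simp add: euclidean_representation)
      also have "\<dots> = (\<Sum>b\<in>Basis. (v \<bullet> b) *\<^sub>R partial_deriv b (F p) x)"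
        by (simp add: D.sum D.scaleR partial_deriv_eq[OF D])
      also have "norm \<dots> \<le> (\<Sum>b\<in>(Basis::'a set). norm v * B)"
        by (intro sum_norm_le) (auto intro!: mult_mono pd Basis_le_norm)
      finally show "norm (D v) \<le> B * real DIM('a) * norm v" by (simp add: mult_ac)
    qed
  qed auto
  moreover have "0 < B * real DIM('a)" using B(1) by simp
  ultimately show ?thesis using that by blast
qed

context algebra_weight
begin

text \<open>Frequencies are cut at a radius \<open>R\<close> beyond which \<open>w / k < e / M\<close>. The high part is then small with
  respect to \<open>w\<close>; the low part has densities supported in a fixed ball with uniformly bounded
  integrals, so that each derivative is bounded uniformly in \<open>y\<close>.\<close>

lemma frequency_splitting:
  assumes k: "k \<in> borel_measurable lebesgue" "\<And>\<xi>. 0 < k \<xi>" "square_integrable (\<lambda>\<xi>. 1 / k \<xi>)"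
    and lim: "((\<lambda>\<xi>. w \<xi> / k \<xi>) \<longlongrightarrow> 0) at_infinity" and h: "\<And>y. fourier_ball k M (h y)" and e: "0 < e"
  obtains S where "unif_smooth S" "\<And>y. fourier_ball w e (\<lambda>x. h y x - S y x)"
proof -
  have M: "0 < M" using fourier_ball_pos[OF h] .
  have "\<forall>\<^sub>F \<xi> in at_infinity. w \<xi> / k \<xi> < e / M"
    using lim by (rule order_tendstoD(2)) (use e M in simp)
  then obtain R0 where R0: "\<And>\<xi>. R0 \<le> norm \<xi> \<Longrightarrow> w \<xi> / k \<xi> < e / M" by (auto simp: eventually_at_infinity)
  define R where "R = max R0 0"
  have "\<forall>y. \<exists>G. integrable lborel G \<and>
     (\<integral>\<^sup>+\<xi>. ennreal ((k \<xi> * norm (G \<xi>))\<^sup>2) \<partial>lebesgue) \<le> ennreal (M\<^sup>2) \<and> (\<forall>x. h y x = fourier G (- x))"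
    using h unfolding fourier_ball_def by blast
  from choice[OF this] obtain G where G: "\<And>y. integrable lborel (G y)"
     "\<And>y. (\<integral>\<^sup>+\<xi>. ennreal ((k \<xi> * norm (G y \<xi>))\<^sup>2) \<partial>lebesgue) \<le> ennreal (M\<^sup>2)"
     "\<And>y x. h y x = fourier (G y) (- x)" by blast
  note Gb[measurable] = integrable_borel[OF G(1)]
  note k(1)[measurable] w_measurable[measurable]
  define lo where "lo = (\<lambda>y \<xi>. indicator (cball 0 R) \<xi> *\<^sub>R G y \<xi>)"
  define hi where "hi = (\<lambda>y \<xi>. indicator (- cball 0 R) \<xi> *\<^sub>R G y \<xi>)"
  have lo_i: "integrable lborel (lo y)" and hi_i: "integrable lborel (hi y)" for y
    unfolding lo_def hi_def using G(1) by (auto intro!: integrable_mult_indicator)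
  have [measurable]: "lo y \<in> borel_measurable borel" for y using integrable_borel[OF lo_i] .
  have hi_le: "w \<xi> * norm (hi y \<xi>) \<le> (e / M) * (k \<xi> * norm (G y \<xi>))" for y \<xi>
  proof (cases "norm \<xi> \<le> R")
    case False
    then have "w \<xi> / k \<xi> < e / M" by (intro R0) (simp add: R_def)
    then have "w \<xi> \<le> (e / M) * k \<xi>" using k(2)[of \<xi>] by (simp add: pos_divide_less_eq)
    then have "w \<xi> * norm (G y \<xi>) \<le> (e / M) * k \<xi> * norm (G y \<xi>)" by (rule mult_right_mono) simp
    then show ?thesis using False by (simp add: hi_def mult.assoc)
  qed (use e M k(2)[of \<xi>] in \<open>simp add: hi_def\<close>)
  have Gl: "G y \<in> borel_measurable lebesgue" for y using Gb by (simp add: measurable_completion)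
  have hi_fourier_ball: "fourier_ball w e (\<lambda>x. fourier (hi y) (- x))" for y
    unfolding fourier_ball_def
  proof (intro conjI exI[of _ "hi y"] allI refl)
    have "(\<integral>\<^sup>+\<xi>. ennreal ((w \<xi> * norm (hi y \<xi>))\<^sup>2) \<partial>lebesgue)
      \<le> (\<integral>\<^sup>+\<xi>. ennreal ((e / M)\<^sup>2) * ennreal ((k \<xi> * norm (G y \<xi>))\<^sup>2) \<partial>lebesgue)"
    proof (rule nn_integral_mono)
      fix \<xi>
      have "(w \<xi> * norm (hi y \<xi>))\<^sup>2 \<le> ((e / M) * (k \<xi> * norm (G y \<xi>)))\<^sup>2"
        using hi_le w_pos[of \<xi>] by (intro power_mono) auto
      then have "ennreal ((w \<xi> * norm (hi y \<xi>))\<^sup>2) \<le> ennreal ((e / M)\<^sup>2 * (k \<xi> * norm (G y \<xi>))\<^sup>2)"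
        by (intro ennreal_leI) (simp only: power_mult_distrib)
      then show "ennreal ((w \<xi> * norm (hi y \<xi>))\<^sup>2) \<le> ennreal ((e / M)\<^sup>2) * ennreal ((k \<xi> * norm (G y \<xi>))\<^sup>2)"
        by (simp add: ennreal_mult)
    qed
    also have "\<dots> = ennreal ((e / M)\<^sup>2) * (\<integral>\<^sup>+\<xi>. ennreal ((k \<xi> * norm (G y \<xi>))\<^sup>2) \<partial>lebesgue)"
      by (rule nn_integral_cmult) (use Gl[of y] in measurable)
    also have "\<dots> \<le> ennreal ((e / M)\<^sup>2) * ennreal (M\<^sup>2)" by (intro mult_left_mono G) simp
    also have "\<dots> = ennreal (e\<^sup>2)" using M by (simp add: ennreal_mult[symmetric] power_divide)
    finally show "(\<integral>\<^sup>+\<xi>. ennreal ((w \<xi> * norm (hi y \<xi>))\<^sup>2) \<partial>lebesgue) \<le> ennreal (e\<^sup>2)" .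
  qed (use e hi_i in auto)
  define S where "S = (\<lambda>y. fourier (\<lambda>\<xi>. lo y (- \<xi>)))"
  have Sx: "S y x = fourier (lo y) (- x)" for y x by (simp add: S_def fourier_reflect)
  have fm: "finite_moments (\<lambda>\<xi>. lo y (- \<xi>))" for y
    unfolding finite_moments_def
  proof (intro conjI allI)
    show "(\<lambda>\<xi>. lo y (- \<xi>)) \<in> borel_measurable borel" by measurable
    fix L
    have "integrable lborel (\<lambda>\<xi>. R ^ L * norm (lo y (- \<xi>)))"
      using lo_i lborel_reflection_invariance(2)[of "lo y"] by simp
    then show "integrable lborel (\<lambda>\<xi>. norm \<xi> ^ L * norm (lo y (- \<xi>)))"
    proof (rule Bochner_Integration.integrable_bound)
      have "norm \<xi> ^ L * norm (lo y (- \<xi>)) \<le> R ^ L * norm (lo y (- \<xi>))" for \<xi>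
        by (cases "norm \<xi> \<le> R") (auto simp: lo_def intro!: mult_right_mono power_mono)
      then show "AE \<xi> in lborel. norm (norm \<xi> ^ L * norm (lo y (- \<xi>))) \<le> norm (R ^ L * norm (lo y (- \<xi>)))"
        by (intro AE_I2) (simp add: R_def)
    qed measurable
  qed
  have "unif_smooth S"
    unfolding unif_smooth_def
  proof (intro conjI allI ballI)
    show "smooth (S y)" for y unfolding S_def by (rule smooth_fourier[OF fm])
    fix bs :: "'a list" assume bs: "bs \<in> lists Basis"
    let ?K = "1 + (L2_norm (\<lambda>\<xi>. 1 / k \<xi>))\<^sup>2"
    have "norm (iter_deriv bs (S y) x) \<le> R ^ length bs * (?K * M)" for y x
    proof -
      have "norm (iter_deriv bs (S y) x) \<le> (\<integral>\<xi>. norm \<xi> ^ length bs * norm (lo y (- \<xi>)) \<partial>lborel)"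
        unfolding S_def by (rule norm_iter_deriv_fourier_le[OF fm bs])
      also have "\<dots> \<le> (\<integral>\<xi>. R ^ length bs * norm (G y (- \<xi>)) \<partial>lborel)"
      proof (rule integral_mono')
        show "integrable lborel (\<lambda>\<xi>. R ^ length bs * norm (G y (- \<xi>)))"
          using G(1) lborel_reflection_invariance(2)[of "G y"] by simp
        show "norm \<xi> ^ length bs * norm (lo y (- \<xi>)) \<le> R ^ length bs * norm (G y (- \<xi>))" for \<xi>
          by (cases "norm \<xi> \<le> R") (auto simp: lo_def R_def intro!: mult_right_mono power_mono)
      qed (simp add: R_def)
      also have "\<dots> = R ^ length bs * (\<integral>\<xi>. norm (G y \<xi>) \<partial>lborel)"
        using lborel_reflection_invariance(1)[of "\<lambda>\<xi>. norm (G y \<xi>)"] by simp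
      also have "\<dots> \<le> R ^ length bs * (?K * M)"
        using weighted_L1_bound(2)[OF k Gb M G(2)] by (intro mult_left_mono) (auto simp: R_def)
      finally show ?thesis .
    qed
    then show "\<exists>B. \<forall>y x. norm (iter_deriv bs (S y) x) \<le> B" by blast
  qed
  moreover have "fourier_ball w e (\<lambda>x. h y x - S y x)" for y
  proof (rule fourier_ball_cong[OF hi_fourier_ball])
    fix x
    have "G y = (\<lambda>\<xi>. lo y \<xi> + hi y \<xi>)" by (auto simp: lo_def hi_def indicator_def)
    then have "h y x = fourier (lo y) (- x) + fourier (hi y) (- x)"
      using fourier_add[OF lo_i hi_i] G(3)[of y x] by metis
    then show "fourier (hi y) (- x) = h y x - S y x" by (simp add: Sx)
  qed
  ultimately show ?thesis by (rule that)
qed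

lemma window_translates:
  assumes "\<And>x. \<omega> x = (\<Sum>z\<in>Y. \<theta> z x * translate z \<psi> x)"
  shows "translate y \<omega> x = (\<Sum>z\<in>Y. translate y (\<theta> z) x * translate (y + z) \<psi> x)"
  using assms[of "x - y"] by (simp add: translate_def diff_diff_eq)

lemma fourier_ball_test_family:
  assumes "\<And>z. z \<in> Y \<Longrightarrow> \<theta> z \<in> test_functions"
  shows "\<exists>C. \<forall>z\<in>Y. \<forall>y. fourier_ball w (C z) (translate y (\<theta> z))"
proof (rule bchoice, rule ballI)
  fix z assume z: "z \<in> Y"
  obtain C where "\<And>y. fourier_ball w C (translate y (\<theta> z))" by (rule fourier_ball_test[OF assms[OF z]]) blast
  then show "\<exists>C. \<forall>y. fourier_ball w C (translate y (\<theta> z))" by blast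
qed

text \<open>The target window is a combination of translates of the given one. The coefficients are test
  functions and act as multipliers on the algebra.\<close>

lemma window_change:
  assumes "\<psi> \<in> test_functions" "\<psi> z \<noteq> 0" "\<omega> \<in> test_functions"
  obtains C where "0 < C" "\<And>f M. (\<And>y. fourier_ball w M (\<lambda>x. translate y \<psi> x * f x)) \<Longrightarrow>
     (\<And>y. fourier_ball w (C * M) (\<lambda>x. translate y \<omega> x * f x))"
proof -
  obtain Y \<theta> where Y: "finite Y" "\<And>y. y \<in> Y \<Longrightarrow> \<theta> y \<in> test_functions"
    "\<And>x. \<omega> x = (\<Sum>y\<in>Y. \<theta> y x * translate y \<psi> x)"
    by (rule test_function_partition[OF assms]) blast
  obtain C where "\<forall>z\<in>Y. \<forall>y. fourier_ball w (C z) (translate y (\<theta> z))"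
    using fourier_ball_test_family[of Y \<theta>] Y(2) by blast
  then have C: "\<And>y z. z \<in> Y \<Longrightarrow> fourier_ball w (C z) (translate y (\<theta> z))" by blast
  have C0: "0 < C z" if "z \<in> Y" for z using fourier_ball_pos[OF C[OF that]] .
  define C' where "C' = 1 + (\<Sum>z\<in>Y. C z)"
  have "0 < C'" unfolding C'_def using C0 by (intro add_pos_nonneg sum_nonneg) (auto intro: less_imp_le)
  moreover have "fourier_ball w (C' * M) (\<lambda>x. translate y \<omega> x * f x)"
    if F: "\<And>y. fourier_ball w M (\<lambda>x. translate y \<psi> x * f x)" for f M y
  proof (cases "Y = {}")
    case True
    then have "translate y \<omega> x * f x = 0" for x by (simp add: translate_def Y(3))
    moreover have "0 < C' * M" using \<open>0 < C'\<close> fourier_ball_pos[OF F] by simp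
    ultimately show ?thesis by (intro fourier_ball_cong[OF fourier_ball_zero]) auto
  next
    case False
    have "fourier_ball w (\<Sum>z\<in>Y. C z * M) (\<lambda>x. \<Sum>z\<in>Y. translate y (\<theta> z) x * (translate (y + z) \<psi> x * f x))"
      by (intro fourier_ball_sum Y(1) False fourier_ball_mult C F)
    then have "fourier_ball w (\<Sum>z\<in>Y. C z * M) (\<lambda>x. translate y \<omega> x * f x)"
      by (rule fourier_ball_cong) (simp add: window_translates[OF Y(3)] sum_distrib_right mult.assoc)
    moreover have "(\<Sum>z\<in>Y. C z * M) \<le> C' * M"
      unfolding C'_def using fourier_ball_pos[OF F] by (simp add: sum_distrib_right[symmetric])
    ultimately show ?thesis by (rule fourier_ball_mono)
  qed
  ultimately show ?thesis by (rule that)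
qed

text \<open>The frequencies are split for the given window; multiplication by the coefficients of
  \<open>test_function_partition\<close> then passes to \<open>\<omega>\<close> and preserves both smooth and small parts.\<close>

lemma window_splitting:
  assumes k: "k \<in> borel_measurable lebesgue" "\<And>\<xi>. 0 < k \<xi>" "square_integrable (\<lambda>\<xi>. 1 / k \<xi>)"
    and lim: "((\<lambda>\<xi>. w \<xi> / k \<xi>) \<longlongrightarrow> 0) at_infinity"
    and \<psi>: "\<psi> \<in> test_functions" "\<psi> z \<noteq> 0" and \<omega>: "\<omega> \<in> test_functions"
    and f: "\<And>y. fourier_ball k M (\<lambda>x. translate y \<psi> x * f x)" and e: "0 < e"
  obtains S where "unif_smooth S" "\<And>y. fourier_ball w e (\<lambda>x. translate y \<omega> x * f x - S y x)"
proof -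
  obtain Y \<theta> where Y: "finite Y" "\<And>y. y \<in> Y \<Longrightarrow> \<theta> y \<in> test_functions"
    "\<And>x. \<omega> x = (\<Sum>y\<in>Y. \<theta> y x * translate y \<psi> x)"
    by (rule test_function_partition[OF \<psi> \<omega>]) blast
  obtain C where "\<forall>z\<in>Y. \<forall>y. fourier_ball w (C z) (translate y (\<theta> z))"
    using fourier_ball_test_family[of Y \<theta>] Y(2) by blast
  then have C: "\<And>y z. z \<in> Y \<Longrightarrow> fourier_ball w (C z) (translate y (\<theta> z))" by blast
  have C0: "0 < C z" if "z \<in> Y" for z using fourier_ball_pos[OF C[OF that]] .
  define C' where "C' = 1 + (\<Sum>z\<in>Y. C z)"
  have C': "0 < C'" unfolding C'_def using C0 by (intro add_pos_nonneg sum_nonneg) (auto intro: less_imp_le)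
  have e': "0 < e / C'" using e C' by simp
  obtain S where S: "unif_smooth S" "\<And>y. fourier_ball w (e / C') (\<lambda>x. translate y \<psi> x * f x - S y x)"
    by (rule frequency_splitting[where h="\<lambda>y x. translate y \<psi> x * f x", OF k lim f e']) blast
  define S' where "S' = (\<lambda>y x. \<Sum>z\<in>Y. translate y (\<theta> z) x * S (y + z) x)"
  have "unif_smooth S'"
    unfolding S'_def by (intro unif_smooth_sum unif_smooth_mult unif_smooth_translate Y(2) unif_smooth_reindex[OF S(1)])
  moreover have "fourier_ball w e (\<lambda>x. translate y \<omega> x * f x - S' y x)" for y
  proof (cases "Y = {}")
    case True
    then have "translate y \<omega> x * f x - S' y x = 0" for x by (simp add: translate_def Y(3) S'_def)
    then show ?thesis using e by (intro fourier_ball_cong[OF fourier_ball_zero]) auto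
  next
    case False
    have "fourier_ball w (\<Sum>z\<in>Y. C z * (e / C')) (\<lambda>x. \<Sum>z\<in>Y. translate y (\<theta> z) x * (translate (y + z) \<psi> x * f x - S (y + z) x))"
      by (intro fourier_ball_sum Y(1) False fourier_ball_mult C S(2))
    then have "fourier_ball w (\<Sum>z\<in>Y. C z * (e / C')) (\<lambda>x. translate y \<omega> x * f x - S' y x)"
      by (rule fourier_ball_cong)
        (simp add: window_translates[OF Y(3)] sum_distrib_right mult.assoc S'_def sum_subtractf right_diff_distrib)
    moreover have "(\<Sum>z\<in>Y. C z * (e / C')) \<le> e"
    proof -
      have "(\<Sum>z\<in>Y. C z * (e / C')) = (\<Sum>z\<in>Y. C z) * (e / C')" by (simp only: sum_distrib_right)
      also have "\<dots> = (C' - 1) * (e / C')" by (simp add: C'_def)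
      also have "\<dots> \<le> C' * (e / C')" using e C' by (intro mult_right_mono) auto
      finally show ?thesis using C' by simp
    qed
    ultimately show ?thesis by (rule fourier_ball_mono)
  qed
  ultimately show ?thesis by (rule that)
qed

text \<open>Telescoping. Writing \<open>e ^ p * (\<eta> / e)\<close> instead of a power with exponent \<open>p - 1\<close> covers \<open>p = 0\<close>.\<close>

lemma fourier_ball_power_diff:
  assumes "fourier_ball w e H" "fourier_ball w e H'" "fourier_ball w \<eta> (\<lambda>x. H x - H' x)"
  shows "fourier_ball w (real (Suc p) * e ^ p * (\<eta> / e)) (\<lambda>x. H x ^ p - H' x ^ p)"
proof (induction p)
  case 0
  have "0 < \<eta> / e" using fourier_ball_pos[OF assms(1)] fourier_ball_pos[OF assms(3)] by simp
  then show ?case by (intro fourier_ball_cong[OF fourier_ball_zero]) auto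
next
  case (Suc p)
  have e: "0 < e" and eta: "0 < \<eta>" using fourier_ball_pos assms by auto
  have "fourier_ball w (e * (real (Suc p) * e ^ p * (\<eta> / e)) + \<eta> * e ^ p) (\<lambda>x. H x ^ Suc p - H' x ^ Suc p)"
  proof (cases p)
    case 0
    show ?thesis using fourier_ball_mono[OF assms(3)] e eta unfolding 0 by simp
  next
    case (Suc i)
    have "fourier_ball w (e * (real (Suc p) * e ^ p * (\<eta> / e)) + \<eta> * e ^ p)
      (\<lambda>x. H x * (H x ^ p - H' x ^ p) + (H x - H' x) * H' x ^ p)"
      unfolding Suc using fourier_ball_power[OF assms(2), of i] Suc.IH[unfolded Suc]
      by (intro fourier_ball_add fourier_ball_mult assms) auto
    then show ?thesis by (rule fourier_ball_cong) (simp add: algebra_simps)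
  qed
  moreover have "e * (real (Suc p) * e ^ p * (\<eta> / e)) + \<eta> * e ^ p = real (Suc (Suc p)) * e ^ Suc p * (\<eta> / e)"
    using e by (simp add: field_simps)
  ultimately show ?case by simp
qed

end

text \<open>With \<open>\<theta> = t ^ L\<close> the claim reduces to the boundedness of \<open>m * t ^ m\<close>.\<close>

lemma poly_times_geometric_bounded:
  fixes \<theta> :: real
  assumes "0 \<le> \<theta>" "\<theta> < 1"
  obtains A where "0 < A" "\<And>m. real (Suc m) ^ L * \<theta> ^ m \<le> A"
proof (cases "L = 0")
  case True
  then show ?thesis using assms by (intro that[of 1]) (auto simp: power_le_one)
next
  case False
  define t where "t = root L \<theta>"
  have t: "0 \<le> t" "t ^ L = \<theta>" using False assms by (auto simp: t_def)
  have t1: "t < 1" using assms False real_root_less_iff[of L \<theta> 1] by (simp add: t_def)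
  have "(\<lambda>n. of_nat n * t ^ n) \<longlonglongrightarrow> 0" by (rule powser_times_n_limit_0) (use t t1 in simp)
  then have "Bseq (\<lambda>n. real n * t ^ n)" by (intro convergent_imp_Bseq convergentI)
  then obtain K where K: "0 < K" "\<And>n. norm (real n * t ^ n) \<le> K" by (auto simp: Bseq_def)
  have "real (Suc m) ^ L * \<theta> ^ m \<le> (K + 1) ^ L" for m
  proof -
    have "real m * t ^ m \<le> K" using K(2)[of m] t(1) by simp
    moreover have "t ^ m \<le> 1" using t(1) t1 by (simp add: power_le_one)
    ultimately have "real (Suc m) * t ^ m \<le> K + 1" by (simp add: distrib_right)
    then have "(real (Suc m) * t ^ m) ^ L \<le> (K + 1) ^ L" using t(1) by (intro power_mono) auto
    moreover have "(real (Suc m) * t ^ m) ^ L = real (Suc m) ^ L * \<theta> ^ m"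
      by (simp only: power_mult_distrib t(2)[symmetric] power_mult[symmetric] mult.commute)
    ultimately show ?thesis by simp
  qed
  then show ?thesis using K(1) by (intro that[of "(K + 1) ^ L"]) auto
qed

context algebra_weight
begin

text \<open>A bound for the spectral radius: the radius needed for the windowed \<open>T\<close> itself may be large, but by
  the binomial theorem and \<open>unif_smooth_power_bound\<close> the powers of \<open>T + H\<close> grow like \<open>(s + e) ^ m\<close> up
  to a polynomial factor, which any \<open>q > s + e\<close> absorbs. The second estimate has
  \<open>fourier_ball_power_diff\<close> in the role of \<open>fourier_ball_power\<close>.\<close>

lemma power_estimate:
  fixes T :: "'p \<Rightarrow> 'a \<Rightarrow> complex"
  assumes T: "unif_smooth T" and \<omega>: "\<omega> \<in> test_functions" "0 \<le> r" "\<And>x. x \<notin> cball 0 r \<Longrightarrow> \<omega> x = 0"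
    and s: "0 < s" "0 < e" "s + e < q" and Ts: "\<And>p x. x \<in> cball (c p) r \<Longrightarrow> norm (T p x) \<le> s"
  obtains A where "0 < A"
    "\<And>p H m. fourier_ball w e H \<Longrightarrow> fourier_ball w (A * q ^ m) (\<lambda>x. translate (c p) \<omega> x * (T p x + H x) ^ m)"
    "\<And>p H H' \<eta> m. fourier_ball w e H \<Longrightarrow> fourier_ball w e H' \<Longrightarrow> fourier_ball w \<eta> (\<lambda>x. H x - H' x) \<Longrightarrow>
       fourier_ball w (A * \<eta> * q ^ m) (\<lambda>x. translate (c p) \<omega> x * ((T p x + H x) ^ m - (T p x + H' x) ^ m))"
proof -
  obtain C L where C: "0 < C" "\<And>\<phi> y B. \<lbrakk>\<phi> \<in> test_functions; \<And>x. x \<notin> cball y r \<Longrightarrow> \<phi> x = 0; 0 < B;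
     \<And>bs x. bs \<in> lists Basis \<Longrightarrow> length bs \<le> L \<Longrightarrow> norm (iter_deriv bs \<phi> x) \<le> B\<rbrakk> \<Longrightarrow> fourier_ball w (C * B) \<phi>"
    by (rule fourier_ball_test_function[OF \<omega>(2)]) blast
  have out: "translate (c p) \<omega> x = 0" if "x \<notin> cball (c p) r" for p x
    using \<omega>(3)[of "x - c p"] that by (auto simp: translate_def dist_norm norm_minus_commute)
  have "\<exists>D>0. \<forall>p x j. norm (iter_deriv bs (\<lambda>x. translate (c p) \<omega> x * T p x ^ j) x) \<le> D * real (Suc j) ^ length bs * s ^ j"
    if bs: "bs \<in> lists Basis" for bs
    by (rule unif_smooth_power_bound[OF bs unif_smooth_translate[OF \<omega>(1)] T s(1), where U="\<lambda>p. cball (c p) r"])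
      (use Ts out in auto)
  then have "\<forall>bs. \<exists>D. bs \<in> lists Basis \<longrightarrow> 0 < D \<and> (\<forall>p x j. norm (iter_deriv bs (\<lambda>x. translate (c p) \<omega> x * T p x ^ j) x) \<le> D * real (Suc j) ^ length bs * s ^ j)"
    by blast
  from choice[OF this] obtain D where D: "\<And>bs. bs \<in> lists Basis \<Longrightarrow> 0 < D bs"
    "\<And>bs p x j. bs \<in> lists Basis \<Longrightarrow> norm (iter_deriv bs (\<lambda>x. translate (c p) \<omega> x * T p x ^ j) x) \<le> D bs * real (Suc j) ^ length bs * s ^ j"
    by blast
  have fin: "finite {bs \<in> lists (Basis :: 'a set). length bs \<le> L}"
    by (rule finite_subset[OF _ finite_lists_length_le[OF finite_Basis, of L]]) auto
  define D' where "D' = 1 + (\<Sum>bs | bs \<in> lists (Basis :: 'a set) \<and> length bs \<le> L. D bs)"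
  have D'0: "0 < D'" unfolding D'_def using D(1) by (intro add_pos_nonneg sum_nonneg) (auto intro: less_imp_le)
  have base: "fourier_ball w (C * (D' * real (Suc j) ^ L * s ^ j)) (\<lambda>x. translate (c p) \<omega> x * T p x ^ j)" for p j
  proof (rule C(2))
    show "(\<lambda>x. translate (c p) \<omega> x * T p x ^ j) \<in> test_functions"
      by (intro test_mult_left test_translate \<omega> smooth_power unif_smoothD[OF T])
    show "translate (c p) \<omega> x * T p x ^ j = 0" if "x \<notin> cball (c p) r" for x using out[OF that] by simp
    show "0 < D' * real (Suc j) ^ L * s ^ j" using D'0 s(1) by simp
    fix bs :: "'a list" and x assume bs: "bs \<in> lists Basis" "length bs \<le> L"
    have "norm (iter_deriv bs (\<lambda>x. translate (c p) \<omega> x * T p x ^ j) x) \<le> D bs * real (Suc j) ^ length bs * s ^ j"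
      by (rule D(2)[OF bs(1)])
    also have "\<dots> \<le> D' * real (Suc j) ^ L * s ^ j"
    proof -
      have "D bs \<le> (\<Sum>bs | bs \<in> lists (Basis :: 'a set) \<and> length bs \<le> L. D bs)"
        using fin bs D(1) by (intro member_le_sum) (auto intro: less_imp_le)
      then have "D bs \<le> D'" by (simp add: D'_def)
      moreover have "real (Suc j) ^ length bs \<le> real (Suc j) ^ L" using bs(2) by (intro power_increasing) auto
      ultimately show ?thesis using D(1)[OF bs(1)] D'0 s(1) by (intro mult_right_mono mult_mono) auto
    qed
    finally show "norm (iter_deriv bs (\<lambda>x. translate (c p) \<omega> x * T p x ^ j) x) \<le> D' * real (Suc j) ^ L * s ^ j" .
  qed
  define E where "E = C * D'"
  have E: "0 < E" using C(1) D'0 by (simp add: E_def)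
  have base: "fourier_ball w (E * real (Suc m) ^ L * s ^ j) (\<lambda>x. translate (c p) \<omega> x * T p x ^ j)" if "j \<le> m" for p j m
  proof (rule fourier_ball_mono[OF base])
    have "real (Suc j) ^ L \<le> real (Suc m) ^ L" using that by (intro power_mono) auto
    then have "E * real (Suc j) ^ L * s ^ j \<le> E * real (Suc m) ^ L * s ^ j"
      using E s(1) by (intro mult_right_mono mult_left_mono) auto
    then show "C * (D' * real (Suc j) ^ L * s ^ j) \<le> E * real (Suc m) ^ L * s ^ j" by (simp add: E_def mult.assoc)
  qed
  have q0: "0 < q" using s by linarith
  have "0 \<le> (s + e) / q" "(s + e) / q < 1" using s q0 by auto
  then obtain K where K: "0 < K" "\<And>m. real (Suc m) ^ Suc L * ((s + e) / q) ^ m \<le> K"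
    by (rule poly_times_geometric_bounded[where L="Suc L"]) blast
  have Kq: "real (Suc m) ^ Suc L * (s + e) ^ m \<le> K * q ^ m" for m
    using mult_right_mono[OF K(2)[of m], of "q ^ m"] q0 by (simp add: power_divide)
  define A where "A = E * K * (1 + 1 / e)"
  have A: "0 < A" unfolding A_def using E K(1) s(2) by (intro mult_pos_pos) (auto intro: add_pos_pos)
  have binom: "(\<Sum>j\<le>m. real (m choose j) * (E * real (Suc m) ^ L * s ^ j) * e ^ (m - j)) = E * real (Suc m) ^ L * (s + e) ^ m" for m
    unfolding binomial_ring[of s e m] sum_distrib_left by (intro sum.cong) (auto simp: mult_ac)
  show ?thesis
  proof (rule that[OF A])
    fix p H m assume H: "fourier_ball w e H"
    have "fourier_ball w (\<Sum>j\<le>m. real (m choose j) * (E * real (Suc m) ^ L * s ^ j) * e ^ (m - j))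
      (\<lambda>x. \<Sum>j\<le>m. of_nat (m choose j) * (translate (c p) \<omega> x * T p x ^ j * H x ^ (m - j)))"
    proof (rule fourier_ball_sum)
      fix j assume j: "j \<in> {..m}"
      have "fourier_ball w ((E * real (Suc m) ^ L * s ^ j) * e ^ (m - j)) (\<lambda>x. translate (c p) \<omega> x * T p x ^ j * H x ^ (m - j))"
      proof (cases "m - j")
        case 0
        then show ?thesis using base[of j m p] j by simp
      next
        case (Suc i)
        show ?thesis unfolding Suc by (rule fourier_ball_mult[OF base fourier_ball_power[OF H]]) (use j in auto)
      qed
      moreover have "0 < real (m choose j) * (E * real (Suc m) ^ L * s ^ j) * e ^ (m - j)" using j E s by simp
      ultimately show "fourier_ball w (real (m choose j) * (E * real (Suc m) ^ L * s ^ j) * e ^ (m - j))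
         (\<lambda>x. of_nat (m choose j) * (translate (c p) \<omega> x * T p x ^ j * H x ^ (m - j)))"
        by (intro fourier_ball_cmult) (auto simp: mult.assoc)
    qed auto
    then have "fourier_ball w (E * real (Suc m) ^ L * (s + e) ^ m) (\<lambda>x. translate (c p) \<omega> x * (T p x + H x) ^ m)"
      unfolding binom by (rule fourier_ball_cong) (simp add: binomial_ring sum_distrib_left mult_ac)
    moreover have "E * real (Suc m) ^ L * (s + e) ^ m \<le> A * q ^ m"
    proof -
      have "real (Suc m) ^ L \<le> real (Suc m) ^ Suc L" by (rule power_increasing) auto
      then have "E * real (Suc m) ^ L * (s + e) ^ m \<le> E * real (Suc m) ^ Suc L * (s + e) ^ m"
        using E s by (intro mult_right_mono mult_left_mono) auto
      also have "\<dots> = E * (real (Suc m) ^ Suc L * (s + e) ^ m)" by (rule mult.assoc)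
      also have "\<dots> \<le> E * (K * q ^ m)" using E by (intro mult_left_mono Kq) auto
      also have "\<dots> = E * K * 1 * q ^ m" by simp
      also have "\<dots> \<le> A * q ^ m"
        unfolding A_def using E K(1) s(2) q0 by (intro mult_right_mono mult_left_mono) auto
      finally show ?thesis .
    qed
    ultimately show "fourier_ball w (A * q ^ m) (\<lambda>x. translate (c p) \<omega> x * (T p x + H x) ^ m)" by (rule fourier_ball_mono)
  next
    fix p H H' \<eta> m assume H: "fourier_ball w e H" "fourier_ball w e H'" "fourier_ball w \<eta> (\<lambda>x. H x - H' x)"
    have eta: "0 < \<eta>" by (rule fourier_ball_pos[OF H(3)])
    have "fourier_ball w (\<Sum>j\<le>m. real (m choose j) * (E * real (Suc m) ^ L * s ^ j) * e ^ (m - j) * (real (Suc m) * (\<eta> / e)))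
      (\<lambda>x. \<Sum>j\<le>m. of_nat (m choose j) * ((translate (c p) \<omega> x * T p x ^ j) * (H x ^ (m - j) - H' x ^ (m - j))))"
    proof (rule fourier_ball_sum)
      fix j assume j: "j \<in> {..m}"
      have "fourier_ball w ((E * real (Suc m) ^ L * s ^ j) * (real (Suc (m - j)) * e ^ (m - j) * (\<eta> / e)))
         (\<lambda>x. (translate (c p) \<omega> x * T p x ^ j) * (H x ^ (m - j) - H' x ^ (m - j)))"
        by (rule fourier_ball_mult[OF base fourier_ball_power_diff[OF H]]) (use j in auto)
      moreover have "(E * real (Suc m) ^ L * s ^ j) * (real (Suc (m - j)) * e ^ (m - j) * (\<eta> / e))
        \<le> (E * real (Suc m) ^ L * s ^ j) * e ^ (m - j) * (real (Suc m) * (\<eta> / e))"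
      proof -
        have "real (Suc (m - j)) * (e ^ (m - j) * (\<eta> / e)) \<le> real (Suc m) * (e ^ (m - j) * (\<eta> / e))"
          using s eta by (intro mult_right_mono) auto
        then have "(E * real (Suc m) ^ L * s ^ j) * (real (Suc (m - j)) * (e ^ (m - j) * (\<eta> / e)))
            \<le> (E * real (Suc m) ^ L * s ^ j) * (real (Suc m) * (e ^ (m - j) * (\<eta> / e)))"
          using E s by (intro mult_left_mono) auto
        then show ?thesis by (simp only: mult_ac)
      qed
      ultimately have "fourier_ball w ((E * real (Suc m) ^ L * s ^ j) * e ^ (m - j) * (real (Suc m) * (\<eta> / e)))
         (\<lambda>x. (translate (c p) \<omega> x * T p x ^ j) * (H x ^ (m - j) - H' x ^ (m - j)))"
        by (rule fourier_ball_mono)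
      moreover have "0 < real (m choose j) * (E * real (Suc m) ^ L * s ^ j) * e ^ (m - j) * (real (Suc m) * (\<eta> / e))"
        using j E s eta by simp
      ultimately show "fourier_ball w (real (m choose j) * (E * real (Suc m) ^ L * s ^ j) * e ^ (m - j) * (real (Suc m) * (\<eta> / e)))
         (\<lambda>x. of_nat (m choose j) * ((translate (c p) \<omega> x * T p x ^ j) * (H x ^ (m - j) - H' x ^ (m - j))))"
        by (intro fourier_ball_cmult) (auto simp: mult.assoc)
    qed auto
    then have "fourier_ball w (E * real (Suc m) ^ L * (s + e) ^ m * (real (Suc m) * (\<eta> / e)))
       (\<lambda>x. translate (c p) \<omega> x * ((T p x + H x) ^ m - (T p x + H' x) ^ m))"
      unfolding sum_distrib_right[symmetric] binom
      by (rule fourier_ball_cong) (simp add: binomial_ring sum_distrib_left sum_subtractf right_diff_distrib mult_ac)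
    moreover have "E * real (Suc m) ^ L * (s + e) ^ m * (real (Suc m) * (\<eta> / e)) \<le> A * \<eta> * q ^ m"
    proof -
      have "E * real (Suc m) ^ L * (s + e) ^ m * (real (Suc m) * (\<eta> / e)) = E * (\<eta> / e) * (real (Suc m) ^ Suc L * (s + e) ^ m)"
        by simp
      also have "\<dots> \<le> E * (\<eta> / e) * (K * q ^ m)" using E eta s by (intro mult_left_mono Kq) auto
      also have "\<dots> = (E * K * (1 / e)) * (\<eta> * q ^ m)" by simp
      also have "\<dots> \<le> A * (\<eta> * q ^ m)"
        unfolding A_def using E K(1) eta q0 s(2) by (intro mult_right_mono mult_left_mono) auto
      finally show ?thesis by (simp only: mult.assoc)
    qed
    ultimately show "fourier_ball w (A * \<eta> * q ^ m) (\<lambda>x. translate (c p) \<omega> x * ((T p x + H x) ^ m - (T p x + H' x) ^ m))"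
      by (rule fourier_ball_mono)
  qed
qed

end

section \<open>Power series of holomorphic functions of several variables\<close>

definition coord_upd :: "complex ^ 'd \<Rightarrow> 'd \<Rightarrow> complex \<Rightarrow> complex ^ 'd" where
  "coord_upd z i v = (\<chi> j. if j = i then v else z $ j)"

definition polydisc :: "complex ^ 'd \<Rightarrow> real \<Rightarrow> (complex ^ 'd) set" where
  "polydisc a r = {z. \<forall>i. norm (z $ i - a $ i) < r}"

text \<open>Continuity together with holomorphy in each variable is inherited by the Taylor coefficients with
  respect to one variable, as functions of the others.\<close>

definition sep_holomorphic :: "complex ^ 'd \<Rightarrow> real \<Rightarrow> (complex ^ 'd \<Rightarrow> complex) \<Rightarrow> bool" where
  "sep_holomorphic a r \<Phi> \<longleftrightarrow> continuous_on (polydisc a r) \<Phi> \<and>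
     (\<forall>z\<in>polydisc a r. \<forall>i. (\<lambda>v. \<Phi> (coord_upd z i v)) holomorphic_on ball (a $ i) r)"

lemma coord_upd_nth [simp]: "coord_upd z i v $ j = (if j = i then v else z $ j)"
  by (simp add: coord_upd_def)

lemma coord_upd_same [simp]: "coord_upd (coord_upd z i u) i v = coord_upd z i v"
  by (simp add: vec_eq_iff)

lemma coord_upd_commute: "i \<noteq> j \<Longrightarrow> coord_upd (coord_upd z i u) j v = coord_upd (coord_upd z j v) i u"
  by (auto simp: vec_eq_iff)

lemma coord_upd_id [simp]: "coord_upd z i (z $ i) = z"
  by (simp add: vec_eq_iff)

lemma coord_upd_polydisc: "z \<in> polydisc a r \<Longrightarrow> v \<in> ball (a $ i) r \<Longrightarrow> coord_upd z i v \<in> polydisc a r"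
  by (auto simp: polydisc_def dist_norm norm_minus_commute)

lemma polydisc_nth: "z \<in> polydisc a r \<Longrightarrow> z $ i \<in> ball (a $ i) r"
  by (simp add: polydisc_def dist_norm norm_minus_commute)

lemma coord_upd_affine: "coord_upd z i v = coord_upd z i u + (v - u) *s axis i 1"
  by (auto simp: vec_eq_iff axis_def)

lemma sep_holomorphic_of_several:
  fixes \<Phi> :: "complex ^ 'd \<Rightarrow> complex"
  assumes \<Phi>: "holomorphic_several \<Phi> \<Omega>" and sub: "polydisc a r \<subseteq> \<Omega>"
  shows "sep_holomorphic a r \<Phi>"
  unfolding sep_holomorphic_def
proof (intro conjI ballI allI)
  show "continuous_on (polydisc a r) \<Phi>"
  proof (rule continuous_at_imp_continuous_on, rule ballI)
    fix z assume "z \<in> polydisc a r"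
    then obtain D where "(\<Phi> has_derivative D) (at z)" using \<Phi> sub unfolding holomorphic_several_def by blast
    then show "isCont \<Phi> z" by (rule has_derivative_continuous)
  qed
  fix z i assume z: "z \<in> polydisc a r"
  show "(\<lambda>v. \<Phi> (coord_upd z i v)) holomorphic_on ball (a $ i) r"
    unfolding holomorphic_on_def
  proof (rule ballI)
    fix v assume "v \<in> ball (a $ i) r"
    then have "coord_upd z i v \<in> \<Omega>" using sub coord_upd_polydisc[OF z] by blast
    then obtain D where D: "(\<Phi> has_derivative D) (at (coord_upd z i v))" "\<And>c x. D (c *s x) = c * D x"
      using \<Phi> unfolding holomorphic_several_def by blast
    have "linear (\<lambda>h::complex. h *s (axis i 1 :: complex ^ 'd))"
      by (rule linearI) (auto simp: vec_eq_iff algebra_simps)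
    then have bl: "bounded_linear (\<lambda>h::complex. h *s (axis i 1 :: complex ^ 'd))"
      by (simp add: linear_conv_bounded_linear)
    have "((\<lambda>v'. coord_upd z i v + (v' - v) *s axis i 1) has_derivative (\<lambda>h. 0 + (h - 0) *s axis i 1)) (at v)"
      by (intro has_derivative_add has_derivative_const bounded_linear.has_derivative[OF bl] has_derivative_diff has_derivative_ident)
    moreover have "(\<lambda>v'. coord_upd z i v + (v' - v) *s axis i 1) = coord_upd z i"
      by (rule ext) (rule coord_upd_affine[symmetric])
    ultimately have "(coord_upd z i has_derivative (\<lambda>h. h *s axis i 1)) (at v)" by simp
    from has_derivative_compose[OF this D(1)]
    have "((\<lambda>v. \<Phi> (coord_upd z i v)) has_derivative (\<lambda>h. D (h *s axis i 1))) (at v)" .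
    moreover have "(\<lambda>h. D (h *s axis i 1)) = (*) (D (axis i 1))" by (auto simp: D(2) mult.commute)
    ultimately have "((\<lambda>v. \<Phi> (coord_upd z i v)) has_field_derivative D (axis i 1)) (at v)"
      unfolding has_field_derivative_def by simp
    then show "(\<lambda>v. \<Phi> (coord_upd z i v)) field_differentiable at v within ball (a $ i) r"
      using field_differentiable_at_within field_differentiable_def by blast
  qed
qed

lemma sep_holomorphic_fix_coord:
  assumes \<Phi>: "sep_holomorphic a r \<Phi>" and v: "v \<in> ball (a $ i) r"
  shows "sep_holomorphic a r (\<lambda>z. \<Phi> (coord_upd z i v))"
  unfolding sep_holomorphic_def
proof (intro conjI ballI allI)
  have "continuous_on (polydisc a r) (\<lambda>z. if j = i then v else z $ j)" for j
    by (cases "j = i") (auto intro!: continuous_intros)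
  then have c: "continuous_on (polydisc a r) (\<lambda>z. coord_upd z i v)"
    unfolding coord_upd_def by (rule continuous_on_vec_lambda)
  have c\<Phi>: "continuous_on (polydisc a r) \<Phi>" using \<Phi> by (simp add: sep_holomorphic_def)
  show "continuous_on (polydisc a r) (\<lambda>z. \<Phi> (coord_upd z i v))"
    by (rule continuous_on_compose2[OF c\<Phi> c]) (use coord_upd_polydisc[OF _ v] in blast)
  fix z j assume z: "z \<in> polydisc a r"
  show "(\<lambda>u. \<Phi> (coord_upd (coord_upd z j u) i v)) holomorphic_on ball (a $ j) r"
  proof (cases "j = i")
    case False
    then have "(\<lambda>u. \<Phi> (coord_upd (coord_upd z j u) i v)) = (\<lambda>u. \<Phi> (coord_upd (coord_upd z i v) j u))"
      by (simp add: coord_upd_commute)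
    then show ?thesis using \<Phi> coord_upd_polydisc[OF z v] by (simp add: sep_holomorphic_def)
  qed simp
qed

lemma sep_holomorphic_sum:
  assumes "\<And>l. l \<in> I \<Longrightarrow> sep_holomorphic a r (F l)"
  shows "sep_holomorphic a r (\<lambda>z. \<Sum>l\<in>I. F l z * c l)"
  using assms unfolding sep_holomorphic_def
  by (auto intro!: continuous_intros holomorphic_intros)

lemma sep_holomorphic_uniform_limit:
  assumes F: "\<And>n. sep_holomorphic a r (F n)" and lim: "uniform_limit (polydisc a r) F G sequentially"
  shows "sep_holomorphic a r G"
  unfolding sep_holomorphic_def
proof (intro conjI ballI allI)
  show "continuous_on (polydisc a r) G"
    by (rule uniform_limit_theorem[OF _ lim]) (use F in \<open>auto simp: sep_holomorphic_def\<close>)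
  fix z i assume z: "z \<in> polydisc a r"
  show "(\<lambda>v. G (coord_upd z i v)) holomorphic_on ball (a $ i) r"
  proof (rule holomorphic_uniform_sequence)
    show "(\<lambda>v. F n (coord_upd z i v)) holomorphic_on ball (a $ i) r" for n
      using F z by (simp add: sep_holomorphic_def)
    fix v assume "v \<in> ball (a $ i) r"
    then obtain d where d: "0 < d" "cball v d \<subseteq> ball (a $ i) r" using open_contains_cball open_ball by blast
    have "uniform_limit (cball v d) (\<lambda>n v. F n (coord_upd z i v)) (\<lambda>v. G (coord_upd z i v)) sequentially"
    proof (rule uniform_limitI)
      fix e :: real assume "0 < e"
      with lim have "\<forall>\<^sub>F n in sequentially. \<forall>z\<in>polydisc a r. dist (F n z) (G z) < e" by (rule uniform_limitD)
      then show "\<forall>\<^sub>F n in sequentially. \<forall>v\<in>cball v d. dist (F n (coord_upd z i v)) (G (coord_upd z i v)) < e"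
        by eventually_elim (use coord_upd_polydisc[OF z] d(2) in blast)
    qed
    with d show "\<exists>d>0. cball v d \<subseteq> ball (a $ i) r \<and>
      uniform_limit (cball v d) (\<lambda>n v. F n (coord_upd z i v)) (\<lambda>v. G (coord_upd z i v)) sequentially" by blast
  qed simp
qed

definition root_unity :: "nat \<Rightarrow> nat \<Rightarrow> complex" where
  "root_unity N l = exp (2 * of_real pi * \<i> * of_nat l / of_nat N)"

lemma root_unity_power: "root_unity N l ^ p = root_unity N p ^ l"
  by (simp add: root_unity_def exp_of_nat_mult[symmetric] mult_ac)

lemma norm_root_unity [simp]: "norm (root_unity N l) = 1"
  by (simp add: root_unity_def norm_exp_eq_Re)

lemma root_unity_orthogonality:
  assumes "m < N" "p < N" "p \<noteq> m"
  shows "(\<Sum>l<N. root_unity N l ^ p / root_unity N l ^ m) = 0"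
proof -
  define x where "x = root_unity N p / root_unity N m"
  have nz: "root_unity N m \<noteq> 0" by (simp add: root_unity_def)
  have one: "root_unity N l ^ N = 1" for l
  proof -
    have "root_unity N l ^ N = exp (of_nat l * (2 * of_real pi * \<i>))"
      using assms by (simp add: root_unity_def exp_of_nat_mult[symmetric] mult_ac)
    also have "\<dots> = exp (2 * of_real pi * \<i>) ^ l" by (rule exp_of_nat_mult)
    finally show ?thesis by simp
  qed
  have "root_unity N p \<noteq> root_unity N m"
    using complex_root_unity_eq[of N p m] assms by (simp add: root_unity_def)
  then have x: "x \<noteq> 1" "x ^ N = 1" using nz by (auto simp: x_def power_divide one)
  have "(\<Sum>l<N. root_unity N l ^ p / root_unity N l ^ m) = (\<Sum>l<N. x ^ l)"
    by (simp add: x_def power_divide root_unity_power[of N _ p] root_unity_power[of N _ m])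
  also have "\<dots> = 0" using geometric_sum[OF x(1), of N] x(2) by simp
  finally show ?thesis .
qed

text \<open>In the average over the \<open>N\<close>-th roots of unity the coefficients of index below \<open>N\<close> other than the
  \<open>m\<close>-th cancel. On a circle of less than a quarter of the radius the later ones contribute an
  error that depends on \<open>g\<close> only through \<open>B\<close>. Finite averages thus replace Cauchy integrals with
  parameters.\<close>

lemma root_unity_average:
  fixes g :: "complex \<Rightarrow> complex"
  assumes g: "g holomorphic_on ball a r" and B: "\<And>v. v \<in> ball a r \<Longrightarrow> norm (g v) \<le> B"
    and \<rho>: "0 < \<rho>" "4 * \<rho> < r" and N: "m < N"
  shows "norm ((\<Sum>l<N. g (a + of_real \<rho> * root_unity N l) * (1 / (of_nat N * (of_real \<rho> * root_unity N l) ^ m)))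
     - (deriv ^^ m) g a / fact m) \<le> 2 * B / \<rho> ^ m * (1/2) ^ N"
proof -
  define c where "c = (\<lambda>p. (deriv ^^ p) g a / fact p)"
  have B0: "0 \<le> B" using order_trans[OF norm_ge_zero B[of a]] \<rho> by simp
  have sub: "cball a (4 * \<rho>) \<subseteq> ball a r" using \<rho> by auto
  have c_le: "norm (c p) \<le> B / (4 * \<rho>) ^ p" for p
  proof -
    have "norm ((deriv ^^ p) g a) \<le> fact p * B / (4 * \<rho>) ^ p"
    proof (rule Cauchy_inequality)
      show "g holomorphic_on ball a (4 * \<rho>)" using g sub ball_subset_cball holomorphic_on_subset by blast
      show "continuous_on (cball a (4 * \<rho>)) g" using g sub continuous_on_subset holomorphic_on_imp_continuous_on by blast
      show "norm (g x) \<le> B" if "norm (a - x) = 4 * \<rho>" for x using that \<rho> by (intro B) (auto simp: dist_norm)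
    qed (use \<rho> in auto)
    then show ?thesis by (simp add: c_def norm_divide divide_le_eq mult.commute)
  qed
  let ?e = "\<lambda>l. of_real \<rho> * root_unity N l"
  have nz: "?e l \<noteq> 0" for l using \<rho> by (simp add: root_unity_def)
  define S where "S = (\<lambda>p. \<Sum>l<N. root_unity N l ^ p / root_unity N l ^ m)"
  have S_le: "norm (S p) \<le> real N" for p
    unfolding S_def by (rule order_trans[OF norm_sum]) (simp add: norm_divide norm_power)
  have S0: "S p = 0" if "p < N" "p \<noteq> m" for p unfolding S_def by (rule root_unity_orthogonality[OF N that])
  have Sm: "S m = of_nat N" unfolding S_def by (simp add: root_unity_def)
  have "(\<lambda>p. c p * (?e l) ^ p * (1 / (of_nat N * ?e l ^ m))) sums (g (a + ?e l) * (1 / (of_nat N * ?e l ^ m)))" for l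
  proof (rule sums_mult2)
    have "a + ?e l \<in> ball a r" using \<rho> by (simp add: dist_norm norm_mult)
    from holomorphic_power_series[OF g this] show "(\<lambda>p. c p * ?e l ^ p) sums g (a + ?e l)" by (simp add: c_def)
  qed
  then have "(\<lambda>p. \<Sum>l<N. c p * (?e l) ^ p * (1 / (of_nat N * ?e l ^ m))) sums (\<Sum>l<N. g (a + ?e l) * (1 / (of_nat N * ?e l ^ m)))"
    by (intro sums_sum)
  moreover have "(\<Sum>l<N. c p * (?e l) ^ p * (1 / (of_nat N * ?e l ^ m))) = c p * of_real \<rho> ^ p / of_real \<rho> ^ m * S p / of_nat N" for p
    unfolding S_def by (simp add: sum_distrib_left sum_divide_distrib power_mult_distrib mult_ac)
  ultimately have s1: "(\<lambda>p. c p * of_real \<rho> ^ p / of_real \<rho> ^ m * S p / of_nat N) sums (\<Sum>l<N. g (a + ?e l) * (1 / (of_nat N * ?e l ^ m)))"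
    by simp
  have s2: "(\<lambda>p. if p = m then c m else 0) sums c m" using sums_single[of m "\<lambda>_. c m"] by simp
  let ?d = "\<lambda>p. c p * of_real \<rho> ^ p / of_real \<rho> ^ m * S p / of_nat N - (if p = m then c m else 0)"
  have d_le: "norm (?d p) \<le> B / \<rho> ^ m * (1/2) ^ N * (1/2) ^ p" for p
  proof (cases "p < N")
    case True
    have "?d p = 0" using True N \<rho> by (cases "p = m") (auto simp: S0 Sm)
    then show ?thesis using B0 \<rho> by simp
  next
    case False
    then have "norm (?d p) = norm (c p) * \<rho> ^ p / \<rho> ^ m * norm (S p) / real N"
      using N \<rho> by (auto simp: norm_mult norm_divide norm_power)
    also have "\<dots> \<le> (B / (4 * \<rho>) ^ p) * \<rho> ^ p / \<rho> ^ m * real N / real N"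
      using \<rho> B0 by (intro divide_right_mono mult_mono c_le S_le) auto
    also have "\<dots> = B / \<rho> ^ m * (1/4) ^ p" using \<rho> N by (simp add: power_mult_distrib power_divide)
    also have "(1/4 :: real) ^ p = (1/2) ^ p * (1/2) ^ p" by (simp add: power_mult_distrib[symmetric])
    also have "B / \<rho> ^ m * ((1/2) ^ p * (1/2) ^ p) \<le> B / \<rho> ^ m * ((1/2) ^ N * (1/2) ^ p)"
      using False B0 \<rho> by (intro mult_left_mono mult_right_mono power_decreasing) auto
    finally show ?thesis by (simp add: mult.assoc)
  qed
  have geo: "(\<lambda>p. B / \<rho> ^ m * (1/2) ^ N * (1/2) ^ p) sums (B / \<rho> ^ m * (1/2) ^ N * 2)"
    using sums_mult[OF geometric_sums[of "1/2 :: real"], of "B / \<rho> ^ m * (1/2) ^ N"] by simp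
  have "(\<Sum>l<N. g (a + ?e l) * (1 / (of_nat N * ?e l ^ m))) - c m = suminf ?d"
    using sums_diff[OF s1 s2] by (simp add: sums_iff)
  also have "norm \<dots> \<le> (\<Sum>p. B / \<rho> ^ m * (1/2) ^ N * (1/2) ^ p)"
    by (rule norm_suminf_le[OF d_le]) (use geo in \<open>auto simp: sums_iff\<close>)
  also have "\<dots> = 2 * B / \<rho> ^ m * (1/2) ^ N" using geo by (simp add: sums_iff)
  finally show ?thesis by (simp add: c_def)
qed

text \<open>The Taylor coefficients in the \<open>i\<close>-th variable are uniform limits of averages of values of \<open>\<Phi>\<close>,
  hence separately holomorphic in the remaining variables.\<close>

lemma coordinate_power_series:
  fixes \<Phi> :: "complex ^ 'd \<Rightarrow> complex"
  assumes \<Phi>: "sep_holomorphic a r \<Phi>" and B: "\<And>z. z \<in> polydisc a r \<Longrightarrow> norm (\<Phi> z) \<le> B"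
    and \<rho>: "0 < \<rho>" "\<rho> < r"
  shows "\<exists>c. (\<forall>m. sep_holomorphic a r (c m)) \<and> (\<forall>m. \<forall>z\<in>polydisc a r. norm (c m z) \<le> B / \<rho> ^ m) \<and>
    (\<forall>z\<in>polydisc a r. (\<lambda>m. c m z * (z $ i - a $ i) ^ m) sums \<Phi> z) \<and>
    (\<forall>m z v. c m (coord_upd z i v) = c m z)"
proof -
  define c where "c = (\<lambda>m z. (deriv ^^ m) (\<lambda>v. \<Phi> (coord_upd z i v)) (a $ i) / fact m)"
  have hol: "(\<lambda>v. \<Phi> (coord_upd z i v)) holomorphic_on ball (a $ i) r" if "z \<in> polydisc a r" for z
    using \<Phi> that by (simp add: sep_holomorphic_def)
  have Bs: "norm (\<Phi> (coord_upd z i v)) \<le> B" if "z \<in> polydisc a r" "v \<in> ball (a $ i) r" for z v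
    by (rule B[OF coord_upd_polydisc[OF that]])
  show ?thesis
  proof (intro exI[of _ c] conjI allI ballI)
    fix m
    define A where "A = (\<lambda>N z. \<Sum>l<N. \<Phi> (coord_upd z i (a $ i + of_real (\<rho>/4) * root_unity N l)) *
        (1 / (of_nat N * (of_real (\<rho>/4) * root_unity N l) ^ m)))"
    show "sep_holomorphic a r (c m)"
    proof (rule sep_holomorphic_uniform_limit)
      show "sep_holomorphic a r (A N)" for N
        unfolding A_def using \<rho>
        by (intro sep_holomorphic_sum sep_holomorphic_fix_coord[OF \<Phi>]) (auto simp: dist_norm norm_mult)
      show "uniform_limit (polydisc a r) A (c m) sequentially"
      proof (rule uniform_limitI)
        fix e :: real assume "0 < e"
        have "(\<lambda>N. 2 * B / (\<rho>/4) ^ m * (1/2) ^ N) \<longlonglongrightarrow> 2 * B / (\<rho>/4) ^ m * 0"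
          by (intro tendsto_mult tendsto_const LIMSEQ_power_zero) simp
        then have "\<forall>\<^sub>F N in sequentially. 2 * B / (\<rho>/4) ^ m * (1/2) ^ N < e"
          by (rule order_tendstoD(2)) (use \<open>0 < e\<close> in simp)
        then show "\<forall>\<^sub>F N in sequentially. \<forall>z\<in>polydisc a r. dist (A N z) (c m z) < e"
          using eventually_gt_at_top[of m]
        proof eventually_elim
          case (elim N)
          show ?case
          proof
            fix z assume z: "z \<in> polydisc a r"
            have "norm (A N z - c m z) \<le> 2 * B / (\<rho>/4) ^ m * (1/2) ^ N"
              unfolding A_def c_def
              by (rule root_unity_average[OF hol[OF z] Bs[OF z]]) (use \<rho> elim in auto)
            also have "\<dots> < e" by (rule elim)
            finally show "dist (A N z) (c m z) < e" by (simp add: dist_norm)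
          qed
        qed
      qed
    qed
  next
    fix m z assume z: "z \<in> polydisc a r"
    have sub: "cball (a $ i) \<rho> \<subseteq> ball (a $ i) r" using \<rho> by auto
    have "norm ((deriv ^^ m) (\<lambda>v. \<Phi> (coord_upd z i v)) (a $ i)) \<le> fact m * B / \<rho> ^ m"
    proof (rule Cauchy_inequality)
      show "(\<lambda>v. \<Phi> (coord_upd z i v)) holomorphic_on ball (a $ i) \<rho>"
        using hol[OF z] sub ball_subset_cball holomorphic_on_subset by blast
      show "continuous_on (cball (a $ i) \<rho>) (\<lambda>v. \<Phi> (coord_upd z i v))"
        using hol[OF z] sub continuous_on_subset holomorphic_on_imp_continuous_on by blast
      show "norm (\<Phi> (coord_upd z i x)) \<le> B" if "norm (a $ i - x) = \<rho>" for x
        using that \<rho> by (intro Bs z) (auto simp: dist_norm)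
    qed (use \<rho> in auto)
    then show "norm (c m z) \<le> B / \<rho> ^ m" by (simp add: c_def norm_divide divide_le_eq mult.commute)
  next
    fix z assume z: "z \<in> polydisc a r"
    from holomorphic_power_series[OF hol[OF z] polydisc_nth[OF z, of i]]
    show "(\<lambda>m. c m z * (z $ i - a $ i) ^ m) sums \<Phi> z" by (simp add: c_def)
  qed (simp add: c_def)
qed

section \<open>Holomorphic functions of Fourier integrals\<close>

text \<open>The variables outside \<open>J\<close> are frozen at the centre \<open>a\<close>; an induction over \<open>J\<close> releases them one
  by one.\<close>

definition coord_mix :: "'d set \<Rightarrow> complex ^ 'd \<Rightarrow> complex ^ 'd \<Rightarrow> complex ^ 'd" where
  "coord_mix J z a = (\<chi> i. if i \<in> J then z $ i else a $ i)"

lemma coord_mix_nth [simp]: "coord_mix J z a $ i = (if i \<in> J then z $ i else a $ i)"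
  by (simp add: coord_mix_def)

lemma coord_mix_UNIV [simp]: "coord_mix UNIV z a = z"
  by (simp add: vec_eq_iff)

lemma coord_mix_polydisc: "z \<in> polydisc a r \<Longrightarrow> 0 < r \<Longrightarrow> coord_mix J z a \<in> polydisc a r"
  by (simp add: polydisc_def)

lemma coord_mix_insert: "i \<notin> J \<Longrightarrow> coord_mix J z a = coord_upd (coord_mix (insert i J) z a) i (a $ i)"
  by (auto simp: vec_eq_iff)

context algebra_weight
begin

text \<open>Induction on the set of variables. Expansion in one variable leaves coefficients that depend on the
  others, to which the induction hypothesis applies. Each variable uses up one factor \<open>\<omega>\<close> and costs
  one geometric series with sum \<open>Q\<close>. Differences are expanded in the same way, with the product rule
  \<open>c x - c' x' = (c - c') x + c' (x - x')\<close>.\<close>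

lemma functional_calculus:
  fixes f g :: "'a \<Rightarrow> complex ^ 'd"
  assumes r: "0 < q" "q < \<rho>" "\<rho> < r" and A: "0 < A" "0 < \<eta>"
    and \<omega>: "fourier_ball w A \<omega>"
    and f: "\<And>i m. fourier_ball w (A * q ^ m) (\<lambda>x. \<omega> x * (f x $ i - a $ i) ^ m)"
    and g: "\<And>i m. fourier_ball w (A * q ^ m) (\<lambda>x. \<omega> x * (g x $ i - a $ i) ^ m)"
    and fg: "\<And>i m. fourier_ball w (A * \<eta> * q ^ m) (\<lambda>x. \<omega> x * ((f x $ i - a $ i) ^ m - (g x $ i - a $ i) ^ m))"
    and inside: "\<And>x. \<omega> x \<noteq> 0 \<Longrightarrow> f x \<in> polydisc a r" "\<And>x. \<omega> x \<noteq> 0 \<Longrightarrow> g x \<in> polydisc a r"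
    and J: "finite J" and \<Phi>: "sep_holomorphic a r \<Phi>" and B: "0 < B" "\<And>z. z \<in> polydisc a r \<Longrightarrow> norm (\<Phi> z) \<le> B"
  defines "Q \<equiv> A / (1 - q / \<rho>)"
  shows "fourier_ball w (B * (A * Q ^ card J)) (\<lambda>x. \<omega> x ^ Suc (card J) * \<Phi> (coord_mix J (f x) a))"
    and "fourier_ball w (B * (A * Q ^ card J)) (\<lambda>x. \<omega> x ^ Suc (card J) * \<Phi> (coord_mix J (g x) a))"
    and "fourier_ball w (B * \<eta> * (real (Suc (card J)) * A * Q ^ card J))
       (\<lambda>x. \<omega> x ^ Suc (card J) * (\<Phi> (coord_mix J (f x) a) - \<Phi> (coord_mix J (g x) a)))"
proof -
  have r0: "0 < r" "0 < \<rho>" using r by auto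
  have qr: "0 < q / \<rho>" "q / \<rho> < 1" using r by auto
  have Q: "0 < Q" unfolding Q_def using A qr by simp
  have geo: "(\<lambda>m. K * (q / \<rho>) ^ m) sums (K / (1 - q / \<rho>))" for K
    using sums_mult[OF geometric_sums[of "q / \<rho>"], of K] qr by simp
  have series: "\<And>x. (\<Sum>m. (\<omega> x ^ Suc n * c m (coord_mix J (h x) a)) * (\<omega> x * (h x $ i - a $ i) ^ m))
        = \<omega> x ^ Suc (Suc n) * \<Phi> (coord_mix (insert i J) (h x) a)"
     "\<And>x. summable (\<lambda>m. (\<omega> x ^ Suc n * c m (coord_mix J (h x) a)) * (\<omega> x * (h x $ i - a $ i) ^ m))"
    if c: "\<And>z. z \<in> polydisc a r \<Longrightarrow> (\<lambda>m. c m z * (z $ i - a $ i) ^ m) sums \<Phi> z" "\<And>m z v. c m (coord_upd z i v) = c m z"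
      and i: "i \<notin> J" and h: "\<And>x. \<omega> x \<noteq> 0 \<Longrightarrow> h x \<in> polydisc a r"
    for h :: "'a \<Rightarrow> complex ^ 'd" and c \<Phi> i n J
  proof -
    fix x
    have "(\<lambda>m. (\<omega> x ^ Suc n * c m (coord_mix J (h x) a)) * (\<omega> x * (h x $ i - a $ i) ^ m))
        sums (\<omega> x ^ Suc (Suc n) * \<Phi> (coord_mix (insert i J) (h x) a))"
    proof (cases "\<omega> x = 0")
      case False
      let ?z = "coord_mix (insert i J) (h x) a"
      have z: "?z \<in> polydisc a r" by (rule coord_mix_polydisc[OF h[OF False] r0(1)])
      have "c m (coord_mix J (h x) a) = c m ?z" for m
        unfolding coord_mix_insert[OF i] by (rule c(2))
      with sums_mult[OF c(1)[OF z], of "\<omega> x ^ Suc (Suc n)"]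
      show ?thesis by (simp add: mult_ac)
    qed simp
    then show "(\<Sum>m. (\<omega> x ^ Suc n * c m (coord_mix J (h x) a)) * (\<omega> x * (h x $ i - a $ i) ^ m))
        = \<omega> x ^ Suc (Suc n) * \<Phi> (coord_mix (insert i J) (h x) a)"
      "summable (\<lambda>m. (\<omega> x ^ Suc n * c m (coord_mix J (h x) a)) * (\<omega> x * (h x $ i - a $ i) ^ m))"
      by (simp_all only: sums_iff)
  qed
  have "fourier_ball w (B * (A * Q ^ card J)) (\<lambda>x. \<omega> x ^ Suc (card J) * \<Phi> (coord_mix J (f x) a)) \<and>
    fourier_ball w (B * (A * Q ^ card J)) (\<lambda>x. \<omega> x ^ Suc (card J) * \<Phi> (coord_mix J (g x) a)) \<and>
    fourier_ball w (B * \<eta> * (real (Suc (card J)) * A * Q ^ card J))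
       (\<lambda>x. \<omega> x ^ Suc (card J) * (\<Phi> (coord_mix J (f x) a) - \<Phi> (coord_mix J (g x) a)))"
    using J \<Phi> B
  proof (induction J arbitrary: \<Phi> B rule: finite_induct)
    case empty
    have mix: "coord_mix {} z a = a" for z by (simp add: vec_eq_iff)
    have "fourier_ball w (B * A) (\<lambda>x. \<Phi> a * \<omega> x)"
      using empty(3)[of a] empty(2) A r0 by (intro fourier_ball_cmult[OF \<omega>]) (auto simp: polydisc_def)
    moreover have "0 < B * \<eta> * A" using empty(2) A by simp
    ultimately show ?case by (auto simp: mix mult.commute[of "\<Phi> a"] intro: fourier_ball_zero)
  next
    case (insert i J)
    obtain c where c: "\<And>m. sep_holomorphic a r (c m)" "\<And>m z. z \<in> polydisc a r \<Longrightarrow> norm (c m z) \<le> B / \<rho> ^ m"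
      "\<And>z. z \<in> polydisc a r \<Longrightarrow> (\<lambda>m. c m z * (z $ i - a $ i) ^ m) sums \<Phi> z"
      "\<And>m z v. c m (coord_upd z i v) = c m z"
      using coordinate_power_series[OF insert.prems(1,3) r0(2) r(3), of i] by blast
    let ?n = "card J"
    have card: "card (insert i J) = Suc ?n" using insert by simp
    have Bm: "0 < B / \<rho> ^ m" for m using insert.prems(2) r0 by simp
    note IH = insert.IH[OF c(1) Bm c(2)]
    have one: "fourier_ball w (B * (A * Q ^ Suc ?n)) (\<lambda>x. \<omega> x ^ Suc (Suc ?n) * \<Phi> (coord_mix (insert i J) (h x) a))"
      if h: "\<And>i m. fourier_ball w (A * q ^ m) (\<lambda>x. \<omega> x * (h x $ i - a $ i) ^ m)" "\<And>x. \<omega> x \<noteq> 0 \<Longrightarrow> h x \<in> polydisc a r"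
        and IH': "\<And>m. fourier_ball w (B / \<rho> ^ m * (A * Q ^ ?n)) (\<lambda>x. \<omega> x ^ Suc ?n * c m (coord_mix J (h x) a))" for h
    proof -
      have eq: "B / \<rho> ^ m * (A * Q ^ ?n) * (A * q ^ m) = (B * (A * Q ^ ?n) * A) * (q / \<rho>) ^ m" for m
        by (simp add: power_divide)
      have s: "summable (\<lambda>m. B / \<rho> ^ m * (A * Q ^ ?n) * (A * q ^ m))" unfolding eq using geo by (auto simp: sums_iff)
      have v: "(\<Sum>m. B / \<rho> ^ m * (A * Q ^ ?n) * (A * q ^ m)) = B * (A * Q ^ Suc ?n)"
        unfolding eq using geo[of "B * (A * Q ^ ?n) * A"] by (simp add: sums_iff Q_def)
      have "fourier_ball w (B / \<rho> ^ m * (A * Q ^ ?n) * (A * q ^ m))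
        (\<lambda>x. (\<omega> x ^ Suc ?n * c m (coord_mix J (h x) a)) * (\<omega> x * (h x $ i - a $ i) ^ m))" for m
        by (rule fourier_ball_mult[OF IH' h(1)])
      from fourier_ball_suminf[OF this s] have "fourier_ball w (B * (A * Q ^ Suc ?n))
         (\<lambda>x. \<Sum>m. (\<omega> x ^ Suc ?n * c m (coord_mix J (h x) a)) * (\<omega> x * (h x $ i - a $ i) ^ m))"
        unfolding v .
      then show ?thesis by (rule fourier_ball_cong) (rule series(1)[OF c(3,4) insert.hyps(2) h(2)])
    qed
    have F1: "fourier_ball w (B * (A * Q ^ Suc ?n)) (\<lambda>x. \<omega> x ^ Suc (Suc ?n) * \<Phi> (coord_mix (insert i J) (f x) a))"
      by (rule one[OF f inside(1)]) (use IH in blast)+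
    have F2: "fourier_ball w (B * (A * Q ^ Suc ?n)) (\<lambda>x. \<omega> x ^ Suc (Suc ?n) * \<Phi> (coord_mix (insert i J) (g x) a))"
      by (rule one[OF g inside(2)]) (use IH in blast)+
    have F3: "fourier_ball w (B * \<eta> * (real (Suc (Suc ?n)) * A * Q ^ Suc ?n))
       (\<lambda>x. \<omega> x ^ Suc (Suc ?n) * (\<Phi> (coord_mix (insert i J) (f x) a) - \<Phi> (coord_mix (insert i J) (g x) a)))"
    proof -
      let ?M = "\<lambda>m. B / \<rho> ^ m * \<eta> * (real (Suc ?n) * A * Q ^ ?n) * (A * q ^ m) + B / \<rho> ^ m * (A * Q ^ ?n) * (A * \<eta> * q ^ m)"
      let ?t = "\<lambda>h m x. (\<omega> x ^ Suc ?n * c m (coord_mix J (h x) a)) * (\<omega> x * (h x $ i - a $ i) ^ m)"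
      have F: "fourier_ball w (?M m) (\<lambda>x. ?t f m x - ?t g m x)" for m
      proof (rule fourier_ball_cong)
        show "fourier_ball w (?M m) (\<lambda>x. (\<omega> x ^ Suc ?n * (c m (coord_mix J (f x) a) - c m (coord_mix J (g x) a))) * (\<omega> x * (f x $ i - a $ i) ^ m)
          + (\<omega> x ^ Suc ?n * c m (coord_mix J (g x) a)) * (\<omega> x * ((f x $ i - a $ i) ^ m - (g x $ i - a $ i) ^ m)))"
          by (rule fourier_ball_add[OF fourier_ball_mult[OF _ f] fourier_ball_mult[OF _ fg]]) (use IH in blast)+
      qed (simp add: algebra_simps)
      have eq: "?M m = (B * \<eta> * (real (Suc (Suc ?n)) * A * Q ^ ?n) * A) * (q / \<rho>) ^ m" for m
        by (simp add: power_divide algebra_simps add_divide_distrib)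
      have s: "summable ?M" unfolding eq using geo by (auto simp: sums_iff)
      have v: "suminf ?M = B * \<eta> * (real (Suc (Suc ?n)) * A * Q ^ Suc ?n)"
        unfolding eq using geo[of "B * \<eta> * (real (Suc (Suc ?n)) * A * Q ^ ?n) * A"] by (simp add: sums_iff Q_def del: of_nat_Suc)
      have "(\<Sum>m. ?t f m x - ?t g m x) = \<omega> x ^ Suc (Suc ?n) * (\<Phi> (coord_mix (insert i J) (f x) a) - \<Phi> (coord_mix (insert i J) (g x) a))" for x
      proof -
        have "summable (\<lambda>m. ?t f m x)" by (rule series(2)[OF c(3,4) insert.hyps(2) inside(1)])
        moreover have "summable (\<lambda>m. ?t g m x)" by (rule series(2)[OF c(3,4) insert.hyps(2) inside(2)])
        ultimately have "(\<Sum>m. ?t f m x - ?t g m x) = (\<Sum>m. ?t f m x) - (\<Sum>m. ?t g m x)"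
          by (rule suminf_diff[symmetric])
        also have "(\<Sum>m. ?t f m x) = \<omega> x ^ Suc (Suc ?n) * \<Phi> (coord_mix (insert i J) (f x) a)"
          by (rule series(1)[OF c(3,4) insert.hyps(2) inside(1)])
        also have "(\<Sum>m. ?t g m x) = \<omega> x ^ Suc (Suc ?n) * \<Phi> (coord_mix (insert i J) (g x) a)"
          by (rule series(1)[OF c(3,4) insert.hyps(2) inside(2)])
        finally show ?thesis by (simp only: right_diff_distrib)
      qed
      then have "(\<lambda>x. \<Sum>m. ?t f m x - ?t g m x) = (\<lambda>x. \<omega> x ^ Suc (Suc ?n) *
          (\<Phi> (coord_mix (insert i J) (f x) a) - \<Phi> (coord_mix (insert i J) (g x) a)))" by (rule ext)
      with fourier_ball_suminf[OF F s] show ?thesis unfolding v by (simp only:)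
    qed
    show ?case unfolding card using F1 F2 F3 by blast
  qed
  then show "fourier_ball w (B * (A * Q ^ card J)) (\<lambda>x. \<omega> x ^ Suc (card J) * \<Phi> (coord_mix J (f x) a))"
    "fourier_ball w (B * (A * Q ^ card J)) (\<lambda>x. \<omega> x ^ Suc (card J) * \<Phi> (coord_mix J (g x) a))"
    "fourier_ball w (B * \<eta> * (real (Suc (card J)) * A * Q ^ card J))
       (\<lambda>x. \<omega> x ^ Suc (card J) * (\<Phi> (coord_mix J (f x) a) - \<Phi> (coord_mix J (g x) a)))" by blast+
qed

end

section \<open>Composition with a holomorphic function\<close>

lemma norm_vec_le_card:
  fixes z :: "complex ^ 'd"
  assumes "\<And>i. norm (z $ i) \<le> c" shows "norm z \<le> real CARD('d) * c"
proof -
  have "norm z \<le> (\<Sum>i\<in>UNIV. norm (z $ i))" unfolding norm_vec_def by (rule L2_set_le_sum) auto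
  also have "\<dots> \<le> (\<Sum>i\<in>(UNIV :: 'd set). c)" by (intro sum_mono assms)
  finally show ?thesis by simp
qed

lemma compact_neighbourhood:
  fixes K :: "'b::euclidean_space set"
  assumes "compact K" "open \<Omega>" "K \<subseteq> \<Omega>"
  obtains r where "0 < r" "compact {x + y |x y. x \<in> K \<and> y \<in> cball 0 r}" "{x + y |x y. x \<in> K \<and> y \<in> cball 0 r} \<subseteq> \<Omega>"
proof -
  obtain r where r: "0 < r" "(\<Union>x\<in>K. cball x r) \<subseteq> \<Omega>"
    using compact_subset_open_imp_cball_epsilon_subset[OF assms] by blast
  have "{x + y |x y. x \<in> K \<and> y \<in> cball 0 r} \<subseteq> (\<Union>x\<in>K. cball x r)"
    by (auto simp: dist_norm)
  then show ?thesis using r compact_sums[OF assms(1) compact_cball[of 0 r]] by (intro that[of r]) auto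
qed

lemma holomorphic_several_continuous_on: "holomorphic_several \<Phi> \<Omega> \<Longrightarrow> continuous_on \<Omega> \<Phi>"
proof (rule continuous_at_imp_continuous_on, rule ballI)
  fix z assume "holomorphic_several \<Phi> \<Omega>" "z \<in> \<Omega>"
  then obtain D where "(\<Phi> has_derivative D) (at z)" unfolding holomorphic_several_def by blast
  then show "isCont \<Phi> z" by (rule has_derivative_continuous)
qed

context algebra_weight
begin

text \<open>Near a point \<open>y\<close> both \<open>f\<close> and \<open>g\<close> are the sum of the constant \<open>a = S y y\<close>, a smooth function \<open>T\<close> that is
  small because the window is narrow, and a small element of the algebra. So \<open>power_estimate\<close>
  provides the hypotheses of \<open>functional_calculus\<close>, with constants that do not depend on \<open>y\<close>.\<close>

lemma composition_estimate:
  fixes f :: "'a \<Rightarrow> complex ^ 'd" and \<Phi> :: "complex ^ 'd \<Rightarrow> complex"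
  assumes k: "k \<in> borel_measurable lebesgue" "\<And>\<xi>. 0 < k \<xi>" "square_integrable (\<lambda>\<xi>. 1 / k \<xi>)"
    and lim: "((\<lambda>\<xi>. w \<xi> / k \<xi>) \<longlongrightarrow> 0) at_infinity"
    and f: "\<And>i. \<exists>\<psi> z M. \<psi> \<in> test_functions \<and> \<psi> z \<noteq> 0 \<and> (\<forall>y. fourier_ball k M (\<lambda>x. translate y \<psi> x * f x $ i))"
    and bdd: "bounded (range f)" and \<Omega>: "closure (range f) \<subseteq> \<Omega>" "open \<Omega>" and \<Phi>: "holomorphic_several \<Phi> \<Omega>"
  obtains \<omega> \<sigma> \<eta>0 C where "\<omega> \<in> test_functions" "\<omega> 0 \<noteq> 0" "\<sigma> \<in> test_functions" "\<sigma> 0 = 1" "0 < \<eta>0" "0 < C"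
    "\<forall>g \<eta>. 0 < \<eta> \<longrightarrow> \<eta> \<le> \<eta>0 \<longrightarrow> (\<forall>i y. fourier_ball w \<eta> (\<lambda>x. translate y \<sigma> x * (g x $ i - f x $ i))) \<longrightarrow>
      (\<forall>y. fourier_ball w C (\<lambda>x. translate y \<omega> x * \<Phi> (g x)) \<and>
           fourier_ball w (C * \<eta>) (\<lambda>x. translate y \<omega> x * (\<Phi> (g x) - \<Phi> (f x))))"
proof -
  let ?d = "real CARD('d)"
  have d: "0 < ?d" by simp
  have "compact (closure (range f))" using bdd by simp
  then obtain r0 where r0: "0 < r0" "compact {x + y |x y. x \<in> closure (range f) \<and> y \<in> cball 0 r0}"
    "{x + y |x y. x \<in> closure (range f) \<and> y \<in> cball 0 r0} \<subseteq> \<Omega>"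
    by (rule compact_neighbourhood[OF _ \<Omega>(2,1)])
  let ?K = "{x + y |x y. x \<in> closure (range f) \<and> y \<in> cball 0 r0}"
  have "continuous_on \<Omega> \<Phi>" by (rule holomorphic_several_continuous_on[OF \<Phi>])
  then have "compact (\<Phi> ` ?K)" using r0 by (intro compact_continuous_image) (rule continuous_on_subset)
  then have "bounded (\<Phi> ` ?K)" by (rule compact_imp_bounded)
  then obtain B0 where B0: "\<And>z. z \<in> ?K \<Longrightarrow> norm (\<Phi> z) \<le> B0" by (auto simp: bounded_iff)
  define B where "B = max 1 B0"
  have B: "0 < B" "\<And>z. z \<in> ?K \<Longrightarrow> norm (\<Phi> z) \<le> B"
    using B0 unfolding B_def by (simp, meson max.cobounded2 order_trans)
  \<comment> \<open>points of a polydisc of radius \<open>r\<close> are at distance at most \<open>r0\<close>\<close>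
  define r where "r = r0 / (2 * ?d)"
  have r: "0 < r" using r0(1) d by (simp add: r_def)
  define W where "W = 1 + (L2_norm (\<lambda>\<xi>. 1 / w \<xi>))\<^sup>2"
  have W: "1 \<le> W" by (simp add: W_def)
  \<comment> \<open>\<open>W\<close> converts a radius in the algebra into a supremum bound, here \<open>2 * e\<close> into \<open>r / 16\<close>\<close>
  define e where "e = r / (32 * W)"
  have e: "0 < e" using r W by (simp add: e_def)
  have We: "W * (2 * e) = r / 16" using W by (simp add: e_def)
  have "1 * (2 * e) \<le> W * (2 * e)" using W e by (intro mult_right_mono) auto
  then have e_le: "2 * e \<le> r / 16" unfolding We by simp
  obtain \<sigma> :: "'a \<Rightarrow> complex" where \<sigma>: "\<sigma> \<in> test_functions" "\<And>x. norm x \<le> 1 \<Longrightarrow> \<sigma> x = 1"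
    by (rule plateau_exists[of 1]) auto
  have "\<exists>S. unif_smooth S \<and> (\<forall>y. fourier_ball w e (\<lambda>x. translate y \<sigma> x * f x $ i - S y x))" for i
  proof -
    obtain \<psi> z M where \<psi>: "\<psi> \<in> test_functions" "\<psi> z \<noteq> 0" "\<And>y. fourier_ball k M (\<lambda>x. translate y \<psi> x * f x $ i)"
      using f[of i] by blast
    show ?thesis
      by (rule window_splitting[OF k lim \<psi>(1,2) \<sigma>(1) \<psi>(3) e]) blast
  qed
  then obtain S where S: "\<And>i. unif_smooth (S i)" "\<And>i y. fourier_ball w e (\<lambda>x. translate y \<sigma> x * f x $ i - S i y x)" by metis
  have "\<exists>L. 0 < L \<and> (\<forall>p x y. norm (S i p x - S i p y) \<le> L * norm (x - y))" for i
    by (rule unif_smooth_Lipschitz[OF S(1)[of i]]) blast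
  then obtain L where L: "\<And>i. 0 < L i" "\<And>i p x y. norm (S i p x - S i p y) \<le> L i * norm (x - y)" by metis
  define L' where "L' = (\<Sum>i\<in>UNIV. L i)"
  have L'_le: "L i \<le> L'" for i unfolding L'_def using L(1) by (intro member_le_sum) (auto intro: less_imp_le)
  have L': "0 < L'" using L(1) L'_le by (meson less_le_trans)
  \<comment> \<open>so narrow a window that the smooth parts vary by at most \<open>r / 16\<close> in it, and that \<open>\<sigma> = 1\<close> on it\<close>
  define \<rho> where "\<rho> = min 1 (r / (16 * L'))"
  have \<rho>: "0 < \<rho>" "\<rho> \<le> 1" "L' * \<rho> \<le> r / 16"
  proof -
    have "L' * \<rho> \<le> L' * (r / (16 * L'))" unfolding \<rho>_def using L' by (intro mult_left_mono) auto
    then show "L' * \<rho> \<le> r / 16" using L' by simp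
  qed (use r L' in \<open>auto simp: \<rho>_def\<close>)
  define \<omega> where "\<omega> = (ball_bump \<rho> :: 'a \<Rightarrow> complex)"
  have \<omega>1: "\<omega> \<in> test_functions" unfolding \<omega>_def by (rule test_ball_bump[OF \<rho>(1)])
  have \<omega>2: "\<omega> x = 0" if "x \<notin> cball 0 \<rho>" for x
    using ball_bump_eq_0[OF \<rho>(1), of x] that by (simp add: \<omega>_def)
  have \<omega>3: "\<omega> 0 \<noteq> 0" using ball_bump_eq_0[OF \<rho>(1), of "0::'a"] \<rho>(1) by (simp add: \<omega>_def)
  note \<omega> = \<omega>1 \<omega>2 \<omega>3
  have \<omega>_near: "norm (x - y) \<le> \<rho>" if "translate y \<omega> x \<noteq> 0" for x y
    using \<omega>(2)[of "x - y"] that by (auto simp: translate_def)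
  define T where "T = (\<lambda>i y x. S i y x - S i y y)"
  have T: "unif_smooth (T i)" for i
  proof -
    obtain D where "0 < D" and D: "\<And>p x. norm (iter_deriv [] (S i p) x) \<le> D"
      by (rule unif_smooth_bound[OF S(1)[of i], of "[]"]) auto
    have "unif_smooth (\<lambda>y (x::'a). - S i y y)" by (rule unif_smooth_scalars[of _ D]) (use D in auto)
    from unif_smooth_add[OF S(1)[of i] this] show ?thesis by (simp add: T_def[abs_def])
  qed
  have T_le: "norm (T i y x) \<le> r / 16" if "x \<in> cball y \<rho>" for i y x
  proof -
    have "norm (T i y x) \<le> L i * norm (x - y)" unfolding T_def by (rule L(2))
    also have "\<dots> \<le> L' * \<rho>" using that L'_le[of i] L(1)[of i] L' by (intro mult_mono) (auto simp: dist_norm norm_minus_commute)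
    also have "\<dots> \<le> r / 16" by (rule \<rho>(3))
    finally show ?thesis .
  qed
  \<comment> \<open>\<open>r / 4\<close> is the growth rate of powers, to be compared with the radius \<open>r / 2\<close> in the Cauchy estimates\<close>
  have se: "0 < r / 16" "0 < 2 * e" "r / 16 + 2 * e < r / 4" using r e e_le by auto
  have "\<exists>A. 0 < A \<and> (\<forall>p H m. fourier_ball w (2 * e) H \<longrightarrow> fourier_ball w (A * (r / 4) ^ m) (\<lambda>x. translate p \<omega> x * (T i p x + H x) ^ m)) \<and>
    (\<forall>p H H' \<eta> m. fourier_ball w (2 * e) H \<longrightarrow> fourier_ball w (2 * e) H' \<longrightarrow> fourier_ball w \<eta> (\<lambda>x. H x - H' x) \<longrightarrow>
       fourier_ball w (A * \<eta> * (r / 4) ^ m) (\<lambda>x. translate p \<omega> x * ((T i p x + H x) ^ m - (T i p x + H' x) ^ m)))" for i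
    by (rule power_estimate[OF T[of i] \<omega>(1) less_imp_le[OF \<rho>(1)] \<omega>(2) se, where c="\<lambda>p. p"])
       (use T_le in blast)+
  then obtain A where A: "0 < A i \<and> (\<forall>p H m. fourier_ball w (2 * e) H \<longrightarrow> fourier_ball w (A i * (r / 4) ^ m) (\<lambda>x. translate p \<omega> x * (T i p x + H x) ^ m)) \<and>
    (\<forall>p H H' \<eta> m. fourier_ball w (2 * e) H \<longrightarrow> fourier_ball w (2 * e) H' \<longrightarrow> fourier_ball w \<eta> (\<lambda>x. H x - H' x) \<longrightarrow>
       fourier_ball w (A i * \<eta> * (r / 4) ^ m) (\<lambda>x. translate p \<omega> x * ((T i p x + H x) ^ m - (T i p x + H' x) ^ m)))" for i
    by (rule that[OF someI_ex])
  note A = A[THEN conjunct1] A[THEN conjunct2, THEN conjunct1, rule_format] A[THEN conjunct2, THEN conjunct2, rule_format]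
  obtain A0 where A0: "\<And>y. fourier_ball w A0 (translate y \<omega>)" by (rule fourier_ball_test[OF \<omega>(1)]) blast
  have A0_pos: "0 < A0" using fourier_ball_pos[OF A0] .
  define A' where "A' = A0 + (\<Sum>i\<in>UNIV. A i)"
  have A'_le: "A i \<le> A'" for i
  proof -
    have "A i \<le> (\<Sum>i\<in>UNIV. A i)" using A(1) by (intro member_le_sum) (auto intro: less_imp_le)
    then show ?thesis using A0_pos by (simp add: A'_def)
  qed
  have A0_le: "A0 \<le> A'" unfolding A'_def using A(1) by (simp add: sum_nonneg less_imp_le)
  have A': "0 < A'" using A0_pos A0_le by linarith
  define Q where "Q = A' / (1 - (r / 4) / (r / 2))"
  have Q: "0 < Q" unfolding Q_def using A' r by simp
  define \<omega>' where "\<omega>' = (\<lambda>x. \<omega> x ^ Suc CARD('d))"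
  have \<omega>'_tr: "translate y \<omega>' x = translate y \<omega> x ^ Suc CARD('d)" for y x by (simp add: \<omega>'_def translate_def)
  define C where "C = B * (real (Suc CARD('d)) * A' * Q ^ CARD('d))"
  have C: "0 < C" unfolding C_def using B A' Q by (intro mult_pos_pos) auto
  have main: "fourier_ball w C (\<lambda>x. translate y \<omega>' x * \<Phi> (g x)) \<and>
       fourier_ball w (C * \<eta>) (\<lambda>x. translate y \<omega>' x * (\<Phi> (g x) - \<Phi> (f x)))"
    if \<eta>: "0 < \<eta>" "\<eta> \<le> e" and g: "\<And>i y. fourier_ball w \<eta> (\<lambda>x. translate y \<sigma> x * (g x $ i - f x $ i))" for g \<eta> y
  proof -
    define a where "a = (\<chi> i. S i y y)"
    define H where "H = (\<lambda>i x. translate y \<sigma> x * f x $ i - S i y x)"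
    define H' where "H' = (\<lambda>i x. translate y \<sigma> x * g x $ i - S i y x)"
    \<comment> \<open>the smooth part of \<open>f\<close> serves \<open>g\<close> as well, since \<open>\<eta> \<le> e\<close>\<close>
    have H: "fourier_ball w (2 * e) (H i)" for i unfolding H_def using e by (intro fourier_ball_mono[OF S(2)]) simp
    have HH: "fourier_ball w \<eta> (\<lambda>x. H' i x - H i x)" for i
      by (rule fourier_ball_cong[OF g[of y i]]) (simp add: H_def H'_def algebra_simps)
    have H': "fourier_ball w (2 * e) (H' i)" for i
    proof (rule fourier_ball_mono)
      show "fourier_ball w (e + \<eta>) (H' i)"
        by (rule fourier_ball_cong[OF fourier_ball_add[OF S(2)[of y i] g[of y i]]]) (simp add: H'_def algebra_simps)
    qed (use \<eta> in simp)
    have near: "T i y x + H i x = f x $ i - a $ i" "T i y x + H' i x = g x $ i - a $ i"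
      if "translate y \<omega> x \<noteq> 0" for i x
    proof -
      have "translate y \<sigma> x = 1" using \<sigma>(2)[of "x - y"] \<omega>_near[OF that] \<rho>(2) by (simp add: translate_def)
      then show "T i y x + H i x = f x $ i - a $ i" "T i y x + H' i x = g x $ i - a $ i"
        by (simp_all add: T_def H_def H'_def a_def)
    qed
    have small: "norm (h x) \<le> r / 16" if "fourier_ball w (2 * e) h" for h x
      using fourier_ball_bounded[OF that, of x] We by (simp add: W_def)
    have inside: "f x \<in> polydisc a r" "g x \<in> polydisc a r" if x: "translate y \<omega> x \<noteq> 0" for x
    proof -
      have "norm (T i y x) \<le> r / 16" for i
        using \<omega>_near[OF x] by (intro T_le) (simp add: dist_norm norm_minus_commute)
      then have le: "norm (T i y x + H i x) \<le> r / 16 + r / 16" "norm (T i y x + H' i x) \<le> r / 16 + r / 16" for i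
        using small[OF H[of i], of x] small[OF H'[of i], of x] by (intro norm_triangle_le add_mono; simp)+
      have "norm (T i y x + H i x) < r" "norm (T i y x + H' i x) < r" for i
        using r by (intro le_less_trans[OF le(1)[of i]] le_less_trans[OF le(2)[of i]]; simp)+
      then show "f x \<in> polydisc a r" "g x \<in> polydisc a r"
        unfolding near[OF x] polydisc_def by simp_all
    qed
    have y0: "translate y \<omega> y \<noteq> 0" using \<omega>(3) by (simp add: translate_def)
    have sub: "polydisc a r \<subseteq> ?K"
    proof
      fix z assume z: "z \<in> polydisc a r"
      have "norm (z - f y) \<le> ?d * (2 * r)"
      proof (rule norm_vec_le_card)
        fix i
        have "norm (f y $ i - a $ i) < r" using inside(1)[OF y0] by (simp add: polydisc_def)
        moreover have "norm (z $ i - a $ i) < r" using z by (simp add: polydisc_def)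
        ultimately have "norm ((z $ i - a $ i) - (f y $ i - a $ i)) \<le> r + r"
          by (intro norm_triangle_le_diff) simp
        then show "norm ((z - f y) $ i) \<le> 2 * r" by simp
      qed
      also have "\<dots> = r0" using d by (simp add: r_def)
      finally have "z - f y \<in> cball 0 r0" by simp
      moreover have "f y \<in> closure (range f)" by (rule subsetD[OF closure_subset rangeI])
      moreover have "z = f y + (z - f y)" by simp
      ultimately show "z \<in> ?K" by blast
    qed
    have sep: "sep_holomorphic a r \<Phi>" by (rule sep_holomorphic_of_several[OF \<Phi>]) (use sub r0(3) in blast)
    have F: "fourier_ball w (A' * (r / 4) ^ m) (\<lambda>x. translate y \<omega> x * (f x $ i - a $ i) ^ m)" for i m
    proof (rule fourier_ball_mono[OF fourier_ball_cong[OF A(2)[OF H[of i], of i m y]]])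
      show "A i * (r / 4) ^ m \<le> A' * (r / 4) ^ m" using A'_le r by (intro mult_right_mono) auto
      show "translate y \<omega> x * (T i y x + H i x) ^ m = translate y \<omega> x * (f x $ i - a $ i) ^ m" for x
        by (cases "translate y \<omega> x = 0") (auto simp: near)
    qed
    have G: "fourier_ball w (A' * (r / 4) ^ m) (\<lambda>x. translate y \<omega> x * (g x $ i - a $ i) ^ m)" for i m
    proof (rule fourier_ball_mono[OF fourier_ball_cong[OF A(2)[OF H'[of i], of i m y]]])
      show "A i * (r / 4) ^ m \<le> A' * (r / 4) ^ m" using A'_le r by (intro mult_right_mono) auto
      show "translate y \<omega> x * (T i y x + H' i x) ^ m = translate y \<omega> x * (g x $ i - a $ i) ^ m" for x
        by (cases "translate y \<omega> x = 0") (auto simp: near)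
    qed
    have FG: "fourier_ball w (A' * \<eta> * (r / 4) ^ m) (\<lambda>x. translate y \<omega> x * ((g x $ i - a $ i) ^ m - (f x $ i - a $ i) ^ m))" for i m
    proof (rule fourier_ball_mono[OF fourier_ball_cong[OF A(3)[OF H'[of i] H[of i] HH[of i], of i m y]]])
      show "A i * \<eta> * (r / 4) ^ m \<le> A' * \<eta> * (r / 4) ^ m" using A'_le r \<eta> by (intro mult_right_mono) auto
      show "translate y \<omega> x * ((T i y x + H' i x) ^ m - (T i y x + H i x) ^ m)
          = translate y \<omega> x * ((g x $ i - a $ i) ^ m - (f x $ i - a $ i) ^ m)" for x
        by (cases "translate y \<omega> x = 0") (auto simp: near)
    qed
    have r': "0 < r / 4" "r / 4 < r / 2" "r / 2 < r" using r by auto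
    have \<omega>A: "fourier_ball w A' (translate y \<omega>)" by (rule fourier_ball_mono[OF A0 A0_le])
    note fc = functional_calculus[OF r' A' \<eta>(1) \<omega>A G F FG inside(2,1) finite_class.finite_UNIV sep B(1), folded Q_def]
    have BP: "norm (\<Phi> z) \<le> B" if "z \<in> polydisc a r" for z using sub that by (intro B(2)) blast
    have "fourier_ball w (B * (A' * Q ^ CARD('d))) (\<lambda>x. translate y \<omega> x ^ Suc CARD('d) * \<Phi> (g x))"
      using fc(1)[OF _ _ BP] by simp
    moreover have "B * (A' * Q ^ CARD('d)) \<le> C"
      unfolding C_def using B(1) A' Q by (intro mult_left_mono) (auto simp: mult.assoc)
    ultimately have 1: "fourier_ball w C (\<lambda>x. translate y \<omega>' x * \<Phi> (g x))" unfolding \<omega>'_tr by (rule fourier_ball_mono)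
    have "fourier_ball w (B * \<eta> * (real (Suc CARD('d)) * A' * Q ^ CARD('d))) (\<lambda>x. translate y \<omega> x ^ Suc CARD('d) * (\<Phi> (g x) - \<Phi> (f x)))"
      using fc(3)[OF _ _ BP] by simp
    moreover have "B * \<eta> * (real (Suc CARD('d)) * A' * Q ^ CARD('d)) = C * \<eta>" by (simp add: C_def)
    ultimately have 2: "fourier_ball w (C * \<eta>) (\<lambda>x. translate y \<omega>' x * (\<Phi> (g x) - \<Phi> (f x)))"
      unfolding \<omega>'_tr by (simp only:)
    from 1 2 show ?thesis by blast
  qed
  have t': "\<omega>' \<in> test_functions" unfolding \<omega>'_def by (rule test_power[OF \<omega>(1)])
  have n': "\<omega>' 0 \<noteq> 0" using \<omega>(3) by (simp add: \<omega>'_def)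
  have s0: "\<sigma> 0 = 1" using \<sigma>(2) by simp
  show ?thesis
    by (rule that[OF t' n' \<sigma>(1) s0 e C]; intro allI impI conjI)
      ((rule main[THEN conjunct1] main[THEN conjunct2], assumption, assumption, (erule allE)+, assumption)+)
qed

end

section \<open>Uniformly local spaces\<close>

lemma fourier_ball_scale_weight:
  assumes "fourier_ball w M h" "0 < C" shows "fourier_ball (\<lambda>\<xi>. C * w \<xi>) (C * M) h"
proof -
  from assms(1) obtain G where G: "integrable lborel G"
     "(\<integral>\<^sup>+\<xi>. ennreal ((w \<xi> * norm (G \<xi>))\<^sup>2) \<partial>lebesgue) \<le> ennreal (M\<^sup>2)" "\<And>x. h x = fourier G (- x)" and M: "0 < M"
    by (auto simp: fourier_ball_def)
  have "(\<integral>\<^sup>+\<xi>. ennreal ((C * w \<xi> * norm (G \<xi>))\<^sup>2) \<partial>lebesgue) =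
        (\<integral>\<^sup>+\<xi>. ennreal (C\<^sup>2) * ennreal ((w \<xi> * norm (G \<xi>))\<^sup>2) \<partial>lebesgue)"
    by (intro nn_integral_cong) (simp add: ennreal_mult[symmetric] power_mult_distrib mult.assoc)
  also have "\<dots> \<le> ennreal (C\<^sup>2) * (\<integral>\<^sup>+\<xi>. ennreal ((w \<xi> * norm (G \<xi>))\<^sup>2) \<partial>lebesgue)"
    using assms(2) by (intro nn_integral_cmult_le) auto
  also have "\<dots> \<le> ennreal (C\<^sup>2) * ennreal (M\<^sup>2)" by (intro mult_left_mono G) simp
  also have "\<dots> = ennreal ((C * M)\<^sup>2)" by (simp add: ennreal_mult[symmetric] power_mult_distrib)
  finally show ?thesis unfolding fourier_ball_def using M assms(2) G by auto
qed

lemma Bk_inf_norm_le_of_fourier_ball: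
  fixes k :: "'a::euclidean_space \<Rightarrow> real"
  assumes k: "k \<in> borel_measurable lebesgue" "\<And>\<xi>. 0 < k \<xi>"
    and f: "represents f u" "continuous_on UNIV f" and \<psi>: "\<psi> \<in> test_functions"
    and fourier_ball: "\<And>y. fourier_ball k M (\<lambda>x. translate y \<psi> x * f x)"
  shows "Bk_inf_norm k \<psi> u \<le> ennreal (M / norm (inversion_factor TYPE('a)))"
  unfolding Bk_inf_norm_def
  by (rule SUP_least) (rule Bk_norm_le_of_fourier_ball[OF k f test_translate[OF \<psi>] fourier_ball])

lemma fourier_ball_of_Bk_inf_norm_le:
  fixes k :: "'a::euclidean_space \<Rightarrow> real"
  assumes k: "k \<in> borel_measurable lebesgue" "\<And>\<xi>. 0 < k \<xi>" "square_integrable (\<lambda>\<xi>. 1 / k \<xi>)"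
    and f: "represents f u" "continuous_on UNIV f" and \<psi>: "\<psi> \<in> test_functions"
    and M: "0 < M" "Bk_inf_norm k \<psi> u \<le> ennreal M"
  shows "fourier_ball k (norm (inversion_factor TYPE('a)) * M) (\<lambda>x. translate y \<psi> x * f x)"
proof (rule fourier_ball_of_Bk_norm_le[OF k f test_translate[OF \<psi>] M(1)])
  show "Bk_norm k (distr_mult u (translate y \<psi>)) \<le> ennreal M"
    using M(2) unfolding Bk_inf_norm_def by (meson SUP_upper UNIV_I order_trans)
qed

lemma Bk_inf_bcfun:
  fixes k :: "'a::euclidean_space \<Rightarrow> real"
  assumes k: "k \<in> borel_measurable lebesgue" "\<And>\<xi>. 0 < k \<xi>" "square_integrable (\<lambda>\<xi>. 1 / k \<xi>)"
    and u: "u \<in> Bk_inf k"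
  shows "continuous_on UNIV (bcfun_of u)" "bounded (range (bcfun_of u))" "represents (bcfun_of u) u"
    and "\<exists>\<psi> z M. \<psi> \<in> test_functions \<and> \<psi> z \<noteq> 0 \<and> (\<forall>y. fourier_ball k M (\<lambda>x. translate y \<psi> x * bcfun_of u x))"
proof -
  obtain f where f: "continuous_on UNIV f" "bounded (range f)" "represents f u"
    by (rule Bk_inf_represented[OF k u])
  have e: "bcfun_of u = f" by (rule bcfun_of_eq[OF f(3,1,2)])
  show *: "continuous_on UNIV (bcfun_of u)" "bounded (range (bcfun_of u))" "represents (bcfun_of u) u"
    unfolding e by (rule f)+
  from u obtain \<psi> where \<psi>: "\<psi> \<in> test_functions" "\<psi> \<noteq> (\<lambda>x. 0)" "Bk_inf_norm k \<psi> u < \<infinity>"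
    by (auto simp: Bk_inf_def)
  then obtain z where z: "\<psi> z \<noteq> 0" by auto
  obtain M where M: "0 < M" "Bk_inf_norm k \<psi> u \<le> ennreal M"
  proof -
    obtain M where "Bk_inf_norm k \<psi> u = ennreal M" "0 \<le> M" using \<psi>(3) by (cases "Bk_inf_norm k \<psi> u") auto
    then show ?thesis by (intro that[of "M + 1"]) (auto simp: ennreal_leI)
  qed
  show "\<exists>\<psi> z M. \<psi> \<in> test_functions \<and> \<psi> z \<noteq> 0 \<and> (\<forall>y. fourier_ball k M (\<lambda>x. translate y \<psi> x * bcfun_of u x))"
    using fourier_ball_of_Bk_inf_norm_le[OF k *(3,1) \<psi>(1) M] \<psi>(1) z by blast
qed

lemma ennreal_tendsto_0I:
  fixes f :: "'b \<Rightarrow> ennreal"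
  assumes "\<And>e. 0 < e \<Longrightarrow> \<forall>\<^sub>F x in F. f x \<le> ennreal e" shows "(f \<longlongrightarrow> 0) F"
proof (rule order_tendstoI)
  fix a :: ennreal assume "0 < a"
  then obtain e where e: "0 < e" "ennreal e < a"
  proof (cases a)
    case (real b)
    then have "0 < b" using \<open>0 < a\<close> by simp
    then show ?thesis using real by (intro that[of "b / 2"]) (auto simp: ennreal_less_iff)
  next
    case top
    then show ?thesis by (intro that[of 1]) auto
  qed
  from assms[OF e(1)] show "\<forall>\<^sub>F x in F. f x < a" by eventually_elim (rule le_less_trans[OF _ e(2)])
qed simp

theorem theorem4p9:
  fixes \<Omega> :: "(complex ^ 'd) set" and \<Phi> :: "complex ^ 'd \<Rightarrow> complex"
    and k k' :: "real ^ 'n \<Rightarrow> real"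
  assumes "open \<Omega>" and "holomorphic_several \<Phi> \<Omega>"
    and "k \<in> K_pol" and "k' \<in> K_a"
    and "((\<lambda>\<xi>. k' \<xi> / k \<xi>) \<longlongrightarrow> 0) at_infinity"
    and "square_integrable (\<lambda>\<xi>. 1 / k' \<xi>)"
  shows "(\<forall>u :: 'd \<Rightarrow> (real ^ 'n) distr.
            (\<forall>i. u i \<in> Bk_inf k) \<and> closure (range (value_map u)) \<subseteq> \<Omega> \<longrightarrow>
            distr_of (\<Phi> \<circ> value_map u) \<in> Bk_inf k') \<and>
         (\<forall>(u :: 'd \<Rightarrow> (real ^ 'n) distr) (ue :: real \<Rightarrow> 'd \<Rightarrow> (real ^ 'n) distr).
            (\<forall>i. u i \<in> Bk_inf k) \<and> (\<forall>\<epsilon>\<in>{0<..1}. \<forall>i. ue \<epsilon> i \<in> Bk_inf k) \<and>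
            closure (range (value_map u)) \<subseteq> \<Omega> \<and>
            (\<forall>i. Bk_inf_tendsto k' (\<lambda>\<epsilon>. ue \<epsilon> i) (u i) (at_right 0)) \<longrightarrow>
            (\<exists>\<epsilon>0\<in>{0<..1}. \<forall>\<epsilon>\<in>{0<..\<epsilon>0}. closure (range (value_map (ue \<epsilon>))) \<subseteq> \<Omega>) \<and>
            Bk_inf_tendsto k' (\<lambda>\<epsilon>. distr_of (\<Phi> \<circ> value_map (ue \<epsilon>)))
              (distr_of (\<Phi> \<circ> value_map u)) (at_right 0))"
proof -
  let ?c = "norm (inversion_factor TYPE(real ^ 'n))" and ?d = "real CARD('d)"
  have c: "0 < ?c" using inversion_factor_nonzero[where 'a="real ^ 'n"] by simp
  have kp': "k' \<in> K_pol" using assms(4) by (simp add: K_a_def)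
  note km = K_pol_measurable[OF assms(3)] and kpos = K_pol_pos[OF assms(3)]
  note km' = K_pol_measurable[OF kp'] and kpos' = K_pol_pos[OF kp']
  obtain Cw where Cw: "0 < Cw" "algebra_weight (\<lambda>\<xi>. Cw * k' \<xi>)"
    by (rule algebra_weight_K_a[OF assms(4,6)])
  define w where "w = (\<lambda>\<xi>. Cw * k' \<xi>)"
  interpret algebra_weight w using Cw(2) unfolding w_def .
  have lim: "((\<lambda>\<xi>. w \<xi> / k \<xi>) \<longlongrightarrow> 0) at_infinity"
    using tendsto_mult_left[OF assms(5), of Cw] by (simp add: w_def)
  obtain D where D: "0 < D" "\<And>\<xi>. k' \<xi> \<le> D * k \<xi>" by (rule K_pol_dominated[OF assms(3) kp' assms(5)]) blast
  have kL2: "square_integrable (\<lambda>\<xi>. 1 / k \<xi>)"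
    unfolding square_integrable_def
  proof
    note km[measurable]
    show "(\<lambda>\<xi>. 1 / k \<xi>) \<in> borel_measurable lebesgue" by measurable
    have "integrable lebesgue (\<lambda>\<xi>. D\<^sup>2 * (norm (1 / k' \<xi>))\<^sup>2)"
      using assms(6) by (simp add: square_integrable_def)
    then show "integrable lebesgue (\<lambda>\<xi>. (norm (1 / k \<xi>))\<^sup>2)"
    proof (rule Bochner_Integration.integrable_bound)
      have "(norm (1 / k \<xi>))\<^sup>2 \<le> D\<^sup>2 * (norm (1 / k' \<xi>))\<^sup>2" for \<xi>
      proof -
        have "1 / k \<xi> \<le> D * (1 / k' \<xi>)" using D(2)[of \<xi>] kpos[of \<xi>] kpos'[of \<xi>] by (simp add: field_simps)
        then have "(1 / k \<xi>)\<^sup>2 \<le> (D * (1 / k' \<xi>))\<^sup>2" using kpos[of \<xi>] by (intro power_mono) (auto simp: less_imp_le)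
        then show ?thesis by (simp add: power_mult_distrib power_divide)
      qed
      then show "AE \<xi> in lebesgue. norm ((norm (1 / k \<xi>))\<^sup>2) \<le> norm (D\<^sup>2 * (norm (1 / k' \<xi>))\<^sup>2)"
        by (intro AE_I2) simp
    qed measurable
  qed
  note k = km kpos kL2 and k' = km' kpos' assms(6)
  note bc = Bk_inf_bcfun[OF k]
  have \<Phi>c: "continuous_on \<Omega> \<Phi>" by (rule holomorphic_several_continuous_on[OF assms(2)])
  have w_of_k': "fourier_ball w (Cw * M) h" if "fourier_ball k' M h" for M h
    unfolding w_def by (rule fourier_ball_scale_weight[OF that Cw(1)])
  have k'_of_w: "fourier_ball k' (M / Cw) h" if "fourier_ball w M h" for M h
    using fourier_ball_scale_weight[OF that, of "1 / Cw"] Cw(1) by (simp add: w_def)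
  define W where "W = 1 + (L2_norm (\<lambda>\<xi>. 1 / w \<xi>))\<^sup>2"
  have W: "1 \<le> W" by (simp add: W_def)
  have vmc: "continuous_on UNIV (value_map u)" if "\<And>i. u i \<in> Bk_inf k" for u :: "'d \<Rightarrow> (real ^ 'n) distr"
    unfolding value_map_def[abs_def] by (intro continuous_on_vec_lambda bc(1) that)
  have vmb: "bounded (range (value_map u))" if "\<And>i. u i \<in> Bk_inf k" for u :: "'d \<Rightarrow> (real ^ 'n) distr"
  proof -
    have "\<exists>b. \<forall>x. norm (bcfun_of (u i) x) \<le> b" for i
      using bc(2)[OF that[of i]] by (auto simp: bounded_iff)
    then obtain b where b: "\<And>i x. norm (bcfun_of (u i) x) \<le> b i" by metis
    have b0: "0 \<le> b i" for i using order_trans[OF norm_ge_zero b[of i 0]] .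
    have "norm (value_map u x) \<le> ?d * (\<Sum>i\<in>UNIV. b i)" for x
    proof (rule norm_vec_le_card)
      fix i
      have "norm (value_map u x $ i) \<le> b i" using b by (simp add: value_map_def)
      also have "\<dots> \<le> (\<Sum>i\<in>UNIV. b i)" using b0 by (intro member_le_sum) auto
      finally show "norm (value_map u x $ i) \<le> (\<Sum>i\<in>UNIV. b i)" .
    qed
    then show ?thesis by (auto simp: bounded_iff)
  qed
  have \<Phi>u: "continuous_on UNIV (\<Phi> \<circ> value_map u)" "represents (\<Phi> \<circ> value_map u) (distr_of (\<Phi> \<circ> value_map u))"
    if u: "\<And>i. u i \<in> Bk_inf k" and sub: "closure (range (value_map u)) \<subseteq> \<Omega>" for u :: "'d \<Rightarrow> (real ^ 'n) distr"
  proof -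
    have "range (value_map u) \<subseteq> \<Omega>" using sub closure_subset by blast
    then show *: "continuous_on UNIV (\<Phi> \<circ> value_map u)"
      by (intro continuous_on_compose vmc u continuous_on_subset[OF \<Phi>c])
    show "represents (\<Phi> \<circ> value_map u) (distr_of (\<Phi> \<circ> value_map u))"
      by (rule represents_distr_of[OF continuous_locally_integrable[OF *]])
  qed
  have comp: "\<exists>\<psi> z M. \<psi> \<in> test_functions \<and> \<psi> z \<noteq> 0 \<and> (\<forall>y. fourier_ball k M (\<lambda>x. translate y \<psi> x * value_map u x $ i))"
    if "\<And>i. u i \<in> Bk_inf k" for i and u :: "'d \<Rightarrow> (real ^ 'n) distr"
    using bc(4)[OF that] by (simp add: value_map_def)
  have a: "distr_of (\<Phi> \<circ> value_map u) \<in> Bk_inf k'"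
    if u: "\<And>i. u i \<in> Bk_inf k" and sub: "closure (range (value_map u)) \<subseteq> \<Omega>" for u :: "'d \<Rightarrow> (real ^ 'n) distr"
  proof -
    obtain \<omega> \<sigma> \<eta>0 C where est: "\<omega> \<in> test_functions" "\<omega> 0 \<noteq> 0" "\<sigma> \<in> test_functions" "\<sigma> 0 = 1" "0 < \<eta>0" "0 < C"
      "\<forall>g \<eta>. 0 < \<eta> \<longrightarrow> \<eta> \<le> \<eta>0 \<longrightarrow> (\<forall>i y. fourier_ball w \<eta> (\<lambda>x. translate y \<sigma> x * (g x $ i - value_map u x $ i))) \<longrightarrow>
        (\<forall>y. fourier_ball w C (\<lambda>x. translate y \<omega> x * \<Phi> (g x)) \<and>
             fourier_ball w (C * \<eta>) (\<lambda>x. translate y \<omega> x * (\<Phi> (g x) - \<Phi> (value_map u x))))"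
      by (rule composition_estimate[OF k lim comp[OF u] vmb[OF u] sub assms(1,2)]) (rule that; assumption)
    have "fourier_ball w C (\<lambda>x. translate y \<omega> x * \<Phi> (value_map u x))" for y
      using est(7)[rule_format, of \<eta>0 "value_map u"] est(5) fourier_ball_zero[OF est(5), of w] by simp
    then have "fourier_ball k' (C / Cw) (\<lambda>x. translate y \<omega> x * (\<Phi> \<circ> value_map u) x)" for y
      unfolding o_def by (rule k'_of_w)
    then have "Bk_inf_norm k' \<omega> (distr_of (\<Phi> \<circ> value_map u)) \<le> ennreal (C / Cw / ?c)"
      by (rule Bk_inf_norm_le_of_fourier_ball[OF k'(1,2) \<Phi>u(2,1)[OF u sub] est(1)])
    then have "Bk_inf_norm k' \<omega> (distr_of (\<Phi> \<circ> value_map u)) < \<infinity>"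
      by (rule order.strict_trans1) simp
    moreover have "\<omega> \<noteq> (\<lambda>x. 0)" using est(2) by auto
    ultimately show ?thesis
      using est(1) distributions_represented[OF \<Phi>u(2)[OF u sub]] by (auto simp: Bk_inf_def)
  qed
  moreover have "(\<exists>\<epsilon>0\<in>{0<..1}. \<forall>\<epsilon>\<in>{0<..\<epsilon>0}. closure (range (value_map (ue \<epsilon>))) \<subseteq> \<Omega>) \<and>
      Bk_inf_tendsto k' (\<lambda>\<epsilon>. distr_of (\<Phi> \<circ> value_map (ue \<epsilon>))) (distr_of (\<Phi> \<circ> value_map u)) (at_right 0)"
    if u: "\<And>i. u i \<in> Bk_inf k" and ue: "\<And>\<epsilon> i. \<epsilon> \<in> {0<..1} \<Longrightarrow> ue \<epsilon> i \<in> Bk_inf k"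
      and sub: "closure (range (value_map u)) \<subseteq> \<Omega>"
      and tends: "\<And>i. Bk_inf_tendsto k' (\<lambda>\<epsilon>. ue \<epsilon> i) (u i) (at_right 0)"
    for u :: "'d \<Rightarrow> (real ^ 'n) distr" and ue :: "real \<Rightarrow> 'd \<Rightarrow> (real ^ 'n) distr"
  proof -
    obtain \<omega> \<sigma> \<eta>0 C where est: "\<omega> \<in> test_functions" "\<omega> 0 \<noteq> 0" "\<sigma> \<in> test_functions" "\<sigma> 0 = 1" "0 < \<eta>0" "0 < C"
      "\<forall>g \<eta>. 0 < \<eta> \<longrightarrow> \<eta> \<le> \<eta>0 \<longrightarrow> (\<forall>i y. fourier_ball w \<eta> (\<lambda>x. translate y \<sigma> x * (g x $ i - value_map u x $ i))) \<longrightarrow>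
        (\<forall>y. fourier_ball w C (\<lambda>x. translate y \<omega> x * \<Phi> (g x)) \<and>
             fourier_ball w (C * \<eta>) (\<lambda>x. translate y \<omega> x * (\<Phi> (g x) - \<Phi> (value_map u x))))"
      by (rule composition_estimate[OF k lim comp[OF u] vmb[OF u] sub assms(1,2)]) (rule that; assumption)
    define P where "P = (\<lambda>\<eta> \<epsilon>. \<epsilon> \<in> {0<..1} \<and>
      (\<forall>i y. fourier_ball w \<eta> (\<lambda>x. translate y \<sigma> x * (value_map (ue \<epsilon>) x $ i - value_map u x $ i))))"
    have unit: "\<forall>\<^sub>F \<epsilon> in at_right 0. \<epsilon> \<in> {0<..1::real}"
      unfolding eventually_at_right_field by (intro exI[of _ 1]) auto
    have ev: "\<forall>\<^sub>F \<epsilon> in at_right 0. P \<eta> \<epsilon>" if \<eta>: "0 < \<eta>" for \<eta>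
    proof -
      \<comment> \<open>\<open>?c\<close> is lost in passing to densities and \<open>Cw\<close> in passing from \<open>k'\<close> to \<open>w\<close>\<close>
      define M where "M = \<eta> / (Cw * ?c)"
      have M: "0 < M" using \<eta> Cw(1) c by (simp add: M_def)
      have "\<forall>\<^sub>F \<epsilon> in at_right 0. Bk_inf_norm k' \<sigma> (distr_diff (ue \<epsilon> i) (u i)) \<le> ennreal M" for i
      proof -
        have "\<sigma> \<in> test_functions - {\<lambda>x. 0}" using est(3,4) by auto
        then have "((\<lambda>\<epsilon>. Bk_inf_norm k' \<sigma> (distr_diff (ue \<epsilon> i) (u i))) \<longlongrightarrow> 0) (at_right 0)"
          using tends[of i] by (simp add: Bk_inf_tendsto_def)
        then have "\<forall>\<^sub>F \<epsilon> in at_right 0. Bk_inf_norm k' \<sigma> (distr_diff (ue \<epsilon> i) (u i)) < ennreal M"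
          by (rule order_tendstoD(2)) (use M in simp)
        then show ?thesis by eventually_elim (rule less_imp_le)
      qed
      then have "\<forall>\<^sub>F \<epsilon> in at_right 0. \<forall>i. Bk_inf_norm k' \<sigma> (distr_diff (ue \<epsilon> i) (u i)) \<le> ennreal M"
        by (rule eventually_all_finite)
      then show ?thesis using unit
      proof eventually_elim
        case (elim \<epsilon>)
        have "fourier_ball w \<eta> (\<lambda>x. translate y \<sigma> x * (value_map (ue \<epsilon>) x $ i - value_map u x $ i))" for i y
        proof -
          have rep: "represents (\<lambda>x. bcfun_of (ue \<epsilon> i) x - bcfun_of (u i) x) (distr_diff (ue \<epsilon> i) (u i))"
            by (intro represents_distr_diff bc(3) u ue elim(2))
          have cont: "continuous_on UNIV (\<lambda>x. bcfun_of (ue \<epsilon> i) x - bcfun_of (u i) x)"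
            by (intro continuous_on_diff bc(1) u ue elim(2))
          have "fourier_ball w (Cw * (?c * M)) (\<lambda>x. translate y \<sigma> x * (bcfun_of (ue \<epsilon> i) x - bcfun_of (u i) x))"
            by (intro w_of_k' fourier_ball_of_Bk_inf_norm_le[OF k' rep cont est(3) M]) (use elim(1) in blast)
          moreover have "Cw * (?c * M) = \<eta>" using Cw(1) c by (simp add: M_def)
          ultimately show ?thesis by (simp add: value_map_def)
        qed
        with elim(2) show ?case by (simp add: P_def)
      qed
    qed
    have "compact (closure (range (value_map u)))" using vmb[OF u] by simp
    then obtain r0 where r0: "0 < r0" "compact {x + y |x y. x \<in> closure (range (value_map u)) \<and> y \<in> cball 0 r0}"
      "{x + y |x y. x \<in> closure (range (value_map u)) \<and> y \<in> cball 0 r0} \<subseteq> \<Omega>"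
      by (rule compact_neighbourhood[OF _ assms(1) sub])
    let ?K = "{x + y |x y. x \<in> closure (range (value_map u)) \<and> y \<in> cball 0 r0}"
    \<comment> \<open>a radius \<open>\<eta>1\<close> for the differences moves values by at most \<open>r0\<close>\<close>
    define \<eta>1 where "\<eta>1 = r0 / (?d * W)"
    have \<eta>1: "0 < \<eta>1" using r0(1) W by (simp add: \<eta>1_def)
    have near: "closure (range (value_map (ue \<epsilon>))) \<subseteq> \<Omega>" if "P \<eta>1 \<epsilon>" for \<epsilon>
    proof -
      have "value_map (ue \<epsilon>) x \<in> ?K" for x
      proof -
        have "norm (value_map (ue \<epsilon>) x - value_map u x) \<le> ?d * (W * \<eta>1)"
        proof (rule norm_vec_le_card)
          fix i
          have "fourier_ball w \<eta>1 (\<lambda>z. translate x \<sigma> z * (value_map (ue \<epsilon>) z $ i - value_map u z $ i))"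
            using that by (simp add: P_def)
          from fourier_ball_bounded[OF this, of x] show "norm ((value_map (ue \<epsilon>) x - value_map u x) $ i) \<le> W * \<eta>1"
            using est(4) by (simp add: W_def translate_def)
        qed
        also have "\<dots> = r0" using W by (simp add: \<eta>1_def)
        finally have "value_map (ue \<epsilon>) x - value_map u x \<in> cball 0 r0" by simp
        moreover have "value_map u x \<in> closure (range (value_map u))" by (rule subsetD[OF closure_subset rangeI])
        moreover have "value_map (ue \<epsilon>) x = value_map u x + (value_map (ue \<epsilon>) x - value_map u x)" by simp
        ultimately show ?thesis by blast
      qed
      then have "closure (range (value_map (ue \<epsilon>))) \<subseteq> ?K"
        by (intro closure_minimal compact_imp_closed[OF r0(2)]) auto
      then show ?thesis using r0(3) by blast
    qed
    from ev[OF \<eta>1] obtain b where b: "0 < b" "\<And>\<epsilon>. 0 < \<epsilon> \<Longrightarrow> \<epsilon> < b \<Longrightarrow> P \<eta>1 \<epsilon>"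
      by (auto simp: eventually_at_right_field)
    have "\<exists>\<epsilon>0\<in>{0<..1}. \<forall>\<epsilon>\<in>{0<..\<epsilon>0}. closure (range (value_map (ue \<epsilon>))) \<subseteq> \<Omega>"
    proof (rule bexI[of _ "min 1 (b / 2)"])
      show "min 1 (b / 2) \<in> {0<..1}" using b(1) by auto
      show "\<forall>\<epsilon>\<in>{0<..min 1 (b / 2)}. closure (range (value_map (ue \<epsilon>))) \<subseteq> \<Omega>"
        using b by (intro ballI near b(2)) auto
    qed
    moreover have "Bk_inf_tendsto k' (\<lambda>\<epsilon>. distr_of (\<Phi> \<circ> value_map (ue \<epsilon>))) (distr_of (\<Phi> \<circ> value_map u)) (at_right 0)"
      unfolding Bk_inf_tendsto_def
    proof (intro conjI ballI)
      show "distr_of (\<Phi> \<circ> value_map u) \<in> Bk_inf k'" by (rule a[OF u sub])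
      show "\<forall>\<^sub>F \<epsilon> in at_right 0. distr_of (\<Phi> \<circ> value_map (ue \<epsilon>)) \<in> Bk_inf k'"
        using ev[OF \<eta>1] by eventually_elim (intro a ue near; simp add: P_def)
      fix \<psi> :: "real ^ 'n \<Rightarrow> complex" assume "\<psi> \<in> test_functions - {\<lambda>x. 0}"
      then have \<psi>: "\<psi> \<in> test_functions" by simp
      obtain C2 where C2: "0 < C2" "\<And>f M y. (\<And>y. fourier_ball w M (\<lambda>x. translate y \<omega> x * f x)) \<Longrightarrow>
          fourier_ball w (C2 * M) (\<lambda>x. translate y \<psi> x * f x)"
        by (rule window_change[OF est(1,2) \<psi>]) blast
      show "((\<lambda>\<epsilon>. Bk_inf_norm k' \<psi> (distr_diff (distr_of (\<Phi> \<circ> value_map (ue \<epsilon>))) (distr_of (\<Phi> \<circ> value_map u)))) \<longlongrightarrow> 0) (at_right 0)"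
      proof (rule ennreal_tendsto_0I)
        fix e :: real assume e: "0 < e"
        \<comment> \<open>chosen such that the change of window and the return to \<open>k'\<close> lead to the bound \<open>e\<close>\<close>
        define \<eta> where "\<eta> = min \<eta>0 (e * Cw * ?c / (C2 * C))"
        have \<eta>: "0 < \<eta>" "\<eta> \<le> \<eta>0" using est(5,6) e Cw(1) c C2(1) by (auto simp: \<eta>_def)
        have le: "C2 * (C * \<eta>) / Cw / ?c \<le> e"
        proof -
          have "C2 * (C * \<eta>) \<le> C2 * (C * (e * Cw * ?c / (C2 * C)))"
            unfolding \<eta>_def using C2(1) est(6) by (intro mult_left_mono) auto
          also have "\<dots> = e * Cw * ?c" using C2(1) est(6) by simp
          finally show ?thesis using Cw(1) c by (simp add: divide_le_eq)
        qed
        show "\<forall>\<^sub>F \<epsilon> in at_right 0. Bk_inf_norm k' \<psi> (distr_diff (distr_of (\<Phi> \<circ> value_map (ue \<epsilon>))) (distr_of (\<Phi> \<circ> value_map u))) \<le> ennreal e"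
          using ev[OF \<eta>(1)] ev[OF \<eta>1]
        proof eventually_elim
          case (elim \<epsilon>)
          have u\<epsilon>: "ue \<epsilon> i \<in> Bk_inf k" for i using elim(1) by (intro ue) (simp add: P_def)
          note sub\<epsilon> = near[OF elim(2)]
          let ?g = "\<lambda>x. (\<Phi> \<circ> value_map (ue \<epsilon>)) x - (\<Phi> \<circ> value_map u) x"
          have "fourier_ball w (C * \<eta>) (\<lambda>x. translate y \<omega> x * ?g x)" for y
            using est(7)[rule_format, OF \<eta>, of "value_map (ue \<epsilon>)"] elim(1) by (simp add: P_def)
          from C2(2)[OF this] have "fourier_ball k' (C2 * (C * \<eta>) / Cw) (\<lambda>x. translate y \<psi> x * ?g x)" for y
            by (rule k'_of_w)
          then have "Bk_inf_norm k' \<psi> (distr_diff (distr_of (\<Phi> \<circ> value_map (ue \<epsilon>))) (distr_of (\<Phi> \<circ> value_map u)))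
              \<le> ennreal (C2 * (C * \<eta>) / Cw / ?c)"
            by (rule Bk_inf_norm_le_of_fourier_ball[OF k'(1,2) represents_distr_diff[OF \<Phi>u(2)[OF u\<epsilon> sub\<epsilon>] \<Phi>u(2)[OF u sub]]
                  continuous_on_diff[OF \<Phi>u(1)[OF u\<epsilon> sub\<epsilon>] \<Phi>u(1)[OF u sub]] \<psi>])
          also have "\<dots> \<le> ennreal e" by (rule ennreal_leI[OF le])
          finally show ?case .
        qed
      qed
    qed
    ultimately show ?thesis by blast
  qed
  ultimately show ?thesis by blast
qed

end
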